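(* Let $k=O(1)$, let $n$ be a positive integer and $w=O(\mathrm{polylog}(n))$. Let $S_1,\dots,S_k$ be sets of $n$ numbers each in $[2^{w}]$, and let $p\in\mathbb{N}[x_1,\dots,x_k]$ be a constant-degree $k$-variate polynomial with coefficients in $[2^{w}]$. For any choice of a constant $0<\alpha<1$, one can construct in $\tilde{O}(n^k)$ time with high probability a data structure using $\tilde{O}(n^{k-\alpha/3})$ words of space which answers, in $\tilde{O}(n^{\alpha})$ time, queries of the following form: given $k$ intervals $B_1,\dots,B_k\subset[2^{w}]$ and an integer $y$, decide whether there are values $x_1\in B_1\cap S_1,\ x_2\in B_2\cap S_2,\dots,x_k\in B_k\cap S_k$ such that $p(x_1,\dots,x_k)=y$.
   Context: $[M]$ denotes $\{0,1,\dots,M-1\}$. The notation $\tilde{O}(\cdot)$ omits factors polylogarithmic in $n$. Intervals are integer intervals. Space is measured in machine words (word RAM model).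
   Formalization: The formal statement takes k ≥ 2, since for k = 1 the space bound is information-theoretically impossible (p = x_1 is membership in an arbitrary n-set), and it gives the integer ⌈n^α⌉ to the construction algorithm as an input word, as α is an arbitrary real. *)

theory Defs
  imports
    "HOL-Probability.Probability"
    "HOL-Library.Landau_Symbols"
    "HOL-Library.Poly_Mapping"
begin

section \<open>Soft-O\<close>

text \<open>
  \<open>softO (\<lambda>_. 1)\<close> is the class polylog\<open>(n)\<close>.
\<close>

definition softO :: "(nat \<Rightarrow> real) \<Rightarrow> (nat \<Rightarrow> real) set" where
  "softO g = {f. \<exists>c::nat. f \<in> O(\<lambda>n. g n * ln (real n) ^ c)}"


section \<open>Multivariate polynomials over the naturals\<close>

text \<open>
  A polynomial maps monomials to coefficients; a monomial maps variable indices to exponents.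
  The variables \<open>x\<^sub>1, \<dots>, x\<^sub>k\<close> are indexed by \<open>0, \<dots>, k - 1\<close>.
\<close>

type_synonym npoly = "(nat \<Rightarrow>\<^sub>0 nat) \<Rightarrow>\<^sub>0 nat"

definition poly_eval :: "npoly \<Rightarrow> (nat \<Rightarrow> nat) \<Rightarrow> nat" where
  "poly_eval p x =
     (\<Sum>m\<in>Poly_Mapping.keys p. Poly_Mapping.lookup p m * (\<Prod>i\<in>Poly_Mapping.keys m. x i ^ Poly_Mapping.lookup m i))"

definition in_vars :: "nat \<Rightarrow> npoly \<Rightarrow> bool" where
  "in_vars k p \<longleftrightarrow> (\<forall>m\<in>Poly_Mapping.keys p. Poly_Mapping.keys m \<subseteq> {..<k})"

definition total_degree_le :: "npoly \<Rightarrow> nat \<Rightarrow> bool" where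
  "total_degree_le p d \<longleftrightarrow>
     (\<forall>m\<in>Poly_Mapping.keys p. (\<Sum>i\<in>Poly_Mapping.keys m. Poly_Mapping.lookup m i) \<le> d)"


section \<open>A word RAM\<close>

text \<open>
  Programs of a word RAM with \<open>b\<close>-bit words, in structured form. A machine has a read-only,
  random-access input, finitely many registers per program, a random-access memory, and a
  read-once source of random words. Programs do not depend on \<open>b\<close>. Each instruction
  and each evaluation of a guard takes unit time.
\<close>

datatype binop = Add | Sub | Mul | Div | Mod | And | Or | Xor | Shl | Shr | Less | Eq

datatype com =
    Const nat nat
  | Op binop nat nat nat
  | Load nat nat
  | Store nat nat
  | Input nat nat
  | Rand nat
  | Seq com com
  | Cond nat com com
  | While nat com

record state =
  reg :: "nat \<Rightarrow> nat"
  mem :: "nat \<Rightarrow> nat"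
  rnd :: "nat list"

fun binop_val :: "nat \<Rightarrow> binop \<Rightarrow> nat \<Rightarrow> nat \<Rightarrow> nat" where
  "binop_val b Add u v = take_bit b (u + v)"
| "binop_val b Sub u v = take_bit b (u + 2 ^ b - v)"
| "binop_val b Mul u v = take_bit b (u * v)"
| "binop_val b Div u v = u div v"
| "binop_val b Mod u v = u mod v"
| "binop_val b And u v = Bit_Operations.and u v"
| "binop_val b Or u v = Bit_Operations.or u v"
| "binop_val b Xor u v = Bit_Operations.xor u v"
| "binop_val b Shl u v = take_bit b (push_bit v u)"
| "binop_val b Shr u v = drop_bit v u"
| "binop_val b Less u v = take_bit b (of_bool (u < v))"
| "binop_val b Eq u v = take_bit b (of_bool (u = v))"

definition set_reg :: "nat \<Rightarrow> nat \<Rightarrow> state \<Rightarrow> state" where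
  "set_reg r v s = s\<lparr>reg := (reg s)(r := v)\<rparr>"

text \<open>
  \<open>exec b inp c s t s'\<close>: with word size \<open>b\<close> and input \<open>inp\<close>, program \<open>c\<close> started in \<open>s\<close> halts
  after \<open>t\<close> steps in \<open>s'\<close>. Reading past the end of the input yields \<open>0\<close>; a program that asks for
  a random word when none is left has no execution.
\<close>

inductive exec :: "nat \<Rightarrow> nat list \<Rightarrow> com \<Rightarrow> state \<Rightarrow> nat \<Rightarrow> state \<Rightarrow> bool"
  for b :: nat and inp :: "nat list" where
  Const: "exec b inp (Const r v) s 1 (set_reg r (take_bit b v) s)"
| Op: "exec b inp (Op f r x y) s 1 (set_reg r (binop_val b f (reg s x) (reg s y)) s)"
| Load: "exec b inp (Load r a) s 1 (set_reg r (mem s (reg s a)) s)"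
| Store: "exec b inp (Store a x) s 1 (s\<lparr>mem := (mem s)(reg s a := reg s x)\<rparr>)"
| Input: "exec b inp (Input r a) s 1 (set_reg r (take_bit b (nth_default 0 inp (reg s a))) s)"
| Rand: "rnd s = u # us \<Longrightarrow> exec b inp (Rand r) s 1 (set_reg r u (s\<lparr>rnd := us\<rparr>))"
| Seq: "exec b inp c1 s t1 s1 \<Longrightarrow> exec b inp c2 s1 t2 s2 \<Longrightarrow>
    exec b inp (Seq c1 c2) s (t1 + t2) s2"
| Cond_true: "reg s x \<noteq> 0 \<Longrightarrow> exec b inp c1 s t s1 \<Longrightarrow> exec b inp (Cond x c1 c2) s (t + 1) s1"
| Cond_false: "reg s x = 0 \<Longrightarrow> exec b inp c2 s t s1 \<Longrightarrow> exec b inp (Cond x c1 c2) s (t + 1) s1"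
| While_true: "reg s x \<noteq> 0 \<Longrightarrow> exec b inp c s t1 s1 \<Longrightarrow> exec b inp (While x c) s1 t2 s2 \<Longrightarrow>
    exec b inp (While x c) s (t1 + t2 + 1) s2"
| While_false: "reg s x = 0 \<Longrightarrow> exec b inp (While x c) s 1 s"

definition init_state :: "(nat \<Rightarrow> nat) \<Rightarrow> nat list \<Rightarrow> state" where
  "init_state M us = \<lparr>reg = (\<lambda>_. 0), mem = M, rnd = us\<rparr>"

definition random_words :: "nat \<Rightarrow> nat \<Rightarrow> nat list pmf" where
  "random_words b len = replicate_pmf len (pmf_of_set {..<2 ^ b})"

text \<open>Words of \<open>\<Theta>(log n)\<close> bits; \<open>n + 2\<close> keeps the word size positive at \<open>n = 1\<close>.\<close>

definition word_size :: "nat \<Rightarrow> nat \<Rightarrow> nat" where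
  "word_size \<kappa> n = \<kappa> * nat \<lceil>log 2 (real n + 2)\<rceil>"


section \<open>Input formats\<close>

definition digits :: "nat \<Rightarrow> nat \<Rightarrow> nat \<Rightarrow> nat list" where
  "digits b len x = map (\<lambda>i. x div 2 ^ (b * i) mod 2 ^ b) [0..<len]"

definition encode_num :: "nat \<Rightarrow> nat \<Rightarrow> nat \<Rightarrow> nat list" where
  "encode_num b w x = digits b (nat \<lceil>real w / real b\<rceil>) x"

text \<open>
  Integers are unbounded, hence encoded with a terminator: a sign word, then the digits of
  the absolute value, each announced by \<open>1\<close>, least significant first, then \<open>0\<close>.
\<close>

definition encode_int :: "nat \<Rightarrow> int \<Rightarrow> nat list" where
  "encode_int b y =
     of_bool (y < 0) #
     concat (map (\<lambda>v. [1, v]) (digits b (LEAST len. nat \<bar>y\<bar> < 2 ^ (b * len)) (nat \<bar>y\<bar>))) @ [0]"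

text \<open>
  \<open>List.n_lists k [0..<Suc d]\<close> enumerates all exponent vectors in \<open>{0..d}\<^sup>k\<close>,
  so the number of coefficients listed is a constant for fixed \<open>k\<close> and \<open>d\<close>.
\<close>

definition encode_poly :: "nat \<Rightarrow> nat \<Rightarrow> nat \<Rightarrow> nat \<Rightarrow> npoly \<Rightarrow> nat list" where
  "encode_poly b w k d p =
     concat (map (\<lambda>e. encode_num b w (Poly_Mapping.lookup p (Poly_Mapping.nth e))) (List.n_lists k [0..<Suc d]))"

text \<open>
  The threshold \<open>\<lceil>n\<^sup>\<alpha>\<rceil>\<close> is part of the input because \<open>\<alpha>\<close> is an arbitrary real number, so that no
  program could compute it in general.
\<close>

definition encode_instance ::
    "nat \<Rightarrow> nat \<Rightarrow> nat \<Rightarrow> nat \<Rightarrow> nat \<Rightarrow> real \<Rightarrow> (nat \<Rightarrow> nat list) \<Rightarrow> npoly \<Rightarrow> nat list" where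
  "encode_instance b w k d n \<alpha> A p =
     [b, n, w, nat \<lceil>real n powr \<alpha>\<rceil>] @
     concat (map (\<lambda>i. concat (map (encode_num b w) (A i))) [0..<k]) @
     encode_poly b w k d p"

definition encode_query ::
    "nat \<Rightarrow> nat \<Rightarrow> nat \<Rightarrow> (nat \<Rightarrow> nat) \<Rightarrow> (nat \<Rightarrow> nat) \<Rightarrow> int \<Rightarrow> nat list" where
  "encode_query b w k l r y =
     concat (map (\<lambda>i. encode_num b w (l i) @ encode_num b w (r i)) [0..<k]) @ encode_int b y"


section \<open>Instances and data structures\<close>

text \<open>The set \<open>S\<^sub>i\<close> is given by an array \<open>A i\<close> listing its elements in arbitrary order.\<close>

definition valid_instance ::
    "nat \<Rightarrow> nat \<Rightarrow> nat \<Rightarrow> nat \<Rightarrow> (nat \<Rightarrow> nat set) \<Rightarrow> (nat \<Rightarrow> nat list) \<Rightarrow> npoly \<Rightarrow> bool" where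
  "valid_instance w k d n S A p \<longleftrightarrow>
     (\<forall>i<k. S i \<subseteq> {..<2 ^ w} \<and> card (S i) = n \<and> distinct (A i) \<and> set (A i) = S i) \<and>
     in_vars k p \<and> total_degree_le p d \<and> (\<forall>m. Poly_Mapping.lookup p m < 2 ^ w)"

definition query_answer ::
    "nat \<Rightarrow> (nat \<Rightarrow> nat set) \<Rightarrow> npoly \<Rightarrow> (nat \<Rightarrow> nat set) \<Rightarrow> int \<Rightarrow> bool" where
  "query_answer k S p B y \<longleftrightarrow>
     (\<exists>x. (\<forall>i<k. x i \<in> B i \<inter> S i) \<and> int (poly_eval p x) = y)"

text \<open>
  The data structure consists of the first \<open>sp\<close> words of \<open>M\<close>; the query program starts with these
  in memory, all other cells being \<open>0\<close>, and has no access to the instance or to random words.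
  The answer is left in register \<open>0\<close>.
\<close>

definition answers_all_queries ::
    "nat \<Rightarrow> nat \<Rightarrow> nat \<Rightarrow> (nat \<Rightarrow> nat set) \<Rightarrow> npoly \<Rightarrow> com \<Rightarrow> nat \<Rightarrow> nat \<Rightarrow> (nat \<Rightarrow> nat) \<Rightarrow> bool" where
  "answers_all_queries b w k S p query qt sp M \<longleftrightarrow>
     (\<forall>l r y. (\<forall>i<k. l i < 2 ^ w \<and> r i < 2 ^ w) \<longrightarrow>
       (\<exists>t s. t \<le> qt \<and>
          exec b (encode_query b w k l r y) query
            (init_state (\<lambda>a. if a < sp then M a else 0) []) t s \<and>
          reg s 0 = of_bool (query_answer k S p (\<lambda>i. {l i..r i}) y)))"

end

theory Submission
 imports Defs "HOL-Real_Asymp.Real_Asymp"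
begin

text \<open>The ranks of the elements of each set are padded to \<open>2^L\<close>, and every rank of an interval lies in an
 aligned dyadic block inside that interval. So a query box is covered by \<open>(2 (L + 1))^k\<close> dyadic boxes whose corners are
 computed from the query. On each of them the map from tuples to values of the polynomial is inverted as by Fiat and Naor.
 With \<open>t = n^(\<alpha>/3)\<close>: boxes of at most \<open>16 t^2\<close> points are searched. In the others, values with more than \<open>t\<close> preimages
 are found in tables of random samples, and the remaining ones in rainbow tables of chains of length \<open>t\<close>, whose walks skip
 the values found in the sample tables; a second moment bound shows that one rainbow table finds a given value with
 probability at least \<open>1/(32 t)\<close>. All boxes of one shape share their tables.

 Values are long numbers, so they are compared and hashed by their residues modulo \<open>1, ..., Q\<close>, which determine them as
 \<open>lcm(1, ..., Q)\<close> is at least \<open>2^(Q - 2)\<close>; a hash value is a sum of random words indexed by these residues.\<close>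

section \<open>Averages over random words and tabulation hashing\<close>

text \<open>The parameters balance one trade-off. A value that is not skipped has at most
  \<open>t\<close> preimages, so in a box of \<open>2 ^ sa\<close> points two chains meet in one
  step with probability of order t / 2^sa. With 2^sa / (16 t^2) chains of length t per table the
  expected losses stay below a constant fraction; more or longer chains would merge. The price is
  that a value with a single preimage is covered by one table with probability of order 1/t, hence
  of order t log n tables of U / (2 t^2) cells: n^k / t words in all up to logarithms. A query tries
  t positions in each table by walks of length t, about t^3 = n^\<alpha> steps, which fixes t.
  Building walks U / (16 t^2) chains of length t for each table, about U steps. Boxes below 16 t^2
  points would get less than one chain and are searched instead.

  Positive answers are verified by recomputing a point with the value asked for, so the random
  choices can only lose points. A union bound over all shapes, boxes and points therefore makes all
  queries correct simultaneously. Every key determines its box, so chains of different boxes share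
  cells but never merge.\<close>

definition expct :: "(('g => real) => real) => 'g set => bool" where
 "expct A C \<longleftrightarrow> (ALL f g. A (%x. f x + g x) = A f + A g) & (ALL f c. A (%x. c * f x) = c * A f) &
   (ALL f g. (\<forall>x\<in>C. f x <= g x) --> A f <= A g) & A (%_. 1) = 1"

text \<open>Expectations are positive linear functionals instead of integrals; the carrier
  \<open>C\<close> restricts only monotonicity. Iterating such a functional models independent
  draws, and independence becomes an unfolding of the recursion without measurability or
  integrability conditions.\<close>

fun seqE :: "(('g => real) => real) => nat => ('g list => real) => real" where
 "seqE A 0 h = h []"
| "seqE A (Suc n) h = A (%g. seqE A n (%gs. h (g # gs)))"

definition avg :: "nat => (nat => real) => real" where
 "avg W f = (\<Sum>w<W. f w) / real W"

lemma expct_avg: "0 < W ==> expct (avg W) {..<W}"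
 unfolding expct_def avg_def
 by (auto simp: sum.distrib add_divide_distrib sum_distrib_left intro!: divide_right_mono sum_mono)

context
 fixes A :: "('g => real) => real" and C :: "'g set"
 assumes A: "expct A C"
begin

lemma E_add: "A (%x. f x + g x) = A f + A g"
 using A by (auto simp: expct_def)

lemma E_cmult: "A (%x. c * f x) = c * A f"
 using A by (auto simp: expct_def)

lemma E_cmultr: "A (%x. f x * c) = A f * c"
 using E_cmult[of c f] by (simp add: mult.commute)

lemma E_mono: "(!!x. x \<in> C ==> f x <= g x) ==> A f <= A g"
 using A by (auto simp: expct_def)

lemma E_const [simp]: "A (%_. c) = c"
proof -
 have "A (%_. c * 1) = c * A (%_. 1)" by (rule E_cmult)
 then show ?thesis using A by (simp add: expct_def)
qed

lemma E_cong: "(!!x. x \<in> C ==> f x = g x) ==> A f = A g"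
 by (intro antisym E_mono) auto

lemma E_diff: "A (%x. f x - g x) = A f - A g"
 using E_add[of f "%x. -1 * g x"] E_cmult[of "-1" g] by simp

lemma E_sum: "finite I ==> A (%x. \<Sum>i\<in>I. f i x) = (\<Sum>i\<in>I. A (f i))"
 by (induction I rule: finite_induct) (auto simp: E_add)

lemma E_le_const: "(!!x. x \<in> C ==> f x <= c) ==> A f <= c"
 using E_mono[of f "%_. c"] by simp

lemma E_ge_const: "(!!x. x \<in> C ==> c <= f x) ==> c <= A f"
 using E_mono[of "%_. c" f] by simp

lemma expct_seqE: "expct (seqE A n) {gs. length gs = n & set gs \<subseteq> C}"
proof (induction n)
 case 0
 then show ?case by (auto simp: expct_def)
next
 case (Suc n)
 then show ?case
  unfolding expct_def
 proof (intro conjI allI impI)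
  fix f g :: "'g list => real"
  assume IH: "(ALL f g. seqE A n (%x. f x + g x) = seqE A n f + seqE A n g) &
    (ALL f c. seqE A n (%x. c * f x) = c * seqE A n f) &
    (ALL f g. (\<forall>x\<in>{gs. length gs = n & set gs \<subseteq> C}. f x <= g x) --> seqE A n f <= seqE A n g) &
    seqE A n (%_. 1) = 1"
  show "seqE A (Suc n) (%x. f x + g x) = seqE A (Suc n) f + seqE A (Suc n) g" using IH by (simp add: E_add)
  assume "\<forall>x\<in>{gs. length gs = Suc n & set gs \<subseteq> C}. f x <= g x"
  then show "seqE A (Suc n) f <= seqE A (Suc n) g" using IH by (auto intro!: E_mono)
 qed (auto simp: E_cmult)
qed

lemma seqE_append: "seqE A (m + n) h = seqE A m (%xs. seqE A n (%ys. h (xs @ ys)))"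
 by (induction m arbitrary: h) auto

lemma seqE_snoc: "seqE A (Suc n) h = seqE A n (%xs. A (%y. h (xs @ [y])))"
 using seqE_append[of n 1 h] by simp

text \<open>Regroups a stream of words into blocks: one block of \<open>m\<close> words seeds one
  hash function.\<close>

lemma seqE_concat: "seqE A (n * m) h = seqE (seqE A m) n (%gs. h (concat gs))"
 by (induction n arbitrary: h) (auto simp: seqE_append)

end

text \<open>Disjoint blocks are independent, so the failure probabilities multiply. This amplifies
  the success of one table over all tables of a kind.\<close>

lemma seqE_groups:
 assumes A: "expct A C" and F: "seqE A N (%gs. of_bool (F gs)) <= q" and q: "0 <= q"
 shows "seqE A (R * N) (%gs. of_bool (ALL r<R. F (take N (drop (r * N) gs)))) <= q ^ R"
proof (induction R)
 case (Suc R)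
 let ?D = "%n. {gs. length gs = n & set gs \<subseteq> C}"
 have EN: "expct (seqE A n) (?D n)" for n by (rule expct_seqE[OF A])
 have "seqE A (Suc R * N) (%gs. of_bool (ALL r<Suc R. F (take N (drop (r * N) gs)))) =
   seqE A N (%xs. seqE A (R * N) (%ys. of_bool (ALL r<Suc R. F (take N (drop (r * N) (xs @ ys))))))"
  by (simp add: seqE_append[OF A])
 also have "... = seqE A N (%xs. of_bool (F xs) * seqE A (R * N) (%ys. of_bool (ALL r<R. F (take N (drop (r * N) ys)))))"
 proof (rule E_cong[OF EN])
  fix xs assume "xs \<in> ?D N"
  then have l: "length xs = N" by simp
  have "of_bool (ALL r<Suc R. F (take N (drop (r * N) (xs @ ys)))) =
    of_bool (F xs) * (of_bool (ALL r<R. F (take N (drop (r * N) ys))) :: real)" for ys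
   using l by (subst All_less_Suc2) auto
  then show "seqE A (R * N) (%ys. of_bool (ALL r<Suc R. F (take N (drop (r * N) (xs @ ys))))) =
    of_bool (F xs) * seqE A (R * N) (%ys. of_bool (ALL r<R. F (take N (drop (r * N) ys))))"
   by (simp only: E_cmult[OF EN])
 qed
 also have "... = seqE A (R * N) (%ys. of_bool (ALL r<R. F (take N (drop (r * N) ys)))) * seqE A N (%xs. of_bool (F xs))"
  by (subst E_cmult[OF EN, symmetric]) (simp add: mult.commute)
 also have "... <= q ^ R * q"
  by (intro mult_mono Suc.IH F) (auto simp: q intro!: E_ge_const[OF EN])
 finally show ?case by (simp add: mult.commute)
qed auto

lemma avg_shift:
 assumes "0 < W" shows "avg W (%w. f ((w + c) mod W)) = avg W f"
proof -
 have inj: "inj_on (%w. (w + c) mod W) {..<W}"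
 proof (rule inj_onI)
  have *: "x = y" if "x <= y" "y < W" "(x + c) mod W = (y + c) mod W" for x y
  proof -
   have "W dvd (y + c) - (x + c)" using that by (subst mod_eq_dvd_iff_nat[symmetric]) auto
   then have "W dvd y - x" by simp
   with that show "x = y" by (auto dest: dvd_imp_le)
  qed
  fix x y assume "x \<in> {..<W}" "y \<in> {..<W}" "(x + c) mod W = (y + c) mod W"
  then show "x = y" using *[of x y] *[of y x] by (cases "x <= y") auto
 qed
 have "(%w. (w + c) mod W) ` {..<W} = {..<W}"
  by (rule endo_inj_surj) (use inj assms in auto)
 then have "(\<Sum>w<W. f ((w + c) mod W)) = (\<Sum>w<W. f w)"
  using sum.reindex[OF inj, of f] by simp
 then show ?thesis by (simp add: avg_def)
qed

text \<open>Isolates the randomness of a single seed word while all others stay fixed. The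
  uniformity and independence of hash values rest on this.\<close>

lemma seqE_resample:
 assumes W: "0 < W" and i: "i < n"
 shows "seqE (avg W) n h = seqE (avg W) n (%ws. avg W (%w. h (ws[i := w])))"
 using i
proof (induction n arbitrary: i h)
 case (Suc n)
 note [simp] = E_const[OF expct_avg[OF W]] E_const[OF expct_seqE[OF expct_avg[OF W]]]
 show ?case
 proof (cases i)
  case 0
  have "seqE (avg W) n (%ws. avg W (%w. h (w # ws))) = avg W (%w. seqE (avg W) n (%ws. h (w # ws)))"
   unfolding avg_def[of W "%w. h (w # _)"] avg_def[of W "%w. seqE (avg W) n (%ws. h (w # ws))"] divide_inverse
   using E_cmult[OF expct_seqE[OF expct_avg[OF W]], of n "inverse (real W)" "%ws. \<Sum>w<W. h (w # ws)"]
    E_sum[OF expct_seqE[OF expct_avg[OF W]], of "{..<W}" n "%w ws. h (w # ws)"]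
   by (simp add: mult.commute)
  then show ?thesis using 0 by simp
 next
  case (Suc j)
  then have "j < n" using Suc.prems by simp
  from Suc.IH[OF this, of "%gs. h (g # gs)" for g] Suc show ?thesis by simp
 qed
qed simp

section \<open>Pairwise independence of tabulation hashing\<close>

definition keys_of :: "nat => nat => nat list set" where
 "keys_of NP Q = {k. length k = NP & set k \<subseteq> {..<Q}}"

text \<open>Tabulation hashing: position \<open>q\<close> of a key owns a row of \<open>Q\<close>
  words, and the digit \<open>k ! q\<close> selects one of them.\<close>

definition hl :: "nat => nat => nat => nat list => nat list => nat" where
 "hl W NP Q g k = (\<Sum>q<NP. g ! (q * Q + k ! q)) mod W"

lemma index_inj:
 assumes "q * Q + a = q' * Q + a'" "a < Q" "a' < (Q::nat)"
 shows "q = q' & a = a'"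
proof -
 have "q = (q * Q + a) div Q" "q' = (q' * Q + a') div Q" using assms(2,3) by auto
 with assms have "q = q'" by metis
 with assms(1) show ?thesis by auto
qed

lemma key_index: "k \<in> keys_of NP Q ==> q < NP ==> k ! q < Q"
 by (auto simp: keys_of_def subset_iff)

lemma key_index_less:
 assumes "k \<in> keys_of NP Q" "q < NP" shows "q * Q + k ! q < NP * Q"
proof -
 have "q * Q + k ! q < Suc q * Q" using key_index[OF assms] by simp
 also have "... <= NP * Q" using assms by (intro mult_le_mono1) simp
 finally show ?thesis .
qed

lemma hl_update_same:
 assumes k: "k \<in> keys_of NP Q" and q: "q < NP" and g: "length g = NP * Q"
 shows "hl W NP Q (g[q * Q + k ! q := w]) k = (w + (\<Sum>q'\<in>{..<NP} - {q}. g ! (q' * Q + k ! q'))) mod W"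
proof -
 have "(\<Sum>q'<NP. g[q * Q + k ! q := w] ! (q' * Q + k ! q')) =
   g[q * Q + k ! q := w] ! (q * Q + k ! q) + (\<Sum>q'\<in>{..<NP} - {q}. g[q * Q + k ! q := w] ! (q' * Q + k ! q'))"
  using q by (simp add: sum.remove)
 also have "g[q * Q + k ! q := w] ! (q * Q + k ! q) = w"
  using key_index_less[OF k q] g by simp
 also have "(\<Sum>q'\<in>{..<NP} - {q}. g[q * Q + k ! q := w] ! (q' * Q + k ! q')) = (\<Sum>q'\<in>{..<NP} - {q}. g ! (q' * Q + k ! q'))"
 proof (rule sum.cong[OF refl])
  fix q' assume q': "q' \<in> {..<NP} - {q}"
  have "q * Q + k ! q ~= q' * Q + k ! q'"
   using index_inj[of q Q "k ! q" q' "k ! q'"] key_index[OF k] q q' by auto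
  then show "g[q * Q + k ! q := w] ! (q' * Q + k ! q') = g ! (q' * Q + k ! q')" by simp
 qed
 finally show ?thesis unfolding hl_def by simp
qed

lemma hl_update_other:
 assumes k: "k \<in> keys_of NP Q" and q: "q < NP" and a: "a < Q" "a ~= k ! q"
 shows "hl W NP Q (g[q * Q + a := w]) k = hl W NP Q g k"
proof -
 have "(\<Sum>q'<NP. g[q * Q + a := w] ! (q' * Q + k ! q')) = (\<Sum>q'<NP. g ! (q' * Q + k ! q'))"
 proof (rule sum.cong[OF refl])
  fix q' assume q': "q' \<in> {..<NP}"
  have "q * Q + a ~= q' * Q + k ! q'"
   using index_inj[of q Q a q' "k ! q'"] key_index[OF k] q q' a by auto
  then show "g[q * Q + a := w] ! (q' * Q + k ! q') = g ! (q' * Q + k ! q')" by simp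
 qed
 then show ?thesis unfolding hl_def by simp
qed

abbreviation hE :: "nat => nat => nat => (nat list => real) => real" where
 "hE W NP Q \<equiv> seqE (avg W) (NP * Q)"

lemma expct_hE: "0 < W ==> expct (hE W NP Q) {gs. length gs = NP * Q & set gs \<subseteq> {..<W}}"
 by (rule expct_seqE[OF expct_avg])

lemma hash_single:
 assumes W: "0 < W" and k: "k \<in> keys_of NP Q" and NP: "0 < NP"
 shows "hE W NP Q (%g. \<phi> (hl W NP Q g k)) = avg W \<phi>"
proof -
 note E = expct_hE[OF W, of NP Q]
 have i: "0 * Q + k ! 0 < NP * Q" by (rule key_index_less[OF k NP])
 have "hE W NP Q (%g. \<phi> (hl W NP Q g k)) = hE W NP Q (%g. avg W (%w. \<phi> (hl W NP Q (g[0 * Q + k ! 0 := w]) k)))"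
  by (rule seqE_resample[OF W i])
 also have "... = hE W NP Q (%g. avg W \<phi>)"
  by (rule E_cong[OF E]) (simp only: hl_update_same[OF k NP] avg_shift[OF W] mem_Collect_eq)
 also have "... = avg W \<phi>" by (rule E_const[OF E])
 finally show ?thesis .
qed

text \<open>Different keys differ in some position \<open>q\<close>. The word that \<open>k\<close>
  selects there is not selected by \<open>k'\<close>, so redrawing it makes the hash value of
  \<open>k\<close> uniform whatever the hash value of \<open>k'\<close> is.\<close>

lemma hash_pair:
 assumes W: "0 < W" and k: "k \<in> keys_of NP Q" and k': "k' \<in> keys_of NP Q" and ne: "k ~= k'"
 shows "hE W NP Q (%g. \<Phi> (hl W NP Q g k) (hl W NP Q g k')) = avg W (%w. avg W (%w'. \<Phi> w w'))"
proof -
 note E = expct_hE[OF W, of NP Q]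
 obtain q where q: "q < NP" "k ! q ~= k' ! q"
  using ne k k' unfolding keys_of_def by (auto simp: list_eq_iff_nth_eq)
 let ?i = "q * Q + k ! q" let ?j = "q * Q + k' ! q"
 have "hE W NP Q (%g. \<Phi> (hl W NP Q g k) (hl W NP Q g k')) =
   hE W NP Q (%g. avg W (%w. \<Phi> (hl W NP Q (g[?i := w]) k) (hl W NP Q (g[?i := w]) k')))"
  by (rule seqE_resample[OF W key_index_less[OF k q(1)]])
 also have "... = hE W NP Q (%g. avg W (%w. \<Phi> w (hl W NP Q g k')))"
 proof (rule E_cong[OF E])
  fix g assume g: "g \<in> {gs. length gs = NP * Q & set gs \<subseteq> {..<W}}"
  have "avg W (%w. \<Phi> (hl W NP Q (g[?i := w]) k) (hl W NP Q (g[?i := w]) k')) =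
    avg W (%w. \<Phi> ((w + (\<Sum>q'\<in>{..<NP} - {q}. g ! (q' * Q + k ! q'))) mod W) (hl W NP Q g k'))"
   using g q key_index[OF k q(1)] by (simp add: hl_update_same[OF k q(1)] hl_update_other[OF k' q(1)])
  also have "... = avg W (%w. \<Phi> w (hl W NP Q g k'))"
   by (rule avg_shift[OF W, where f = "%w. \<Phi> w (hl W NP Q g k')"])
  finally show "avg W (%w. \<Phi> (hl W NP Q (g[?i := w]) k) (hl W NP Q (g[?i := w]) k')) = ..." .
 qed
 also have "... = avg W (%w'. avg W (%w. \<Phi> w w'))"
  by (rule hash_single[OF W k', where \<phi> = "%w'. avg W (%w. \<Phi> w w')"]) (use q in simp)
 also have "... = avg W (%w. avg W (%w'. \<Phi> w w'))"
  unfolding avg_def sum_divide_distrib by (rule sum.swap)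
 finally show ?thesis .
qed

lemma avg_mod:
 assumes W: "0 < W" "P dvd W" and c: "c < P"
 shows "avg W (%w. of_bool (w mod P = c)) = 1 / real P"
proof -
 obtain m where m: "W = P * m" using W by auto
 then have pos: "0 < P" "0 < m" using W by auto
 have "{w. w < W & w mod P = c} = (%j. j * P + c) ` {..<m}"
 proof (intro equalityI subsetI)
  fix w assume "w \<in> {w. w < W & w mod P = c}"
  then have "w = (w div P) * P + c" "w div P < m" using m pos
   by (auto simp: less_mult_imp_div_less mult.commute)
  then show "w \<in> (%j. j * P + c) ` {..<m}" by blast
 next
  fix w assume "w \<in> (%j. j * P + c) ` {..<m}"
  then obtain j where j: "w = j * P + c" "j < m" by auto
  have "w < Suc j * P" using j c by simp
  also have "... <= m * P" using j by (intro mult_le_mono1) simp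
  finally show "w \<in> {w. w < W & w mod P = c}" using j c m by (simp add: mult.commute)
 qed
 moreover have "inj_on (%j. j * P + c) {..<m}" using pos by (auto simp: inj_on_def)
 ultimately have "card {w. w < W & w mod P = c} = m" by (simp add: card_image)
 moreover have "(\<Sum>w<W. of_bool (w mod P = c)) = real (card {w. w < W & w mod P = c})"
  by (subst sum_of_bool_eq) (auto simp: Int_def)
 ultimately show ?thesis using m pos by (simp add: avg_def)
qed

text \<open>The bridge from the \<open>pmf\<close> of the theorem to the functionals in which all
  probabilities are estimated.\<close>

lemma prob_random_words:
 assumes "0 < b"
 shows "measure_pmf.prob (random_words b n) S = seqE (avg (2 ^ b)) n (indicator S)"
proof (induction n arbitrary: S)
 case 0
 show ?case by (simp add: random_words_def indicator_def)
next
 case (Suc n)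
 let ?p = "pmf_of_set {..<2 ^ b} :: nat pmf"
 have fin: "finite {..<(2::nat) ^ b}" "{..<(2::nat) ^ b} ~= {}" by (auto simp: lessThan_empty_iff)
 have ind: "indicator ((#) x -` S) = (%gs. of_bool (x # gs \<in> S) :: real)" "indicator S = (%gs. of_bool (gs \<in> S) :: real)" for x
  by (auto simp: indicator_def fun_eq_iff)
 have "set_pmf (random_words b n) \<subseteq> {xs. set xs \<subseteq> {..<2 ^ b} & length xs = n}"
  using fin by (auto simp: random_words_def set_replicate_pmf)
 then have finrw: "finite (set_pmf (random_words b n))"
  by (rule finite_subset) (rule finite_lists_length_eq[OF fin(1)])
 have "measure_pmf.prob (random_words b (Suc n)) S =
   measure_pmf.prob (bind_pmf ?p (%x. map_pmf ((#) x) (random_words b n))) S"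
  by (simp add: random_words_def map_pmf_def)
 also have "... = measure_pmf.expectation (bind_pmf ?p (%x. map_pmf ((#) x) (random_words b n))) (indicator S)"
  by simp
 also have "... = (\<Sum>x<2 ^ b. measure_pmf.expectation (map_pmf ((#) x) (random_words b n)) (indicator S) /\<^sub>R real (card {..<(2::nat) ^ b}))"
  by (rule pmf_expectation_bind_pmf_of_set) (use fin finrw in auto)
 also have "... = (\<Sum>x<2 ^ b. measure_pmf.prob (map_pmf ((#) x) (random_words b n)) S) / real (2 ^ b)"
  by (simp add: sum_divide_distrib divide_inverse mult.commute sum_distrib_left)
 also have "... = avg (2 ^ b) (%x. seqE (avg (2 ^ b)) n (indicator ((#) x -` S)))"
  by (subst avg_def) (simp add: Suc.IH)
 also have "... = seqE (avg (2 ^ b)) (Suc n) (indicator S)"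
  by (simp add: ind)
 finally show ?case .
qed

section \<open>Chains of one table: abstract setting and second moment bound\<close>

locale chains =
 fixes W P NP Q :: nat and kf :: "'a => nat list" and trans :: "'a => nat => 'a"
  and V :: "'a set" and box :: "'a => 'b" and \<beta> :: real and ky :: "nat list" and Wy :: "nat set" and bx :: 'b
 assumes W: "0 < W" and P: "0 < P" "P dvd W" and NP: "0 < NP"
  and V_keys: "s \<in> V ==> kf s \<in> keys_of NP Q"
  and V_trans: "s \<in> V ==> w < W ==> trans s w \<in> V"
  and box_trans: "s \<in> V ==> w < W ==> box (trans s w) = box s"
  and box_eq: "s \<in> V ==> s' \<in> V ==> kf s = kf s' ==> box s = box s'"
  and trans_eq: "s \<in> V ==> s' \<in> V ==> kf s = kf s' ==> w < W ==> kf (trans s w) = kf (trans s' w)"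
  and \<beta>_bound: "s \<in> V ==> k ~= kf s ==> avg W (%w. of_bool (kf (trans s w) = k)) <= \<beta>"
  and \<beta>0: "0 <= \<beta>"
  and Wy: "s \<in> V ==> box s = bx ==> w < W ==> w \<in> Wy ==> kf (trans s w) = ky"
  and ky_box: "s \<in> V ==> kf s = ky ==> box s = bx"
begin

text \<open>Every word of \<open>Wy\<close> takes any state of the target's box to the target, so
  one number serves for all states of that box.\<close>

definition \<delta> :: real where "\<delta> = avg W (%w. of_bool (w \<in> Wy))"

abbreviation "G \<equiv> {gs. length gs = NP * Q & set gs \<subseteq> {..<W}}"
abbreviation "E \<equiv> hE W NP Q"
abbreviation "Es \<equiv> seqE E"

definition ap :: "nat list => 'a => nat" where "ap g s = hl W NP Q g (kf s)"

fun run :: "nat list list => 'a => 'a" where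
 "run [] s = s"
| "run (g # gs) s = run gs (trans s (ap g s))"

text \<open>A hit is defined by the word drawn and not by the key reached: its probability is then
  the same at every step and independent of the history.\<close>

fun hit :: "nat list list => 'a => nat => bool" where
 "hit [] s i = False"
| "hit (g # gs) s 0 = (ap g s \<in> Wy)"
| "hit (g # gs) s (Suc i) = hit gs (trans s (ap g s)) i"

text \<open>\<open>gl\<close> is the last hash function of a table; it maps the ends of chains to
  cells.\<close>

definition coll :: "nat list list => nat list => 'a => 'a => bool" where
 "coll gs gl s s' \<longleftrightarrow> ap gl (run gs s) mod P = ap gl (run gs s') mod P"

lemma expE: "expct E G"
 by (rule expct_hE[OF W])

lemma expEs: "expct (Es n) {gs. length gs = n & set gs \<subseteq> G}"
 by (rule expct_seqE[OF expE])

lemma expW: "expct (avg W) {..<W}"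
 by (rule expct_avg[OF W])

lemma ap_less: "ap g s < W"
 using W by (simp add: ap_def hl_def)

lemma single: "s \<in> V ==> E (%g. \<phi> (ap g s)) = avg W \<phi>"
 unfolding ap_def by (rule hash_single[OF W V_keys NP])

lemma pair: "s \<in> V ==> s' \<in> V ==> kf s ~= kf s' ==>
  E (%g. \<Phi> (ap g s) (ap g s')) = avg W (%w. avg W (%w'. \<Phi> w w'))"
 unfolding ap_def by (rule hash_pair[OF W V_keys V_keys])

lemma run_eq: "s \<in> V ==> s' \<in> V ==> kf s = kf s' ==> kf (run gs s) = kf (run gs s')"
proof (induction gs arbitrary: s s')
 case (Cons g gs)
 have "ap g s = ap g s'" using Cons.prems by (simp add: ap_def)
 then show ?case using Cons by (auto intro!: Cons.IH V_trans ap_less trans_eq)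
qed auto

text \<open>Both chains arrive at the target in the same step, and from then on the same hash
  functions act on equal keys.\<close>

lemma hit_run_eq:
 "s \<in> V ==> s' \<in> V ==> box s = bx ==> box s' = bx ==> hit gs s i ==> hit gs s' i ==> kf (run gs s) = kf (run gs s')"
proof (induction gs arbitrary: s s' i)
 case (Cons g gs)
 have V: "trans s (ap g s) \<in> V" "trans s' (ap g s') \<in> V" using Cons.prems by (auto intro!: V_trans ap_less)
 show ?case
 proof (cases i)
  case 0
  with Cons.prems have "kf (trans s (ap g s)) = ky" "kf (trans s' (ap g s')) = ky" by (auto intro!: Wy ap_less)
  then show ?thesis using run_eq[OF V] by simp
 next
  case (Suc j)
  have "box (trans s (ap g s)) = bx" "box (trans s' (ap g s')) = bx"
   using Cons.prems by (simp_all add: box_trans ap_less)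
  then show ?thesis using Cons.IH[OF V, of j] Cons.prems Suc by simp
 qed
qed auto

text \<open>A step stays in its box and equal keys have equal boxes, so chains can merge only within
  a box.\<close>

definition \<beta>' :: "'a => 'a => real" where "\<beta>' s s' = (if box s = box s' then \<beta> else 0)"

lemma \<beta>'0: "0 <= \<beta>' s s'"
 using \<beta>0 by (simp add: \<beta>'_def)

lemma \<delta>0: "0 <= \<delta>"
 unfolding \<delta>_def by (rule E_ge_const[OF expW]) simp

text \<open>A step may leave a state where it is, which is why \<open>\<beta>\<close> bounds only
  the probability of keys other than the current one. Either the first state moves to the key of the
  second, or the second has to move to a key other than its own: one \<open>\<beta>\<close> for each
  case.\<close>

lemma merge_pair:
 assumes s: "s \<in> V" "s' \<in> V" "kf s ~= kf s'"
 shows "avg W (%w. avg W (%w'. of_bool (kf (trans s w) = kf (trans s' w')))) <= 2 * \<beta>' s s'"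
proof (cases "box s = box s'")
 case True
 have "avg W (%w. avg W (%w'. of_bool (kf (trans s w) = kf (trans s' w')))) <= avg W (%w. of_bool (kf (trans s w) = kf s') + \<beta>)"
 proof (rule E_mono[OF expW])
  fix w
  show "avg W (%w'. of_bool (kf (trans s w) = kf (trans s' w'))) <= of_bool (kf (trans s w) = kf s') + \<beta>"
  proof (cases "kf (trans s w) = kf s'")
   case True
   have "avg W (%w'. of_bool (kf (trans s w) = kf (trans s' w'))) <= 1"
    by (rule E_le_const[OF expW]) simp
   then show ?thesis using True \<beta>0 by simp
  next
   case False
   then show ?thesis using \<beta>_bound[OF s(2) False] by (simp add: eq_commute)
  qed
 qed
 also have "... = avg W (%w. of_bool (kf (trans s w) = kf s')) + \<beta>"
  by (simp add: E_add[OF expW] E_const[OF expW])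
 also have "... <= \<beta> + \<beta>" using \<beta>_bound[OF s(1)] s(3) by auto
 finally show ?thesis using True by (simp add: \<beta>'_def)
next
 case False
 have "avg W (%w. avg W (%w'. of_bool (kf (trans s w) = kf (trans s' w')))) <= 0"
 proof (intro E_le_const[OF expW])
  fix w w' assume "w \<in> {..<W}" "w' \<in> {..<W}"
  then have "kf (trans s w) ~= kf (trans s' w')"
   using False s box_eq[of "trans s w" "trans s' w'"] by (auto simp: V_trans box_trans)
  then show "of_bool (kf (trans s w) = kf (trans s' w')) <= (0 :: real)" by simp
 qed
 then show ?thesis using \<beta>'0[of s s'] by linarith
qed

lemma target_step:
 assumes s: "s \<in> V" "s' \<in> V" "kf s' ~= ky" "box s = bx"
 shows "avg W (%w'. of_bool (kf (trans s' w') = ky)) <= \<beta>' s s'"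
proof (cases "box s = box s'")
 case True
 then show ?thesis using \<beta>_bound[OF s(2)] s(3) by (auto simp: \<beta>'_def)
next
 case False
 have "avg W (%w'. of_bool (kf (trans s' w') = ky)) <= 0"
 proof (intro E_le_const[OF expW])
  fix w' assume "w' \<in> {..<W}"
  then have "kf (trans s' w') ~= ky"
   using False s ky_box[of "trans s' w'"] by (auto simp: V_trans box_trans)
  then show "of_bool (kf (trans s' w') = ky) <= (0 :: real)" by simp
 qed
 then show ?thesis using \<beta>'0[of s s'] by linarith
qed

lemma \<beta>'_trans: "s \<in> V ==> s' \<in> V ==> w < W ==> w' < W ==> \<beta>' (trans s w) (trans s' w') = \<beta>' s s'"
 by (simp add: \<beta>'_def box_trans)

definition pc :: "nat => 'a => 'a => real" where
 "pc n s s' = Es n (%gs. E (%gl. of_bool (coll gs gl s s')))"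

lemma pc_Suc: "pc (Suc n) s s' = E (%g. pc n (trans s (ap g s)) (trans s' (ap g s')))"
 by (simp add: pc_def coll_def)

lemma pc_le_1: "pc n s s' <= 1"
 unfolding pc_def by (intro E_le_const[OF expEs] E_le_const[OF expE]) auto

text \<open>Two chains merge in a given step with probability at most 2 \<open>\<beta>\<close>, and
  unmerged ends share a cell with probability 1 / P by pairwise independence of the last hash
  function.\<close>

lemma coll_bound:
 "s \<in> V ==> s' \<in> V ==> kf s ~= kf s' ==> pc n s s' <= real n * 2 * \<beta>' s s' + 1 / P"
proof (induction n arbitrary: s s')
 case 0
 have "pc 0 s s' = avg W (%w. avg W (%w'. of_bool (w mod P = w' mod P)))"
  using pair[OF 0, of "%w w'. of_bool (w mod P = w' mod P)"] by (simp add: pc_def coll_def)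
 also have "... = avg W (%w. 1 / P)"
  using avg_mod[OF W P(2), of "w mod P" for w] P(1) by (simp add: eq_commute)
 finally show ?case by (simp add: E_const[OF expW])
next
 case (Suc n)
 let ?c = "real n * 2 * \<beta>' s s' + 1 / P"
 have c0: "0 <= ?c" using \<beta>'0 by simp
 have "pc (Suc n) s s' <= E (%g. of_bool (kf (trans s (ap g s)) = kf (trans s' (ap g s'))) + ?c)"
  unfolding pc_Suc
 proof (rule E_mono[OF expE])
  fix g
  show "pc n (trans s (ap g s)) (trans s' (ap g s')) <= of_bool (kf (trans s (ap g s)) = kf (trans s' (ap g s'))) + ?c"
  proof (cases "kf (trans s (ap g s)) = kf (trans s' (ap g s'))")
   case True
   then show ?thesis using pc_le_1[of n "trans s (ap g s)" "trans s' (ap g s')"] c0 by simp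
  next
   case False
   then show ?thesis using Suc.IH[of "trans s (ap g s)" "trans s' (ap g s')"] Suc.prems
    by (simp add: V_trans ap_less \<beta>'_trans)
  qed
 qed
 also have "... = avg W (%w. avg W (%w'. of_bool (kf (trans s w) = kf (trans s' w')))) + ?c"
  using pair[OF Suc.prems, of "%w w'. of_bool (kf (trans s w) = kf (trans s' w'))"]
  by (simp add: E_add[OF expE] E_const[OF expE])
 also have "... <= 2 * \<beta>' s s' + ?c" using merge_pair[OF Suc.prems] by simp
 finally show ?case by (simp add: algebra_simps)
qed

lemma hit_exp: "s \<in> V ==> i < n ==> Es n (%gs. of_bool (hit gs s i)) = \<delta>"
proof (induction n arbitrary: s i)
 case (Suc n)
 show ?case
 proof (cases i)
  case 0
  then show ?thesis using single[OF Suc.prems(1), of "%w. of_bool (w \<in> Wy)"]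
   by (simp add: E_const[OF expEs] \<delta>_def)
 next
  case (Suc j)
  then have "Es (Suc n) (%gs. of_bool (hit gs s i)) = E (%g. \<delta>)"
   using Suc.prems by (simp add: Suc.IH V_trans ap_less)
  then show ?thesis by (simp add: E_const[OF expE])
 qed
qed simp

text \<open>Different steps use independent hash functions. Two hits in the same step are left out
  here because such chains merge, so that they are accounted for as collisions.\<close>

lemma hit_hit:
 "s \<in> V ==> s' \<in> V ==> i' < i ==> i < n ==>
  Es n (%gs. of_bool (hit gs s' i') * of_bool (hit gs s i)) = \<delta> * \<delta>"
proof (induction n arbitrary: s s' i i')
 case (Suc n)
 from Suc.prems obtain j where i: "i = Suc j" by (cases i) auto
 show ?case
 proof (cases i')
  case 0
  have "Es (Suc n) (%gs. of_bool (hit gs s' i') * of_bool (hit gs s i)) =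
    E (%g. of_bool (ap g s' \<in> Wy) * Es n (%gs. of_bool (hit gs (trans s (ap g s)) j)))"
   by (simp add: i 0 E_cmult[OF expEs])
  also have "... = E (%g. of_bool (ap g s' \<in> Wy) * \<delta>)"
   using Suc.prems i by (simp add: hit_exp V_trans ap_less)
  also have "... = \<delta> * E (%g. of_bool (ap g s' \<in> Wy))"
   by (simp add: E_cmult[OF expE, symmetric] mult.commute)
  also have "E (%g. of_bool (ap g s' \<in> Wy)) = \<delta>"
   using single[OF Suc.prems(2), of "%w. of_bool (w \<in> Wy)"] by (simp add: \<delta>_def)
  finally show ?thesis .
 next
  case (Suc j')
  then show ?thesis using Suc.prems i by (simp add: Suc.IH V_trans ap_less E_const[OF expE])
 qed
qed simp

text \<open>Compared with \<open>coll_bound\<close> the hit contributes the factor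
  \<open>\<delta>\<close>. In addition the other chain may run into the target itself, which costs a
  third \<open>\<beta>\<close> per step.\<close>

lemma hit_coll:
 "s \<in> V ==> s' \<in> V ==> kf s ~= kf s' ==> kf s' ~= ky ==> box s = bx ==> i < n ==>
  Es n (%gs. of_bool (hit gs s i) * E (%gl. of_bool (coll gs gl s s'))) <= \<delta> * (real n * (3 * \<beta>' s s') + 1 / P)"
proof (induction n arbitrary: s s' i)
 case (Suc n)
 note s = Suc.prems
 let ?b = "\<beta>' s s'"
 show ?case
 proof (cases i)
  case 0
  let ?c = "real n * 2 * ?b + 1 / P"
  have c0: "0 <= ?c" using \<beta>'0 by simp
  have "Es (Suc n) (%gs. of_bool (hit gs s i) * E (%gl. of_bool (coll gs gl s s'))) =
    E (%g. of_bool (ap g s \<in> Wy) * pc n (trans s (ap g s)) (trans s' (ap g s')))"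
   by (simp add: 0 E_cmult[OF expEs] pc_def coll_def)
  \<comment> \<open>The first chain is now at the target. The other one joins it in this step only
    by stepping onto the target as well; later merging is covered by
    \<open>coll_bound\<close>.\<close>
  also have "... <= E (%g. of_bool (ap g s \<in> Wy) * (of_bool (kf (trans s' (ap g s')) = ky) + ?c))"
  proof (rule E_mono[OF expE])
   fix g
   let ?a = "trans s (ap g s)" let ?a' = "trans s' (ap g s')"
   have "pc n ?a ?a' <= of_bool (kf ?a' = ky) + ?c" if "ap g s \<in> Wy"
   proof (cases "kf ?a = kf ?a'")
    case True
    have "kf ?a = ky" using that s by (intro Wy) (auto simp: ap_less)
    then show ?thesis using True pc_le_1[of n ?a ?a'] c0 by simp
   next
    case False
    have "pc n ?a ?a' <= ?c" using coll_bound[OF _ _ False] s by (simp add: V_trans ap_less \<beta>'_trans)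
    then show ?thesis by (simp add: add_increasing)
   qed
   then show "of_bool (ap g s \<in> Wy) * pc n ?a ?a' <= of_bool (ap g s \<in> Wy) * (of_bool (kf ?a' = ky) + ?c)"
    by auto
  qed
  also have "... = avg W (%w. avg W (%w'. of_bool (w \<in> Wy) * (of_bool (kf (trans s' w') = ky) + ?c)))"
   by (rule pair[OF s(1-3)])
  also have "... = avg W (%w. of_bool (w \<in> Wy) * (avg W (%w'. of_bool (kf (trans s' w') = ky)) + ?c))"
   by (simp only: E_cmult[OF expW] E_add[OF expW] E_const[OF expW])
  also have "... = \<delta> * (avg W (%w'. of_bool (kf (trans s' w') = ky)) + ?c)"
   unfolding \<delta>_def by (rule E_cmultr[OF expW])
  also have "... <= \<delta> * (?b + ?c)"
   using target_step[OF s(1,2,4,5)] \<delta>0 by (intro mult_left_mono) auto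
  also have "... <= \<delta> * (real (Suc n) * (3 * ?b) + 1 / P)"
   using \<delta>0 \<beta>'0[of s s'] by (intro mult_left_mono) (auto simp: algebra_simps)
  finally show ?thesis .
 next
  case (Suc j)
  let ?c = "real n * (3 * ?b) + 1 / P"
  have c0: "0 <= ?c" using \<beta>'0 by simp
  let ?Y = "%a a'. Es n (%gs. of_bool (hit gs a j) * E (%gl. of_bool (coll gs gl a a')))"
  have "Es (Suc n) (%gs. of_bool (hit gs s i) * E (%gl. of_bool (coll gs gl s s'))) =
    E (%g. ?Y (trans s (ap g s)) (trans s' (ap g s')))"
   by (simp add: Suc coll_def)
  \<comment> \<open>The induction hypothesis requires different keys and a second chain off the
    target. In both exceptional cases the later hit still has probability \<open>\<delta>\<close>,
    so that each of them costs \<open>\<delta>\<close> times its own probability.\<close>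
  also have "... <= E (%g. \<delta> * (of_bool (kf (trans s (ap g s)) = kf (trans s' (ap g s'))) + of_bool (kf (trans s' (ap g s')) = ky) + ?c))"
  proof (rule E_mono[OF expE])
   fix g
   let ?a = "trans s (ap g s)" let ?a' = "trans s' (ap g s')"
   have V: "?a \<in> V" "?a' \<in> V" using s by (auto intro!: V_trans ap_less)
   show "?Y ?a ?a' <= \<delta> * (of_bool (kf ?a = kf ?a') + of_bool (kf ?a' = ky) + ?c)"
   proof (cases "kf ?a = kf ?a' \<or> kf ?a' = ky")
    case True
    have "?Y ?a ?a' <= Es n (%gs. of_bool (hit gs ?a j))"
    proof (rule E_mono[OF expEs])
     fix gs
     have "E (%gl. of_bool (coll gs gl ?a ?a')) <= 1" by (rule E_le_const[OF expE]) simp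
     then show "of_bool (hit gs ?a j) * E (%gl. of_bool (coll gs gl ?a ?a')) <= of_bool (hit gs ?a j)" by auto
    qed
    also have "... = \<delta> * 1" using Suc s V by (simp add: hit_exp)
    also have "... <= \<delta> * (of_bool (kf ?a = kf ?a') + of_bool (kf ?a' = ky) + ?c)"
     using True c0 \<delta>0 by (intro mult_left_mono) auto
    finally show ?thesis .
   next
    case False
    have "?Y ?a ?a' <= \<delta> * (real n * (3 * \<beta>' ?a ?a') + 1 / P)"
     using False Suc s V by (intro Suc.IH) (auto simp: box_trans ap_less)
    then show ?thesis using False s by (simp add: \<beta>'_trans ap_less)
   qed
  qed
  also have "... = avg W (%w. avg W (%w'. \<delta> * (of_bool (kf (trans s w) = kf (trans s' w')) + of_bool (kf (trans s' w') = ky) + ?c)))"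
   by (rule pair[OF s(1-3)])
  also have "... = \<delta> * (avg W (%w. avg W (%w'. of_bool (kf (trans s w) = kf (trans s' w')))) + avg W (%w'. of_bool (kf (trans s' w') = ky)) + ?c)"
   by (simp only: E_cmult[OF expW] E_add[OF expW] E_const[OF expW])
  also have "... <= \<delta> * (2 * ?b + ?b + ?c)"
   using target_step[OF s(1,2,4,5)] merge_pair[OF s(1-3)] \<delta>0 by (intro mult_left_mono) auto
  also have "... = \<delta> * (real (Suc n) * (3 * ?b) + 1 / P)"
   by (simp add: algebra_simps)
  finally show ?thesis .
 qed
qed simp

text \<open>A cell keeps only the last counter written to it, so the end cell has to belong to one
  chain alone.\<close>

definition covered :: "'a set => nat list list => nat list => bool" where
 "covered St gs gl \<longleftrightarrow> (\<exists>s\<in>St. box s = bx & (EX i<length gs. hit gs s i) & (\<forall>s'\<in>St. s' ~= s --> ~ coll gs gl s s'))"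

text \<open>Truncated inclusion-exclusion. A summand is positive only for a hit without collision
  and without an earlier hit from the box, and at most one pair is of this kind.\<close>

lemma covered_ge:
 assumes St: "finite St" "St \<subseteq> V" and n: "length gs = n" and Sy: "Sy = {s \<in> St. box s = bx}"
 shows "(\<Sum>(s, i)\<in>Sy \<times> {..<n}. of_bool (hit gs s i) - (\<Sum>s'\<in>St - {s}. of_bool (hit gs s i) * of_bool (coll gs gl s s'))
      - (\<Sum>s'\<in>Sy. \<Sum>i'<i. of_bool (hit gs s' i') * of_bool (hit gs s i))) <= (of_bool (covered St gs gl) :: real)"
  (is "sum ?t _ <= _")
proof -
 let ?X = "Sy \<times> {..<n}"
 have finX: "finite ?X" using St Sy by simp
 define good where "good s i \<longleftrightarrow> hit gs s i & (\<forall>s'\<in>St - {s}. ~ coll gs gl s s') & (\<forall>s'\<in>Sy. ALL i'<i. ~ hit gs s' i')" for s i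
 have t_le: "?t (s, i) <= of_bool (good s i)" if "(s, i) \<in> ?X" for s i
 proof (cases "good s i")
  case True
  have "0 <= (\<Sum>s'\<in>St - {s}. of_bool (hit gs s i) * of_bool (coll gs gl s s') :: real)"
   "0 <= (\<Sum>s'\<in>Sy. \<Sum>i'<i. of_bool (hit gs s' i') * of_bool (hit gs s i) :: real)"
   by (auto intro!: sum_nonneg)
  moreover have "of_bool (good s i) = (1::real)" "of_bool (hit gs s i) <= (1::real)" using True by simp_all
  ultimately show ?thesis unfolding prod.case by linarith
 next
  case False
  show ?thesis
  proof (cases "hit gs s i")
   case hit: True
   have nn: "0 <= (\<Sum>s'\<in>St - {s}. of_bool (coll gs gl s s') :: real)"
    "0 <= (\<Sum>s'\<in>Sy. \<Sum>i'<i. of_bool (hit gs s' i') :: real)"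
    by (auto intro!: sum_nonneg)
   consider s' where "s' \<in> St - {s}" "coll gs gl s s'" | s' i' where "s' \<in> Sy" "i' < i" "hit gs s' i'"
    using False hit unfolding good_def by blast
   then have "1 <= (\<Sum>s'\<in>St - {s}. of_bool (coll gs gl s s') :: real) + (\<Sum>s'\<in>Sy. \<Sum>i'<i. of_bool (hit gs s' i') :: real)"
   proof cases
    case 1
    then have "of_bool (coll gs gl s s') <= (\<Sum>s'\<in>St - {s}. of_bool (coll gs gl s s') :: real)"
     using St by (intro member_le_sum) auto
    with 1 nn show ?thesis by simp
   next
    case 2
    then have "(\<Sum>i'<i. of_bool (hit gs s' i') :: real) <= (\<Sum>s'\<in>Sy. \<Sum>i'<i. of_bool (hit gs s' i') :: real)"
     using St Sy by (intro member_le_sum[of s' Sy "%s'. \<Sum>i'<i. of_bool (hit gs s' i')"]) (auto intro: sum_nonneg)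
    moreover have "of_bool (hit gs s' i') <= (\<Sum>i'<i. of_bool (hit gs s' i') :: real)"
     using 2 by (intro member_le_sum) auto
    ultimately show ?thesis using 2 nn by simp
   qed
   then show ?thesis using hit False by simp
  qed simp
 qed
 \<comment> \<open>Good pairs are earliest hits and therefore agree in the step. Their chains end
   with equal keys and would collide if they were different.\<close>
 have uniq: "(s, i) = (s', i')" if "(s, i) \<in> ?X" "(s', i') \<in> ?X" "good s i" "good s' i'" for s i s' i'
 proof -
  have "~ i < i'" "~ i' < i" using that by (auto simp: good_def)
  then have i: "i = i'" by simp
  have "kf (run gs s) = kf (run gs s')"
   by (rule hit_run_eq[where i = i]) (use that i Sy St in "auto simp: good_def")
  then have "coll gs gl s s'" by (simp add: coll_def ap_def)
  then have "s = s'" using that Sy by (auto simp: good_def)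
  with i show ?thesis by simp
 qed
 have "sum ?t ?X <= (\<Sum>(s, i)\<in>?X. of_bool (good s i))"
  by (rule sum_mono) (use t_le in auto)
 also have "... <= of_bool (covered St gs gl)"
 proof (cases "EX s i. (s, i) \<in> ?X & good s i")
  case True
  then obtain s i where si: "(s, i) \<in> ?X" "good s i" by blast
  have "(\<Sum>(s, i)\<in>?X. of_bool (good s i)) = (\<Sum>x\<in>?X. if x = (s, i) then 1 else (0::real))"
   by (rule sum.cong[OF refl]) (use uniq si in fastforce)
  also have "... = 1" using si finX by simp
  finally have "(\<Sum>(s, i)\<in>?X. of_bool (good s i)) = (1 :: real)" .
  moreover have "covered St gs gl"
   unfolding covered_def using si Sy n by (auto simp: good_def intro!: bexI[of _ s] exI[of _ i])
  ultimately show ?thesis by simp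
 next
  case False
  then have "(\<Sum>(s, i)\<in>?X. of_bool (good s i)) = (0 :: real)" by (intro sum.neutral) auto
  then show ?thesis by simp
 qed
 finally show ?thesis .
qed

text \<open>Linearity of expectation applied to \<open>covered_ge\<close>. Relative to the expected
  number of hits, the bracket subtracts the losses by merging, by shared cells and by repeated
  hits.\<close>

lemma covered_prob:
 assumes St: "finite St" "St \<subseteq> V" "inj_on kf St" and ky: "!!s. s \<in> St ==> kf s ~= ky"
  and Sy: "Sy = {s \<in> St. box s = bx}"
 shows "real (card Sy) * real n * \<delta> * (1 - 3 * real (card Sy) * real n * \<beta> - real (card St) / P - real (card Sy) * real n * \<delta>)
   <= Es n (%gs. E (%gl. of_bool (covered St gs gl)))"
proof -
 let ?m = "real (card Sy)" and ?M = "real (card St)"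
 have fSy: "finite Sy" "Sy \<subseteq> St" using St Sy by auto
 have tm: "\<delta> - \<delta> * (real n * 3 * \<beta> * ?m + ?M / P) - ?m * real n * (\<delta> * \<delta>) <=
   Es n (%gs. of_bool (hit gs s i)) -
     (\<Sum>s'\<in>St - {s}. Es n (%gs. of_bool (hit gs s i) * E (%gl. of_bool (coll gs gl s s')))) -
     (\<Sum>s'\<in>Sy. \<Sum>i'<i. Es n (%gs. of_bool (hit gs s' i') * of_bool (hit gs s i)))"
  if si: "(s, i) \<in> Sy \<times> {..<n}" for s i
 proof -
  have s: "s \<in> V" "s \<in> St" "box s = bx" "i < n" using si Sy St by auto
  have h: "Es n (%gs. of_bool (hit gs s i)) = \<delta>" by (rule hit_exp[OF s(1,4)])
  have "(\<Sum>s'\<in>St - {s}. Es n (%gs. of_bool (hit gs s i) * E (%gl. of_bool (coll gs gl s s')))) <=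
    (\<Sum>s'\<in>St - {s}. \<delta> * (real n * (3 * \<beta>' s s') + 1 / P))"
  proof (rule sum_mono)
   fix s' assume s': "s' \<in> St - {s}"
   then have "kf s ~= kf s'" using St(3) s(2) by (auto simp: inj_on_def)
   then show "Es n (%gs. of_bool (hit gs s i) * E (%gl. of_bool (coll gs gl s s'))) <= \<delta> * (real n * (3 * \<beta>' s s') + 1 / P)"
    using s s' St ky by (intro hit_coll) auto
  qed
  also have "... <= (\<Sum>s'\<in>St. \<delta> * (real n * (3 * \<beta>' s s') + 1 / P))"
   using St \<delta>0 \<beta>'0 by (intro sum_mono2) auto
  also have "... = \<delta> * (real n * 3 * (\<Sum>s'\<in>St. \<beta>' s s') + ?M / P)"
   by (simp add: sum_distrib_left[symmetric] sum.distrib algebra_simps)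
  also have "(\<Sum>s'\<in>St. \<beta>' s s') = (\<Sum>s'\<in>Sy. \<beta>)"
   unfolding Sy using s St by (subst sum.inter_filter) (auto simp: \<beta>'_def intro!: sum.cong)
  also have "\<delta> * (real n * 3 * (\<Sum>s'\<in>Sy. \<beta>) + ?M / P) = \<delta> * (real n * 3 * \<beta> * ?m + ?M / P)" by simp
  finally have a: "(\<Sum>s'\<in>St - {s}. Es n (%gs. of_bool (hit gs s i) * E (%gl. of_bool (coll gs gl s s')))) <= ..." .
  have "(\<Sum>s'\<in>Sy. \<Sum>i'<i. Es n (%gs. of_bool (hit gs s' i') * of_bool (hit gs s i))) = (\<Sum>s'\<in>Sy. \<Sum>i'<i. \<delta> * \<delta>)"
   by (intro sum.cong refl hit_hit) (use s fSy St in auto)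
  also have "... <= ?m * real n * (\<delta> * \<delta>)"
  proof -
   have "?m * real i * (\<delta> * \<delta>) <= ?m * real n * (\<delta> * \<delta>)"
    using s by (intro mult_right_mono mult_left_mono) auto
   then show ?thesis by (simp add: mult.assoc)
  qed
  finally show ?thesis using a h by linarith
 qed
 have "real (card Sy) * real n * \<delta> * (1 - 3 * real (card Sy) * real n * \<beta> - real (card St) / P - real (card Sy) * real n * \<delta>) =
   (\<Sum>(s, i)\<in>Sy \<times> {..<n}. \<delta> - \<delta> * (real n * 3 * \<beta> * ?m + ?M / P) - ?m * real n * (\<delta> * \<delta>))"
  by (simp add: card_cartesian_product algebra_simps)
 also have "... <= (\<Sum>(s, i)\<in>Sy \<times> {..<n}. Es n (%gs. of_bool (hit gs s i)) -
     (\<Sum>s'\<in>St - {s}. Es n (%gs. of_bool (hit gs s i) * E (%gl. of_bool (coll gs gl s s')))) -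
     (\<Sum>s'\<in>Sy. \<Sum>i'<i. Es n (%gs. of_bool (hit gs s' i') * of_bool (hit gs s i))))"
  by (rule sum_mono) (use tm in auto)
 also have "... = Es n (%gs. E (%gl. \<Sum>(s, i)\<in>Sy \<times> {..<n}. of_bool (hit gs s i) - (\<Sum>s'\<in>St - {s}. of_bool (hit gs s i) * of_bool (coll gs gl s s'))
      - (\<Sum>s'\<in>Sy. \<Sum>i'<i. of_bool (hit gs s' i') * of_bool (hit gs s i))))"
  by (simp only: finite_cartesian_product finite_lessThan finite_Diff fSy(1) St(1) case_prod_unfold E_sum[OF expE] E_sum[OF expEs] E_diff[OF expE] E_diff[OF expEs] E_cmult[OF expE] E_const[OF expE])
 also have "... <= Es n (%gs. E (%gl. of_bool (covered St gs gl)))"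
  by (intro E_mono[OF expEs] E_mono[OF expE] covered_ge[OF St(1,2) _ Sy]) auto
 finally show ?thesis .
qed

text \<open>Chebyshev's inequality for the number of sampled points in \<open>Wy\<close>, plus a union bound over the other samples
 that could overwrite the cell of \<open>ky\<close>.\<close>

lemma sample_prob:
 assumes St: "finite St" "St \<subseteq> V" "inj_on kf St"
  and Sy: "Sy = {s \<in> St. box s = bx}" and kyV: "ky \<in> keys_of NP Q" and m: "0 < real (card Sy) * \<delta>"
 shows "E (%g. E (%gl. of_bool (~ ((\<exists>s\<in>Sy. ap g s \<in> Wy) &
    (\<forall>s\<in>St. kf (trans s (ap g s)) ~= ky --> ap gl (trans s (ap g s)) mod P ~= hl W NP Q gl ky mod P)))))
   <= 1 / (real (card Sy) * \<delta>) + real (card St) / P"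
proof -
 let ?\<mu> = "real (card Sy) * \<delta>"
 let ?x = "%g s. of_bool (ap g s \<in> Wy) :: real"
 let ?z = "%g. of_bool (\<forall>s\<in>Sy. ap g s \<notin> Wy) :: real"
 let ?D = "%g. ((\<Sum>s\<in>Sy. ?x g s) - ?\<mu>) * ((\<Sum>s\<in>Sy. ?x g s) - ?\<mu>)"
 let ?h = "%gl k. hl W NP Q gl k mod P"
 let ?B = "%g gl s. kf (trans s (ap g s)) ~= ky & ?h gl (kf (trans s (ap g s))) = ?h gl ky"
 let ?A = "%g gl. of_bool (~ ((\<exists>s\<in>Sy. ap g s \<in> Wy) & (\<forall>s\<in>St. kf (trans s (ap g s)) ~= ky --> ap gl (trans s (ap g s)) mod P ~= ?h gl ky))) :: real"
 have fSy: "finite Sy" "Sy \<subseteq> St" using St Sy by auto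
 have EX1: "E (%g. ?x g s) = \<delta>" if "s \<in> Sy" for s
  using single[of s "%w. of_bool (w \<in> Wy)"] that fSy St by (auto simp: \<delta>_def)
 have EX2: "E (%g. ?x g s * ?x g s') <= (if s = s' then \<delta> else 0) + \<delta> * \<delta>" if ss': "s \<in> Sy" "s' \<in> Sy" for s s'
 proof (cases "s = s'")
  case True
  have "E (%g. ?x g s * ?x g s') = E (%g. ?x g s)" using True by (simp flip: of_bool_conj)
  then show ?thesis using EX1[OF ss'(1)] True \<delta>0 by simp
 next
  case False
  then have "kf s ~= kf s'" using St(3) ss' fSy by (auto simp: inj_on_def)
  then have "E (%g. ?x g s * ?x g s') = avg W (%w. avg W (%w'. of_bool (w \<in> Wy) * of_bool (w' \<in> Wy)))"
   using pair[of s s' "%w w'. of_bool (w \<in> Wy) * of_bool (w' \<in> Wy)"] ss' fSy St by auto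
  also have "... = \<delta> * \<delta>" by (simp add: E_cmult[OF expW] E_cmultr[OF expW] \<delta>_def)
  finally show ?thesis using False by simp
 qed
 have sq: "E (%g. ?D g) <= ?\<mu>"
 proof -
  have "E (%g. ?D g) =
    E (%g. (\<Sum>s\<in>Sy. \<Sum>s'\<in>Sy. ?x g s * ?x g s') - (2 * ?\<mu>) * (\<Sum>s\<in>Sy. ?x g s) + ?\<mu> * ?\<mu>)"
   by (simp add: sum_product[symmetric] algebra_simps)
  also have "... = (\<Sum>s\<in>Sy. \<Sum>s'\<in>Sy. E (%g. ?x g s * ?x g s')) - (2 * ?\<mu>) * (\<Sum>s\<in>Sy. E (%g. ?x g s)) + ?\<mu> * ?\<mu>"
   by (simp only: E_add[OF expE] E_diff[OF expE] E_cmult[OF expE] E_const[OF expE] E_sum[OF expE fSy(1)])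
  also have "... <= (\<Sum>s\<in>Sy. \<Sum>s'\<in>Sy. (if s = s' then \<delta> else 0) + \<delta> * \<delta>) - (2 * ?\<mu>) * (\<Sum>s\<in>Sy. \<delta>) + ?\<mu> * ?\<mu>"
   using EX1 EX2 by (intro add_right_mono diff_mono sum_mono) auto
  also have "... = ?\<mu>" using fSy by (simp add: sum.distrib algebra_simps)
  finally show ?thesis .
 qed
 have nohit: "E (%g. ?z g) <= 1 / ?\<mu>"
 proof -
  have "E (%g. (?\<mu> * ?\<mu>) * ?z g) <= E (%g. ?D g)"
  proof (rule E_mono[OF expE])
   fix g
   show "(?\<mu> * ?\<mu>) * ?z g <= ?D g"
   proof (cases "\<forall>s\<in>Sy. ap g s \<notin> Wy")
    case True
    then have "(\<Sum>s\<in>Sy. ?x g s) = 0" by (intro sum.neutral) auto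
    then show ?thesis using True by simp
   qed auto
  qed
  then have "(?\<mu> * ?\<mu>) * E (%g. ?z g) <= ?\<mu>"
   using sq by (simp only: E_cmult[OF expE])
  then have "?\<mu> * E (%g. ?z g) <= 1"
   using m mult_le_cancel_left_pos[of ?\<mu> "?\<mu> * E (%g. ?z g)" 1] by (simp only: mult.assoc mult_1_right)
  then show ?thesis using m by (simp add: pos_le_divide_eq mult.commute)
 qed
 have over: "E (%gl. of_bool (k ~= ky & ?h gl k = ?h gl ky)) <= 1 / P"
  if k: "k \<in> keys_of NP Q" for k
 proof (cases "k = ky")
  case False
  have "E (%gl. of_bool (k ~= ky & ?h gl k = ?h gl ky)) =
    avg W (%w. avg W (%w'. of_bool (k ~= ky & w mod P = w' mod P)))"
   by (rule hash_pair[OF W k kyV False])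
  also have "... = avg W (%w. 1 / P)"
   using avg_mod[OF W P(2), of "w mod P" for w] P(1) False by (simp add: eq_commute)
  finally show ?thesis by (simp add: E_const[OF expW])
 qed (simp add: E_const[OF expE])
 have "E (%g. E (%gl. ?A g gl)) <=
   E (%g. E (%gl. ?z g +
    (\<Sum>s\<in>St. of_bool (?B g gl s))))"
 proof (intro E_mono[OF expE])
  fix g gl
  have nn: "0 <= (\<Sum>s\<in>St. of_bool (?B g gl s) :: real)" by (auto intro!: sum_nonneg)
  have "1 <= (\<Sum>s\<in>St. of_bool (?B g gl s) :: real)" if "s \<in> St" "?B g gl s" for s
   using member_le_sum[of s St "%s. of_bool (?B g gl s) :: real"] that St by simp
  then show "?A g gl <=
   ?z g + (\<Sum>s\<in>St. of_bool (?B g gl s) :: real)"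
   using nn unfolding ap_def by (cases "\<forall>s\<in>Sy. hl W NP Q g (kf s) \<notin> Wy") auto
 qed
 also have "... = E (%g. ?z g) + E (%g. (\<Sum>s\<in>St. E (%gl. of_bool (?B g gl s))))"
  by (simp only: E_add[OF expE] E_const[OF expE] E_sum[OF expE St(1)])
 also have "... <= 1 / ?\<mu> + E (%g. (\<Sum>s\<in>St. 1 / P))"
  using St by (intro add_mono nohit E_mono[OF expE] sum_mono over V_keys V_trans ap_less) auto
 finally show ?thesis by (simp add: E_const[OF expE])
qed

end

section \<open>Growth up to polylogarithmic factors\<close>

text \<open>\<open>softO\<close> in an explicit form closed under sums and products of exponents;
  exponent 0 is the class of polylogarithmic functions.\<close>

definition SO :: "real => (nat => nat) => bool" where
 "SO a f \<longleftrightarrow> (EX C c. eventually (%n. real (f n) <= C * (real n powr a * ln (real n) ^ c)) at_top)"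

lemma ln_ge1: "eventually (%n::nat. 1 <= ln (real n)) at_top"
 by real_asymp

lemma n_ge1: "eventually (%n::nat. 1 <= n) at_top"
 by (rule eventually_ge_at_top)

lemma SO_softO: "SO a f \<longleftrightarrow> (%n. real (f n)) \<in> softO (%n. real n powr a)"
proof
 assume "SO a f"
 then obtain C c where C: "eventually (%n. real (f n) <= C * (real n powr a * ln (real n) ^ c)) at_top" unfolding SO_def by blast
 have "(%n. real (f n)) \<in> O(%n. real n powr a * ln (real n) ^ c)"
 proof (rule bigoI[where c = C])
  show "eventually (%n. norm (real (f n)) <= C * norm (real n powr a * ln (real n) ^ c)) at_top"
   using C ln_ge1 by eventually_elim simp
 qed
 then show "(%n. real (f n)) \<in> softO (%n. real n powr a)" unfolding softO_def by blast
next
 assume "(%n. real (f n)) \<in> softO (%n. real n powr a)"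
 then obtain c where "(%n. real (f n)) \<in> O(%n. real n powr a * ln (real n) ^ c)" unfolding softO_def by blast
 then obtain C where "eventually (%n. norm (real (f n)) <= C * norm (real n powr a * ln (real n) ^ c)) at_top" by (elim landau_o.bigE)
 then have "eventually (%n. real (f n) <= C * (real n powr a * ln (real n) ^ c)) at_top"
  using ln_ge1 by eventually_elim simp
 then show "SO a f" unfolding SO_def by blast
qed

lemma softO_cong:
 assumes "eventually (%n. g n = h n) at_top" shows "softO g = softO h"
proof -
 have "O(%n. g n * ln (real n) ^ c) = O(%n. h n * ln (real n) ^ c)" for c
  by (rule landau_o.big.cong) (use assms in eventually_elim, simp)
 then show ?thesis unfolding softO_def by simp
qed

lemma SO_I: "eventually (%n. real (f n) <= C * real n powr a) at_top ==> SO a f"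
 unfolding SO_def by (intro exI[of _ C] exI[of _ 0]) simp

lemma SO_le: "SO a f ==> eventually (%n. g n <= f n) at_top ==> SO a g"
proof -
 assume "SO a f" and e: "eventually (%n. g n <= f n) at_top"
 then obtain C c where C: "eventually (%n. real (f n) <= C * (real n powr a * ln (real n) ^ c)) at_top" unfolding SO_def by blast
 have "eventually (%n. real (g n) <= C * (real n powr a * ln (real n) ^ c)) at_top"
  using C e by eventually_elim (meson le_trans of_nat_mono order_trans)
 then show ?thesis unfolding SO_def by blast
qed

lemma SO_nonneg:
 assumes "SO a f"
 obtains C c where "0 <= C" "eventually (%n. real (f n) <= C * (real n powr a * ln (real n) ^ c)) at_top"
proof -
 obtain C c where C: "eventually (%n. real (f n) <= C * (real n powr a * ln (real n) ^ c)) at_top" using assms unfolding SO_def by blast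
 have "eventually (%n. real (f n) <= \<bar>C\<bar> * (real n powr a * ln (real n) ^ c)) at_top"
  using C ln_ge1
 proof eventually_elim
  case (elim n)
  have "C * (real n powr a * ln (real n) ^ c) <= \<bar>C\<bar> * (real n powr a * ln (real n) ^ c)"
   using elim by (intro mult_right_mono) auto
  then show ?case using elim by linarith
 qed
 then show thesis using that[of "\<bar>C\<bar>" c] by simp
qed

lemma SO_mono: "SO a f ==> a <= a' ==> SO a' f"
proof -
 assume f: "SO a f" and a: "a <= a'"
 obtain C c where C: "0 <= C" "eventually (%n. real (f n) <= C * (real n powr a * ln (real n) ^ c)) at_top" using SO_nonneg[OF f] by blast
 have "eventually (%n. real (f n) <= C * (real n powr a' * ln (real n) ^ c)) at_top"
  using C(2) ln_ge1 n_ge1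
 proof eventually_elim
  case (elim n)
  have "C * (real n powr a * ln (real n) ^ c) <= C * (real n powr a' * ln (real n) ^ c)"
   using elim a C by (intro mult_left_mono mult_right_mono powr_mono) auto
  then show ?case using elim by linarith
 qed
 then show ?thesis unfolding SO_def by blast
qed

lemma SO_mult: "SO a f ==> SO a' g ==> SO (a + a') (%n. f n * g n)"
proof -
 assume f: "SO a f" and g: "SO a' g"
 obtain C c where C: "0 <= C" "eventually (%n. real (f n) <= C * (real n powr a * ln (real n) ^ c)) at_top" using SO_nonneg[OF f] by blast
 obtain C' c' where C': "0 <= C'" "eventually (%n. real (g n) <= C' * (real n powr a' * ln (real n) ^ c')) at_top" using SO_nonneg[OF g] by blast
 have "eventually (%n. real (f n * g n) <= (C * C') * (real n powr (a + a') * ln (real n) ^ (c + c'))) at_top"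
  using C(2) C'(2) ln_ge1
 proof eventually_elim
  case (elim n)
  have "real (f n) * real (g n) <= (C * (real n powr a * ln (real n) ^ c)) * (C' * (real n powr a' * ln (real n) ^ c'))"
   using elim by (intro mult_mono) auto
  then show ?case by (simp add: powr_add power_add algebra_simps)
 qed
 then show ?thesis unfolding SO_def by blast
qed

lemma SO_add: "SO a f ==> SO a g ==> SO a (%n. f n + g n)"
proof -
 assume f: "SO a f" and g: "SO a g"
 obtain C c where C: "0 <= C" "eventually (%n. real (f n) <= C * (real n powr a * ln (real n) ^ c)) at_top" using SO_nonneg[OF f] by blast
 obtain C' c' where C': "0 <= C'" "eventually (%n. real (g n) <= C' * (real n powr a * ln (real n) ^ c')) at_top" using SO_nonneg[OF g] by blast
 have "eventually (%n. real (f n + g n) <= (C + C') * (real n powr a * ln (real n) ^ (c + c'))) at_top"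
  using C(2) C'(2) ln_ge1
 proof eventually_elim
  case (elim n)
  have "C * (real n powr a * ln (real n) ^ c) <= C * (real n powr a * ln (real n) ^ (c + c'))"
   using elim C by (intro mult_left_mono power_increasing) auto
  moreover have "C' * (real n powr a * ln (real n) ^ c') <= C' * (real n powr a * ln (real n) ^ (c + c'))"
   using elim C' by (intro mult_left_mono power_increasing) auto
  ultimately show ?case using elim by (simp add: distrib_right)
 qed
 then show ?thesis unfolding SO_def by blast
qed

lemma SO_const: "SO 0 (%_. c)"
proof (rule SO_I[where C = "real c"])
 show "eventually (%n. real c <= real c * real n powr 0) at_top" using n_ge1 by eventually_elim simp
qed

lemma SO_const': "0 <= a ==> SO a (%_. c)"
 by (rule SO_mono[OF SO_const])

lemma SO_mult_PL: "SO 0 f ==> SO a g ==> SO a (%n. f n * g n)" "SO a f ==> SO 0 g ==> SO a (%n. f n * g n)"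
 using SO_mult[of 0 f a g] SO_mult[of a f 0 g] by simp_all

lemma PL_pow: "SO 0 f ==> SO 0 (%n. f n ^ c)"
 by (induction c) (auto intro: SO_const SO_mult_PL)

lemma SO_id: "SO 1 (%n. n)"
proof (rule SO_I[where C = 1])
 show "eventually (%n. real n <= 1 * real n powr 1) at_top" using n_ge1 by eventually_elim simp
qed

text \<open>The word size is \<open>ka * lg n\<close>, and \<open>lg n\<close> also serves as the
  number \<open>L\<close> of bits of a rank.\<close>

definition lg :: "nat => nat" where "lg n = nat \<lceil>log 2 (real n + 2)\<rceil>"

lemma lg_bounds: "1 <= lg n" "n + 2 <= 2 ^ lg n" "2 ^ lg n <= 2 * (n + 2)"
proof -
 have 1: "1 <= log 2 (real n + 2)" by simp
 then have p: "real (lg n) = of_int \<lceil>log 2 (real n + 2)\<rceil>" unfolding lg_def by (simp add: ceiling_mono)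
 then have ge: "log 2 (real n + 2) <= real (lg n)" and lt: "real (lg n) < log 2 (real n + 2) + 1" by linarith+
 have "1 <= real (lg n)" using 1 ge by linarith
 then show "1 <= lg n" by simp
 have "real n + 2 = 2 powr log 2 (real n + 2)" by simp
 also have "... <= 2 powr real (lg n)" using ge by (intro powr_mono) auto
 also have "... = 2 ^ lg n" by (simp add: powr_realpow)
 finally have "real (n + 2) <= real (2 ^ lg n)" by simp
 then show "n + 2 <= 2 ^ lg n" by (simp only: of_nat_le_iff)
 have "(2::real) ^ lg n = 2 powr real (lg n)" by (simp add: powr_realpow)
 also have "... <= 2 powr (log 2 (real n + 2) + 1)" using lt by (intro powr_mono) auto
 also have "... = 2 * (real n + 2)" by (simp add: powr_add)
 finally have "real (2 ^ lg n) <= real (2 * (n + 2))" by simp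
 then show "2 ^ lg n <= 2 * (n + 2)" by (simp only: of_nat_le_iff)
qed

lemma SO_lg: "SO 0 lg"
proof -
 have "eventually (%n. real (lg n) <= 4 * (real n powr 0 * ln (real n) ^ 1)) at_top"
 proof -
  have "eventually (%n::nat. 2 * ln (real n + 2) + 1 <= 4 * ln (real n)) at_top" by real_asymp
  then show ?thesis using n_ge1
  proof eventually_elim
   case (elim n)
   have "0 <= log 2 (real n + 2)" by simp
   then have "real (lg n) <= log 2 (real n + 2) + 1" unfolding lg_def by linarith
   moreover have "log 2 (real n + 2) <= 2 * ln (real n + 2)"
   proof -
    have "ln (real n + 2) * 1 <= ln (real n + 2) * (2 * ln 2)" using ln2_ge_two_thirds by (intro mult_left_mono) auto
    then show ?thesis by (simp add: log_def divide_le_eq)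
   qed
   ultimately have "real (lg n) <= 2 * ln (real n + 2) + 1" by linarith
   then show ?case using elim by simp
  qed
 qed
 then show ?thesis unfolding SO_def by blast
qed

lemma SO_two_lg: "SO 1 (%n. 2 ^ lg n)" "SO (real k) (%n. 2 ^ (k * lg n))"
proof -
 show 1: "SO 1 (%n. 2 ^ lg n)"
 proof (rule SO_I[where C = 6])
  show "eventually (%n. real (2 ^ lg n) <= 6 * real n powr 1) at_top"
   using n_ge1
  proof eventually_elim
   case (elim n)
   have "real (2 ^ lg n) <= real (2 * (n + 2))" using lg_bounds(3)[of n] by (simp only: of_nat_le_iff)
   then show ?case using elim by simp
  qed
 qed
 show "SO (real k) (%n. 2 ^ (k * lg n))"
 proof (induction k)
  case (Suc k)
  then show ?case using SO_mult[OF 1 Suc] by (simp add: power_add add.commute)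
 qed (simp add: SO_const)
qed

text \<open>The bound has to hold for every \<open>n\<close>, as the word size is chosen once for
  all \<open>n\<close>; finitely many exceptional values are absorbed in \<open>B\<close>.\<close>

lemma PL_bounded:
 assumes "SO 0 f" shows "EX B. ALL n. f n <= B * 2 ^ lg n"
proof -
 obtain C c where C: "0 <= C" "eventually (%n. real (f n) <= C * (real n powr 0 * ln (real n) ^ c)) at_top" using SO_nonneg[OF assms] by blast
 have "eventually (%n::nat. ln (real n) ^ c <= real n) at_top" by real_asymp
 with C(2) have "eventually (%n. real (f n) <= C * real n) at_top" using n_ge1
 proof eventually_elim
  case (elim n)
  have "C * ln (real n) ^ c <= C * real n" using elim C by (intro mult_left_mono) auto
  then show ?case using elim by simp
 qed
 then obtain N where N: "!!n. N <= n ==> real (f n) <= C * real n" unfolding eventually_at_top_linorder by blast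
 define B where "B = nat \<lceil>C\<rceil> + (\<Sum>n<N. f n)"
 have "f n <= B * 2 ^ lg n" for n
 proof (cases "n < N")
  case True
  then have "f n <= (\<Sum>n<N. f n)" by (intro member_le_sum) auto
  also have "... <= B * 1" by (simp add: B_def)
  also have "... <= B * 2 ^ lg n" by (intro mult_le_mono2) simp
  finally show ?thesis .
 next
  case False
  then have "real (f n) <= C * real n" using N by simp
  also have "... <= real (nat \<lceil>C\<rceil>) * real n" using C by (intro mult_right_mono) linarith+
  finally have "f n <= nat \<lceil>C\<rceil> * n" by (metis of_nat_le_iff of_nat_mult)
  also have "... <= B * 2 ^ lg n" using lg_bounds(2)[of n] by (intro mult_le_mono) (auto simp: B_def)
  finally show ?thesis .
 qed
 then show ?thesis by blast
qed

text \<open>Functions of the word size factor \<open>ka\<close> and of \<open>n\<close> that are polynomial in \<open>ka\<close> and \<open>n\<close>: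
 a sufficiently large \<open>ka\<close> makes them smaller than \<open>2 ^ (ka * lg n)\<close> for all \<open>n\<close>.\<close>

definition pb :: "(nat => nat => nat) => bool" where
 "pb F \<longleftrightarrow> (EX C x y. ALL ka>=1. ALL n. F ka n <= C * ka ^ x * 2 ^ (y * lg n))"

lemma pb_const: "pb (%_ _. c)"
 unfolding pb_def by (intro exI[of _ c] exI[of _ 0]) simp

lemma pb_le: "pb F ==> (!!ka n. 1 <= ka ==> G ka n <= F ka n) ==> pb G"
 unfolding pb_def by (meson le_trans)

lemma pb_add: "pb F ==> pb G ==> pb (%ka n. F ka n + G ka n)"
proof -
 assume "pb F" "pb G"
 then obtain C x y C' x' y' where F: "!!ka n. 1 <= ka ==> F ka n <= C * ka ^ x * 2 ^ (y * lg n)" and G: "!!ka n. 1 <= ka ==> G ka n <= C' * ka ^ x' * 2 ^ (y' * lg n)"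
  unfolding pb_def by blast
 have "F ka n + G ka n <= (C + C') * ka ^ (x + x') * 2 ^ ((y + y') * lg n)" if ka: "1 <= ka" for ka n
 proof -
  have "C * ka ^ x * 2 ^ (y * lg n) <= C * ka ^ (x + x') * 2 ^ ((y + y') * lg n)"
   using ka by (intro mult_le_mono power_increasing) auto
  moreover have "C' * ka ^ x' * 2 ^ (y' * lg n) <= C' * ka ^ (x + x') * 2 ^ ((y + y') * lg n)"
   using ka by (intro mult_le_mono power_increasing) auto
  ultimately show ?thesis using F[OF ka, of n] G[OF ka, of n] unfolding add_mult_distrib[of C C'] add_mult_distrib[of "C * _"] by linarith
 qed
 then show ?thesis unfolding pb_def by blast
qed

lemma pb_mult: "pb F ==> pb G ==> pb (%ka n. F ka n * G ka n)"
proof -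
 assume "pb F" "pb G"
 then obtain C x y C' x' y' where F: "!!ka n. 1 <= ka ==> F ka n <= C * ka ^ x * 2 ^ (y * lg n)" and G: "!!ka n. 1 <= ka ==> G ka n <= C' * ka ^ x' * 2 ^ (y' * lg n)"
  unfolding pb_def by blast
 have "F ka n * G ka n <= (C * C') * ka ^ (x + x') * 2 ^ ((y + y') * lg n)" if ka: "1 <= ka" for ka n
  using mult_le_mono[OF F[OF ka, of n] G[OF ka, of n]] by (simp add: power_add algebra_simps)
 then show ?thesis unfolding pb_def by blast
qed

lemma pb_pow: "pb F ==> pb (%ka n. F ka n ^ c)"
 by (induction c) (auto intro: pb_const pb_mult)

lemma pb_kappa: "pb (%ka _. ka)"
 unfolding pb_def by (intro exI[of _ 1] exI[of _ 1] exI[of _ 0]) simp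

lemma pb_two: "pb (%_ n. 2 ^ (c * lg n))"
 unfolding pb_def by (intro exI[of _ 1] exI[of _ 0] exI[of _ c]) simp

lemma pb_lg: "pb (%_ n. lg n)"
 by (rule pb_le[OF pb_two[of 1]]) simp

text \<open>\<open>ka\<close> enters the left side only polynomially but the right side in the
  exponent. A choice that works with \<open>lg n\<close> replaced by 1 works for all
  \<open>n\<close>, because \<open>lg n\<close> is at least 1.\<close>

lemma pb_choose:
 assumes "pb F" shows "EX ka>=1. ALL n. F ka n < 2 ^ (ka * lg n)"
proof -
 obtain C x y where F: "!!ka n. 1 <= ka ==> F ka n <= C * ka ^ x * 2 ^ (y * lg n)" using assms unfolding pb_def by blast
 have "eventually (%ka::nat. real C * real ka ^ x * 2 ^ y < 2 ^ ka) at_top" by real_asymp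
 then have "eventually (%ka::nat. real C * real ka ^ x * 2 ^ y < 2 ^ ka & y + 1 <= ka) at_top"
  using eventually_ge_at_top by (rule eventually_conj)
 then obtain ka where ka: "real C * real ka ^ x * 2 ^ y < 2 ^ ka" "y + 1 <= ka" by (auto simp: eventually_at_top_linorder)
 have "real (C * ka ^ x * 2 ^ y) < real (2 ^ ka)" using ka(1) by simp
 then have "C * ka ^ x * 2 ^ y < 2 ^ ka" by (simp only: of_nat_less_iff)
 also have "(2::nat) ^ ka = 2 ^ (ka - y) * 2 ^ y" using ka(2) by (simp flip: power_add)
 finally have c: "C * ka ^ x < 2 ^ (ka - y)" by simp
 have "F ka n < 2 ^ (ka * lg n)" for n
 proof -
  have "F ka n <= C * ka ^ x * 2 ^ (y * lg n)" using F ka(2) by simp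
  also have "... < 2 ^ (ka - y) * 2 ^ (y * lg n)" using c by simp
  also have "... <= 2 ^ ((ka - y) * lg n) * 2 ^ (y * lg n)"
  proof -
   have "(ka - y) * 1 <= (ka - y) * lg n" by (intro mult_le_mono2 lg_bounds)
   then show ?thesis by (intro mult_le_mono1 power_increasing) auto
  qed
  also have "... = 2 ^ (ka * lg n)" using ka(2) by (simp flip: power_add add: distrib_right[symmetric])
  finally show ?thesis .
 qed
 then show ?thesis using ka(2) by (intro exI[of _ ka]) auto
qed

section \<open>Programs and their cost\<close>

text \<open>Total correctness with a time bound. Conditions describe states by explicit parameters,
  so that the outcome of guards and the number of iterations are known in advance.\<close>

definition
 "tri b inp c P T Q \<longleftrightarrow> (ALL s. P s --> (EX t s'. t <= T & exec b inp c s t s' & Q s'))"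

lemma tri_conseq: "tri b inp c P T Q ==> (!!s. P' s ==> P s) ==> (!!s. Q s ==> Q' s) ==> T <= T' ==> tri b inp c P' T' Q'"
 unfolding tri_def by (meson le_trans)

lemma tri_Seq: "tri b inp c1 P T1 Q ==> tri b inp c2 Q T2 R ==> tri b inp (Seq c1 c2) P (T1 + T2) R"
 unfolding tri_def by (meson add_mono exec.Seq)

lemma tri_step: "(!!s. P s ==> exec b inp c s 1 (F s) & Q (F s)) ==> tri b inp c P 1 Q"
 unfolding tri_def by blast

lemma tri_Const: "(!!s. P s ==> Q (set_reg r (take_bit b v) s)) ==> tri b inp (Const r v) P 1 Q"
 by (rule tri_step, rule conjI, rule exec.Const)

lemma tri_Op: "(!!s. P s ==> Q (set_reg r (binop_val b f (reg s x) (reg s y)) s)) ==> tri b inp (Op f r x y) P 1 Q"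
 by (rule tri_step, rule conjI, rule exec.Op)

lemma tri_Load: "(!!s. P s ==> Q (set_reg r (mem s (reg s x)) s)) ==> tri b inp (Load r x) P 1 Q"
 by (rule tri_step, rule conjI, rule exec.Load)

lemma tri_Store: "(!!s. P s ==> Q (s\<lparr>mem := (mem s)(reg s x := reg s y)\<rparr>)) ==> tri b inp (Store x y) P 1 Q"
 by (rule tri_step, rule conjI, rule exec.Store)

lemma tri_Input: "(!!s. P s ==> Q (set_reg r (take_bit b (nth_default 0 inp (reg s x))) s)) ==> tri b inp (Input r x) P 1 Q"
 by (rule tri_step, rule conjI, rule exec.Input)

lemma tri_Rand: "(!!s. P s ==> rnd s = u # us & Q (set_reg r u (s\<lparr>rnd := us\<rparr>))) ==> tri b inp (Rand r) P 1 Q"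
 by (rule tri_step, rule conjI, rule exec.Rand) auto

lemma tri_Cond:
 assumes "!!s. P s ==> (reg s x ~= 0) = B" "B ==> tri b inp c1 P T1 Q" "~ B ==> tri b inp c2 P T2 Q"
 shows "tri b inp (Cond x c1 c2) P (max T1 T2 + 1) Q"
 unfolding tri_def
proof (intro allI impI)
 fix s assume s: "P s"
 obtain t s' where "t <= max T1 T2" "exec b inp (if B then c1 else c2) s t s'" "Q s'"
  using assms(2,3) s unfolding tri_def by (cases B) (auto, (meson le_max_iff_disj)+)
 then show "EX t s'. t <= max T1 T2 + 1 & exec b inp (Cond x c1 c2) s t s' & Q s'"
  using assms(1)[OF s] exec.Cond_true[of s x b inp c1 t s' c2] exec.Cond_false[of s x b inp c2 t s' c1]
  by (intro exI[of _ "t + 1"] exI[of _ s']) (cases B; simp)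
qed

lemma tri_While:
 assumes step: "!!i. i < n ==> tri b inp c (S i) T (S (Suc i))" and flag: "!!i s. i <= n ==> S i s ==> (reg s x ~= 0) = (i < n)"
 shows "tri b inp (While x c) (S 0) (n * (T + 1) + 1) (S n)"
proof -
 have "tri b inp (While x c) (S (n - m)) (m * (T + 1) + 1) (S n)" if "m <= n" for m
  using that
 proof (induction m)
  case 0
  have "exec b inp (While x c) s 1 s" if "S n s" for s using flag[of n s] that by (intro exec.While_false) simp
  then show ?case unfolding tri_def by (metis diff_zero le_add2)
 next
  case (Suc m)
  then have n: "n - Suc m < n" "Suc (n - Suc m) = n - m" by auto
  show ?case unfolding tri_def
  proof (intro allI impI)
   fix s assume s: "S (n - Suc m) s"
   obtain t1 s1 where 1: "t1 <= T" "exec b inp c s t1 s1" "S (n - m) s1" using step[OF n(1)] s unfolding n(2) tri_def by blast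
   obtain t2 s2 where 2: "t2 <= m * (T + 1) + 1" "exec b inp (While x c) s1 t2 s2" "S n s2" using Suc 1(3) unfolding tri_def by auto
   have "exec b inp (While x c) s (t1 + t2 + 1) s2" by (rule exec.While_true[OF _ 1(2) 2(2)]) (use flag[OF _ s] n in auto)
   then show "EX t s'. t <= Suc m * (T + 1) + 1 & exec b inp (While x c) s t s' & S n s'"
    using 1(1) 2 by (intro exI[of _ "t1 + t2 + 1"] exI[of _ s2]) auto
  qed
 qed
 from this[of n] show ?thesis by simp
qed

text \<open>A program is given the number of registers in use: an expression leaves its value in the next one.\<close>

type_synonym prog = "nat => com"

text \<open>Nothing is claimed about registers from \<open>K\<close> on. They are scratch space,
  which lets nested expressions be composed without freshness conditions.\<close>

definition
 "cfg M us K V s \<longleftrightarrow> mem s = M & rnd s = us & (ALL x<K. reg s x = V x)"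

lemmas cfgs = cfg_def set_reg_def less_Suc_eq numeral_eq_Suc

definition
 "evals b inp M e K V v T \<longleftrightarrow> (ALL us. tri b inp (e K) (cfg M us K V) T (cfg M us (Suc K) (V(K := v))))"

definition
 "runs b inp c K V M us M' us' T \<longleftrightarrow> tri b inp (c K) (cfg M us K V) T (cfg M' us' K V)"

text \<open>Conjunction of a register with itself serves as the move instruction, here as well as in
  \<open>LET\<close> and \<open>ITER\<close>.\<close>

definition "VAR x K = Op And K x x"
definition "CST v K = Const K v"
definition
 "BIN f e1 e2 K = Seq (e1 K) (Seq (e2 (Suc K)) (Op f K K (Suc K)))"
definition "MEM e K = Seq (e K) (Load K K)"
definition "INP e K = Seq (e K) (Input K K)"
definition
 "LET e f K = Seq (e K) (Seq (f K (Suc K)) (Op And K (Suc K) (Suc K)))"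
definition
 "IFE e e1 e2 K = Seq (e K) (Cond K (e1 K) (e2 K))"
text \<open>Register \<open>K\<close> holds the accumulator, \<open>K + 1\<close> the bound,
  \<open>K + 2\<close> the counter; \<open>K + 3\<close> is the guard and receives the result of the
  body in between.\<close>

definition
 "ITER n a f K = Seq (a K) (Seq (n (K + 1)) (Seq (Const (K + 2) 0) (Seq (Op Less (K + 3) (K + 2) (K + 1))
   (While (K + 3) (Seq (f (K + 2) K (K + 3)) (Seq (Op And K (K + 3) (K + 3))
    (Seq (Const (K + 3) 1) (Seq (Op Add (K + 2) (K + 2) (K + 3)) (Op Less (K + 3) (K + 2) (K + 1))))))))))"

definition
 "STO e1 e2 K = Seq (e1 K) (Seq (e2 (Suc K)) (Store K (Suc K)))"
definition
 "RND e K = Seq (e K) (Seq (Rand (Suc K)) (Store K (Suc K)))"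
definition CSEQ :: "prog => prog => prog" (infixr ";;" 60) where "(c1 ;; c2) K = Seq (c1 K) (c2 K)"
text \<open>The other branch has to be some instruction; it overwrites a scratch register.\<close>

definition "CIF e c K = Seq (e K) (Cond K (c K) (Const K 0))"
definition "CLET e f K = Seq (e K) (f K (Suc K))"
definition
 "FOR n f K = Seq (n K) (Seq (Const (K + 1) 0) (Seq (Op Less (K + 2) (K + 1) K)
   (While (K + 2) (Seq (f (K + 1) (K + 2))
    (Seq (Const (K + 2) 1) (Seq (Op Add (K + 1) (K + 1) (K + 2)) (Op Less (K + 2) (K + 1) K)))))))"

fun itr :: "(nat => 'a => 'a) => nat => 'a => 'a" where
 "itr f 0 a = a"
| "itr f (Suc n) a = f n (itr f n a)"

text \<open>The effect of a program on the memory is a list of writes. Later writes win, which is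
  how tables lose entries.\<close>

fun upds :: "(nat \<times> nat) list => (nat => nat) => (nat => nat)" where
 "upds [] M = M"
| "upds ((a, v) # ws) M = upds ws (M(a := v))"

lemma upds_append: "upds (xs @ ys) M = upds ys (upds xs M)"
 by (induction xs arbitrary: M) auto

lemma upds_notin: "a \<notin> fst ` set ws ==> upds ws M a = M a"
 by (induction ws arbitrary: M) auto

lemma upds_in: "a \<in> fst ` set ws ==> (a, upds ws M a) \<in> set ws"
proof (induction ws arbitrary: M)
 case (Cons w ws)
 then show ?case by (cases w; cases "a \<in> fst ` set ws") (auto simp: upds_notin)
qed auto

lemma upds_unique: "(a, v) \<in> set ws ==> (!!v'. (a, v') \<in> set ws ==> v' = v) ==> upds ws M a = v"
proof -
 assume *: "(a, v) \<in> set ws" "!!v'. (a, v') \<in> set ws ==> v' = v"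
 then have "a \<in> fst ` set ws" by force
 from *(2)[OF upds_in[OF this]] show ?thesis .
qed

lemma evals_weaken: "evals b inp M e K V v T ==> v = v' ==> T <= T' ==> evals b inp M e K V v' T'"
 unfolding evals_def by (blast intro: tri_conseq)

lemma runs_weaken: "runs b inp c K V M us M' us' T ==> M' = M'' ==> us' = us'' ==> T <= T' ==>
  runs b inp c K V M us M'' us'' T'"
 unfolding runs_def by (blast intro: tri_conseq)

lemma ev_VAR: "x < K ==> V x = v ==> evals b inp M (VAR x) K V v 1"
 unfolding evals_def VAR_def by (intro allI tri_Op) (auto simp: cfgs)

lemma evals_CST: "v < 2 ^ b ==> evals b inp M (CST v) K V v 1"
 unfolding evals_def CST_def by (intro allI tri_Const) (auto simp: cfgs take_bit_nat_eq_self)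

lemma tri_evals: "evals b inp M e K V v T ==> tri b inp (e K) (cfg M us K V) T (cfg M us (Suc K) (V(K := v)))"
 by (simp add: evals_def)

lemma evals_MEM: "evals b inp M e K V a T ==> M a = v ==> evals b inp M (MEM e) K V v (T + 1)"
 unfolding evals_def[of _ _ _ "MEM e"] MEM_def
 by (intro allI tri_Seq[OF tri_evals tri_Load]) (auto simp: cfgs)

lemma evals_INP: "evals b inp M e K V a T ==> take_bit b (nth_default 0 inp a) = v ==> evals b inp M (INP e) K V v (T + 1)"
 unfolding evals_def[of _ _ _ "INP e"] INP_def
 by (intro allI tri_Seq[OF tri_evals tri_Input]) (auto simp: cfgs)

text \<open>In these rules the environment of a subexpression is only constrained on the
 registers below the current depth and on the freshly bound ones.\<close>

lemma ev_BIN: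
 assumes "evals b inp M e1 K V v1 T1"
  and "!!V'. (!!x. x < K ==> V' x = V x) ==> evals b inp M e2 (Suc K) V' v2 T2"
 shows "evals b inp M (BIN f e1 e2) K V (binop_val b f v1 v2) (T1 + T2 + 1)"
 unfolding evals_def BIN_def add.assoc
proof (intro allI tri_Seq[OF tri_evals[OF assms(1)]] tri_Seq[OF tri_evals[OF assms(2)]] tri_Op)
 show "cfg M us (Suc (Suc K)) (V(K := v1, Suc K := v2)) s ==>
   cfg M us (Suc K) (V(K := binop_val b f v1 v2)) (set_reg K (binop_val b f (reg s K) (reg s (Suc K))) s)" for us s
  by (auto simp: cfgs)
qed auto

abbreviation "ADD \<equiv> BIN Add"
abbreviation "SUBT \<equiv> BIN Sub"
abbreviation "MUL \<equiv> BIN Mul"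
abbreviation "DIVE \<equiv> BIN Div"
abbreviation "MODE \<equiv> BIN Mod"
abbreviation "SHLE \<equiv> BIN Shl"
abbreviation "SHRE \<equiv> BIN Shr"
abbreviation "LTE \<equiv> BIN Less"
abbreviation "EQE \<equiv> BIN Eq"

lemma
 assumes "evals b inp M e1 K V v1 T1"
  and "!!V'. (!!x. x < K ==> V' x = V x) ==> evals b inp M e2 (Suc K) V' v2 T2"
 shows ev_ADD: "v1 + v2 < 2 ^ b ==> evals b inp M (ADD e1 e2) K V (v1 + v2) (T1 + T2 + 1)"
  and ev_SUBT: "v2 <= v1 ==> v1 < 2 ^ b ==> evals b inp M (SUBT e1 e2) K V (v1 - v2) (T1 + T2 + 1)"
  and ev_MUL: "v1 * v2 < 2 ^ b ==> evals b inp M (MUL e1 e2) K V (v1 * v2) (T1 + T2 + 1)"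
  and ev_DIVE: "evals b inp M (DIVE e1 e2) K V (v1 div v2) (T1 + T2 + 1)"
  and ev_MODE: "evals b inp M (MODE e1 e2) K V (v1 mod v2) (T1 + T2 + 1)"
  and ev_SHLE: "v1 * 2 ^ v2 < 2 ^ b ==> evals b inp M (SHLE e1 e2) K V (v1 * 2 ^ v2) (T1 + T2 + 1)"
  and ev_SHRE: "evals b inp M (SHRE e1 e2) K V (v1 div 2 ^ v2) (T1 + T2 + 1)"
  and ev_LTE: "0 < b ==> evals b inp M (LTE e1 e2) K V (of_bool (v1 < v2)) (T1 + T2 + 1)"
  and ev_EQE: "0 < b ==> evals b inp M (EQE e1 e2) K V (of_bool (v1 = v2)) (T1 + T2 + 1)"
proof -
 note * = evals_weaken[OF ev_BIN[OF assms] _ order.refl]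
 show "evals b inp M (SUBT e1 e2) K V (v1 - v2) (T1 + T2 + 1)" if "v2 <= v1" "v1 < 2 ^ b"
 proof (rule *)
  have "v1 + 2 ^ b - v2 = (v1 - v2) + 2 ^ b" using that by simp
  then show "binop_val b Sub v1 v2 = v1 - v2" using that by (simp only: binop_val.simps take_bit_eq_mod mod_add_self2) simp
 qed
qed ((rule evals_weaken[OF ev_BIN[OF assms] _ order.refl],
 auto simp: take_bit_nat_eq_self push_bit_nat_def drop_bit_nat_def)[1])+

lemma ev_LET:
 assumes "evals b inp M e K V v1 T1"
  and "!!V'. (!!x. x < K ==> V' x = V x) ==> V' K = v1 ==> evals b inp M (f K) (Suc K) V' v T2"
 shows "evals b inp M (LET e f) K V v (T1 + T2 + 1)"
 unfolding evals_def LET_def add.assoc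
proof (intro allI tri_Seq[OF tri_evals[OF assms(1)]] tri_Seq[OF tri_evals[OF assms(2)]] tri_Op)
 show "cfg M us (Suc (Suc K)) (V(K := v1, Suc K := v)) s ==>
   cfg M us (Suc K) (V(K := v)) (set_reg K (binop_val b And (reg s (Suc K)) (reg s (Suc K))) s)" for us s
  by (auto simp: cfgs)
qed auto

text \<open>Only the branch taken has to be evaluated. Both costs are added instead of maximized so
  that cost terms remain polynomials.\<close>

lemma ev_IFE:
 assumes "evals b inp M e K V v0 T0" "0 < v0 ==> evals b inp M e1 K V v1 T1"
  "v0 = 0 ==> evals b inp M e2 K V v2 T2"
 shows "evals b inp M (IFE e e1 e2) K V (if 0 < v0 then v1 else v2) (T0 + (T1 + T2) + 1)"
 unfolding evals_def IFE_def add.assoc[of T0]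
proof (intro allI tri_Seq[OF tri_evals[OF assms(1)]])
 fix us
 let ?Q = "cfg M us (Suc K) (V(K := if 0 < v0 then v1 else v2))"
 have "tri b inp (Cond K (e1 K) (e2 K)) (cfg M us (Suc K) (V(K := v0))) (max T1 T2 + 1) ?Q"
  by (rule tri_Cond[where B = "0 < v0"])
   (use tri_evals[OF assms(2), of us] tri_evals[OF assms(3), of us] in "auto simp: cfg_def elim!: tri_conseq")
 then show "tri b inp (Cond K (e1 K) (e2 K)) (cfg M us (Suc K) (V(K := v0))) (T1 + T2 + 1) ?Q" by (rule tri_conseq) auto
qed

lemma ev_LOOP:
 assumes b: "0 < b" and n: "n < 2 ^ b" and 0: "evals b inp M ea K V a0 T0"
  and 1: "!!V'. (!!x. x < K ==> V' x = V x) ==> evals b inp M en (Suc K) V' n T1"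
  and g0: "g 0 = a0"
  and 2: "!!i V'. i < n ==> (!!x. x < K ==> V' x = V x) ==> V' K = g i ==> V' (Suc (Suc K)) = i ==>
   evals b inp M (f (Suc (Suc K)) K) (K + 3) V' (g (Suc i)) Tb"
 shows "evals b inp M (ITER en ea f) K V (g n) (T0 + T1 + n * (Tb + 5) + 3)"
 unfolding evals_def
proof
 fix us
 let ?V = "%i. V(K := g i, Suc K := n, Suc (Suc K) := i)"
 let ?S = "%i. cfg M us (K + 4) ((?V i)(K + 3 := of_bool (i < n)))"
 have one: "take_bit b (Suc 0) = Suc 0" using b by (simp add: take_bit_nat_eq_self)
 have step: "tri b inp (Seq (f (K + 2) K (K + 3)) (Seq (Op And K (K + 3) (K + 3)) (Seq (Const (K + 3) 1)
   (Seq (Op Add (K + 2) (K + 2) (K + 3)) (Op Less (K + 3) (K + 2) (K + 1)))))) (?S i) (Tb + (1 + (1 + (1 + 1)))) (?S (Suc i))" if i: "i < n" for i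
 proof (intro tri_Seq)
  have "evals b inp M (f (Suc (Suc K)) K) (K + 3) (?V i) (g (Suc i)) Tb" by (rule 2[OF i]) auto
  from tri_evals[OF this, of us] show "tri b inp (f (K + 2) K (K + 3)) (?S i) Tb (cfg M us (Suc (K + 3)) ((?V i)(K + 3 := g (Suc i))))"
   unfolding add_2_eq_Suc' by (rule tri_conseq) (auto simp: cfg_def)
  have t: "take_bit b (Suc i) = Suc i" using i n by (simp add: take_bit_nat_eq_self)
  show "tri b inp (Op And K (K + 3) (K + 3)) (cfg M us (Suc (K + 3)) ((?V i)(K + 3 := g (Suc i)))) 1 (cfg M us (K + 3) ((?V i)(K := g (Suc i))))"
   "tri b inp (Const (K + 3) 1) (cfg M us (K + 3) ((?V i)(K := g (Suc i)))) 1 (cfg M us (K + 4) ((?V i)(K := g (Suc i), K + 3 := 1)))"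
   "tri b inp (Op Add (K + 2) (K + 2) (K + 3)) (cfg M us (K + 4) ((?V i)(K := g (Suc i), K + 3 := 1))) 1 (cfg M us (K + 4) ((?V (Suc i))(K + 3 := 1)))"
   "tri b inp (Op Less (K + 3) (K + 2) (K + 1)) (cfg M us (K + 4) ((?V (Suc i))(K + 3 := 1))) 1 (?S (Suc i))"
   by (rule tri_Const tri_Op, (auto simp: b t one cfgs)[1])+
 qed
 have "tri b inp (ITER en ea f K) (cfg M us K V) (T0 + (T1 + (1 + (1 + (n * (Tb + (1 + (1 + (1 + 1))) + 1) + 1))))) (?S n)"
  unfolding ITER_def
 proof (intro tri_Seq)
  show "tri b inp (ea K) (cfg M us K V) T0 (cfg M us (Suc K) (V(K := g 0)))" using tri_evals[OF 0] g0 by simp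
  have "evals b inp M en (Suc K) (V(K := g 0)) n T1" by (rule 1) auto
  from tri_evals[OF this, of us] show "tri b inp (en (K + 1)) (cfg M us (Suc K) (V(K := g 0))) T1 (cfg M us (K + 2) (V(K := g 0, Suc K := n)))"
   by simp
  show "tri b inp (Const (K + 2) 0) (cfg M us (K + 2) (V(K := g 0, Suc K := n))) 1 (cfg M us (K + 3) (?V 0))"
   "tri b inp (Op Less (K + 3) (K + 2) (K + 1)) (cfg M us (K + 3) (?V 0)) 1 (?S 0)"
   by (rule tri_Const tri_Op, (auto simp: b one cfgs)[1])+
 qed (rule tri_While[where S = ?S, OF step]; auto simp: cfg_def)
 then show "tri b inp (ITER en ea f K) (cfg M us K V) (T0 + T1 + n * (Tb + 5) + 3) (cfg M us (Suc K) (V(K := g n)))"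
  by (rule tri_conseq) (auto simp: cfg_def numeral_eq_Suc)
qed

definition
 "SUME n f = ITER n (CST 0) (%i a. ADD (VAR a) (f i))"

definition
 "EXE n f = ITER n (CST 0) (%i a. IFE (f i) (CST 1) (VAR a))"

lemma ev_SUM:
 assumes b: "0 < b" and n: "n < 2 ^ b"
  and en: "!!V'. (!!x. x < K ==> V' x = V x) ==> evals b inp M en (Suc K) V' n T1"
  and f: "!!i V'. i < n ==> (!!x. x < K ==> V' x = V x) ==> V' (Suc (Suc K)) = i ==>
   evals b inp M (f (Suc (Suc K))) (K + 4) V' (g i) Tb"
 shows "evals b inp M (SUME en f) K V ((\<Sum>i<n. g i) mod 2 ^ b) (T1 + n * (Tb + 7) + 4)"
 unfolding SUME_def
proof (rule evals_weaken[OF ev_LOOP[where g = "%n. (\<Sum>i<n. g i) mod 2 ^ b" and Tb = "1 + Tb + 1", OF b n evals_CST en]])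
 fix i V' assume h: "i < n" "!!x. x < K ==> V' x = V x" "V' K = (\<Sum>i<i. g i) mod 2 ^ b" "V' (Suc (Suc K)) = i"
 show "evals b inp M (ADD (VAR K) (f (Suc (Suc K)))) (K + 3) V' ((\<Sum>i<Suc i. g i) mod 2 ^ b) (1 + Tb + 1)"
 proof (rule evals_weaken[OF ev_BIN[OF ev_VAR[where V = V' and x = K, OF _ h(3)]]])
  show "evals b inp M (f (Suc (Suc K))) (Suc (K + 3)) V'' (g i) Tb" if "!!x. x < K + 3 ==> V'' x = V' x" for V''
   using f[OF h(1), of V''] that h by (simp add: numeral_eq_Suc)
 qed (auto simp: take_bit_eq_mod mod_add_left_eq)
qed (auto simp: algebra_simps)

lemma ev_SUME:
 assumes "0 < b" "n < 2 ^ b"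
  and "!!V'. (!!x. x < K ==> V' x = V x) ==> evals b inp M en (Suc K) V' n T1"
  and "!!i V'. i < n ==> (!!x. x < K ==> V' x = V x) ==> V' (Suc (Suc K)) = i ==>
   evals b inp M (f (Suc (Suc K))) (K + 4) V' (g i) Tb"
  and "(\<Sum>i<n. g i) < 2 ^ b"
 shows "evals b inp M (SUME en f) K V (\<Sum>i<n. g i) (T1 + n * (Tb + 7) + 4)"
proof (rule evals_weaken)
 show "evals b inp M (SUME en f) K V ((\<Sum>i<n. g i) mod 2 ^ b) (T1 + n * (Tb + 7) + 4)" by (rule ev_SUM) (fact assms)+
qed (use assms(5) in auto)

lemma ev_EXE:
 assumes b: "0 < b" and n: "n < 2 ^ b"
  and en: "!!V'. (!!x. x < K ==> V' x = V x) ==> evals b inp M en (Suc K) V' n T1"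
  and f: "!!i V'. i < n ==> (!!x. x < K ==> V' x = V x) ==> V' (Suc (Suc K)) = i ==>
   evals b inp M (f (Suc (Suc K))) (K + 3) V' (g i) Tb"
 shows "evals b inp M (EXE en f) K V (of_bool (EX i<n. 0 < g i)) (T1 + n * (Tb + 8) + 4)"
 unfolding EXE_def
proof (rule evals_weaken[OF ev_LOOP[where g = "%n. of_bool (EX i<n. 0 < g i)" and Tb = "Tb + (1 + 1) + 1", OF b n evals_CST en]])
 fix i V' assume h: "i < n" "!!x. x < K ==> V' x = V x" "V' K = of_bool (EX j<i. 0 < g j)" "V' (Suc (Suc K)) = i"
 show "evals b inp M (IFE (f (Suc (Suc K))) (CST 1) (VAR K)) (K + 3) V' (of_bool (EX j<Suc i. 0 < g j)) (Tb + (1 + 1) + 1)"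
  by (rule evals_weaken[OF ev_IFE[OF f[OF h(1,2,4)] evals_CST ev_VAR[where V = V' and x = K, OF _ h(3)]]])
   (use b one_less_power[of "2::nat" b] in "auto simp: less_Suc_eq")
qed (auto simp: algebra_simps)

lemma runs_STO:
 assumes "evals b inp M e1 K V a T1"
  and "!!V'. (!!x. x < K ==> V' x = V x) ==> evals b inp M e2 (Suc K) V' v T2"
 shows "runs b inp (STO e1 e2) K V M us (upds [(a, v)] M) us (T1 + T2 + 1)"
 unfolding runs_def STO_def add.assoc
proof (intro tri_Seq[OF tri_evals[OF assms(1)]] tri_Seq[OF tri_evals[OF assms(2)]] tri_Store)
 show "cfg M us (Suc (Suc K)) (V(K := a, Suc K := v)) s ==>
   cfg (upds [(a, v)] M) us K V (s\<lparr>mem := (mem s)(reg s K := reg s (Suc K))\<rparr>)" for s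
  by (auto simp: cfg_def)
qed auto

lemma runs_RND:
 assumes "evals b inp M e1 K V a T1" and us: "us = u # us'"
 shows "runs b inp (RND e1) K V M us (upds [(a, u)] M) us' (T1 + 2)"
proof -
 have "tri b inp (RND e1 K) (cfg M us K V) (T1 + (1 + 1)) (cfg (upds [(a, u)] M) us' K V)"
  unfolding RND_def
  by (rule tri_Seq[OF tri_evals[OF assms(1)] tri_Seq[OF tri_Rand[where Q = "cfg M us' (Suc (Suc K)) (V(K := a, Suc K := u))"] tri_Store]])
   (auto simp: cfg_def set_reg_def us)
 then show ?thesis by (simp add: runs_def)
qed

lemma runs_CSEQ:
 "runs b inp c1 K V M us M1 us1 T1 ==> runs b inp c2 K V M1 us1 M2 us2 T2 ==> runs b inp (c1 ;; c2) K V M us M2 us2 (T1 + T2)"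
 unfolding runs_def CSEQ_def by (rule tri_Seq)

lemma runs_CIF:
 assumes "evals b inp M e K V v T1" and "v ~= 0 ==> runs b inp c K V M us M' us' T2"
 shows "runs b inp (CIF e c) K V M us (if v ~= 0 then M' else M) (if v ~= 0 then us' else us) (T1 + T2 + 2)"
 unfolding runs_def CIF_def add.assoc[of T1]
proof (rule tri_Seq[OF tri_evals[OF assms(1)]])
 let ?Q = "cfg (if v ~= 0 then M' else M) (if v ~= 0 then us' else us) K V"
 have "tri b inp (Cond K (c K) (Const K 0)) (cfg M us (Suc K) (V(K := v))) (max T2 1 + 1) ?Q"
 proof (rule tri_Cond[where B = "v ~= 0"])
  show "tri b inp (Const K 0) (cfg M us (Suc K) (V(K := v))) 1 ?Q" if "~ v ~= 0"
   using that by (intro tri_Const) (auto simp: cfg_def set_reg_def)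
  show "tri b inp (c K) (cfg M us (Suc K) (V(K := v))) T2 ?Q" if "v ~= 0"
   using assms(2)[OF that] that unfolding runs_def by (auto elim!: tri_conseq simp: cfg_def)
 qed (auto simp: cfg_def)
 then show "tri b inp (Cond K (c K) (Const K 0)) (cfg M us (Suc K) (V(K := v))) (T2 + 2) ?Q" by (rule tri_conseq) auto
qed

lemma runs_CLET:
 assumes "evals b inp M e K V v T1"
  and "!!V'. (!!x. x < K ==> V' x = V x) ==> V' K = v ==> runs b inp (f K) (Suc K) V' M us M' us' T2"
 shows "runs b inp (CLET e f) K V M us M' us' (T1 + T2)"
 unfolding runs_def CLET_def
proof (rule tri_Seq[OF tri_evals[OF assms(1)]])
 have "runs b inp (f K) (Suc K) (V(K := v)) M us M' us' T2" by (rule assms(2)) auto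
 then show "tri b inp (f K (Suc K)) (cfg M us (Suc K) (V(K := v))) T2 (cfg M' us' K V)"
  unfolding runs_def by (rule tri_conseq) (auto simp: cfg_def)
qed

lemma runs_FOR:
 assumes b: "0 < b" and n: "n < 2 ^ b"
  and 0: "evals b inp (Mf 0) en K V n T0"
  and 1: "!!i V'. i < n ==> (!!x. x < K ==> V' x = V x) ==> V' (Suc K) = i ==>
   runs b inp (f (K + 1)) (K + 2) V' (Mf i) (uf i) (Mf (Suc i)) (uf (Suc i)) Tb"
 shows "runs b inp (FOR en f) K V (Mf 0) (uf 0) (Mf n) (uf n) (T0 + n * (Tb + 4) + 3)"
 unfolding runs_def
proof -
 let ?V = "%i. V(K := n, Suc K := i)"
 let ?C = "%m i v. cfg (Mf m) (uf m) (K + 3) ((?V i)(K + 2 := v))"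
 let ?S = "%i. ?C i i (of_bool (i < n))"
 have one: "take_bit b (Suc 0) = Suc 0" using b by (simp add: take_bit_nat_eq_self)
 have step: "tri b inp (Seq (f (K + 1) (K + 2)) (Seq (Const (K + 2) 1) (Seq (Op Add (K + 1) (K + 1) (K + 2)) (Op Less (K + 2) (K + 1) K))))
   (?S i) (Tb + (1 + (1 + 1))) (?S (Suc i))" if i: "i < n" for i
 proof (intro tri_Seq)
  have "runs b inp (f (K + 1)) (K + 2) (?V i) (Mf i) (uf i) (Mf (Suc i)) (uf (Suc i)) Tb" by (rule 1[OF i]) auto
  then show "tri b inp (f (K + 1) (K + 2)) (?S i) Tb (cfg (Mf (Suc i)) (uf (Suc i)) (K + 2) (?V i))"
   unfolding runs_def by (rule tri_conseq) (auto simp: cfg_def)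
  have t: "take_bit b (Suc i) = Suc i" using i n by (simp add: take_bit_nat_eq_self)
  show "tri b inp (Const (K + 2) 1) (cfg (Mf (Suc i)) (uf (Suc i)) (K + 2) (?V i)) 1 (?C (Suc i) i 1)"
   "tri b inp (Op Add (K + 1) (K + 1) (K + 2)) (?C (Suc i) i 1) 1 (?C (Suc i) (Suc i) 1)"
   "tri b inp (Op Less (K + 2) (K + 1) K) (?C (Suc i) (Suc i) 1) 1 (?S (Suc i))"
   by (rule tri_Const tri_Op, (auto simp: b t one cfgs)[1])+
 qed
 have "tri b inp (FOR en f K) (cfg (Mf 0) (uf 0) K V) (T0 + (1 + (1 + (n * (Tb + (1 + (1 + 1)) + 1) + 1)))) (?S n)"
  unfolding FOR_def
 proof (intro tri_Seq[OF tri_evals[OF 0]] tri_Seq)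
  show "tri b inp (Const (K + 1) 0) (cfg (Mf 0) (uf 0) (Suc K) (V(K := n))) 1 (cfg (Mf 0) (uf 0) (K + 2) (?V 0))"
   "tri b inp (Op Less (K + 2) (K + 1) K) (cfg (Mf 0) (uf 0) (K + 2) (?V 0)) 1 (?S 0)"
   by (rule tri_Const tri_Op, (auto simp: b one cfgs)[1])+
 qed (rule tri_While[where S = ?S, OF step]; auto simp: cfg_def)
 then show "tri b inp (FOR en f K) (cfg (Mf 0) (uf 0) K V) (T0 + n * (Tb + 4) + 3) (cfg (Mf n) (uf n) K V)"
  by (rule tri_conseq) (auto simp: cfg_def algebra_simps)
qed

declare One_nat_def [simp del]

section \<open>The query program\<close>

definition "HD j = MEM (CST j)"

definition
 "POWE e i = ITER (VAR i) (CST 1) (%_ a. MUL (VAR a) e)"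

definition
 "DIGE x e i = MODE (DIVE (VAR x) (POWE e i)) e"

definition L1E :: prog where "L1E = ADD (HD 3) (CST 1)"

text \<open>Inside a box of shape \<open>lam\<close>, coordinate \<open>i\<close> consumes
  \<open>lev lam i\<close> bits of a hash value, after the bits of the earlier coordinates.\<close>

definition
 "OFFE lam i = SUME (VAR i) (%j. DIGE lam L1E j)"

definition
 "DEPE k lam h = SUME (CST k) (%i. SHLE (MODE (SHRE (VAR h) (OFFE lam i)) (SHLE (CST 1) (DIGE lam L1E i)))
   (MUL (VAR i) (HD 3)))"

text \<open>Box numbers \<open>mu\<close> use the complementary \<open>L - lev lam i\<close> bits
  per coordinate: so many bits number the dyadic blocks of that side length.\<close>

definition
 "COFFE lam i = SUME (VAR i) (%j. SUBT (HD 3) (DIGE lam L1E j))"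

definition
 "CRNE k lam mu = SUME (CST k) (%i. SHLE (SHLE (MODE (SHRE (VAR mu) (COFFE lam i)) (SHLE (CST 1) (SUBT (HD 3) (DIGE lam L1E i))))
   (DIGE lam L1E i)) (MUL (VAR i) (HD 3)))"

definition
 "FLDE z i = MODE (SHRE (VAR z) (MUL (VAR i) (HD 3))) (SHLE (CST 1) (HD 3))"

text \<open>Horner's rule on the digits of a number, most significant digit first; cell 19 holds \<open>2 ^ b - 1\<close>.\<close>

definition
 "RESE cnt dig q = LET (ADD (MODE (HD 19) (VAR q)) (CST 1)) (%bm. ITER cnt (CST 0)
   (%e a. MODE (ADD (MUL (VAR a) (VAR bm)) (MODE (dig e) (VAR q))) (VAR q)))"

definition
 "NUMRES i p q = RESE (HD 2) (%e. MEM (ADD (CST 32) (ADD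
   (MUL (ADD (MUL (VAR i) (SHLE (CST 1) (HD 3))) (VAR p)) (HD 2)) (SUBT (SUBT (HD 2) (CST 1)) (VAR e))))) q"

definition
 "COEFRES idx q = RESE (HD 2) (%e. MEM (ADD (HD 10) (ADD
   (MUL (VAR idx) (HD 2)) (SUBT (SUBT (HD 2) (CST 1)) (VAR e))))) q"

text \<open>The digits of \<open>y\<close> follow the \<open>2 * k\<close> interval ends and the
  sign word, each preceded by its announcing word: digit \<open>e\<close> has offset
  \<open>2 + 2 * e\<close>.\<close>

definition
 "YRES k q = RESE (HD 9) (%e. INP (ADD (MUL (CST (2 * k)) (HD 2)) (ADD (CST 2)
   (MUL (CST 2) (SUBT (SUBT (HD 9) (CST 1)) (VAR e)))))) q"

definition
 "PVE k d z q = ITER (CST (Suc d ^ k)) (CST 0) (%idx a. MODE (ADD (VAR a)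
   (LET (COEFRES idx q) (%c. ITER (CST k) (VAR c) (%i u. ITER (DIGE idx (CST (Suc d)) i) (VAR u)
    (%_ v. MODE (MUL (VAR v) (LET (FLDE z i) (%p. NUMRES i p q))) (VAR q)))))) (VAR q))"

text \<open>The first \<open>b\<close> components are bits: of the corner for a point or for
  \<open>y\<close>, of the code itself for a start. The others are residues of the value modulo 1,
  ..., Q. A point and the value it takes thus have the same key, and the key of \<open>y\<close> is
  computable without knowing a point.\<close>

definition
 "COMPE k d zc code q = IFE (LTE (VAR q) (HD 0))
   (MODE (SHRE (IFE (LTE (VAR code) (HD 14)) (VAR zc) (IFE (EQE (VAR code) (HD 19)) (VAR zc) (VAR code))) (VAR q)) (CST 2))
   (LET (ADD (SUBT (VAR q) (HD 0)) (CST 1)) (%q1. IFE (LTE (VAR code) (HD 14)) (PVE k d code q1)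
    (IFE (EQE (VAR code) (HD 19)) (YRES k q1) (CST 0))))"

definition
 "HASHE k d sg zc code = SUME (HD 18) (%q. MEM (ADD (HD 11) (ADD (VAR sg) (ADD (MUL (VAR q) (HD 4)) (COMPE k d zc code q)))))"

definition
 "EQVE k d zc u v = EQE (EXE (HD 18) (%q. EQE (EQE (COMPE k d zc u q) (COMPE k d zc v q)) (CST 0))) (CST 0)"

definition
 "PTE k d lam zc sg code = ADD (VAR zc) (LET (HASHE k d sg zc code) (%h. DEPE k lam h))"

text \<open>Sample table \<open>r\<close> owns the hash function \<open>2 * r\<close>, which draws
  the samples, and \<open>2 * r + 1\<close>, which chooses cells. The sample recorded in the cell is
  recomputed and compared, so that a positive outcome is always right.\<close>

definition
 "HVE k d lam zc code = EXE (HD 7) (%r. LET (MUL (ADD (MUL (CST 2) (VAR r)) (CST 1)) (HD 17)) (%sg.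
   LET (MEM (ADD (HD 12) (ADD (MUL (ADD (MUL (VAR lam) (HD 7)) (VAR r)) (HD 15)) (MODE (HASHE k d sg zc code) (HD 15))))) (%c.
    IFE (VAR c) (LET (MUL (MUL (CST 2) (VAR r)) (HD 17)) (%sg0. LET (ADD (MUL (VAR c) (HD 14)) (VAR zc)) (%st.
     LET (PTE k d lam zc sg0 st) (%u. EQVE k d zc u code)))) (CST 0))))"

text \<open>A step onto a value known to the sample tables is rejected and the old code kept. The
  walk is not stuck, since every step has its own hash function.\<close>

definition
 "STEPE k d lam zc r s code = LET (MUL (ADD (MUL (CST 2) (HD 7)) (ADD (MUL (VAR r) (ADD (HD 5) (CST 1))) (VAR s))) (HD 17)) (%sg.
   LET (PTE k d lam zc sg code) (%z. IFE (HVE k d lam zc z) (VAR code) (VAR z)))"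

definition
 "WALKE k d lam zc r s0 cnt code = ITER (VAR cnt) (VAR code) (%i a. LET (ADD (VAR s0) (VAR i)) (%s. STEPE k d lam zc r s a))"

text \<open>The \<open>t + 1\<close> hash functions of each rainbow table are numbered after the
  \<open>2 * R1\<close> of the sample tables; the last of them addresses the cells.\<close>

definition
 "CELL2E k d lam zc r e = LET (MUL (ADD (MUL (CST 2) (HD 7)) (ADD (MUL (VAR r) (ADD (HD 5) (CST 1))) (HD 5))) (HD 17)) (%sg.
   ADD (HD 13) (ADD (MUL (ADD (MUL (VAR lam) (HD 8)) (VAR r)) (HD 16)) (MODE (HASHE k d sg zc e) (HD 16))))"

lemma ev_HD: "j < 2 ^ b ==> M j = v ==> evals b inp M (HD j) K V v 2"
 unfolding HD_def by (rule evals_weaken[OF evals_MEM[OF evals_CST]]) auto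

lemma ev_POWE:
 assumes "i < K" "V i = vi"
  and e: "!!K' V'. K <= K' ==> (!!x. x < K ==> V' x = V x) ==> evals b inp M e K' V' v Te"
  and "v ^ vi < 2 ^ b" "vi < 2 ^ b" "0 < b" "0 < v"
 shows "evals b inp M (POWE e i) K V (v ^ vi) (vi * (Te + 7) + 5)"
proof -
 have le: "v ^ Suc j < 2 ^ b" if "j < vi" for j using assms(4) power_increasing[of "Suc j" vi v] that assms(7) by linarith
 have one: "1 < (2::nat) ^ b" using one_less_power[of "2::nat" b] assms by simp
 show ?thesis
  proof (rule evals_weaken)
  show "evals b inp M (POWE e i) K V (v ^ vi) (1 + 1 + vi * ((1 + Te + 1) + 5) + 3)" unfolding POWE_def
  proof (rule ev_LOOP[where g = "%j. v ^ j"])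
   show "evals b inp M (VAR i) (Suc K) V' vi 1" if "!!x. x < K ==> V' x = V x" for V'
    by (rule ev_VAR) (use that assms in auto)
   fix j V' assume h: "j < vi" "!!x. x < K ==> V' x = V x" "V' K = v ^ j"
   have e': "evals b inp M e (Suc (K + 3)) V'' v Te" if "!!x. x < K + 3 ==> V'' x = V' x" for V''
    by (rule e) (use that h in auto)
   have "v ^ j * v < 2 ^ b" using le[OF h(1)] by (simp add: mult.commute)
   then show "evals b inp M (MUL (VAR K) e) (K + 3) V' (v ^ Suc j) (1 + Te + 1)"
    by (intro evals_weaken[OF ev_MUL[OF ev_VAR e']]) (use h in auto)
  qed (use assms one in "auto intro: evals_CST")
 qed (simp_all add: algebra_simps)
qed

lemma ev_DIGE:
 assumes "x < K" "i < K" "V x = vx" "V i = vi"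
  and e: "!!K' V'. K <= K' ==> (!!x. x < K ==> V' x = V x) ==> evals b inp M e K' V' v Te"
  and "v ^ vi < 2 ^ b" "vi < 2 ^ b" "0 < b" "0 < v"
 shows "evals b inp M (DIGE x e i) K V (vx div v ^ vi mod v) (vi * (Te + 7) + Te + 9)"
 proof (rule evals_weaken)
 show "evals b inp M (DIGE x e i) K V (vx div v ^ vi mod v) (1 + (vi * (Te + 7) + 5) + 1 + Te + 1)" unfolding DIGE_def
  by (intro ev_MODE ev_DIVE ev_VAR ev_POWE e) (use assms in auto)
qed simp_all

lemma digit_step: "X div 2 ^ (b * i) = X div 2 ^ (b * Suc i) * 2 ^ b + X div 2 ^ (b * i) mod (2 ^ b :: nat)"
proof -
 have "X div 2 ^ (b * Suc i) = X div 2 ^ (b * i) div 2 ^ b"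
  unfolding mult_Suc_right add.commute[of b "b * i"] power_add div_mult2_eq ..
 then show ?thesis by (simp only: div_mult_mod_eq)
qed

lemma ev_RESE:
 assumes q: "q < K" "V q = m" "0 < m" "m * m + m < 2 ^ b" and b: "5 <= b" and M: "M 19 = 2 ^ b - 1"
  and cnt: "!!K' V'. K <= K' ==> (!!x. x < K ==> V' x = V x) ==> evals b inp M cntE K' V' cnt Tc" "cnt < 2 ^ b"
  and dig: "!!K' V' e x. K <= x ==> x < K' ==> (!!x. x < K ==> V' x = V x) ==> V' x = e ==> e < cnt ==>
   evals b inp M (digE x) K' V' (X div 2 ^ (b * (cnt - 1 - e)) mod 2 ^ b) Td"
  and X: "X < 2 ^ (b * cnt)"
 shows "evals b inp M (RESE cntE digE q) K V (X mod m) (Tc + cnt * (Td + 13) + 12)"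
proof -
 have big: "32 <= (2::nat) ^ b" using power_increasing[of 5 b "2::nat"] b by simp
 have b0: "0 < b" using b by simp
 \<comment> \<open>The base \<open>2 ^ b\<close> itself does not fit into a word; \<open>bm\<close>
   is congruent to it modulo \<open>m\<close> and is computed from \<open>2 ^ b - 1\<close>.\<close>
 define bm where "bm = (2 ^ b - 1) mod m + 1"
 have bm: "bm <= m" "bm mod m = 2 ^ b mod m"
 proof -
  show "bm <= m" using q(3) mod_less_divisor[of m "2 ^ b - 1"] unfolding bm_def by linarith
  have "bm mod m = ((2 ^ b - 1) + 1) mod m" unfolding bm_def by (simp add: mod_simps)
  then show "bm mod m = 2 ^ b mod m" by simp
 qed
 have step: "(X div 2 ^ (b * (cnt - e)) mod m * bm + X div 2 ^ (b * (cnt - 1 - e)) mod 2 ^ b mod m) mod m =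
   X div 2 ^ (b * (cnt - Suc e)) mod m" if "e < cnt" for e
 proof -
  have "cnt - e = Suc (cnt - Suc e)" "cnt - 1 - e = cnt - Suc e" using that by auto
  moreover have "(X div 2 ^ (b * (cnt - e)) mod m * bm + X div 2 ^ (b * (cnt - 1 - e)) mod 2 ^ b mod m) mod m =
    (X div 2 ^ (b * (cnt - e)) * 2 ^ b + X div 2 ^ (b * (cnt - 1 - e)) mod 2 ^ b) mod m"
   using bm(2) by (metis mod_add_left_eq mod_add_right_eq mod_mult_left_eq mod_mult_right_eq)
  ultimately show ?thesis using digit_step[of X b "cnt - Suc e"] by simp
 qed
 show ?thesis
  proof (rule evals_weaken)
  show "evals b inp M (RESE cntE digE q) K V (X mod m)
    ((2 + 1 + 1 + 1 + 1) + (1 + Tc + cnt * (Td + 8 + 5) + 3) + 1)" unfolding RESE_def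
  proof (rule ev_LET[where ?v1.0 = "bm"], goal_cases a h)
   case a show ?case
    unfolding bm_def
   proof (intro ev_ADD ev_MODE ev_HD ev_VAR evals_CST)
    show "(2 ^ b - 1) mod m + 1 < 2 ^ b" using bm(1) q(4) unfolding bm_def by linarith
   qed (use q big M in auto)
   case (h V')
   have "evals b inp M (ITER cntE (CST 0) (%e a. MODE (ADD (MUL (VAR a) (VAR K)) (MODE (digE e) (VAR q))) (VAR q))) (Suc K) V'
     (X div 2 ^ (b * (cnt - cnt)) mod m) (1 + Tc + cnt * (Td + 8 + 5) + 3)"
   proof (rule ev_LOOP[where g = "%e. X div 2 ^ (b * (cnt - e)) mod m"])
    show "X div 2 ^ (b * (cnt - 0)) mod m = 0" using X by simp
    show "evals b inp M cntE (Suc (Suc K)) V'' cnt Tc" if "!!x. x < Suc K ==> V'' x = V' x" for V''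
     by (rule cnt(1)) (use h that in auto)
    fix e V'' assume h': "e < cnt" "!!x. x < Suc K ==> V'' x = V' x" "V'' (Suc K) = X div 2 ^ (b * (cnt - e)) mod m"
      "V'' (Suc (Suc (Suc K))) = e"
    \<comment> \<open>A Horner step stays below \<open>m * m + m\<close> and hence within one
      word.\<close>
    have lt: "X div 2 ^ (b * (cnt - e)) mod m * bm <= (m - 1) * m"
     using bm(1) q(3) by (intro mult_le_mono) (auto simp: less_eq_Suc_le[symmetric] less_Suc_eq_le[symmetric] Suc_leI)
    then have lt2: "X div 2 ^ (b * (cnt - e)) mod m * bm < 2 ^ b"
     using q by (simp add: algebra_simps diff_mult_distrib)
    have "X div 2 ^ (b * (cnt - 1 - e)) mod 2 ^ b mod m < m" using q by simp
    moreover have "(m - 1) * m <= m * m" by simp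
    ultimately have lt3: "X div 2 ^ (b * (cnt - e)) mod m * bm + X div 2 ^ (b * (cnt - 1 - e)) mod 2 ^ b mod m < 2 ^ b"
     using lt q(4) by linarith
    show "evals b inp M (MODE (ADD (MUL (VAR (Suc K)) (VAR K)) (MODE (digE (Suc (Suc (Suc K)))) (VAR q))) (VAR q)) (Suc K + 3) V''
      (X div 2 ^ (b * (cnt - Suc e)) mod m) (Td + 8)"
    proof (rule evals_weaken[where v = "(X div 2 ^ (b * (cnt - e)) mod m * bm + X div 2 ^ (b * (cnt - 1 - e)) mod 2 ^ b mod m) mod m" and T = "((1 + 1 + 1) + (Td + 1 + 1) + 1) + 1 + 1"], goal_cases a)
     case a show ?case
      by (intro ev_ADD ev_MODE ev_MUL ev_VAR dig) (use h h' q lt2 lt3 in auto)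
    qed (use step[OF h'(1)] in auto)
   qed (use cnt(2) b0 in "auto intro: evals_CST")
   then show ?case by simp
  qed
 qed (simp_all add: algebra_simps)
qed

text \<open>Mixed-radix notation: fields of \<open>L\<close> bits are packed into a word.\<close>

definition pack :: "nat => nat => (nat => nat) => nat" where
 "pack k L x = (\<Sum>i<k. x i * 2 ^ (i * L))"

definition fld :: "nat => nat => nat => nat" where
 "fld L z i = z div 2 ^ (i * L) mod 2 ^ L"

text \<open>Like \<open>fld\<close>, but field \<open>i\<close> has its own width
  \<open>a i\<close>.\<close>

definition ext :: "(nat => nat) => nat => nat => nat" where
 "ext a h i = h div 2 ^ (\<Sum>j<i. a j) mod 2 ^ a i"

definition dg :: "nat => nat => nat => nat" where
 "dg v x i = x div v ^ i mod v"

text \<open>Words have \<open>b\<close> bits, elements of the sets \<open>len\<close> words, values of the polynomial \<open>lim\<close> words; \<open>nm i p\<close> is the element of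
 rank \<open>p\<close> in the \<open>i\<close>-th set (0 for \<open>n <= p < 2^L\<close>) and \<open>cf\<close> gives the coefficients. The shape \<open>lam\<close> of a box packs the logarithms
 of its side lengths, \<open>mu\<close> numbers the boxes of this shape, \<open>zc\<close> is the corner of a box. For each shape there are \<open>R1\<close> sample tables of
 \<open>P1\<close> cells and \<open>R2\<close> rainbow tables of \<open>P2\<close> cells. A code is a point (packed ranks, below \<open>U\<close>), \<open>YC\<close> for the value asked for,
 or \<open>c * U + zc\<close> for the start of the sample or chain \<open>c\<close> in the box at \<open>zc\<close>.\<close>

locale inst =
 fixes k d b n len L J Q R1 R2 lim :: nat and nm :: "nat => nat => nat" and cf :: "nat => nat"
begin

definition "U = (2::nat) ^ (k * L)"
definition "NP = b + Q"
definition "SL = NP * Q"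
definition "t = (2::nat) ^ J"
definition "NL = Suc L ^ k"
text \<open>Two hash functions per sample table; per rainbow table one for each of the
  \<open>t\<close> steps and one for the cells.\<close>

definition "NS = (2 * R1 + R2 * (t + 1)) * SL"
text \<open>This is 16 U / t. The boxes of one shape together contribute 4 U / t samples, a quarter
  of it.\<close>

definition "P1 = (2::nat) ^ (k * L + 4 - J)"
text \<open>This is U / (2 t^2). The boxes of one shape together contribute U / (16 t^2) chains, an
  eighth of it.\<close>

definition "P2 = U div 2 ^ (2 * J + 1)"
definition "CB = 32 + k * 2 ^ L * len"
definition "SB = CB + Suc d ^ k * len"
definition "A1 = SB + NS"
definition "A2 = A1 + NL * R1 * P1"
definition "TOT = A2 + NL * R2 * P2"
definition "YC = (2::nat) ^ b - 1"

definition lev :: "nat => nat => nat" where "lev lam i = dg (Suc L) lam i"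
definition sa :: "nat => nat" where "sa lam = (\<Sum>i<k. lev lam i)"
definition dep :: "nat => nat => nat" where "dep lam h = pack k L (ext (lev lam) h)"
definition crn :: "nat => nat => nat" where
 "crn lam mu = pack k L (%i. ext (%j. L - lev lam j) mu i * 2 ^ lev lam i)"
definition pv :: "nat => nat" where
 "pv z = (\<Sum>idx<Suc d ^ k. cf idx * (\<Prod>i<k. nm i (fld L z i) ^ dg (Suc d) idx i))"

definition comp :: "nat => nat => nat => nat => nat" where
 "comp Y zc code q =
   (if q < b then (if code < U \<or> code = YC then zc else code) div 2 ^ q mod 2
   else if code < U then pv code mod (q - b + 1)
   else if code = YC then Y mod (q - b + 1) else 0)"

definition kf :: "nat => nat => nat => nat list" where
 "kf Y zc code = map (comp Y zc code) [0..<NP]"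

text \<open>Zero marks an empty cell; counters are stored from 1 on.\<close>

definition
 "hv H T Y lam zc code \<longleftrightarrow> (EX r<R1. let c = T (A1 + ((lam * R1 + r) * P1 + H (2 * r + 1) (kf Y zc code) mod P1)) in
   0 < c & kf Y zc (zc + dep lam (H (2 * r) (kf Y zc (c * U + zc)))) = kf Y zc code)"

definition
 "stp H T Y lam zc r s code = (let z = zc + dep lam (H (2 * R1 + (r * (t + 1) + s)) (kf Y zc code)) in
   if hv H T Y lam zc z then code else z)"

definition
 "wlk H T Y lam zc r s0 m code = itr (%i a. stp H T Y lam zc r (s0 + i) a) m code"

definition
 "cell2 H Y lam zc r e = A2 + ((lam * R2 + r) * P2 + H (2 * R1 + (r * (t + 1) + t)) (kf Y zc e) mod P2)"

definition hash_of :: "(nat => nat) => nat => nat list => nat" where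
 "hash_of sd j key = (\<Sum>q<NP. sd (j * SL + q * Q + key ! q)) mod 2 ^ b"

definition hdr :: "(nat => nat) => bool" where
 "hdr M \<longleftrightarrow> M 0 = b & M 1 = n & M 2 = len & M 3 = L & M 4 = Q & M 5 = t & M 6 = J & M 7 = R1 & M 8 = R2 & M 9 = lim &
   M 10 = CB & M 11 = SB & M 12 = A1 & M 13 = A2 & M 14 = U & M 15 = P1 & M 16 = P2 & M 17 = SL & M 18 = NP & M 19 = YC"

definition dat :: "(nat => nat) => bool" where
 "dat M \<longleftrightarrow> (ALL i<k. ALL p<2 ^ L. ALL e<len. M (32 + ((i * 2 ^ L + p) * len + e)) = nm i p div 2 ^ (b * e) mod 2 ^ b) &
   (ALL idx<Suc d ^ k. ALL e<len. M (CB + (idx * len + e)) = cf idx div 2 ^ (b * e) mod 2 ^ b)"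

definition seeded :: "(nat => nat) => (nat => nat) => bool" where
 "seeded sd M \<longleftrightarrow> (ALL x<NS. M (SB + x) = sd x)"

definition yin :: "nat => nat list => bool" where
 "yin Y inp \<longleftrightarrow> (ALL e<lim. take_bit b (nth_default 0 inp (2 * k * len + (2 + 2 * e))) = Y div 2 ^ (b * e) mod 2 ^ b)"

text \<open>Cost bounds of the programs. The constants are generous: only the growth of these terms
  enters the theorem.\<close>

definition "tD = 11 * k + 20"
definition "tOFF = k * (tD + 8) + 6"
definition "tDEP = k * (tOFF + tD + 40) + 10"
definition "tNUM = len * 60 + 30"
definition "tPV = Suc d ^ k * (tNUM + k * (tD + d * (tNUM + 50) + 30) + 40) + 30"
definition "tY = lim * 60 + 30"
definition "tC = tPV + tY + 60"
definition "tH = NP * (tC + 40) + 20"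
definition "tE = NP * (2 * tC + 40) + 20"
definition "tPT = tH + tDEP + 20"
definition "tHV = R1 * (tH + tPT + tE + 140) + 20"
definition "tS = tPT + tHV + 60"
definition "tW = t * (tS + 20) + 20"
definition "tCRN = k * (tOFF + 3 * k + 2 * tD + 50) + 10"
definition "tLESS = len * 80 + 10"
definition "tBS = L * (tLESS + 40) + 10"
definition "tCORN = 2 * tBS + 3 * tD + 60"
definition "tBAD = tCORN + 2 * tBS + tD + 40"
definition "tSM = 16 * t * t * (tDEP + tE + 40) + 20"
definition "tBIG = R2 * (t * (2 * tW + tH + tE + 200) + 40) + 20"
definition "tBOX = tSM + tBIG + tHV + 2 * tOFF + 60"
definition "tQ = NL * (2 ^ k * (k * (tBAD + tCORN + 40) + tBOX + 60) + 60) + 11 * k + 60"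
definition "tHDR = L * 50 + 11 * k + 200"
definition "tRANK = n * (len * 60 + 40) + 20"
definition "tSORT = k * (n * (tRANK + len * 70 + 40) + 40) + 30"
definition "tCOEF = Suc d ^ k * len * 40 + 30"
definition "tSEED = NS * 12 + 20"
definition "tCELL1 = tPT + 2 * tH + 100"
definition "TT1 = U * (tCRN + 24 + R1 * (tOFF + 40)) + 4 * U * R1 * (tCELL1 + 20)"
definition "TT2 c = U * (tCRN + 24 + c * L * (tOFF + 40)) + U * c * L * (tS + tH + 200)"
definition "tBUILD c = 20 * (tHDR + 5) + tSORT + tCOEF + tSEED + NL * (TT1 + TT2 c + 4 * tOFF + 120) + 22 * k + 100"

end

section \<open>Evaluation of arithmetic expressions without overflow\<close>

locale inst_ok = inst +
 assumes k2: "2 <= k" and Q2: "2 <= Q" and b8: "8 <= b" and R1p: "1 <= R1" and JL: "J <= L" and nL: "n < 2 ^ L"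
  and TOTb: "TOT + 40 < 2 ^ b" and Qb: "Q * Q + Q < 2 ^ b" and Ub: "(64 * U + 64) * U < 2 ^ b"
  and NLb: "NL < 2 ^ b" and db: "Suc d ^ k < 2 ^ b" and limb: "2 * k * len + 2 * lim + 10 < 2 ^ b"
  and kLb: "2 * (k * L) + 2 * k + 10 <= b" and R1b: "R1 * 2 < 2 ^ b" and R2b: "R2 * (t + 1) < 2 ^ b"
  and nm_less: "nm i p < 2 ^ (b * len)" and cf_less: "cf idx < 2 ^ (b * len)"
begin

lemma U_pos: "0 < U" by (simp add: U_def)
lemma t_pos: "0 < t" by (simp add: t_def)
lemma NP_pos: "0 < NP" "b < NP" using Q2 by (simp_all add: NP_def)

lemma small: "m < 256 ==> m < (2::nat) ^ b"
 using power_increasing[of 8 b "2::nat"] b8 by simp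

lemma b0: "0 < b" using b8 by simp

lemma NS_ge: "2 * R1 * SL <= NS" "SL <= NS"
proof -
 show 1: "2 * R1 * SL <= NS" unfolding NS_def by (intro mult_le_mono1) simp
 have "1 * SL <= 2 * R1 * SL" using R1p by (intro mult_le_mono1) simp
 with 1 show "SL <= NS" by linarith
qed

lemma addr: "32 + k * 2 ^ L * len <= CB" "CB + Suc d ^ k * len = SB" "SB + NS = A1" "A1 + NL * R1 * P1 = A2" "A2 + NL * R2 * P2 = TOT"
 by (simp_all add: CB_def SB_def A1_def A2_def TOT_def)

lemma addr_less: "CB < 2 ^ b" "SB < 2 ^ b" "A1 < 2 ^ b" "A2 < 2 ^ b" "NS < 2 ^ b" "SL < 2 ^ b"
 using addr TOTb NS_ge by linarith+

lemma NP_less: "NP < 2 ^ b"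
proof -
 have "NP * 1 <= SL" unfolding SL_def using Q2 by (intro mult_le_mono2) simp
 then show ?thesis using addr_less by simp
qed

lemma Q_less: "Q < 2 ^ b" using Qb by simp
lemma U_less: "U < 2 ^ b" "64 * U < 2 ^ b"
proof -
 have "64 * U * 1 <= (64 * U + 64) * U" using U_pos by (intro mult_le_mono) auto
 then show "64 * U < 2 ^ b" using Ub by linarith
 then show "U < 2 ^ b" by linarith
qed

lemma pow_kL: "m <= k * L ==> 2 ^ m <= U"
 unfolding U_def by (rule power_increasing) auto

lemma lev_le: "lev lam i <= L"
proof -
 have "lev lam i < Suc L" unfolding lev_def dg_def by simp
 then show ?thesis by simp
qed

lemma hdrD: assumes "hdr M"
 shows "M 0 = b" "M 1 = n" "M 2 = len" "M 3 = L" "M 4 = Q" "M 5 = t" "M 6 = J" "M 7 = R1" "M 8 = R2" "M 9 = lim"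
  "M 10 = CB" "M 11 = SB" "M 12 = A1" "M 13 = A2" "M 14 = U" "M 15 = P1" "M 16 = P2" "M 17 = SL" "M 18 = NP" "M 19 = YC"
 using assms by (simp_all add: hdr_def)

lemma ev_L1E: "hdr M ==> evals b inp M L1E K V (Suc L) 4"
 unfolding L1E_def
proof (rule evals_weaken)
 assume "hdr M"
 then show "evals b inp M (ADD (HD 3) (CST 1)) K V (L + 1) (2 + 1 + 1)"
 proof (intro ev_ADD ev_HD evals_CST)
  have "L <= k * L" using k2 by simp
  then show "L + 1 < 2 ^ b" using kLb less_exp[of b] by linarith
 qed (auto simp: hdrD intro!: small)
qed simp_all

lemma SucL_pow: "i <= k ==> Suc L ^ i < 2 ^ b"
 using NLb power_increasing[of i k "Suc L"] unfolding NL_def by simp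

lemma k_less: "k < 2 ^ b" "i <= k ==> i < 2 ^ b"
proof -
 show "k < 2 ^ b" using kLb less_exp[of b] by linarith
 then show "i <= k ==> i < 2 ^ b" by simp
qed

lemma ev_lev:
 assumes "hdr M" "lam < K" "i < K" "V lam = vlam" "V i = vi" "vi <= k"
 shows "evals b inp M (DIGE lam L1E i) K V (lev vlam vi) tD"
proof (rule evals_weaken)
 show "evals b inp M (DIGE lam L1E i) K V (vlam div Suc L ^ vi mod Suc L) (vi * (4 + 7) + 4 + 9)"
  by (intro ev_DIGE ev_L1E) (use assms in "auto simp: b0 SucL_pow k_less")
qed (use assms in "auto simp: tD_def lev_def dg_def")

lemma sum_lev_le: "i <= k ==> (\<Sum>j<i. lev lam j) <= k * L"
proof -
 assume "i <= k"
 have "(\<Sum>j<i. lev lam j) <= (\<Sum>j<i. L)" by (intro sum_mono lev_le)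
 also have "... <= k * L" using \<open>i <= k\<close> by simp
 finally show ?thesis .
qed

lemma kL_less: "m <= k * L ==> m < 2 ^ b"
 using kLb less_exp[of b] by linarith

lemma ev_OFFE:
 assumes "hdr M" "lam < K" "i < K" "V lam = vlam" "V i = vi" "vi <= k"
 shows "evals b inp M (OFFE lam i) K V (\<Sum>j<vi. lev vlam j) tOFF"
 proof (rule evals_weaken)
 show "evals b inp M (OFFE lam i) K V (\<Sum>j<vi. lev vlam j) (1 + vi * (tD + 7) + 4)" unfolding OFFE_def
  by (intro ev_SUME ev_VAR ev_lev) (use assms in "auto simp: b0 k_less kL_less sum_lev_le")
 have "vi * (tD + 7) <= k * (tD + 8)" using assms by (intro mult_le_mono) auto
 then show "1 + vi * (tD + 7) + 4 <= tOFF" by (simp add: tOFF_def)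
qed simp

lemma pack_less: "(!!i. i < m ==> x i < 2 ^ L) ==> pack m L x < 2 ^ (m * L)"
proof (induction m)
 case (Suc m)
 have "pack m L x < 2 ^ (m * L)" using Suc by simp
 moreover have "Suc (x m) * 2 ^ (m * L) <= 2 ^ L * 2 ^ (m * L)" using Suc.prems[of m] by (intro mult_le_mono1) simp
 ultimately show ?case by (simp add: pack_def power_add)
qed (simp add: pack_def)

lemma ext_less: "ext a h i < 2 ^ a i"
 by (simp add: ext_def)

lemma ext_lev_less: "ext (lev lam) h i < 2 ^ L"
proof -
 have "2 ^ lev lam i <= (2::nat) ^ L" by (intro power_increasing lev_le) simp
 with ext_less[of "lev lam" h i] show ?thesis by linarith
qed

lemma dep_less: "dep lam h < U"
 unfolding dep_def U_def by (rule pack_less) (rule ext_lev_less)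

lemma pack_term:
 fixes x :: "nat => nat"
 assumes a: "!!i. i < k ==> x i < 2 ^ L" "i < k"
 shows "x i * 2 ^ (i * L) < 2 ^ b"
proof -
 have "x i * 2 ^ (i * L) <= pack k L x" unfolding pack_def using a by (intro member_le_sum) auto
 also have "... < U" unfolding U_def by (rule pack_less) (rule a)
 finally show ?thesis using U_less by simp
qed

lemma two_lev: "2 ^ lev lam i < (2::nat) ^ b" "2 ^ L < (2::nat) ^ b"
proof -
 have "L <= k * L" using k2 by simp
 then have "L < b" using kLb by linarith
 then show "2 ^ L < (2::nat) ^ b" by simp
 then show "2 ^ lev lam i < (2::nat) ^ b" using power_increasing[OF lev_le[of lam i], of "2::nat"] by simp
qed

lemma ev_iL: "hdr M ==> i < K ==> V i = vi ==> vi < k ==> evals b inp M (MUL (VAR i) (HD 3)) K V (vi * L) 4"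
proof (rule evals_weaken)
 assume a: "hdr M" "i < K" "V i = vi" "vi < k"
 show "evals b inp M (MUL (VAR i) (HD 3)) K V (vi * L) (1 + 2 + 1)"
  by (intro ev_MUL ev_VAR ev_HD) (use a in "auto simp: hdrD kL_less intro!: small")
qed simp_all

lemma ev_DEPE:
 assumes "hdr M" "lam < K" "h < K" "V lam = vlam" "V h = vh"
 shows "evals b inp M (DEPE k lam h) K V (dep vlam vh) tDEP"
 unfolding DEPE_def dep_def pack_def ext_def
proof (rule evals_weaken[where v = "\<Sum>i<k. (vh div 2 ^ (\<Sum>j<i. lev vlam j) mod (1 * 2 ^ lev vlam i)) * 2 ^ (i * L)" and T = "1 + k * ((1 + tOFF + 1 + (1 + tD + 1) + 1 + 4 + 1) + 7) + 4"], goal_cases a)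
 case a show ?case
 proof (intro ev_SUME ev_SHLE ev_MODE ev_SHRE ev_VAR ev_OFFE ev_lev evals_CST ev_iL)
  show "(\<Sum>i<k. (vh div 2 ^ (\<Sum>j<i. lev vlam j) mod (1 * 2 ^ lev vlam i)) * 2 ^ (i * L)) < 2 ^ b"
   using dep_less[of vlam vh] U_less by (simp add: dep_def pack_def ext_def)
  fix i assume "i < k"
  then show "(vh div 2 ^ (\<Sum>j<i. lev vlam j) mod (1 * 2 ^ lev vlam i)) * 2 ^ (i * L) < 2 ^ b"
   using pack_term[of "ext (lev vlam) vh" i, OF ext_lev_less] by (simp add: ext_def)
 qed (use assms in "auto simp: b0 k_less two_lev intro: small")
qed (simp_all add: tDEP_def algebra_simps)

lemma ev_FLDE:
 assumes "hdr M" "z < K" "i < K" "V z = vz" "V i = vi" "vi < k"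
 shows "evals b inp M (FLDE z i) K V (fld L vz vi) 12"
 unfolding FLDE_def fld_def
proof (rule evals_weaken[where v = "vz div 2 ^ (vi * L) mod (1 * 2 ^ L)" and T = "1 + 4 + 1 + (1 + 2 + 1) + 1"], goal_cases a)
 case a show ?case
  by (intro ev_SHLE ev_MODE ev_SHRE ev_VAR evals_CST ev_iL ev_HD)
   (use assms in "auto simp: two_lev hdrD intro: small")
qed simp_all

lemma index_le: "i < m ==> x < c ==> i * c + x < m * (c::nat)"
proof -
 assume "i < m" "x < c"
 then have "i * c + x < Suc i * c" "Suc i * c <= m * c" by (simp, intro mult_le_mono1) simp
 then show ?thesis by linarith
qed

lemma dat_num: "dat M ==> i < k ==> p < 2 ^ L ==> e < len ==>
  M (32 + ((i * 2 ^ L + p) * len + e)) = nm i p div 2 ^ (b * e) mod 2 ^ b"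
 and dat_cf: "dat M ==> idx < Suc d ^ k ==> e < len ==> M (CB + (idx * len + e)) = cf idx div 2 ^ (b * e) mod 2 ^ b"
 unfolding dat_def by blast+

lemma len_less: "len < 2 ^ b" "lim < 2 ^ b" "len - x < 2 ^ b" "lim - x < 2 ^ b"
proof -
 have "1 * len <= 2 * k * len" using k2 by (intro mult_le_mono1) simp
 then show "len < 2 ^ b" "lim < 2 ^ b" "len - x < 2 ^ b" "lim - x < 2 ^ b" using limb by linarith+
qed

lemma ev_NUMRES:
 assumes M: "hdr M" "dat M" and v: "i < K" "p < K" "q < K" "V i = vi" "V p = vp" "V q = m"
  and b: "vi < k" "vp < 2 ^ L" "0 < m" "m <= Q"
 shows "evals b inp M (NUMRES i p q) K V (nm vi vp mod m) tNUM"
 proof (rule evals_weaken)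
 show "evals b inp M (NUMRES i p q) K V
   (nm vi vp mod m) (2 + len * (24 + 13) + 12)" unfolding NUMRES_def
 proof (rule ev_RESE[where cnt = len])
  show "m * m + m < 2 ^ b" using b(4) Qb mult_le_mono[OF b(4) b(4)] by linarith
  show "5 <= b" using b8 by simp
  show "evals b inp M (HD 2) K' V' len 2" for K' V'
   by (rule ev_HD) (use M in "auto simp: hdrD intro!: small")
  show lenb: "len < 2 ^ b" by (rule len_less)
  fix K' V' e x assume h: "K <= x" "x < K'" "!!x. x < K ==> V' x = V x" "V' x = e" "e < len"
  have 1: "vi * 2 ^ L + vp < k * 2 ^ L" by (rule index_le) (use b in auto)
  have 2: "(vi * 2 ^ L + vp) * len + (len - 1 - e) < k * 2 ^ L * len" by (rule index_le) (use 1 h in auto)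
  have 3: "32 + ((vi * 2 ^ L + vp) * len + (len - 1 - e)) < 2 ^ b" using 2 addr addr_less by linarith
  \<comment> \<open>Each intermediate result is at most the final address, so one bound on the
    address excludes overflow everywhere.\<close>
  have 4: "(vi * 2 ^ L + vp) * 1 <= (vi * 2 ^ L + vp) * len" using h by (intro mult_le_mono2) simp
  have 5: "(vi * 2 ^ L + vp) * len < 2 ^ b" using 3 by linarith
  have "vi * 2 ^ L + vp < 2 ^ b" using le_less_trans[OF 4 5] by simp
  then have "vi * 2 ^ L < 2 ^ b" "vi * 2 ^ L + vp < 2 ^ b" by simp_all
  with 5 show "evals b inp M (MEM (ADD (CST 32) (ADD
   (MUL (ADD (MUL (VAR i) (SHLE (CST 1) (HD 3))) (VAR p)) (HD 2)) (SUBT (SUBT (HD 2) (CST 1)) (VAR x))))) K' V'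
    (nm vi vp div 2 ^ (b * (len - 1 - e)) mod 2 ^ b) 24"
  proof (intro evals_weaken[OF evals_MEM[OF ev_ADD[OF evals_CST ev_ADD[OF ev_MUL[OF ev_ADD[OF ev_MUL[OF ev_VAR ev_SHLE[OF evals_CST ev_HD]] ev_VAR] ev_HD]
    ev_SUBT[OF ev_SUBT[OF ev_HD evals_CST] ev_VAR]]]]])
   show "M (32 + ((vi * (1 * 2 ^ L) + vp) * len + (len - 1 - e))) = nm vi vp div 2 ^ (b * (len - 1 - e)) mod 2 ^ b"
    unfolding mult_1 by (rule dat_num[OF M(2) b(1,2)]) (use h in simp)
  qed (use M v h b 3 in "auto simp: hdrD two_lev lenb len_less add.assoc intro: small")
 qed (use M v b in "auto simp: hdrD YC_def nm_less")
qed (simp_all add: tNUM_def)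

end

context inst_ok begin

lemma m_sq: "0 < m ==> m <= Q ==> m * m + m < 2 ^ b"
 using Qb mult_le_mono[of m Q m Q] by linarith

lemma ev_COEFRES:
 assumes M: "hdr M" "dat M" and v: "idx < K" "q < K" "V idx = vi" "V q = m"
  and b: "vi < Suc d ^ k" "0 < m" "m <= Q"
 shows "evals b inp M (COEFRES idx q) K V (cf vi mod m) tNUM"
 proof (rule evals_weaken)
 show "evals b inp M (COEFRES idx q) K V
   (cf vi mod m) (2 + len * (24 + 13) + 12)" unfolding COEFRES_def
 proof (rule ev_RESE[where cnt = len])
  show "m * m + m < 2 ^ b" using m_sq b by simp
  show "5 <= b" using b8 by simp
  show "evals b inp M (HD 2) K' V' len 2" for K' V'
   by (rule ev_HD) (use M in "auto simp: hdrD intro!: small")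
  show lenb: "len < 2 ^ b" by (rule len_less)
  fix K' V' e x assume h: "K <= x" "x < K'" "!!x. x < K ==> V' x = V x" "V' x = e" "e < len"
  have 2: "vi * len + (len - 1 - e) < Suc d ^ k * len" by (rule index_le) (use b h in auto)
  have 3: "CB + (vi * len + (len - 1 - e)) < 2 ^ b" using 2 addr addr_less by linarith
  then have 4: "vi * len < 2 ^ b" by linarith
  show "evals b inp M (MEM (ADD (HD 10) (ADD (MUL (VAR idx) (HD 2)) (SUBT (SUBT (HD 2) (CST 1)) (VAR x))))) K' V'
    (cf vi div 2 ^ (b * (len - 1 - e)) mod 2 ^ b) 24"
  proof (intro evals_weaken[OF evals_MEM[OF ev_ADD[OF ev_HD ev_ADD[OF ev_MUL[OF ev_VAR ev_HD]
    ev_SUBT[OF ev_SUBT[OF ev_HD evals_CST] ev_VAR]]]]])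
   show "M (CB + (vi * len + (len - 1 - e))) = cf vi div 2 ^ (b * (len - 1 - e)) mod 2 ^ b"
    by (rule dat_cf[OF M(2) b(1)]) (use h in simp)
  qed (use M v h b 3 4 in "auto simp: hdrD two_lev lenb len_less add.assoc intro: small")
 qed (use M v b in "auto simp: hdrD YC_def cf_less")
qed (simp_all add: tNUM_def)

lemma ev_YRES:
 assumes M: "hdr M" "yin Y inp" and v: "q < K" "V q = m" and b: "0 < m" "m <= Q" and Y: "Y < 2 ^ (b * lim)"
 shows "evals b inp M (YRES k q) K V (Y mod m) tY"
 proof (rule evals_weaken)
 show "evals b inp M (YRES k q) K V
   (Y mod m) (2 + lim * (24 + 13) + 12)" unfolding YRES_def
 proof (rule ev_RESE[where cnt = lim])
  show "m * m + m < 2 ^ b" using m_sq b by simp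
  show "5 <= b" using b8 by simp
  show "evals b inp M (HD 9) K' V' lim 2" for K' V'
   by (rule ev_HD) (use M in "auto simp: hdrD intro!: small")
  show limb': "lim < 2 ^ b" by (rule len_less)
  fix K' V' e x assume h: "K <= x" "x < K'" "!!x. x < K ==> V' x = V x" "V' x = e" "e < lim"
  have 3: "2 * k * len + (2 + 2 * (lim - 1 - e)) < 2 ^ b" using limb h by linarith
  have 5: "2 * k < 2 ^ b" using kLb less_exp[of b] by linarith
  show "evals b inp M (INP (ADD (MUL (CST (2 * k)) (HD 2)) (ADD (CST 2) (MUL (CST 2) (SUBT (SUBT (HD 9) (CST 1)) (VAR x)))))) K' V'
    (Y div 2 ^ (b * (lim - 1 - e)) mod 2 ^ b) 24"
  proof (intro evals_weaken[OF evals_INP[OF ev_ADD[OF ev_MUL[OF evals_CST ev_HD] ev_ADD[OF evals_CST ev_MUL[OF evals_CST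
    ev_SUBT[OF ev_SUBT[OF ev_HD evals_CST] ev_VAR]]]]]])
   have "lim - 1 - e < lim" using h by simp
   with M(2) show "take_bit b (nth_default 0 inp (2 * k * len + (2 + 2 * (lim - 1 - e)))) = Y div 2 ^ (b * (lim - 1 - e)) mod 2 ^ b"
    unfolding yin_def by blast
  qed (use M v h b 3 5 limb' len_less in "auto simp: hdrD intro: small")
 qed (use M v b Y in "auto simp: hdrD YC_def")
qed (simp_all add: tY_def)

lemma mod_mult_step: "(a mod m * (x mod m)) mod m = (a * x) mod (m::nat)"
 by (simp add: mod_simps)

text \<open>The value of the polynomial exceeds a word, so partial sums, partial products and
  partial powers, the accumulators of three nested loops, are all kept modulo \<open>m\<close>,
  where products of two still fit.\<close>

lemma ev_PVE:
 assumes M: "hdr M" "dat M" and v: "z < K" "q < K" "V z = vz" "V q = m"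
  and b: "0 < m" "m <= Q"
 shows "evals b inp M (PVE k d z q) K V (pv vz mod m) tPV"
proof -
 let ?e = "%idx i. dg (Suc d) idx i"
 let ?T3 = "tNUM + 17"
 let ?T2 = "1 + tD + d * (?T3 + 5) + 3"
 let ?T1 = "1 + 1 + k * (?T2 + 5) + 3"
 let ?T0 = "1 + (tNUM + ?T1 + 1) + 1 + 1 + 1"
 have mm: "m * m + m < 2 ^ b" using m_sq b by simp
 have mb: "m < 2 ^ b" using mm by linarith
 have mod_lt: "a mod m < m" for a using b by simp
 have mod_mult_lt: "a mod m * (c mod m) < 2 ^ b" for a c
 proof -
  have "a mod m * (c mod m) <= m * m" using mod_lt[of a] mod_lt[of c] by (intro mult_le_mono) auto
  then show ?thesis using mm by linarith
 qed
 have fl: "fld L vz i < 2 ^ L" for i by (simp add: fld_def)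
 have dp: "Suc d ^ i < 2 ^ b" if "i <= k" for i using db power_increasing[OF that, of "Suc d"] by simp
 have db': "d < 2 ^ b" using dp[of 1] k2 by simp
 let ?P = "%idx i. \<Prod>j<i. nm j (fld L vz j) ^ ?e idx j"
 have "evals b inp M (PVE k d z q) K V ((\<Sum>idx<Suc d ^ k. cf idx * ?P idx k) mod m) (1 + 1 + Suc d ^ k * (?T0 + 5) + 3)"
  unfolding PVE_def
 proof (rule ev_LOOP[where g = "%n. (\<Sum>idx<n. cf idx * ?P idx k) mod m"])
  fix idx V1 assume 1: "idx < Suc d ^ k" "!!x. x < K ==> V1 x = V x" "V1 K = (\<Sum>idx<idx. cf idx * ?P idx k) mod m" "V1 (Suc (Suc K)) = idx"
  let ?term = "LET (COEFRES (Suc (Suc K)) q) (%c. ITER (CST k) (VAR c) (%i u. ITER (DIGE (Suc (Suc K)) (CST (Suc d)) i) (VAR u)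
    (%_ v. MODE (MUL (VAR v) (LET (FLDE z i) (%p. NUMRES i p q))) (VAR q))))"
  have tm: "evals b inp M ?term (Suc (K + 3)) V2 ((cf idx * ?P idx k) mod m) (tNUM + ?T1 + 1)"
   if 2: "!!x. x < K + 3 ==> V2 x = V1 x" for V2
  proof (rule ev_LET[where ?v1.0 = "cf idx mod m"], goal_cases a 3)
   case a show ?case
    by (rule ev_COEFRES[OF M]) (use 1 2 v b in auto)
   case (3 V3)
   show ?case
   proof (rule ev_LOOP[where g = "%i. (cf idx * ?P idx i) mod m"])
    fix i V4 assume 4: "i < k" "!!x. x < Suc (Suc (K + 3)) ==> V4 x = V3 x" "V4 (Suc (Suc (K + 3))) = cf idx * ?P idx i mod m"
     "V4 (Suc (Suc (Suc (Suc (K + 3))))) = i"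
    let ?K4 = "Suc (Suc (K + 3))"
    have e_le: "?e idx i <= d" unfolding dg_def by (simp add: less_Suc_eq_le[symmetric])
    let ?X = "nm i (fld L vz i)"
    have "evals b inp M (ITER (DIGE (Suc (Suc K)) (CST (Suc d)) (Suc (Suc ?K4))) (VAR ?K4)
      (%_ v. MODE (MUL (VAR v) (LET (FLDE z (Suc (Suc ?K4))) (%p. NUMRES (Suc (Suc ?K4)) p q))) (VAR q))) (?K4 + 3) V4
      ((cf idx * ?P idx i * ?X ^ ?e idx i) mod m) (1 + tD + ?e idx i * (?T3 + 5) + 3)"
    proof (rule ev_LOOP[where g = "%j. (cf idx * ?P idx i * ?X ^ j) mod m"])
     show "evals b inp M (VAR ?K4) (?K4 + 3) V4 (cf idx * ?P idx i mod m) 1"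
      by (rule ev_VAR) (use 4 in auto)
     show "evals b inp M (DIGE (Suc (Suc K)) (CST (Suc d)) (Suc (Suc ?K4))) (Suc (?K4 + 3)) V5 (?e idx i) tD"
      if 5: "!!x. x < ?K4 + 3 ==> V5 x = V4 x" for V5
     proof (rule evals_weaken[where v = "idx div Suc d ^ i mod Suc d" and T = "i * (1 + 7) + 1 + 9"], goal_cases a)
      case a show ?case
       by (rule ev_DIGE) (use 1 2 3 4 5 dp[of 1] dp[of i] k2 b0 k_less in "auto intro!: evals_CST")
     qed (use 4 in "auto simp: dg_def tD_def")
     fix j V6 assume 6: "!!x. x < ?K4 + 3 ==> V6 x = V4 x" "V6 (?K4 + 3) = cf idx * ?P idx i * ?X ^ j mod m"
     let ?K6 = "?K4 + 3"
     show "evals b inp M (MODE (MUL (VAR ?K6) (LET (FLDE z (Suc (Suc ?K4))) (%p. NUMRES (Suc (Suc ?K4)) p q))) (VAR q)) (?K6 + 3) V6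
       (cf idx * ?P idx i * ?X ^ Suc j mod m) ?T3"
     proof (rule evals_weaken[where v = "(cf idx * ?P idx i * ?X ^ j mod m * (?X mod m)) mod m" and T = "1 + (12 + tNUM + 1) + 1 + 1 + 1"], goal_cases a)
      case a show ?case
       by (intro ev_MODE ev_MUL ev_VAR ev_LET[OF ev_FLDE ev_NUMRES] mod_mult_lt M)
        (use 1(2) 2 3(1) 4 6 v b fl in auto)
      show "(cf idx * ?P idx i * ?X ^ j mod m * (?X mod m)) mod m = cf idx * ?P idx i * ?X ^ Suc j mod m"
       unfolding mod_mult_step power_Suc2 mult.assoc ..
     qed simp
    qed (use b0 e_le db' in auto)
    moreover have "cf idx * ?P idx i * ?X ^ ?e idx i = cf idx * ?P idx (Suc i)"
     by (simp only: prod.lessThan_Suc mult.assoc)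
    ultimately show "evals b inp M (ITER (DIGE (Suc (Suc K)) (CST (Suc d)) (Suc (Suc ?K4))) (VAR ?K4)
      (%_ v. MODE (MUL (VAR v) (LET (FLDE z (Suc (Suc ?K4))) (%p. NUMRES (Suc (Suc ?K4)) p q))) (VAR q))) (?K4 + 3) V4
      ((cf idx * ?P idx (Suc i)) mod m) ?T2"
     by (elim evals_weaken) (use mult_le_mono1[OF e_le, of "?T3 + 5"] in "simp_all add: mult.assoc")
   qed (use b0 k_less 3 in "auto intro!: ev_VAR evals_CST")
  qed
  show "evals b inp M (MODE (ADD (VAR K) ?term) (VAR q)) (K + 3) V1 ((\<Sum>idx<Suc idx. cf idx * ?P idx k) mod m) ?T0"
  proof (rule evals_weaken[where v = "((\<Sum>idx<idx. cf idx * ?P idx k) mod m + (cf idx * ?P idx k) mod m) mod m" and T = "?T0"], goal_cases a)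
   case a show ?case
   proof (intro ev_MODE ev_ADD ev_VAR tm)
    have "m <= m * m" using b by simp
    then show "(\<Sum>idx<idx. cf idx * ?P idx k) mod m + (cf idx * ?P idx k) mod m < 2 ^ b"
     using mod_lt[of "\<Sum>idx<idx. cf idx * ?P idx k"] mod_lt[of "cf idx * ?P idx k"] mm by linarith
   qed (use 1 v in auto)
  qed (simp_all add: mod_simps)
 qed (use b0 db in "auto intro!: evals_CST")
 then show ?thesis by (rule evals_weaken) (simp_all add: pv_def tPV_def algebra_simps)
qed

end

section \<open>Keys, hash values, sample lookups and walks\<close>

context inst_ok begin

text \<open>\<open>YC\<close> stands for a number found in the query input only. The condition is
  void during preprocessing, where the codes that occur are points and starts.\<close>

definition okc :: "nat => nat list => nat => bool" where
 "okc Y inp code \<longleftrightarrow> (code = YC --> yin Y inp & Y < 2 ^ (b * lim))"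

lemma YC_less: "YC < 2 ^ b" "U < YC"
proof -
 show "YC < 2 ^ b" by (simp add: YC_def)
 have "64 * U < 2 ^ b" by (rule U_less)
 then show "U < YC" using U_pos unfolding YC_def by linarith
qed

lemma comp_less: "q < NP ==> comp Y zc code q < Q"
proof -
 assume "q < NP"
 then have "q - b + 1 <= Q" if "~ q < b" using that by (simp add: NP_def)
 moreover have "x mod (q - b + 1) < q - b + 1" for x by simp
 ultimately have *: "x mod (q - b + 1) < Q" if "~ q < b" for x using that less_le_trans by blast
 show ?thesis using * Q2 unfolding comp_def by (auto intro: less_le_trans[of _ 2])
qed

lemma ev_COMPE:
 assumes M: "hdr M" "dat M" and v: "zc < K" "code < K" "q < K" "V zc = vz" "V code = vc" "V q = vq"
  and b: "vq < NP" "okc Y inp vc"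
 shows "evals b inp M (COMPE k d zc code q) K V (comp Y vz vc vq) tC"
 unfolding COMPE_def
proof (rule evals_weaken)
 let ?m = "vq - b + 1"
 show "evals b inp M (IFE (LTE (VAR q) (HD 0))
   (MODE (SHRE (IFE (LTE (VAR code) (HD 14)) (VAR zc) (IFE (EQE (VAR code) (HD 19)) (VAR zc) (VAR code))) (VAR q)) (CST 2))
   (LET (ADD (SUBT (VAR q) (HD 0)) (CST 1)) (%q1. IFE (LTE (VAR code) (HD 14)) (PVE k d code q1)
    (IFE (EQE (VAR code) (HD 19)) (YRES k q1) (CST 0))))) K V
   (if 0 < (of_bool (vq < b) :: nat) then (if 0 < (of_bool (vc < U) :: nat) then vz else if 0 < (of_bool (vc = YC) :: nat) then vz else vc) div 2 ^ vq mod 2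
   else (if 0 < (of_bool (vc < U) :: nat) then pv vc mod ?m else if 0 < (of_bool (vc = YC) :: nat) then Y mod ?m else 0))
   ((1 + 2 + 1) + (((((1 + 2 + 1) + (1 + ((1 + 2 + 1) + (1 + 1) + 1)) + 1) + 1 + 1) + 1 + 1) + ((((1 + 2 + 1) + 1 + 1) + ((1 + 2 + 1) + (tPV + ((1 + 2 + 1) + (tY + 1) + 1)) + 1) + 1))) + 1)"
 proof (rule ev_IFE)
  show "evals b inp M (LTE (VAR q) (HD 0)) K V (of_bool (vq < b)) (1 + 2 + 1)"
   by (intro ev_LTE ev_VAR ev_HD) (use M v b0 in "auto simp: hdrD")
  show "evals b inp M (MODE (SHRE (IFE (LTE (VAR code) (HD 14)) (VAR zc) (IFE (EQE (VAR code) (HD 19)) (VAR zc) (VAR code))) (VAR q)) (CST 2)) K V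
   ((if 0 < (of_bool (vc < U) :: nat) then vz else if 0 < (of_bool (vc = YC) :: nat) then vz else vc) div 2 ^ vq mod 2) ((((1 + 2 + 1) + (1 + ((1 + 2 + 1) + (1 + 1) + 1)) + 1) + 1 + 1) + 1 + 1)"
   by (intro ev_MODE ev_SHRE ev_IFE ev_LTE ev_EQE ev_VAR ev_HD evals_CST) (use M v b0 in "auto simp: hdrD intro: small")
  assume "of_bool (vq < b) = (0::nat)"
  then have vq: "b <= vq" by simp
  then have m: "0 < ?m" "?m <= Q" "vq < 2 ^ b" "vq - b + 1 < 2 ^ b" using b NP_less Q_less by (auto simp: NP_def)
  show "evals b inp M (LET (ADD (SUBT (VAR q) (HD 0)) (CST 1)) (%q1. IFE (LTE (VAR code) (HD 14)) (PVE k d code q1)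
    (IFE (EQE (VAR code) (HD 19)) (YRES k q1) (CST 0)))) K V
   (if 0 < (of_bool (vc < U) :: nat) then pv vc mod ?m else if 0 < (of_bool (vc = YC) :: nat) then Y mod ?m else 0)
   (((1 + 2 + 1) + 1 + 1) + ((1 + 2 + 1) + (tPV + ((1 + 2 + 1) + (tY + 1) + 1)) + 1) + 1)"
   by (intro ev_LET[where ?v1.0 = ?m] ev_ADD ev_SUBT ev_IFE ev_LTE ev_EQE ev_VAR ev_HD evals_CST ev_PVE ev_YRES)
    (use M v m vq b0 b in "auto simp: hdrD okc_def intro: small")
 qed
qed (use YC_less in "auto simp: tC_def comp_def")

lemma kf_nth: "q < NP ==> kf Y zc code ! q = comp Y zc code q"
 by (simp add: kf_def)

lemma kf_eq_iff: "kf Y zc u = kf Y zc' v \<longleftrightarrow> (ALL q<NP. comp Y zc u q = comp Y zc' v q)"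
 by (auto simp: kf_def)

lemma ev_HASHE:
 assumes M: "hdr M" "dat M" "seeded sd M" and v: "sg < K" "zc < K" "code < K" "V sg = j * SL" "V zc = vz" "V code = vc"
  and b: "okc Y inp vc" "j < 2 * R1 + R2 * (t + 1)"
 shows "evals b inp M (HASHE k d sg zc code) K V (hash_of sd j (kf Y vz vc)) tH"
 unfolding HASHE_def hash_of_def
proof (rule evals_weaken)
 let ?c = "comp Y vz vc"
 have idx: "j * SL + (q * Q + ?c q) < NS" if "q < NP" for q
 proof -
  have "q * Q + ?c q < NP * Q" by (rule index_le) (use that comp_less in auto)
  then show ?thesis unfolding NS_def SL_def[symmetric] by (intro index_le b(2)) (simp add: SL_def)
 qed
 have lt: "SB + (j * SL + (q * Q + ?c q)) < 2 ^ b" if "q < NP" for q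
  using idx[OF that] addr addr_less by linarith
 have lt2: "q * Q < 2 ^ b" "q * Q + ?c q < 2 ^ b" "j * SL + (q * Q + ?c q) < 2 ^ b" if "q < NP" for q
  using lt[OF that] by linarith+
 show "evals b inp M (SUME (HD 18) (%q. MEM (ADD (HD 11) (ADD (VAR sg) (ADD (MUL (VAR q) (HD 4)) (COMPE k d zc code q)))))) K V
   ((\<Sum>q<NP. sd (j * SL + (q * Q + ?c q))) mod 2 ^ b) (2 + NP * (((2 + (1 + ((1 + 2 + 1) + tC + 1) + 1) + 1) + 1) + 7) + 4)"
 proof (rule ev_SUM)
  fix q V' assume q: "q < NP" and 1: "!!x. x < K ==> V' x = V x" "V' (Suc (Suc K)) = q"
  show "evals b inp M (MEM (ADD (HD 11) (ADD (VAR sg) (ADD (MUL (VAR (Suc (Suc K))) (HD 4)) (COMPE k d zc code (Suc (Suc K))))))) (K + 4) V'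
    (sd (j * SL + (q * Q + ?c q))) ((2 + (1 + ((1 + 2 + 1) + tC + 1) + 1) + 1) + 1)"
  proof (rule evals_MEM)
   show "M (SB + (j * SL + (q * Q + ?c q))) = sd (j * SL + (q * Q + ?c q))"
    using M(3) idx[OF q] unfolding seeded_def by blast
   show "evals b inp M (ADD (HD 11) (ADD (VAR sg) (ADD (MUL (VAR (Suc (Suc K))) (HD 4)) (COMPE k d zc code (Suc (Suc K)))))) (K + 4) V'
     (SB + (j * SL + (q * Q + ?c q))) (2 + (1 + ((1 + 2 + 1) + tC + 1) + 1) + 1)"
    by (intro ev_ADD ev_MUL ev_HD ev_VAR ev_COMPE[where Y = Y])
     (use M v b lt[OF q] lt2[OF q] q 1 in "auto simp: hdrD intro: small")
  qed
 qed (use M b0 NP_less in "auto simp: hdrD intro!: ev_HD intro: small")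
qed (simp_all add: tH_def kf_nth algebra_simps)

lemma ev_EQVE:
 assumes M: "hdr M" "dat M" and v: "zc < K" "u < K" "v < K" "V zc = vz" "V u = vu" "V v = vv"
  and b: "okc Y inp vu" "okc Y inp vv"
 shows "evals b inp M (EQVE k d zc u v) K V (of_bool (kf Y vz vu = kf Y vz vv)) tE"
 proof (rule evals_weaken[where v = "of_bool ((of_bool (EX q<NP. 0 < (of_bool (of_bool (comp Y vz vu q = comp Y vz vv q) = (0::nat)) :: nat)) :: nat) = 0)" and T = "(2 + NP * (((tC + tC + 1) + 1 + 1) + 8) + 4) + 1 + 1"], goal_cases a)
 case a show ?case unfolding EQVE_def
  by (intro ev_EQE ev_EXE evals_CST ev_HD ev_COMPE[where Y = Y])
   (use M v b b0 NP_less in "auto simp: hdrD intro: small")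
qed (auto simp: tE_def kf_eq_iff algebra_simps)

lemma ev_PTE:
 assumes M: "hdr M" "dat M" "seeded sd M" and v: "lam < K" "sg < K" "zc < K" "code < K" "V lam = vl" "V sg = j * SL" "V zc = vz" "V code = vc"
  and b: "okc Y inp vc" "j < 2 * R1 + R2 * (t + 1)" "vz < U"
 shows "evals b inp M (PTE k d lam zc sg code) K V (vz + dep vl (hash_of sd j (kf Y vz vc))) tPT"
 unfolding PTE_def
proof (rule evals_weaken[where v = "vz + dep vl (hash_of sd j (kf Y vz vc))" and T = "1 + (tH + tDEP + 1) + 1"], goal_cases a)
 have *: "vz + dep vl x < 2 ^ b" for x using b(3) dep_less[of vl x] U_less by linarith
 case a show ?case
 proof (intro ev_ADD ev_LET ev_VAR)
  fix V' assume 1: "!!x. x < K ==> V' x = V x"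
  show "evals b inp M (HASHE k d sg zc code) (Suc K) V' (hash_of sd j (kf Y vz vc)) tH"
   by (rule ev_HASHE[OF M, where j = j]) (use v b 1 in auto)
  fix V'' assume 2: "!!x. x < Suc K ==> V'' x = V' x" "V'' (Suc K) = hash_of sd j (kf Y vz vc)"
  show "evals b inp M (DEPE k lam (Suc K)) (Suc (Suc K)) V'' (dep vl (hash_of sd j (kf Y vz vc))) tDEP"
   by (rule ev_DEPE[OF M(1)]) (use v b 1 2 in auto)
 qed (use v * in auto)
qed (simp_all add: tPT_def)

lemma P1_pos: "0 < P1" unfolding P1_def by (rule zero_less_power) simp

lemma T1_addr: "lam < NL ==> r < R1 ==> A1 + ((lam * R1 + r) * P1 + x mod P1) < A2"
proof -
 assume "lam < NL" "r < R1"
 then have "(lam * R1 + r) * P1 + x mod P1 < NL * R1 * P1" by (intro index_le) (auto simp: P1_pos)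
 then show ?thesis using addr by linarith
qed

text \<open>All entries of the tables are counters of samples or chains.\<close>

definition tabs_ok :: "(nat => nat) => bool" where
 "tabs_ok M \<longleftrightarrow> (ALL a. A1 <= a --> M a <= 4 * U)"

text \<open>The margin \<open>(64 * U + 64) * U < 2 ^ b\<close> leaves room for all starts below
  \<open>YC\<close>. With counters at least 1 they also lie above the points, so the three kinds of
  codes cannot be confused.\<close>

lemma start_code: "c <= 4 * U ==> zc < U ==> c * U + zc < YC"
proof -
 assume "c <= 4 * U" "zc < U"
 then have "c * U + zc < Suc (4 * U) * U" by (intro index_le) auto
 also have "... < (64 * U + 64) * U" using U_pos by (intro mult_strict_right_mono) auto
 finally have "Suc (c * U + zc) < 2 ^ b" using Ub by linarith
 then show ?thesis unfolding YC_def by linarith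
qed

lemma okc_start: "c <= 4 * U ==> zc < U ==> okc Y inp (c * U + zc)"
 using start_code[of c zc] by (simp add: okc_def)

text \<open>A genuine corner plus an offset is below \<open>U\<close>, but for an arbitrary
  \<open>zc < U\<close> only \<open>2 * U\<close> is guaranteed. This weaker bound already separates
  points from \<open>YC\<close>.\<close>

lemma okc_point: "z < 2 * U ==> okc Y inp z"
 using U_less(2) U_pos by (auto simp: okc_def YC_def)

lemma r1_less: assumes "r < R1"
 shows "2 * r < 2 ^ b" "2 * r + 1 < 2 ^ b" "2 * r * SL < 2 ^ b" "(2 * r + 1) * SL < 2 ^ b"
proof -
 show "2 * r < 2 ^ b" "2 * r + 1 < 2 ^ b" using assms R1b by linarith+
 have "2 * r * SL <= (2 * r + 1) * SL" by (intro mult_le_mono1) simp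
 moreover have "(2 * r + 1) * SL <= 2 * R1 * SL" using assms by (intro mult_le_mono1) simp
 ultimately show "2 * r * SL < 2 ^ b" "(2 * r + 1) * SL < 2 ^ b" using NS_ge addr_less by linarith+
qed

lemma ev_HVE:
 assumes M: "hdr M" "dat M" "seeded sd M" "tabs_ok M" and v: "lam < K" "zc < K" "code < K" "V lam = vl" "V zc = vz" "V code = vc"
  and b: "okc Y inp vc" "vl < NL" "vz < U"
 shows "evals b inp M (HVE k d lam zc code) K V (of_bool (hv (hash_of sd) M Y vl vz vc)) tHV"
proof -
 let ?H = "hash_of sd"
 let ?a = "%r. A1 + ((vl * R1 + r) * P1 + ?H (2 * r + 1) (kf Y vz vc) mod P1)"
 let ?g = "%r. if 0 < M (?a r) then (of_bool (kf Y vz (vz + dep vl (?H (2 * r) (kf Y vz (M (?a r) * U + vz)))) = kf Y vz vc) :: nat) else 0"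
 let ?T2 = "((1 + 1 + 1) + 2 + 1) + (((1 + 2 + 1) + 1 + 1) + (tPT + tE + 1) + 1) + 1"
 let ?T1 = "(2 + (((1 + 2 + 1) + 1 + 1) + 2 + 1 + (tH + 2 + 1) + 1) + 1) + 1"
 let ?T = "(((1 + 1 + 1) + 1 + 1) + 2 + 1) + (?T1 + (1 + (?T2 + 1) + 1) + 1) + 1"
 have "evals b inp M (HVE k d lam zc code) K V (of_bool (EX r<R1. 0 < ?g r)) (2 + R1 * (?T + 8) + 4)"
  unfolding HVE_def
 proof (rule ev_EXE)
  fix r V1 assume 1: "r < R1" "!!x. x < K ==> V1 x = V x" "V1 (Suc (Suc K)) = r"
  have al: "?a r < 2 ^ b" using T1_addr[OF b(2) 1(1)] addr_less by (meson less_trans)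
  have al2: "(vl * R1 + r) * P1 + ?H (2 * r + 1) (kf Y vz vc) mod P1 < 2 ^ b" "(vl * R1 + r) * P1 < 2 ^ b" using al by linarith+
  have "(vl * R1 + r) * 1 <= (vl * R1 + r) * P1" using P1_pos by (intro mult_le_mono2) linarith
  then have al3: "vl * R1 + r < 2 ^ b" "vl * R1 < 2 ^ b" using al2(2) by (simp_all add: add_mult_distrib)
  have tab: "M (?a r) <= 4 * U" using M(4) unfolding tabs_ok_def by simp
  have st: "M (?a r) * U + vz < 2 ^ b" "M (?a r) * U < 2 ^ b" using start_code[OF tab b(3)] YC_less by linarith+
  have pt: "okc Y inp (vz + dep vl x)" for x using b(3) dep_less[of vl x] by (intro okc_point) simp
  show "evals b inp M (LET (MUL (ADD (MUL (CST 2) (VAR (Suc (Suc K)))) (CST 1)) (HD 17)) (%sg.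
   LET (MEM (ADD (HD 12) (ADD (MUL (ADD (MUL (VAR lam) (HD 7)) (VAR (Suc (Suc K)))) (HD 15)) (MODE (HASHE k d sg zc code) (HD 15))))) (%c.
    IFE (VAR c) (LET (MUL (MUL (CST 2) (VAR (Suc (Suc K)))) (HD 17)) (%sg0. LET (ADD (MUL (VAR c) (HD 14)) (VAR zc)) (%st.
     LET (PTE k d lam zc sg0 st) (%u. EQVE k d zc u code)))) (CST 0)))) (K + 3) V1 (?g r) ?T"
  proof (rule ev_LET[where ?v1.0 = "(2 * r + 1) * SL"], goal_cases a 2)
   case a show ?case
    by (intro ev_MUL ev_ADD ev_VAR ev_HD evals_CST) (use M 1 r1_less[OF 1(1)] in "auto simp: hdrD intro: small")
   case (2 V2)
   let ?K = "Suc (K + 3)"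
   have hash: "evals b inp M (HASHE k d (K + 3) zc code) K' V' (?H (2 * r + 1) (kf Y vz vc)) tH"
    if "?K <= K'" "!!x. x < ?K ==> V' x = V2 x" for K' V'
    by (rule ev_HASHE[OF M(1-3), where j = "2 * r + 1"]) (use that v b 1 2 in auto)
   show ?case
   proof (rule ev_LET[where ?v1.0 = "M (?a r)"], goal_cases a 3)
    case a show ?case
    proof (rule evals_MEM[OF _ refl])
     show "evals b inp M (ADD (HD 12) (ADD (MUL (ADD (MUL (VAR lam) (HD 7)) (VAR (Suc (Suc K)))) (HD 15)) (MODE (HASHE k d (K + 3) zc code) (HD 15)))) ?K V2
      (?a r) (2 + (((1 + 2 + 1) + 1 + 1) + 2 + 1 + (tH + 2 + 1) + 1) + 1)"
      by (intro ev_ADD ev_MUL ev_MODE ev_VAR ev_HD hash)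
       (use M v 1 2 al al2 al3 in "auto simp: hdrD intro: small")
    qed
    case (3 V3)
    let ?st = "M (?a r) * U + vz"
    have "evals b inp M (LET (MUL (MUL (CST 2) (VAR (Suc (Suc K)))) (HD 17)) (%sg0. LET (ADD (MUL (VAR ?K) (HD 14)) (VAR zc)) (%st.
     LET (PTE k d lam zc sg0 st) (%u. EQVE k d zc u code)))) (Suc ?K) V3 (of_bool (kf Y vz (vz + dep vl (?H (2 * r) (kf Y vz ?st))) = kf Y vz vc)) ?T2"
    proof (rule ev_LET[where ?v1.0 = "2 * r * SL"], goal_cases a 4)
     case a show ?case
      by (intro ev_MUL ev_ADD ev_VAR ev_HD evals_CST) (use M 1 2 3 r1_less[OF 1(1)] in "auto simp: hdrD intro: small")
     case (4 V4)
     show ?case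
     proof (rule ev_LET[where ?v1.0 = ?st], goal_cases a 5)
      case a show ?case
       by (intro ev_MUL ev_ADD ev_VAR ev_HD evals_CST) (use M v 1 2 3 4 st in "auto simp: hdrD intro: small")
      case (5 V5)
      show ?case
      proof (rule ev_LET)
       show "evals b inp M (PTE k d lam zc (Suc ?K) (Suc (Suc ?K))) (Suc (Suc (Suc ?K))) V5 (vz + dep vl (?H (2 * r) (kf Y vz ?st))) tPT"
        by (rule ev_PTE[OF M(1-3), where j = "2 * r"]) (use v b 1 2 3 4 5 okc_start[OF tab b(3)] in auto)
      qed (rule ev_EQVE[OF M(1,2)], use v b 1 2 3 4 5 pt in auto)
     qed
    qed
    then show ?case
     by (intro ev_IFE ev_VAR evals_CST) (use 3 in auto)
   qed
  qed
 qed (use M b0 R1b in "auto simp: hdrD intro!: ev_HD intro: small")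
 moreover have "(EX r<R1. 0 < ?g r) = hv ?H M Y vl vz vc"
  unfolding hv_def Let_def by (intro ex_cong) auto
 ultimately show ?thesis by (elim evals_weaken) (simp_all add: tHV_def algebra_simps)
qed

lemma SL_pos: "0 < SL"
 using NP_pos Q2 by (simp add: SL_def)

lemma sg2: assumes "r < R2" "s <= t"
 shows "2 * R1 + (r * (t + 1) + s) < 2 * R1 + R2 * (t + 1)"
  "(2 * R1 + (r * (t + 1) + s)) * SL < 2 ^ b" "2 * R1 + (r * (t + 1) + s) < 2 ^ b"
  "r * (t + 1) + s < 2 ^ b" "r * (t + 1) < 2 ^ b"
proof -
 have *: "r * (t + 1) + s < R2 * (t + 1)" by (rule index_le) (use assms in auto)
 then show 1: "2 * R1 + (r * (t + 1) + s) < 2 * R1 + R2 * (t + 1)" by simp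
 have le: "(2 * R1 + R2 * (t + 1)) * SL < 2 ^ b" using addr_less NS_def by simp
 have "(2 * R1 + (r * (t + 1) + s)) * SL <= (2 * R1 + R2 * (t + 1)) * SL" using 1 by (intro mult_le_mono1) simp
 then show 2: "(2 * R1 + (r * (t + 1) + s)) * SL < 2 ^ b" using le by linarith
 have "(2 * R1 + (r * (t + 1) + s)) * 1 <= (2 * R1 + (r * (t + 1) + s)) * SL"
  using SL_pos by (intro mult_le_mono2) linarith
 from le_less_trans[OF this 2] show "2 * R1 + (r * (t + 1) + s) < 2 ^ b" by simp
 then show "r * (t + 1) + s < 2 ^ b" "r * (t + 1) < 2 ^ b" by linarith+
qed

lemma t_less: "t + 1 < 2 ^ b" "t < 2 ^ b"
proof -
 have "J <= k * L" using JL k2 by (metis le_trans mult_le_mono1 mult_1 one_le_numeral)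
 then have "t <= U" unfolding t_def by (rule pow_kL)
 then show "t + 1 < 2 ^ b" "t < 2 ^ b" using U_less U_pos by linarith+
qed

lemma ev_STEPE:
 assumes M: "hdr M" "dat M" "seeded sd M" "tabs_ok M"
  and v: "lam < K" "zc < K" "r < K" "s < K" "code < K" "V lam = vl" "V zc = vz" "V r = vr" "V s = vs" "V code = vc"
  and b: "okc Y inp vc" "vl < NL" "vz < U" "vr < R2" "vs <= t"
 shows "evals b inp M (STEPE k d lam zc r s code) K V (stp (hash_of sd) M Y vl vz vr vs vc) tS"
proof -
 let ?H = "hash_of sd"
 let ?j = "2 * R1 + (vr * (t + 1) + vs)"
 let ?z = "vz + dep vl (?H ?j (kf Y vz vc))"
 note sg = sg2[OF b(4,5)]
 have "evals b inp M (STEPE k d lam zc r s code) K V (if 0 < (of_bool (hv ?H M Y vl vz ?z) :: nat) then vc else ?z)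
   ((((1 + 2 + 1) + ((1 + (2 + 1 + 1) + 1) + 1 + 1) + 1) + 2 + 1) + (tPT + (tHV + (1 + 1) + 1) + 1) + 1)"
  unfolding STEPE_def
 proof (rule ev_LET[where ?v1.0 = "?j * SL"], goal_cases a 1)
  case a show ?case
   by (intro ev_MUL ev_ADD ev_VAR ev_HD evals_CST) (use M v sg t_less R1b in "auto simp: hdrD intro: small")
  case (1 V1)
  show ?case
  proof (rule ev_LET[where ?v1.0 = "?z"], goal_cases a 2)
   case a show ?case
    by (rule ev_PTE[OF M(1-3), where j = ?j]) (use v b 1 sg in auto)
   case (2 V2)
   have "?z < 2 * U" using b(3) dep_less[of vl "?H ?j (kf Y vz vc)"] by simp
   then show ?case
    by (intro ev_IFE ev_VAR ev_HVE[OF M]) (use v b 1 2 in "auto intro: okc_point")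
  qed
 qed
 then show ?thesis by (rule evals_weaken) (simp_all add: stp_def Let_def tS_def)
qed

text \<open>A step either keeps its code or moves to a point, so it never introduces
  \<open>YC\<close>.\<close>

lemma stp_okc: "okc Y inp code ==> zc < U ==> okc Y inp (stp H T Y lam zc r s code)"
 unfolding stp_def Let_def by (auto intro!: okc_point) (metis add_mono_thms_linordered_field(5) dep_less mult_2)

lemma wlk_okc: "okc Y inp code ==> zc < U ==> okc Y inp (wlk H T Y lam zc r s0 m code)"
 unfolding wlk_def by (induction m) (auto intro: stp_okc)

lemma ev_WALKE:
 assumes M: "hdr M" "dat M" "seeded sd M" "tabs_ok M"
  and v: "lam < K" "zc < K" "r < K" "s < K" "m < K" "code < K" "V lam = vl" "V zc = vz" "V r = vr" "V s = vs" "V code = vc" "V m = vm"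
  and b: "okc Y inp vc" "vl < NL" "vz < U" "vr < R2" "vs + vm <= t"
 shows "evals b inp M (WALKE k d lam zc r s m code) K V (wlk (hash_of sd) M Y vl vz vr vs vm vc) tW"
proof -
 have "evals b inp M (WALKE k d lam zc r s m code) K V (wlk (hash_of sd) M Y vl vz vr vs vm vc) (1 + 1 + vm * (((1 + 1 + 1) + tS + 1) + 5) + 3)"
  unfolding WALKE_def
 proof (rule ev_LOOP[where g = "%i. wlk (hash_of sd) M Y vl vz vr vs i vc"])
  fix i V1 assume 1: "i < vm" "!!x. x < K ==> V1 x = V x" "V1 K = wlk (hash_of sd) M Y vl vz vr vs i vc" "V1 (Suc (Suc K)) = i"
  show "evals b inp M (LET (ADD (VAR s) (VAR (Suc (Suc K)))) (%s. STEPE k d lam zc r s K)) (K + 3) V1 (wlk (hash_of sd) M Y vl vz vr vs (Suc i) vc) ((1 + 1 + 1) + tS + 1)"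
  proof (rule ev_LET[where ?v1.0 = "vs + i"], goal_cases a 2)
   case a show ?case
    by (intro ev_ADD ev_VAR) (use v b 1 t_less in auto)
   case (2 V2)
   have "wlk (hash_of sd) M Y vl vz vr vs (Suc i) vc = stp (hash_of sd) M Y vl vz vr (vs + i) (wlk (hash_of sd) M Y vl vz vr vs i vc)"
    by (simp add: wlk_def)
   then show ?case
    using v b 1 2 by (auto intro!: ev_STEPE[OF M] wlk_okc)
  qed
 qed (use v b b0 t_less in "auto simp: wlk_def intro!: ev_VAR")
 moreover have "vm * (tS + 9) <= t * (tS + 9)" using b by (intro mult_le_mono1) simp
 ultimately show ?thesis by (elim evals_weaken) (simp_all add: tW_def algebra_simps)
qed

lemma T2_addr: "lam < NL ==> r < R2 ==> 0 < P2 ==> A2 + ((lam * R2 + r) * P2 + x mod P2) < TOT"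
proof -
 assume "lam < NL" "r < R2" "0 < P2"
 then have "(lam * R2 + r) * P2 + x mod P2 < NL * R2 * P2" by (intro index_le) auto
 then show ?thesis using addr by linarith
qed

lemma ev_CELL2E:
 assumes M: "hdr M" "dat M" "seeded sd M"
  and v: "lam < K" "zc < K" "r < K" "e < K" "V lam = vl" "V zc = vz" "V r = vr" "V e = vc"
  and b: "okc Y inp vc" "vl < NL" "vr < R2" "0 < P2"
 shows "evals b inp M (CELL2E k d lam zc r e) K V (cell2 (hash_of sd) Y vl vz vr vc) (tH + 60)"
proof -
 let ?H = "hash_of sd"
 let ?j = "2 * R1 + (vr * (t + 1) + t)"
 note sg = sg2[OF b(3) order.refl]
 let ?a = "A2 + ((vl * R2 + vr) * P2 + ?H ?j (kf Y vz vc) mod P2)"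
 have al: "?a < 2 ^ b" using T2_addr[OF b(2,3,4), of "?H ?j (kf Y vz vc)"] TOTb by linarith
 have al2: "(vl * R2 + vr) * P2 + ?H ?j (kf Y vz vc) mod P2 < 2 ^ b" "(vl * R2 + vr) * P2 < 2 ^ b" using al by linarith+
 have "(vl * R2 + vr) * 1 <= (vl * R2 + vr) * P2" using b(4) by (intro mult_le_mono2) linarith
 then have al3: "vl * R2 + vr < 2 ^ b" "vl * R2 < 2 ^ b" using al2(2) by (simp_all add: add_mult_distrib)
 have R2': "R2 < 2 ^ b" using R2b t_pos by (simp add: distrib_left)
 have "evals b inp M (CELL2E k d lam zc r e) K V ?a
   ((((1 + 2 + 1) + ((1 + (2 + 1 + 1) + 1) + 2 + 1) + 1) + 2 + 1) + (2 + (((1 + 2 + 1) + 1 + 1) + 2 + 1 + (tH + 2 + 1) + 1) + 1) + 1)"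
  unfolding CELL2E_def
 proof (rule ev_LET[where ?v1.0 = "?j * SL"], goal_cases a 1)
  case a show ?case
   by (intro ev_MUL ev_ADD ev_VAR ev_HD evals_CST) (use M v sg t_less R1b in "auto simp: hdrD intro: small")
  case (1 V1)
  have hash: "evals b inp M (HASHE k d K zc e) K' V' (?H ?j (kf Y vz vc)) tH"
   if "Suc K <= K'" "!!x. x < Suc K ==> V' x = V1 x" for K' V'
   by (rule ev_HASHE[OF M(1-3), where j = ?j]) (use that v b 1 sg in auto)
  show ?case
   by (intro ev_ADD ev_MUL ev_MODE ev_VAR ev_HD hash)
    (use M v 1 al al2 al3 in "auto simp: hdrD intro: small")
 qed
 then show ?thesis by (rule evals_weaken) (simp_all add: cell2_def)
qed

lemma crn_field_less: "ext (%j. L - lev lam j) mu i * 2 ^ lev lam i < 2 ^ L"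
proof -
 have "ext (%j. L - lev lam j) mu i * 2 ^ lev lam i < 2 ^ (L - lev lam i) * 2 ^ lev lam i"
  by (intro mult_strict_right_mono ext_less) simp
 then show ?thesis using lev_le[of lam i] by (simp flip: power_add)
qed

lemma crn_less: "crn lam mu < U"
 unfolding crn_def U_def by (rule pack_less) (rule crn_field_less)

lemma ev_COFFE:
 assumes "hdr M" "lam < K" "i < K" "V lam = vlam" "V i = vi" "vi <= k"
 shows "evals b inp M (COFFE lam i) K V (\<Sum>j<vi. L - lev vlam j) (tOFF + 3 * k)"
 unfolding COFFE_def
proof (rule evals_weaken)
 have "(\<Sum>j<vi. L - lev vlam j) <= (\<Sum>j<vi. L)" by (intro sum_mono) simp
 also have "... <= k * L" using assms by simp
 finally have "(\<Sum>j<vi. L - lev vlam j) < 2 ^ b" by (rule kL_less)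
 moreover have "L < 2 ^ b" using kL_less[of L] k2 by simp
 ultimately show "evals b inp M (SUME (VAR i) (%j. SUBT (HD 3) (DIGE lam L1E j))) K V (\<Sum>j<vi. L - lev vlam j) (1 + vi * ((2 + tD + 1) + 7) + 4)"
  by (intro ev_SUME ev_VAR ev_SUBT ev_HD ev_lev) (use assms in "auto simp: b0 k_less lev_le hdrD intro: small")
 have "vi * (tD + 10) <= k * (tD + 10)" using assms by (intro mult_le_mono) auto
 then show "1 + vi * ((2 + tD + 1) + 7) + 4 <= tOFF + 3 * k" by (simp add: tOFF_def algebra_simps)
qed simp

lemma ev_CRNE:
 assumes "hdr M" "lam < K" "mu < K" "V lam = vlam" "V mu = vmu"
 shows "evals b inp M (CRNE k lam mu) K V (crn vlam vmu) tCRN"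
 unfolding CRNE_def crn_def pack_def ext_def
proof (rule evals_weaken)
 let ?c = "%i. (vmu div 2 ^ (\<Sum>j<i. L - lev vlam j) mod (1 * 2 ^ (L - lev vlam i))) * 2 ^ lev vlam i"
 have Lb: "L < 2 ^ b" using kL_less[of L] k2 by simp
 have 1: "?c i < 2 ^ b" for i
 proof -
  have "?c i < 2 ^ L" using crn_field_less[of vlam vmu i] by (simp add: ext_def)
  then show ?thesis using two_lev(2) by linarith
 qed
 have 2: "?c i * 2 ^ (i * L) < 2 ^ b" if "i < k" for i
  using pack_term[of "%i. ext (%j. L - lev vlam j) vmu i * 2 ^ lev vlam i" i, OF crn_field_less that] by (simp add: ext_def)
 have 3: "(\<Sum>i<k. ?c i * 2 ^ (i * L)) < 2 ^ b"
  using crn_less[of vlam vmu] U_less by (simp add: crn_def pack_def ext_def)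
 have 4: "1 * (2::nat) ^ (L - lev vlam i) < 2 ^ b" for i
  using two_lev(2) power_increasing[of "L - lev vlam i" L "2::nat"] by simp
 show "evals b inp M (SUME (CST k) (%i. SHLE (SHLE (MODE (SHRE (VAR mu) (COFFE lam i)) (SHLE (CST 1) (SUBT (HD 3) (DIGE lam L1E i))))
   (DIGE lam L1E i)) (MUL (VAR i) (HD 3)))) K V (\<Sum>i<k. ?c i * 2 ^ (i * L))
   (1 + k * ((((1 + (tOFF + 3 * k) + 1) + (1 + (2 + tD + 1) + 1) + 1) + tD + 1 + 4 + 1) + 7) + 4)"
  by (intro ev_SUME ev_SHLE ev_MODE ev_SHRE ev_SUBT ev_HD ev_VAR ev_COFFE ev_lev evals_CST ev_iL;
   (rule 1 3 4 Lb | (rule 2, assumption) | (use assms in "auto simp: b0 k_less lev_le hdrD intro: small")))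
qed (simp_all add: tCRN_def algebra_simps)

end

section \<open>Locating intervals and candidate boxes\<close>

definition
 "LESSE cnt dA dB = ITER cnt (CST 0) (%e a. LET (dA e) (%u. LET (dB e) (%v.
   IFE (LTE (VAR u) (VAR v)) (CST 1) (IFE (LTE (VAR v) (VAR u)) (CST 0) (VAR a)))))"

definition
 "ELD i x e = MEM (ADD (CST 32) (ADD (MUL (ADD (MUL (VAR i) (SHLE (CST 1) (HD 3))) (SUBT (VAR x) (CST 1))) (HD 2)) (VAR e)))"

definition
 "IND j i e = INP (ADD (MUL (ADD (MUL (CST 2) (VAR i)) (CST j)) (HD 2)) (VAR e))"

definition
 "BSE cmp = ITER (HD 3) (CST 0) (%j a. LET (ADD (VAR a) (SHLE (CST 1) (SUBT (SUBT (HD 3) (CST 1)) (VAR j)))) (%x.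
   IFE (LTE (HD 1) (VAR x)) (VAR a) (IFE (cmp x) (VAR x) (VAR a))))"

definition
 "LOE i = BSE (%x. LESSE (HD 2) (ELD i x) (IND 0 i))"

definition
 "HIE i = BSE (%x. EQE (LESSE (HD 2) (IND 1 i) (ELD i x)) (CST 0))"

text \<open>For a given side length only two aligned blocks are candidates in each coordinate: for
  side 1 the last one that ends by \<open>hi\<close>, otherwise the first one that begins at or
  after \<open>lo\<close>. The value \<open>n\<close> replaces a missing block; \<open>BADE\<close>
  rejects it, as such a block would end beyond \<open>n\<close>.\<close>

definition
 "CORNE lam side i = LET (DIGE lam L1E i) (%a. IFE (DIGE side (CST 2) i)
   (LET (SHRE (HIE i) (VAR a)) (%u. IFE (VAR u) (SHLE (SUBT (VAR u) (CST 1)) (VAR a)) (HD 1)))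
   (SHLE (SHRE (SUBT (ADD (LOE i) (SHLE (CST 1) (VAR a))) (CST 1)) (VAR a)) (VAR a)))"

definition
 "BADE lam side i = LET (CORNE lam side i) (%c. IFE (LTE (VAR c) (LOE i)) (CST 1)
   (LTE (HIE i) (ADD (VAR c) (SHLE (CST 1) (DIGE lam L1E i)))))"

definition
 "SAE k lam = SUME (CST k) (%i. DIGE lam L1E i)"

definition
 "SMALLE k d lam zc y = EXE (SHLE (CST 1) (SAE k lam)) (%h. LET (ADD (VAR zc) (DEPE k lam h)) (%z. EQVE k d zc z y))"

text \<open>The guess is that a chain reaches \<open>y\<close> in step \<open>s + 1\<close>. The
  rest of the chain is walked from \<open>y\<close>, the end cell names a chain, and this chain is
  rerun for \<open>s + 1\<close> steps to confirm the guess.\<close>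

definition
 "CHKE k d lam zc y r s = LET (ADD (VAR s) (CST 1)) (%s1. LET (SUBT (HD 5) (VAR s1)) (%m. LET (WALKE k d lam zc r s1 m y) (%e.
   LET (MEM (CELL2E k d lam zc r e)) (%c. IFE (VAR c)
    (LET (ADD (MUL (VAR c) (HD 14)) (VAR zc)) (%st. LET (CST 0) (%z0. LET (WALKE k d lam zc r z0 s1 st) (%u. EQVE k d zc u y))))
    (CST 0)))))"

definition
 "BOXE k d lam zc = LET (HD 19) (%y. IFE (LTE (SAE k lam) (ADD (MUL (CST 2) (HD 6)) (CST 4))) (SMALLE k d lam zc y)
   (IFE (HVE k d lam zc y) (CST 1) (EXE (HD 8) (%r. EXE (HD 5) (CHKE k d lam zc y r)))))"

definition
 "SIDEE k d lam side = IFE (EXE (CST k) (BADE lam side)) (CST 0)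
   (LET (SUME (CST k) (%i. SHLE (CORNE lam side i) (MUL (VAR i) (HD 3)))) (BOXE k d lam))"

text \<open>A negative \<open>y\<close> and a \<open>y\<close> of more than \<open>lim\<close>
  digits are answered at once. The word at offset \<open>1 + 2 * lim\<close> announces digit number
  \<open>lim\<close>, the first one beyond the admissible length.\<close>

definition
 "QRYE k d = IFE (INP (MUL (CST (2 * k)) (HD 2))) (CST 0)
   (IFE (INP (ADD (MUL (CST (2 * k)) (HD 2)) (ADD (CST 1) (MUL (CST 2) (HD 9))))) (CST 0)
    (EXE (LET (CST k) (POWE L1E)) (%lam. EXE (CST (2 ^ k)) (SIDEE k d lam))))"

lemma mod_digit: "x mod 2 ^ (b * Suc e) = (x div 2 ^ (b * e) mod 2 ^ b) * 2 ^ (b * e) + x mod (2 ^ (b * e) :: nat)"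
proof -
 have "x mod (2 ^ (b * e) * 2 ^ b) = 2 ^ (b * e) * (x div 2 ^ (b * e) mod 2 ^ b) + x mod 2 ^ (b * e)"
  by (rule mod_mult2_eq)
 then show ?thesis by (simp add: power_add mult.commute)
qed

text \<open>The recursion behind \<open>LESSE\<close>: digits are read from the least significant
  one upwards, and a strict comparison overrides the verdict of the lower digits.\<close>

lemma digit_less:
 fixes A B :: nat
 shows "A mod 2 ^ (b * Suc e) < B mod 2 ^ (b * Suc e) \<longleftrightarrow>
  (let u = A div 2 ^ (b * e) mod 2 ^ b; v = B div 2 ^ (b * e) mod 2 ^ b in
   if u < v then True else if v < u then False else A mod 2 ^ (b * e) < B mod 2 ^ (b * e))"
proof -
 have lt: "x * (2::nat) ^ (b * e) + r < y * 2 ^ (b * e) + s" if "x < y" "r < 2 ^ (b * e)" for x y r s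
 proof -
  have "x * (2::nat) ^ (b * e) + r < Suc x * 2 ^ (b * e)" using that by simp
  also have "... <= y * 2 ^ (b * e)" using that by (intro mult_le_mono1) simp
  finally show ?thesis by simp
 qed
 have m: "x mod 2 ^ (b * e) < 2 ^ (b * e)" for x :: nat by simp
 show ?thesis
  unfolding mod_digit Let_def
  using lt[OF _ m, of "A div 2 ^ (b * e) mod 2 ^ b" "B div 2 ^ (b * e) mod 2 ^ b"]
   lt[OF _ m, of "B div 2 ^ (b * e) mod 2 ^ b" "A div 2 ^ (b * e) mod 2 ^ b"]
  by (smt (verit, ccfv_threshold) add_less_cancel_left not_less_iff_gr_or_eq order_less_asym)
qed

lemma ev_LESSE:
 assumes b: "0 < b" and c: "cnt < 2 ^ b"
  and cnt: "!!V'. (!!x. x < K ==> V' x = V x) ==> evals b inp M cE (Suc K) V' cnt Tc"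
  and dA: "!!K' V' e x. K <= x ==> x < K' ==> (!!x. x < K ==> V' x = V x) ==> V' x = e ==> e < cnt ==>
   evals b inp M (dA x) K' V' (A div 2 ^ (b * e) mod 2 ^ b) Td"
  and dB: "!!K' V' e x. K <= x ==> x < K' ==> (!!x. x < K ==> V' x = V x) ==> V' x = e ==> e < cnt ==>
   evals b inp M (dB x) K' V' (B div 2 ^ (b * e) mod 2 ^ b) Td"
  and lt: "A < 2 ^ (b * cnt)" "B < 2 ^ (b * cnt)"
 shows "evals b inp M (LESSE cE dA dB) K V (of_bool (A < B)) (Tc + cnt * (2 * Td + 18) + 4)"
proof -
 have one: "1 < (2::nat) ^ b" using one_less_power[of "2::nat" b] b by simp
 have "evals b inp M (LESSE cE dA dB) K V (of_bool (A mod 2 ^ (b * cnt) < B mod 2 ^ (b * cnt)))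
   (1 + Tc + cnt * ((Td + (Td + ((1 + 1 + 1) + (1 + ((1 + 1 + 1) + (1 + 1) + 1)) + 1) + 1) + 1) + 5) + 3)"
  unfolding LESSE_def
 proof (rule ev_LOOP[where g = "%e. of_bool (A mod 2 ^ (b * e) < B mod 2 ^ (b * e))"])
  fix e V1 assume 1: "e < cnt" "!!x. x < K ==> V1 x = V x" "V1 K = of_bool (A mod 2 ^ (b * e) < B mod 2 ^ (b * e))" "V1 (Suc (Suc K)) = e"
  let ?u = "A div 2 ^ (b * e) mod 2 ^ b" let ?v = "B div 2 ^ (b * e) mod 2 ^ b"
  show "evals b inp M (LET (dA (Suc (Suc K))) (%u. LET (dB (Suc (Suc K))) (%v.
   IFE (LTE (VAR u) (VAR v)) (CST 1) (IFE (LTE (VAR v) (VAR u)) (CST 0) (VAR K))))) (K + 3) V1 (of_bool (A mod 2 ^ (b * Suc e) < B mod 2 ^ (b * Suc e)))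
    (Td + (Td + ((1 + 1 + 1) + (1 + ((1 + 1 + 1) + (1 + 1) + 1)) + 1) + 1) + 1)"
  proof (rule ev_LET[where ?v1.0 = "?u"], goal_cases a 2)
   case a show ?case by (rule dA) (use 1 in auto)
   case (2 V2)
   show ?case
   proof (rule ev_LET[where ?v1.0 = "?v"], goal_cases a 3)
    case a show ?case by (rule dB) (use 1 2 in auto)
    case (3 V3)
    show ?case
    proof (rule evals_weaken[where v = "if 0 < (of_bool (?u < ?v) :: nat) then 1 else if 0 < (of_bool (?v < ?u) :: nat) then 0 else of_bool (A mod 2 ^ (b * e) < B mod 2 ^ (b * e))" and T = "(1 + 1 + 1) + (1 + ((1 + 1 + 1) + (1 + 1) + 1)) + 1"], goal_cases a)
     case a show ?case
      by (intro ev_IFE ev_LTE ev_VAR evals_CST) (use 1 2 3 b one in auto)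
    qed (unfold digit_less Let_def, simp_all)
   qed
  qed
 qed (use b c cnt in "auto intro!: evals_CST")
 then show ?thesis by (rule evals_weaken) (use lt in "simp_all add: algebra_simps")
qed

text \<open>Binary lifting: each round settles one more leading bit of the answer, and positions
  beyond \<open>n\<close> count as failures.\<close>

fun bsr :: "(nat => bool) => nat => nat => nat => nat" where
 "bsr P n L 0 = 0"
| "bsr P n L (Suc j) = (let a = bsr P n L j; x = a + 2 ^ (L - 1 - j) in if n < x then a else if P x then x else a)"

lemma bsr_le: "bsr P n L j <= n"
 by (induction j) (auto simp: Let_def)

lemma bsr_inv:
 assumes anti: "!!x y. 0 < x ==> x <= y ==> y <= n ==> P y ==> P x"
 shows "j <= L ==> n < 2 ^ L ==> (bsr P n L j = 0 \<or> P (bsr P n L j)) & (ALL x. bsr P n L j + 2 ^ (L - j) <= x --> x <= n --> ~ P x)"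
proof (induction j)
 case (Suc j)
 let ?a = "bsr P n L j" let ?x = "?a + 2 ^ (L - 1 - j)"
 have IH: "?a = 0 \<or> P ?a" "!!x. ?a + 2 ^ (L - j) <= x ==> x <= n ==> ~ P x" using Suc by auto
 have L: "L - j = Suc (L - 1 - j)" "L - Suc j = L - 1 - j" using Suc.prems by auto
 then have two: "(2::nat) ^ (L - j) = 2 ^ (L - 1 - j) + 2 ^ (L - 1 - j)" by simp
 consider "n < ?x" | "?x <= n" "P ?x" | "?x <= n" "~ P ?x" by linarith
 then show ?case
 proof cases
  case 1
  then show ?thesis using IH L by (auto simp: Let_def)
 next
  case 2
  then show ?thesis using IH L two by (auto simp: Let_def)
 next
  case 3
  have "~ P x" if "?x <= x" "x <= n" for x using anti[of ?x x] 3 that by auto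
  then show ?thesis using 3 IH L by (auto simp: Let_def)
 qed
qed auto

lemma bsr_spec:
 assumes anti: "!!x y. 0 < x ==> x <= y ==> y <= n ==> P y ==> P x" and n: "n < 2 ^ L"
  and p: "0 < p" "p <= n"
 shows "p <= bsr P n L L \<longleftrightarrow> P p"
proof -
 have h: "bsr P n L L = 0 \<or> P (bsr P n L L)" "!!x. bsr P n L L + 1 <= x ==> x <= n ==> ~ P x"
  using bsr_inv[where P = P and n = n and L = L and j = L] anti n by auto
 show ?thesis
 proof
  assume "p <= bsr P n L L"
  then show "P p" using h(1) anti[OF p(1), of "bsr P n L L"] bsr_le[of P n L L] p by auto
 next
  assume "P p"
  then show "p <= bsr P n L L" using h(2)[of p] p by linarith
 qed
qed

context inst_ok begin

lemma ev_BSE: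
 assumes M: "hdr M"
  and cmp: "!!K' V' x vx. K <= x ==> x < K' ==> (!!x. x < K ==> V' x = V x) ==> V' x = vx ==> 0 < vx ==> vx <= n ==>
   evals b inp M (cmp x) K' V' (of_bool (P vx)) (tLESS + 4)"
 shows "evals b inp M (BSE cmp) K V (bsr P n L L) tBS"
proof -
 have Lb: "L < 2 ^ b" using kL_less[of L] k2 by simp
 have "L <= k * L" using k2 by simp
 then have "L + 1 < b" using kLb by linarith
 then have L1: "2 ^ Suc L <= (2::nat) ^ b" by (intro power_increasing) auto
 have nb: "n + 2 ^ L < 2 ^ b" using nL L1 by simp
 let ?T = "(1 + (1 + ((2 + 1 + 1) + 1 + 1) + 1) + 1) + ((2 + 1 + 1) + (1 + ((tLESS + 4) + (1 + 1) + 1)) + 1) + 1"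
 have "evals b inp M (BSE cmp) K V (bsr P n L L) (1 + 2 + L * (?T + 5) + 3)"
  unfolding BSE_def
 proof (rule ev_LOOP[where g = "bsr P n L"])
  fix j V1 assume 1: "j < L" "!!x. x < K ==> V1 x = V x" "V1 K = bsr P n L j" "V1 (Suc (Suc K)) = j"
  let ?a = "bsr P n L j" let ?x = "?a + 2 ^ (L - 1 - j)"
  have p1: "2 ^ (L - 1 - j) <= (2::nat) ^ L" by (rule power_increasing) auto
  then have xb: "?x < 2 ^ b" "(2::nat) ^ (L - 1 - j) < 2 ^ b" using bsr_le[of P n L j] nb by linarith+
  show "evals b inp M (LET (ADD (VAR K) (SHLE (CST 1) (SUBT (SUBT (HD 3) (CST 1)) (VAR (Suc (Suc K)))))) (%x.
   IFE (LTE (HD 1) (VAR x)) (VAR K) (IFE (cmp x) (VAR x) (VAR K)))) (K + 3) V1 (bsr P n L (Suc j)) ?T"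
  proof (rule ev_LET[where ?v1.0 = "?a + 1 * 2 ^ (L - 1 - j)"], goal_cases a 2)
   case a show ?case
    by (intro ev_ADD ev_SHLE ev_SUBT ev_HD ev_VAR evals_CST) (use M 1 xb Lb in "auto simp: hdrD simp del: power_strict_increasing_iff intro: small")
   case (2 V2)
   show ?case
   proof (rule evals_weaken[where v = "if 0 < (of_bool (n < ?x) :: nat) then ?a else if 0 < (of_bool (P ?x) :: nat) then ?x else ?a" and T = "(2 + 1 + 1) + (1 + ((tLESS + 4) + (1 + 1) + 1)) + 1"], goal_cases a)
    case a show ?case
     by (intro ev_IFE ev_LTE ev_HD ev_VAR cmp) (use M 1 2 b0 in "auto simp: hdrD intro: small")
   qed (simp_all add: Let_def)
  qed
 qed (use b0 Lb M in "auto simp: hdrD intro!: evals_CST ev_HD intro: small")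
 then show ?thesis by (rule evals_weaken) (simp_all add: tBS_def algebra_simps)
qed

definition lin :: "nat => (nat => nat) => nat list => bool" where
 "lin j l inp \<longleftrightarrow> (ALL i<k. l i < 2 ^ (b * len) & (ALL e<len. take_bit b (nth_default 0 inp ((2 * i + j) * len + e)) = l i div 2 ^ (b * e) mod 2 ^ b))"

lemma ev_IND:
 assumes M: "hdr M" "lin j l inp" and v: "i < K" "e < K" "V i = vi" "V e = ve" "vi < k" "ve < len" "j < 2"
 shows "evals b inp M (IND j i e) K V (l vi div 2 ^ (b * ve) mod 2 ^ b) 20"
 unfolding IND_def
proof (rule evals_weaken[where v = "l vi div 2 ^ (b * ve) mod 2 ^ b" and T = "(((((1 + 1 + 1) + 1 + 1) + 2 + 1) + 1 + 1)) + 1"], goal_cases a)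
 have 1: "(2 * vi + j) * len + ve < 2 * k * len" by (rule index_le) (use v in auto)
 then have 2: "(2 * vi + j) * len + ve < 2 ^ b" "(2 * vi + j) * len < 2 ^ b" using limb by linarith+
 have 3: "2 * k < 2 ^ b" using kLb less_exp[of b] by linarith
 case a show ?case
 proof (rule evals_INP)
  show "evals b inp M (ADD (MUL (ADD (MUL (CST 2) (VAR i)) (CST j)) (HD 2)) (VAR e)) K V ((2 * vi + j) * len + ve) ((((1 + 1 + 1) + 1 + 1) + 2 + 1) + 1 + 1)"
   by (intro ev_ADD ev_MUL ev_HD ev_VAR evals_CST) (use M v 2 3 in "auto simp: hdrD intro: small")
  show "take_bit b (nth_default 0 inp ((2 * vi + j) * len + ve)) = l vi div 2 ^ (b * ve) mod 2 ^ b"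
   using M(2) v unfolding lin_def by blast
 qed
qed simp_all

lemma ev_ELD:
 assumes M: "hdr M" "dat M" and v: "i < K" "x < K" "e < K" "V i = vi" "V x = vx" "V e = ve" "vi < k" "ve < len" "0 < vx" "vx <= n"
 shows "evals b inp M (ELD i x e) K V (nm vi (vx - 1) div 2 ^ (b * ve) mod 2 ^ b) 25"
 unfolding ELD_def
proof (rule evals_weaken[where v = "nm vi (vx - 1) div 2 ^ (b * ve) mod 2 ^ b" and T = "(1 + ((((1 + (1 + 2 + 1) + 1) + (1 + 1 + 1) + 1) + 2 + 1) + 1 + 1) + 1) + 1"], goal_cases a)
 have p: "vx - 1 < 2 ^ L" using nL v by linarith
 have 1: "vi * 2 ^ L + (vx - 1) < k * 2 ^ L" by (rule index_le) (use p v in auto)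
 have 2: "(vi * 2 ^ L + (vx - 1)) * len + ve < k * 2 ^ L * len" by (rule index_le) (use 1 v in auto)
 have 3: "32 + ((vi * 2 ^ L + (vx - 1)) * len + ve) < 2 ^ b" using 2 addr addr_less by linarith
 have 4: "(vi * 2 ^ L + (vx - 1)) * 1 <= (vi * 2 ^ L + (vx - 1)) * len" using v by (intro mult_le_mono2) simp
 have 5: "(vi * 2 ^ L + (vx - 1)) * len < 2 ^ b" using 3 by linarith
 have 6: "vi * 2 ^ L + (vx - 1) < 2 ^ b" using le_less_trans[OF 4 5] by simp
 then have 7: "vi * 2 ^ L < 2 ^ b" by simp
 have 8: "vx < 2 ^ b" using nL two_lev(2) v by linarith
 case a show ?case
 proof (rule evals_MEM)
  show "evals b inp M (ADD (CST 32) (ADD (MUL (ADD (MUL (VAR i) (SHLE (CST 1) (HD 3))) (SUBT (VAR x) (CST 1))) (HD 2)) (VAR e))) K V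
    (32 + ((vi * (1 * 2 ^ L) + (vx - 1)) * len + ve)) (1 + ((((1 + (1 + 2 + 1) + 1) + (1 + 1 + 1) + 1) + 2 + 1) + 1 + 1) + 1)"
   by (intro ev_ADD ev_MUL ev_SHLE ev_SUBT ev_HD ev_VAR evals_CST) (use M v 3 5 6 7 8 two_lev in "auto simp: hdrD intro: small")
  show "M (32 + ((vi * (1 * 2 ^ L) + (vx - 1)) * len + ve)) = nm vi (vx - 1) div 2 ^ (b * ve) mod 2 ^ b"
   unfolding mult_1 by (rule dat_num[OF M(2)]) (use p v in auto)
 qed
qed simp_all

text \<open>\<open>lo\<close> counts the elements below the left end and \<open>hi\<close> those up
  to the right end, so the interval consists of the ranks \<open>lo, ..., hi - 1\<close>. Positions
  in the search start at 1 and refer to rank \<open>x - 1\<close>, which leaves 0 for an empty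
  count.\<close>

definition lo :: "(nat => nat) => nat => nat" where "lo l i = bsr (%x. nm i (x - 1) < l i) n L L"
definition hi :: "(nat => nat) => nat => nat" where "hi r i = bsr (%x. nm i (x - 1) <= r i) n L L"

lemma ev_LOE:
 assumes M: "hdr M" "dat M" "lin 0 l inp" and v: "i < K" "V i = vi" "vi < k"
 shows "evals b inp M (LOE i) K V (lo l vi) tBS"
 unfolding LOE_def lo_def
proof (rule ev_BSE[OF M(1)])
 fix K' V' x vx
 assume h: "K <= x" "x < K'" "!!x. x < K ==> V' x = V x" "V' x = vx" "0 < vx" "vx <= n"
 show "evals b inp M (LESSE (HD 2) (ELD i x) (IND 0 i)) K' V' (of_bool (nm vi (vx - 1) < l vi)) (tLESS + 4)"
 proof (rule evals_weaken[where v = "of_bool (nm vi (vx - 1) < l vi)" and T = "2 + len * (2 * 25 + 18) + 4"], goal_cases a)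
  case a show ?case
  proof (rule ev_LESSE)
   show "evals b inp M (HD 2) (Suc K') V'' len 2" for V'' by (rule ev_HD) (use M in "auto simp: hdrD intro: small")
   fix K1 V1 e y assume h1: "K' <= y" "y < K1" "!!x. x < K' ==> V1 x = V' x" "V1 y = e" "e < len"
   show "evals b inp M (ELD i x y) K1 V1 (nm vi (vx - 1) div 2 ^ (b * e) mod 2 ^ b) 25"
    by (rule ev_ELD[OF M(1,2)]) (use h h1 v in auto)
   show "evals b inp M (IND 0 i y) K1 V1 (l vi div 2 ^ (b * e) mod 2 ^ b) 25"
    by (rule evals_weaken[OF ev_IND[OF M(1,3)]]) (use h h1 v in auto)
  qed (use b0 len_less nm_less M(3) v in "auto simp: lin_def")
 qed (simp_all add: tLESS_def)
qed

lemma ev_HIE: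
 assumes M: "hdr M" "dat M" "lin 1 r inp" and v: "i < K" "V i = vi" "vi < k"
 shows "evals b inp M (HIE i) K V (hi r vi) tBS"
 unfolding HIE_def hi_def
proof (rule ev_BSE[OF M(1)])
 fix K' V' x vx
 assume h: "K <= x" "x < K'" "!!x. x < K ==> V' x = V x" "V' x = vx" "0 < vx" "vx <= n"
 show "evals b inp M (EQE (LESSE (HD 2) (IND 1 i) (ELD i x)) (CST 0)) K' V' (of_bool (nm vi (vx - 1) <= r vi)) (tLESS + 4)"
 proof (rule evals_weaken[where v = "of_bool (of_bool (r vi < nm vi (vx - 1)) = (0::nat))" and T = "(2 + len * (2 * 25 + 18) + 4) + 1 + 1"], goal_cases a)
  case a show ?case
  proof (intro ev_EQE evals_CST)
   show "evals b inp M (LESSE (HD 2) (IND 1 i) (ELD i x)) K' V' (of_bool (r vi < nm vi (vx - 1))) (2 + len * (2 * 25 + 18) + 4)"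
   proof (rule ev_LESSE)
    show "evals b inp M (HD 2) (Suc K') V'' len 2" for V'' by (rule ev_HD) (use M in "auto simp: hdrD intro: small")
    fix K1 V1 e y assume h1: "K' <= y" "y < K1" "!!x. x < K' ==> V1 x = V' x" "V1 y = e" "e < len"
    show "evals b inp M (ELD i x y) K1 V1 (nm vi (vx - 1) div 2 ^ (b * e) mod 2 ^ b) 25"
     by (rule ev_ELD[OF M(1,2)]) (use h h1 v in auto)
    show "evals b inp M (IND 1 i y) K1 V1 (r vi div 2 ^ (b * e) mod 2 ^ b) 25"
     by (rule evals_weaken[OF ev_IND[OF M(1,3)]]) (use h h1 v in auto)
   qed (use b0 len_less nm_less M(3) v in "auto simp: lin_def")
  qed (use b0 in auto)
 qed (auto simp: tLESS_def)
qed

definition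
 "corn l r lam side i = (let a = lev lam i in
   if 0 < dg 2 side i then (let u = hi r i div 2 ^ a in if 0 < u then (u - 1) * 2 ^ a else n)
   else (lo l i + 2 ^ a - 1) div 2 ^ a * 2 ^ a)"

definition
 "bad l r lam side i \<longleftrightarrow> corn l r lam side i < lo l i \<or> hi r i < corn l r lam side i + 2 ^ lev lam i"

lemma lo_hi_le: "lo l i <= n" "hi r i <= n"
 unfolding lo_def hi_def by (rule bsr_le)+

lemma two_pow_bounds: "n + 2 ^ lev lam i + 2 ^ lev lam' i' < 2 ^ b" "n < 2 ^ b"
proof -
 have "L <= k * L" using k2 by simp
 then have "L + 2 < b" using kLb by linarith
 then have L1: "2 ^ (L + 2) <= (2::nat) ^ b" by (intro power_increasing) auto
 moreover have "2 ^ lev lam i <= (2::nat) ^ L" "2 ^ lev lam' i' <= (2::nat) ^ L" by (intro power_increasing lev_le; simp)+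
 moreover have "(2::nat) ^ (L + 2) = 4 * 2 ^ L" by (simp add: power_add)
 ultimately show "n + 2 ^ lev lam i + 2 ^ lev lam' i' < 2 ^ b" "n < 2 ^ b" using nL by linarith+
qed

lemma corn_le: "corn l r lam side i <= n + 2 ^ lev lam i"
proof -
 have "hi r i div 2 ^ lev lam i * 2 ^ lev lam i <= n" using lo_hi_le(2)[of r i] by (meson div_times_less_eq_dividend le_trans)
 moreover have "(u - 1) * 2 ^ lev lam i <= u * 2 ^ lev lam i" for u :: nat by simp
 ultimately have 1: "(hi r i div 2 ^ lev lam i - 1) * 2 ^ lev lam i <= n" by (meson le_trans)
 have "(lo l i + 2 ^ lev lam i - 1) div 2 ^ lev lam i * 2 ^ lev lam i <= lo l i + 2 ^ lev lam i - 1" by (rule div_times_less_eq_dividend)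
 then have 2: "(lo l i + 2 ^ lev lam i - 1) div 2 ^ lev lam i * 2 ^ lev lam i <= n + 2 ^ lev lam i" using lo_hi_le(1)[of l i] by linarith
 show ?thesis using 1 2 unfolding corn_def Let_def by auto
qed

lemma ev_CORNE:
 assumes M: "hdr M" "dat M" "lin 0 l inp" "lin 1 r inp" and v: "lam < K" "side < K" "i < K" "V lam = vl" "V side = vs" "V i = vi" "vi < k"
 shows "evals b inp M (CORNE lam side i) K V (corn l r vl vs vi) tCORN"
proof -
 let ?a = "lev vl vi"
 let ?u = "hi r vi div 2 ^ ?a"
 have two_k: "(2::nat) ^ vi < 2 ^ b" using kLb v less_exp[of b] by (intro power_strict_increasing) auto
 have c1: "(?u - 1) * 2 ^ ?a < 2 ^ b"
 proof -
  have "(?u - 1) * 2 ^ ?a <= ?u * 2 ^ ?a" by simp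
  also have "... <= n" using lo_hi_le(2)[of r vi] by (meson div_times_less_eq_dividend le_trans)
  finally show ?thesis using two_pow_bounds(2) by linarith
 qed
 have c2: "(lo l vi + 2 ^ ?a - 1) div 2 ^ ?a * 2 ^ ?a < 2 ^ b"
 proof -
  have "(lo l vi + 2 ^ ?a - 1) div 2 ^ ?a * 2 ^ ?a <= lo l vi + 2 ^ ?a - 1" by (rule div_times_less_eq_dividend)
  then show ?thesis using two_pow_bounds(1)[of vl vi vl vi] lo_hi_le(1)[of l vi] by linarith
 qed
 have c3: "lo l vi + 2 ^ ?a < 2 ^ b" using two_pow_bounds(1)[of vl vi vl vi] lo_hi_le(1)[of l vi] by linarith
 have "0 < (2::nat) ^ ?a" by simp
 then have c5: "1 <= lo l vi + 1 * 2 ^ ?a" by linarith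
 have c4: "?u < 2 ^ b" "hi r vi < 2 ^ b" "lo l vi < 2 ^ b" using two_pow_bounds(2) lo_hi_le(2)[of r vi] lo_hi_le(1)[of l vi]
  by (meson div_le_dividend le_less_trans)+
 have "evals b inp M (CORNE lam side i) K V (if 0 < dg 2 vs vi then (if 0 < ?u then (?u - 1) * 2 ^ ?a else n) else (lo l vi + 1 * 2 ^ ?a - 1) div 2 ^ ?a * 2 ^ ?a)
   (tD + (tD + (((tBS + 1 + 1) + (1 + ((1 + 1 + 1) + 1 + 1 + 2) + 1) + 1) + ((((tBS + (1 + 1 + 1) + 1) + 1 + 1) + 1 + 1) + 1 + 1)) + 1) + 1)"
  unfolding CORNE_def
 proof (rule ev_LET[where ?v1.0 = "?a"], goal_cases a 1)
  case a show ?case by (rule ev_lev) (use M v in auto)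
  case (1 V1)
  show ?case
  proof (rule ev_IFE)
   show "evals b inp M (DIGE side (CST 2) i) (Suc K) V1 (dg 2 vs vi) tD"
   proof (rule evals_weaken[where v = "vs div 2 ^ vi mod 2" and T = "vi * (1 + 7) + 1 + 9"], goal_cases a)
    case a show ?case
     by (intro ev_DIGE evals_CST) (use v 1 two_k b0 k_less in "auto simp del: power_strict_increasing_iff intro: small")
   qed (use v in "auto simp: dg_def tD_def")
   show "evals b inp M (LET (SHRE (HIE i) (VAR K)) (%u. IFE (VAR u) (SHLE (SUBT (VAR u) (CST 1)) (VAR K)) (HD 1))) (Suc K) V1
     (if 0 < ?u then (?u - 1) * 2 ^ ?a else n) ((tBS + 1 + 1) + (1 + ((1 + 1 + 1) + 1 + 1 + 2) + 1) + 1)"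
   proof (rule ev_LET[where ?v1.0 = "?u"], goal_cases a 2)
    case a show ?case
     by (intro ev_SHRE ev_HIE[OF M(1,2,4)] ev_VAR) (use v 1 in auto)
    case (2 V2)
    show ?case
     by (intro ev_IFE ev_VAR ev_SHLE ev_SUBT evals_CST ev_HD; (rule c1 c4 | (use M 1 2 in "auto simp: hdrD intro: small")))
   qed
   show "evals b inp M (SHLE (SHRE (SUBT (ADD (LOE i) (SHLE (CST 1) (VAR K))) (CST 1)) (VAR K)) (VAR K)) (Suc K) V1
     ((lo l vi + 1 * 2 ^ ?a - 1) div 2 ^ ?a * 2 ^ ?a) ((((tBS + (1 + 1 + 1) + 1) + 1 + 1) + 1 + 1) + 1 + 1)"
    by (intro ev_SHLE ev_SHRE ev_SUBT ev_ADD ev_LOE[OF M(1,2,3)] ev_VAR evals_CST)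
     (use v 1 c2 c3 c5 two_lev in "auto intro: small")
  qed
 qed
 then show ?thesis by (rule evals_weaken) (simp_all add: corn_def Let_def tCORN_def)
qed

lemma ev_BADE:
 assumes M: "hdr M" "dat M" "lin 0 l inp" "lin 1 r inp" and v: "lam < K" "side < K" "i < K" "V lam = vl" "V side = vs" "V i = vi" "vi < k"
 shows "evals b inp M (BADE lam side i) K V (of_bool (bad l r vl vs vi)) tBAD"
proof -
 let ?c = "corn l r vl vs vi" let ?a = "lev vl vi"
 have cb: "?c + 2 ^ ?a < 2 ^ b" "?c + 1 * 2 ^ ?a < 2 ^ b" using corn_le[of l r vl vs vi] two_pow_bounds(1)[of vl vi vl vi] by linarith+
 have "evals b inp M (BADE lam side i) K V (if 0 < (of_bool (?c < lo l vi) :: nat) then 1 else of_bool (hi r vi < ?c + 1 * 2 ^ ?a))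
   (tCORN + ((1 + tBS + 1) + (1 + (tBS + (1 + (1 + tD + 1) + 1) + 1)) + 1) + 1)"
  unfolding BADE_def
 proof (rule ev_LET[where ?v1.0 = "?c"], goal_cases a 1)
  case a show ?case by (rule ev_CORNE[OF M v])
  case (1 V1)
  show ?case
   by (intro ev_IFE ev_LTE ev_VAR ev_LOE[OF M(1,2,3)] ev_HIE[OF M(1,2,4)] ev_ADD ev_SHLE ev_lev evals_CST)
    (use M v 1 cb b0 two_lev in "auto intro: small")
 qed
 then show ?thesis by (rule evals_weaken) (auto simp: bad_def tBAD_def)
qed

end

section \<open>Deciding one box and answering a query\<close>

context inst_ok begin

text \<open>The mathematical content of \<open>BOXE\<close>; soundness and completeness are proved
  for this predicate.\<close>

definition
 "qbox H M Y lam zc \<longleftrightarrow> (if sa lam < 2 * J + 4 then EX h<2 ^ sa lam. kf Y zc (zc + dep lam h) = kf Y zc YC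
   else hv H M Y lam zc YC \<or> (EX r<R2. EX s<t. let c = M (cell2 H Y lam zc r (wlk H M Y lam zc r (s + 1) (t - (s + 1)) YC)) in
    0 < c & kf Y zc (wlk H M Y lam zc r 0 (s + 1) (c * U + zc)) = kf Y zc YC))"

lemma sa_le: "sa lam <= k * L"
 unfolding sa_def by (rule sum_lev_le) simp

lemma ev_SAE:
 assumes "hdr M" "lam < K" "V lam = vl"
 shows "evals b inp M (SAE k lam) K V (sa vl) tOFF"
 unfolding SAE_def sa_def
proof (rule evals_weaken[where v = "\<Sum>j<k. lev vl j" and T = "1 + k * (tD + 7) + 4"], goal_cases a)
 case a show ?case
  by (intro ev_SUME evals_CST ev_lev) (use assms in "auto simp: b0 k_less kL_less sum_lev_le")
qed (simp_all add: tOFF_def algebra_simps)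

lemma P2_pos: "2 * J + 4 <= sa lam ==> 0 < P2"
proof -
 assume "2 * J + 4 <= sa lam"
 then have "2 ^ (2 * J + 1) <= U" using sa_le[of lam] by (intro pow_kL) simp
 then show ?thesis unfolding P2_def by (simp add: div_greater_zero_iff)
qed

lemma ev_BOXE:
 assumes M: "hdr M" "dat M" "seeded sd M" "tabs_ok M"
  and v: "lam < K" "zc < K" "V lam = vl" "V zc = vz"
  and b: "okc Y inp YC" "vl < NL" "vz < U"
 shows "evals b inp M (BOXE k d lam zc) K V (of_bool (qbox (hash_of sd) M Y vl vz)) tBOX"
proof -
 let ?H = "hash_of sd"
 have sab: "sa vl < 2 ^ b" "2 ^ sa vl < (2::nat) ^ b"
  using kL_less[OF sa_le] pow_kL[OF sa_le[of vl]] U_less by (auto intro: le_less_trans simp del: power_strict_increasing_iff)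
 have J: "2 * J + 4 < 2 ^ b"
 proof -
  have "J <= k * L" using JL k2 by (metis le_trans mult_le_mono1 mult_1 one_le_numeral)
  then show ?thesis using kLb less_exp[of b] by linarith
 qed
 have pt: "okc Y inp (vz + dep vl x)" "vz + dep vl x < 2 ^ b" for x
  using b(3) dep_less[of vl x] U_less by (auto intro: okc_point)
 let ?vS = "of_bool (EX h<1 * 2 ^ sa vl. 0 < (of_bool (kf Y vz (vz + dep vl h) = kf Y vz YC) :: nat)) :: nat"
 have small_case: "evals b inp M (SMALLE k d lam zc K) (Suc K) V1
   ?vS (tSM + tOFF)"
  if sm: "sa vl < 2 * J + 4" and 1: "!!x. x < K ==> V1 x = V x" "V1 K = YC" for V1
 proof (rule evals_weaken[where v = ?vS and T = "(1 + tOFF + 1) + (1 * 2 ^ sa vl) * (((1 + tDEP + 1) + tE + 1) + 8) + 4"], goal_cases a)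
  case a show ?case
  unfolding SMALLE_def
   proof (rule ev_EXE)
   show "evals b inp M (SHLE (CST 1) (SAE k lam)) (Suc (Suc K)) V2 (1 * 2 ^ sa vl) (1 + tOFF + 1)"
    if "!!x. x < Suc K ==> V2 x = V1 x" for V2
    by (intro ev_SHLE evals_CST ev_SAE) (use M v 1 that sab in "auto intro: small")
   fix h V2 assume 2: "!!x. x < Suc K ==> V2 x = V1 x" "V2 (Suc (Suc (Suc K))) = h"
   show "evals b inp M (LET (ADD (VAR zc) (DEPE k lam (Suc (Suc (Suc K))))) (%z. EQVE k d zc z K)) (Suc K + 3) V2
     (of_bool (kf Y vz (vz + dep vl h) = kf Y vz YC)) ((1 + tDEP + 1) + tE + 1)"
   proof (rule ev_LET[where ?v1.0 = "vz + dep vl h"], goal_cases a 3)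
    case a show ?case
     by (intro ev_ADD ev_VAR ev_DEPE) (use M v 1 2 pt in auto)
    case (3 V3)
    show ?case
     by (rule ev_EQVE[OF M(1,2)]) (use v 1 2 3 pt b in auto)
   qed
  qed (use b0 sab in auto)
  have "sa vl <= 2 * J + 4" using sm by simp
  then have "(2::nat) ^ sa vl <= 2 ^ (2 * J + 4)" by (rule power_increasing) simp
  also have "... = 16 * t * t" by (simp add: t_def power_add power_mult power2_eq_square mult.commute flip: power_mult_distrib)
  finally have "1 * 2 ^ sa vl <= 16 * t * t" by simp
  then have "(1 * 2 ^ sa vl) * (((1 + tDEP + 1) + tE + 1) + 8) <= (16 * t * t) * (tDEP + tE + 40)" by (rule mult_le_mono) simp
  then show "(1 + tOFF + 1) + (1 * 2 ^ sa vl) * (((1 + tDEP + 1) + tE + 1) + 8) + 4 <= tSM + tOFF" unfolding tSM_def by linarith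
 qed simp
 let ?c = "%r s. M (cell2 ?H Y vl vz r (wlk ?H M Y vl vz r (s + 1) (t - (s + 1)) YC))"
 let ?g = "%r s. if 0 < ?c r s then (of_bool (kf Y vz (wlk ?H M Y vl vz r 0 (s + 1) (?c r s * U + vz)) = kf Y vz YC) :: nat) else 0"
 let ?vB = "of_bool (EX r<R2. 0 < (of_bool (EX s<t. 0 < ?g r s) :: nat)) :: nat"
 let ?T3 = "((1 + 2 + 1) + 1 + 1) + (1 + (tW + tE + 1) + 1) + 1"
 let ?T2 = "(1 + 1 + 1) + ((2 + 1 + 1) + (tW + (((tH + 60) + 1) + (1 + (?T3 + 1) + 1) + 1) + 1) + 1) + 1"
 have big_case: "evals b inp M (EXE (HD 8) (%r. EXE (HD 5) (CHKE k d lam zc K r))) (Suc K) V1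
   ?vB tBIG"
  if bg: "~ sa vl < 2 * J + 4" and 1: "!!x. x < K ==> V1 x = V x" "V1 K = YC" for V1
 proof (rule evals_weaken[where v = "of_bool (EX r<R2. 0 < (of_bool (EX s<t. 0 < ?g r s) :: nat))" and T = "2 + R2 * ((2 + t * (?T2 + 8) + 4) + 8) + 4"], goal_cases a)
  have P2: "0 < P2" using P2_pos[of vl] bg by simp
  have R2': "R2 < 2 ^ b" using R2b t_pos by (simp add: distrib_left)
  case a show ?case
  proof (intro ev_EXE)
   fix r V2 s V3
   assume "r < R2" and 2: "!!x. x < Suc K ==> V2 x = V1 x" "V2 (Suc (Suc (Suc K))) = r"
    and "s < t" and 3: "!!x. x < Suc K + 3 ==> V3 x = V2 x" "V3 (Suc (Suc (Suc K + 3))) = s"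
   note rs = \<open>r < R2\<close> \<open>s < t\<close>
   let ?K = "Suc K + 3 + 3" let ?r = "Suc (Suc (Suc K))" let ?s = "Suc (Suc (Suc K + 3))"
   let ?e = "wlk ?H M Y vl vz r (s + 1) (t - (s + 1)) YC"
   have tab: "?c r s <= 4 * U" using M(4) unfolding tabs_ok_def cell2_def using addr by simp
   have st: "?c r s * U + vz < 2 ^ b" "?c r s * U < 2 ^ b" using start_code[OF tab b(3)] YC_less by linarith+
   have eok: "okc Y inp ?e" by (rule wlk_okc[OF b(1,3)])
   have sok: "okc Y inp (?c r s * U + vz)" by (rule okc_start[OF tab b(3)])
   have uok: "okc Y inp (wlk ?H M Y vl vz r 0 (s + 1) (?c r s * U + vz))" by (rule wlk_okc[OF sok b(3)])
   show "evals b inp M (CHKE k d lam zc K ?r ?s) ?K V3 (?g r s) ?T2"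
    unfolding CHKE_def
   proof (rule ev_LET[where ?v1.0 = "s + 1"], goal_cases a 4)
    case a show ?case
     by (intro ev_ADD ev_VAR evals_CST) (use 3 rs t_less in "auto intro: small")
    case (4 V4)
    show ?case
    proof (rule ev_LET[where ?v1.0 = "t - (s + 1)"], goal_cases a 5)
     case a show ?case
      by (intro ev_SUBT ev_VAR ev_HD) (use M 4 rs t_less in "auto simp: hdrD intro: small")
     case (5 V5)
     show ?case
     proof (rule ev_LET[where ?v1.0 = "?e"], goal_cases a 6)
      case a show ?case
       by (rule ev_WALKE[OF M]) (use v 1 2 3 4 5 b rs in auto)
      case (6 V6)
      show ?case
      proof (rule ev_LET[where ?v1.0 = "?c r s"], goal_cases a 7)
       case a show ?case
        by (rule evals_MEM[OF ev_CELL2E[OF M(1-3)] refl]) (use v 1 2 3 4 5 6 b rs eok P2 in auto)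
       case (7 V7)
       let ?K7 = "Suc (Suc (Suc ?K))"
       have "evals b inp M (LET (ADD (MUL (VAR ?K7) (HD 14)) (VAR zc)) (%st. LET (CST 0) (%z0. LET (WALKE k d lam zc ?r z0 ?K st) (%u. EQVE k d zc u K)))) (Suc ?K7) V7
         (of_bool (kf Y vz (wlk ?H M Y vl vz r 0 (s + 1) (?c r s * U + vz)) = kf Y vz YC)) ?T3"
       proof (rule ev_LET[where ?v1.0 = "?c r s * U + vz"], goal_cases a 8)
        case a show ?case
         by (intro ev_ADD ev_MUL ev_VAR ev_HD) (use M v 1 2 3 4 5 6 7 st in "auto simp: hdrD intro: small")
        case (8 V8)
        show ?case
        proof (rule ev_LET[where ?v1.0 = "0"], goal_cases a 9)
         case a show ?case by (rule evals_CST) simp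
         case (9 V9)
         show ?case
         proof (rule ev_LET[where ?v1.0 = "wlk ?H M Y vl vz r 0 (s + 1) (?c r s * U + vz)"], goal_cases a 10)
          case a show ?case
           by (rule ev_WALKE[OF M]) (use v 1 2 3 4 5 6 7 8 9 b rs sok in auto)
          case (10 V10)
          show ?case
           by (rule ev_EQVE[OF M(1,2)]) (use v 1 2 3 4 5 6 7 8 9 10 b uok in auto)
         qed
        qed
       qed
       then show ?case
        by (intro ev_IFE ev_VAR evals_CST) (use 7 in auto)
      qed
     qed
    qed
   qed
  qed (use M b0 t_less R2' in "auto simp: hdrD intro!: ev_HD intro: small")
  have "R2 * ((2 + t * (?T2 + 8) + 4) + 8) <= R2 * (t * (2 * tW + tH + tE + 200) + 40)"
   by (intro mult_le_mono2) (simp add: algebra_simps)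
  then show "2 + R2 * ((2 + t * (?T2 + 8) + 4) + 8) + 4 <= tBIG" unfolding tBIG_def by linarith
 qed simp
 have "evals b inp M (BOXE k d lam zc) K V
   (if 0 < (of_bool (sa vl < 2 * J + 4) :: nat) then ?vS else if 0 < (of_bool (hv ?H M Y vl vz YC) :: nat) then 1 else ?vB)
   (2 + ((tOFF + ((1 + 2 + 1) + 1 + 1) + 1) + ((tSM + tOFF) + (tHV + (1 + tBIG) + 1)) + 1) + 1)"
  unfolding BOXE_def
 proof (rule ev_LET[where ?v1.0 = "YC"], goal_cases a 1)
  case a show ?case by (rule ev_HD) (use M in "auto simp: hdrD intro: small")
  case (1 V1)
  show ?case
  proof (rule ev_IFE, goal_cases a b c)
   case a show ?case
    by (intro ev_LTE ev_SAE ev_ADD ev_MUL ev_HD evals_CST) (use M v 1 b0 J in "auto simp: hdrD intro: small")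
  next
   case b then show ?case by (intro small_case 1) simp
  next
   case c then show ?case
    by (intro ev_IFE ev_HVE[OF M] evals_CST big_case) (use v 1 b small in auto)
  qed
 qed
 moreover have *: "(EX r<R2. 0 < (of_bool (EX s<t. 0 < ?g r s) :: nat)) \<longleftrightarrow> (EX r<R2. EX s<t. 0 < ?c r s & kf Y vz (wlk ?H M Y vl vz r 0 (s + 1) (?c r s * U + vz)) = kf Y vz YC)"
  by (auto split: if_splits)
 ultimately show ?thesis unfolding * by (elim evals_weaken) (simp_all add: qbox_def Let_def tBOX_def)
qed

definition
 "qry H M Y l r \<longleftrightarrow> (EX lam<NL. EX side<2 ^ k. (ALL i<k. ~ bad l r lam side i) & qbox H M Y lam (pack k L (corn l r lam side)))"

lemma ev_QRYE:
 assumes M: "hdr M" "dat M" "seeded sd M" "tabs_ok M" "lin 0 l inp" "lin 1 r inp"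
  and Y: "take_bit b (nth_default 0 inp (2 * k * len)) = sgn'" "take_bit b (nth_default 0 inp (2 * k * len + (1 + 2 * lim))) = en"
   "sgn' = 0 ==> en = 0 ==> okc Y inp YC"
 shows "evals b inp M (QRYE k d) K V (of_bool (sgn' = 0 & en = 0 & qry (hash_of sd) M Y l r)) tQ"
proof -
 let ?H = "hash_of sd"
 have k2b: "2 * k < 2 ^ b" "2 ^ k < (2::nat) ^ b" using kLb less_exp[of b] by (linarith, intro power_strict_increasing) auto
 have ib: "2 * k * len < 2 ^ b" "2 * k * len + (1 + 2 * lim) < 2 ^ b" using limb by linarith+
 let ?g = "%lam side. if 0 < (of_bool (EX i<k. 0 < (of_bool (bad l r lam side i) :: nat)) :: nat) then (0::nat) else
   of_bool (qbox ?H M Y lam (pack k L (corn l r lam side)))"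
 let ?Ti = "((1 + k * (tBAD + 8) + 4) + (1 + ((1 + k * ((tCORN + 4 + 1) + 7) + 4) + tBOX + 1)) + 1)"
 have inner: "evals b inp M (EXE (LET (CST k) (POWE L1E)) (%lam. EXE (CST (2 ^ k)) (SIDEE k d lam))) K V
   (of_bool (EX lam<NL. 0 < (of_bool (EX side<2 ^ k. 0 < ?g lam side) :: nat)))
   ((1 + (k * (4 + 7) + 5) + 1) + NL * ((1 + 2 ^ k * (?Ti + 8) + 4) + 8) + 4)" if ok: "okc Y inp YC" for K V
 proof (intro ev_EXE)
  show "evals b inp M (LET (CST k) (POWE L1E)) (Suc K) V' NL (1 + (k * (4 + 7) + 5) + 1)" for V'
   unfolding NL_def
   by (intro ev_LET evals_CST ev_POWE ev_L1E) (use M k_less SucL_pow[of k] b0 in "auto intro: evals_CST")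
  fix lam V2 side V3
  assume lam: "lam < NL" and 2: "!!x. x < K ==> V2 x = V x" "V2 (Suc (Suc K)) = lam"
   and side: "side < 2 ^ k" and 3: "!!x. x < K + 3 ==> V3 x = V2 x" "V3 (Suc (Suc (K + 3))) = side"
  let ?l = "Suc (Suc K)" let ?s = "Suc (Suc (K + 3))" let ?K = "K + 3 + 3"
  show "evals b inp M (SIDEE k d ?l ?s) ?K V3 (?g lam side) ?Ti"
   unfolding SIDEE_def
  proof (rule ev_IFE, goal_cases a b c)
   case a show ?case
    by (intro ev_EXE evals_CST ev_BADE[OF M(1,2,5,6)]) (use 2 3 b0 k_less in auto)
  next
   case b show ?case by (rule evals_CST) simp
  next
   case c
   then have nb: "~ bad l r lam side i" if "i < k" for i using that by auto
   \<comment> \<open>Corners are known to fit into their fields only for blocks inside the interval,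
     which is why the test precedes the packing.\<close>
   have cl: "corn l r lam side i < 2 ^ L" if "i < k" for i
   proof -
    have "0 < (2::nat) ^ lev lam i" by simp
    then show ?thesis using nb[OF that] lo_hi_le(2)[of r i] nL unfolding bad_def by linarith
   qed
   have pl: "pack k L (corn l r lam side) < U" unfolding U_def by (rule pack_less) (rule cl)
   show ?case
   proof (rule ev_LET[where ?v1.0 = "pack k L (corn l r lam side)"], goal_cases a 4)
    case a show ?case
     unfolding pack_def
    proof (intro ev_SUME ev_SHLE evals_CST ev_CORNE[OF M(1,2,5,6)] ev_iL[OF M(1)])
     show "(\<Sum>i<k. corn l r lam side i * 2 ^ (i * L)) < 2 ^ b" using pl U_less unfolding pack_def by linarith
     fix i assume "i < k"
     then show "corn l r lam side i * 2 ^ (i * L) < 2 ^ b" using pack_term[of "corn l r lam side" i] cl by blast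
    qed (use 2 3 b0 k_less in auto)
    case (4 V4)
    show ?case
     by (rule ev_BOXE[OF M(1-4)]) (use 2 3 4 ok lam pl in auto)
   qed
  qed
 qed (use b0 NLb k2b in "auto intro!: evals_CST simp del: power_strict_increasing_iff")
 have "evals b inp M (QRYE k d) K V (if 0 < sgn' then 0 else if 0 < en then 0 else of_bool (EX lam<NL. 0 < (of_bool (EX side<2 ^ k. 0 < ?g lam side) :: nat)))
   (((1 + 2 + 1) + 1) + (1 + ((((1 + 2 + 1) + (1 + (1 + 2 + 1) + 1) + 1) + 1) + (1 + ((1 + (k * (4 + 7) + 5) + 1) + NL * ((1 + 2 ^ k * (?Ti + 8) + 4) + 8) + 4)) + 1)) + 1)"
  unfolding QRYE_def
 proof (intro ev_IFE)
  show "evals b inp M (INP (MUL (CST (2 * k)) (HD 2))) K V sgn' ((1 + 2 + 1) + 1)"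
   by (intro evals_INP[OF _ Y(1)] ev_MUL evals_CST ev_HD) (use M k2b ib in "auto simp: hdrD intro: small")
  show "evals b inp M (INP (ADD (MUL (CST (2 * k)) (HD 2)) (ADD (CST 1) (MUL (CST 2) (HD 9))))) K V en (((1 + 2 + 1) + (1 + (1 + 2 + 1) + 1) + 1) + 1)"
   by (intro evals_INP[OF _ Y(2)] ev_ADD ev_MUL evals_CST ev_HD) (use M k2b ib in "auto simp: hdrD intro: small")
  show "evals b inp M (CST 0) K V 0 1" "evals b inp M (CST 0) K V 0 1" by (rule evals_CST, simp)+
 qed (rule inner, use Y(3) in simp)
 then show ?thesis
 proof (rule evals_weaken)
  have *: "(EX lam<NL. 0 < (of_bool (EX side<2 ^ k. 0 < ?g lam side) :: nat)) = qry ?H M Y l r"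
   unfolding qry_def by auto
  show "(if 0 < sgn' then 0 else if 0 < en then 0 else of_bool (EX lam<NL. 0 < (of_bool (EX side<2 ^ k. 0 < ?g lam side) :: nat))) =
    of_bool (sgn' = 0 & en = 0 & qry ?H M Y l r)" unfolding * by auto
  have "2 ^ k * (?Ti + 8) <= 2 ^ k * (k * (tBAD + tCORN + 40) + tBOX + 60)" by (intro mult_le_mono2) (simp add: algebra_simps)
  then have "(1 + 2 ^ k * (?Ti + 8) + 4) + 8 <= 2 ^ k * (k * (tBAD + tCORN + 40) + tBOX + 60) + 60" by linarith
  then have "NL * ((1 + 2 ^ k * (?Ti + 8) + 4) + 8) <= NL * (2 ^ k * (k * (tBAD + tCORN + 40) + tBOX + 60) + 60)" by (rule mult_le_mono2)
  moreover have "x <= y ==> ((1 + 2 + 1) + 1) + (1 + ((((1 + 2 + 1) + (1 + (1 + 2 + 1) + 1) + 1) + 1) + (1 + ((1 + (k * (4 + 7) + 5) + 1) + x + 4)) + 1)) + 1 <= y + 11 * k + 60" for x y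
   by simp
  ultimately show "((1 + 2 + 1) + 1) + (1 + ((((1 + 2 + 1) + (1 + (1 + 2 + 1) + 1) + 1) + 1) + (1 + ((1 + (k * (4 + 7) + 5) + 1) + NL * ((1 + 2 ^ k * (?Ti + 8) + 4) + 8) + 4)) + 1)) + 1 <= tQ"
   unfolding tQ_def by blast
 qed
qed

end

section \<open>The preprocessing program\<close>

text \<open>A value of the polynomial is at most \<open>2 ^ (Suc d * w + Suc d * k)\<close>:
  \<open>Suc d\<close> numbers of \<open>len\<close> words, one word for each of the further
  \<open>Suc d * k\<close> bits, and one word to make the bound strict.\<close>

definition
 "LIME k d = ADD (MUL (CST (Suc d)) (HD 2)) (CST (Suc d * k + 1))"
text \<open>Input word 3 is the ceiling of n^\<alpha>. The number of \<open>i\<close> with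
  \<open>8 ^ i\<close> below it is the least \<open>J\<close> with \<open>8 ^ J\<close> not below
  it, so \<open>t = 2 ^ J\<close> is its cube root up to a constant factor, obtained in integer
  arithmetic.\<close>

definition JE :: prog where
 "JE = SUME (HD 3) (%i. LTE (SHLE (CST 1) (MUL (CST 3) (VAR i))) (INP (CST 3)))"
definition
 "P1E k = SHLE (CST 1) (SUBT (ADD (MUL (CST k) (HD 3)) (CST 4)) (HD 6))"

text \<open>Each entry uses only the input and header cells with smaller addresses. \<open>L\<close>
  is recovered from the word size as \<open>b div ka\<close>, so no logarithm has to be
  computed.\<close>

definition
 "HDRE ka C1 C2 k d j = [
   INP (CST 0),
   INP (CST 1),
   DIVE (SUBT (ADD (INP (CST 2)) (HD 0)) (CST 1)) (HD 0),
   DIVE (HD 0) (CST ka),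
   ADD (MUL (HD 0) (LIME k d)) (CST 2),
   SHLE (CST 1) JE,
   JE,
   MUL (CST C1) (HD 3),
   MUL (MUL (CST C2) (HD 5)) (HD 3),
   LIME k d,
   ADD (CST 32) (MUL (MUL (CST k) (SHLE (CST 1) (HD 3))) (HD 2)),
   ADD (HD 10) (MUL (CST (Suc d ^ k)) (HD 2)),
   ADD (HD 11) (MUL (ADD (MUL (CST 2) (HD 7)) (MUL (HD 8) (ADD (HD 5) (CST 1)))) (MUL (ADD (HD 0) (HD 4)) (HD 4))),
   ADD (HD 12) (MUL (MUL (LET (CST k) (POWE L1E)) (HD 7)) (P1E k)),
   SHLE (CST 1) (MUL (CST k) (HD 3)),
   P1E k,
   DIVE (HD 14) (SHLE (CST 1) (ADD (MUL (CST 2) (HD 6)) (CST 1))),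
   MUL (ADD (HD 0) (HD 4)) (HD 4),
   ADD (HD 0) (HD 4),
   BIN Sub (CST 0) (CST 1)] ! j"

lemma HDRE_vals:
 "HDRE ka C1 C2 k d 0 = INP (CST 0)"
 "HDRE ka C1 C2 k d 1 = INP (CST 1)"
 "HDRE ka C1 C2 k d 2 = DIVE (SUBT (ADD (INP (CST 2)) (HD 0)) (CST 1)) (HD 0)"
 "HDRE ka C1 C2 k d 3 = DIVE (HD 0) (CST ka)"
 "HDRE ka C1 C2 k d 4 = ADD (MUL (HD 0) (LIME k d)) (CST 2)"
 "HDRE ka C1 C2 k d 5 = SHLE (CST 1) JE"
 "HDRE ka C1 C2 k d 6 = JE"
 "HDRE ka C1 C2 k d 7 = MUL (CST C1) (HD 3)"
 "HDRE ka C1 C2 k d 8 = MUL (MUL (CST C2) (HD 5)) (HD 3)"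
 "HDRE ka C1 C2 k d 9 = LIME k d"
 "HDRE ka C1 C2 k d 10 = ADD (CST 32) (MUL (MUL (CST k) (SHLE (CST 1) (HD 3))) (HD 2))"
 "HDRE ka C1 C2 k d 11 = ADD (HD 10) (MUL (CST (Suc d ^ k)) (HD 2))"
 "HDRE ka C1 C2 k d 12 = ADD (HD 11) (MUL (ADD (MUL (CST 2) (HD 7)) (MUL (HD 8) (ADD (HD 5) (CST 1)))) (MUL (ADD (HD 0) (HD 4)) (HD 4)))"
 "HDRE ka C1 C2 k d 13 = ADD (HD 12) (MUL (MUL (LET (CST k) (POWE L1E)) (HD 7)) (P1E k))"
 "HDRE ka C1 C2 k d 14 = SHLE (CST 1) (MUL (CST k) (HD 3))"
 "HDRE ka C1 C2 k d 15 = P1E k"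
 "HDRE ka C1 C2 k d 16 = DIVE (HD 14) (SHLE (CST 1) (ADD (MUL (CST 2) (HD 6)) (CST 1)))"
 "HDRE ka C1 C2 k d 17 = MUL (ADD (HD 0) (HD 4)) (HD 4)"
 "HDRE ka C1 C2 k d 18 = ADD (HD 0) (HD 4)"
 "HDRE ka C1 C2 k d 19 = BIN Sub (CST 0) (CST 1)"
 by (simp_all add: HDRE_def nth_Cons')

fun HDRC :: "nat => nat => nat => nat => nat => nat => prog" where
 "HDRC ka C1 C2 k d 0 = (%K. Const K 0)"
| "HDRC ka C1 C2 k d (Suc j) = HDRC ka C1 C2 k d j ;; STO (CST j) (HDRE ka C1 C2 k d j)"

definition
 "AIN i j e = INP (ADD (CST 4) (ADD (MUL (ADD (MUL (VAR i) (HD 1)) (VAR j)) (HD 2)) (VAR e)))"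

definition
 "RANKE i j = SUME (HD 1) (%j'. LESSE (HD 2) (AIN i j') (AIN i j))"

text \<open>Ranks are found by counting smaller elements. This takes of order n^2 comparisons, which
  the time bound n^k allows because k is at least 2.\<close>

definition
 "SORTC k = FOR (CST k) (%i. FOR (HD 1) (%j. CLET (RANKE i j) (%p. FOR (HD 2) (%e.
   STO (ADD (CST 32) (ADD (MUL (ADD (MUL (VAR i) (SHLE (CST 1) (HD 3))) (VAR p)) (HD 2)) (VAR e))) (AIN i j e)))))"

definition
 "COEFC k d = FOR (MUL (CST (Suc d ^ k)) (HD 2)) (%x. STO (ADD (HD 10) (VAR x))
   (INP (ADD (CST 4) (ADD (MUL (MUL (CST k) (HD 1)) (HD 2)) (VAR x)))))"

definition SEEDC :: prog where
 "SEEDC = FOR (SUBT (HD 12) (HD 11)) (%x. RND (ADD (HD 11) (VAR x)))"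

text \<open>Boxes small enough for direct search get no tables, so the loop passes over their
  shapes.\<close>

definition
 "LEVELSC k body = FOR (LET (CST k) (POWE L1E)) (%lam. CIF (EQE (LTE (SAE k lam) (ADD (MUL (CST 2) (HD 6)) (CST 4))) (CST 0))
   (FOR (SHLE (CST 1) (SUBT (MUL (CST k) (HD 3)) (SAE k lam))) (%mu. CLET (CRNE k lam mu) (%zc. body lam zc))))"

definition
 "START zc c = ADD (MUL (ADD (VAR c) (CST 1)) (HD 14)) (VAR zc)"

definition
 "CELL1E k d lam zc r c = LET (START zc c) (%st. LET (MUL (MUL (CST 2) (VAR r)) (HD 17)) (%sg0. LET (PTE k d lam zc sg0 st) (%z.
   LET (MUL (ADD (MUL (CST 2) (VAR r)) (CST 1)) (HD 17)) (%sg.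
    ADD (HD 12) (ADD (MUL (ADD (MUL (VAR lam) (HD 7)) (VAR r)) (HD 15)) (MODE (HASHE k d sg zc z) (HD 15)))))))"

definition
 "LAYERC j ce cell = FOR (HD j) (%r. FOR (SHLE (CST 1) ce) (%c. STO (cell r c) (ADD (VAR c) (CST 1))))"

definition
 "T1C k d = LEVELSC k (%lam zc. LAYERC 7 (SUBT (ADD (SAE k lam) (CST 2)) (HD 6)) (CELL1E k d lam zc))"

definition
 "T2C k d = LEVELSC k (%lam zc. LAYERC 8 (SUBT (SAE k lam) (ADD (MUL (CST 2) (HD 6)) (CST 4))) (%r c.
   LET (START zc c) (%st. LET (CST 0) (%z0. LET (HD 5) (%m. LET (WALKE k d lam zc r z0 m st) (%e. CELL2E k d lam zc r e))))))"

definition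
 "BUILDC ka C1 C2 k d = HDRC ka C1 C2 k d 20 ;; SORTC k ;; COEFC k d ;; SEEDC ;; T1C k d ;; T2C k d"

lemma upds_concat_inv:
 assumes "S M" "!!i M. i < n ==> S M ==> S (upds (ws i) M)"
 shows "i <= n ==> S (upds (concat (map ws [0..<i])) M)"
 by (induction i) (auto simp: upds_append assms)

text \<open>The lists of writes are fixed beforehand; the invariant \<open>S\<close> expresses that
  the cells read by an iteration are not disturbed by earlier ones.\<close>

lemma runs_FOR_stat:
 assumes b: "0 < b" and n: "n < 2 ^ b" and 0: "evals b inp M en K V n T0" and S: "S M"
  and 1: "!!i V' M. i < n ==> S M ==> (!!x. x < K ==> V' x = V x) ==> V' (Suc K) = i ==>
   runs b inp (f (Suc K)) (Suc (Suc K)) V' M us (upds (ws i) M) us Tb"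
  and 2: "!!i M. i < n ==> S M ==> S (upds (ws i) M)"
 shows "runs b inp (FOR en f) K V M us (upds (concat (map ws [0..<n])) M) us (T0 + n * (Tb + 4) + 3)"
proof -
 let ?M = "%i. upds (concat (map ws [0..<i])) M"
 have "runs b inp (FOR en f) K V (?M 0) us (?M n) us (T0 + n * (Tb + 4) + 3)"
 proof (rule runs_FOR[where Mf = ?M and uf = "%_. us", OF b n])
  fix i V' assume i: "i < n" and h: "!!x. x < K ==> V' x = V x" "V' (Suc K) = i"
  have "S (?M i)" using upds_concat_inv[where S = S and n = n and i = i, OF S 2] i by simp
  from 1[OF i this h] show "runs b inp (f (K + 1)) (K + 2) V' (?M i) us (?M (Suc i)) us Tb" by (simp add: upds_append flip: Suc_eq_plus1)
 qed (use 0 in simp)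
 then show ?thesis by simp
qed

text \<open>Ties the parameters to the words of the input. \<open>av\<close> lists the elements in
  input order, \<open>nm\<close> in sorted order, and the last assumptions say that counting smaller
  elements translates between them.\<close>

locale inst_build = inst_ok +
 fixes ka C1 C2 w \<tau> :: nat and inp :: "nat list" and av :: "nat => nat => nat"
 assumes len_eq: "len = (w + b - 1) div b" and L_eq: "L = b div ka" and lim_eq: "lim = Suc d * len + (Suc d * k + 1)"
  and Q_eq: "Q = b * lim + 2" and J_eq: "J = (\<Sum>i<L. of_bool (2 ^ (3 * i) < \<tau>))" and R1_eq: "R1 = C1 * L" and R2_eq: "R2 = C2 * t * L"
  and wb: "w + b < 2 ^ b" and kab: "ka < 2 ^ b" and C1b: "C1 < 2 ^ b" and C2b: "C2 * t < 2 ^ b" "C2 < 2 ^ b" and limcb: "Suc d * k + 1 < 2 ^ b"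
  and inp0: "take_bit b (nth_default 0 inp 0) = b" "take_bit b (nth_default 0 inp 1) = n"
   "take_bit b (nth_default 0 inp 2) = w" "take_bit b (nth_default 0 inp 3) = \<tau>"
  and inpA: "i < k ==> j < n ==> e < len ==> take_bit b (nth_default 0 inp (4 + ((i * n + j) * len + e))) = av i j div 2 ^ (b * e) mod 2 ^ b"
  and inpC: "idx < Suc d ^ k ==> e < len ==> take_bit b (nth_default 0 inp (4 + (k * n * len + (idx * len + e)))) = cf idx div 2 ^ (b * e) mod 2 ^ b"
  and av_less: "av i j < 2 ^ (b * len)"
  and nm_rank: "i < k ==> j < n ==> nm i (\<Sum>j'<n. of_bool (av i j' < av i j)) = av i j"
  and nm_ge: "n <= p ==> nm i p = 0"
  and rank_surj: "i < k ==> p < n ==> EX j<n. (\<Sum>j'<n. of_bool (av i j' < av i j)) = p"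
begin

definition hd_vec :: "nat => nat" where
 "hd_vec j = [b, n, len, L, Q, t, J, R1, R2, lim, CB, SB, A1, A2, U, P1, P2, SL, NP, YC] ! j"

definition hm :: "nat => nat => nat" where "hm j a = (if a < j then hd_vec a else 0)"

lemma hm_simps: "a < j ==> hm j a = hd_vec a"
 by (simp add: hm_def)

lemma hm_hdr: "20 <= j ==> hdr (hm j)"
 by (simp add: hdr_def hm_def hd_vec_def nth_Cons')

lemma hm_Suc: "upds [(j, hd_vec j)] (hm j) = hm (Suc j)"
 by (auto simp: hm_def fun_eq_iff less_Suc_eq)

lemma L3: "3 * L + 2 < b"
proof -
 have "2 * L <= k * L" using k2 by (rule mult_le_mono1)
 then show ?thesis using kLb by linarith
qed

lemma ev_JE: "3 < j ==> evals b inp (hm j) JE K V J (L * 20 + 10)"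
 unfolding JE_def
proof (rule evals_weaken)
 assume j: "3 < j"
 have "(2::nat) ^ (3 * i) < 2 ^ b" if "i < L" for i using L3 that by (intro power_strict_increasing) auto
 moreover have "3 * i < 2 ^ b" if "i < L" for i using L3 that less_exp[of b] by linarith
 moreover have "L < 2 ^ b" using L3 less_exp[of b] by linarith
 moreover have "(\<Sum>i<L. of_bool (1 * 2 ^ (3 * i) < \<tau>)) <= (\<Sum>i<L. 1 :: nat)" by (rule sum_mono) simp
 ultimately show "evals b inp (hm j) (SUME (HD 3) (%i. LTE (SHLE (CST 1) (MUL (CST 3) (VAR i))) (INP (CST 3)))) K V
   (\<Sum>i<L. of_bool (1 * 2 ^ (3 * i) < \<tau>)) (2 + L * (((1 + (1 + 1 + 1) + 1) + (1 + 1) + 1) + 7) + 4)"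
  by (intro ev_SUME ev_LTE ev_SHLE ev_MUL evals_INP[OF evals_CST] evals_CST ev_VAR ev_HD)
   (use j b0 in "auto simp: hm_def hd_vec_def inp0 simp del: power_strict_increasing_iff intro: small")
qed (simp_all add: J_eq)

lemma ev_LIME: "2 < j ==> evals b inp (hm j) (LIME k d) K V lim 6"
 unfolding LIME_def
proof (rule evals_weaken)
 assume j: "2 < j"
 have "Suc d * len + (Suc d * k + 1) < 2 ^ b" using len_less(2) lim_eq by simp
 moreover have "Suc d < 2 ^ b" using db power_increasing[of 1 k "Suc d"] k2 by simp
 ultimately have "Suc d * len + (Suc d * k + 1) < 2 ^ b" "Suc d * len < 2 ^ b" "Suc d < 2 ^ b" by linarith+
 then show "evals b inp (hm j) (ADD (MUL (CST (Suc d)) (HD 2)) (CST (Suc d * k + 1))) K V (Suc d * len + (Suc d * k + 1)) ((1 + 2 + 1) + 1 + 1)"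
  by (intro ev_ADD ev_MUL evals_CST ev_HD) (use j limcb in "auto simp: hm_def hd_vec_def intro: small")
qed (simp_all add: lim_eq)

lemma hd_vals: "hd_vec 0 = b" "hd_vec 1 = n" "hd_vec 2 = len" "hd_vec 3 = L" "hd_vec 4 = Q" "hd_vec 5 = t" "hd_vec 6 = J" "hd_vec 7 = R1"
 "hd_vec 8 = R2" "hd_vec 9 = lim" "hd_vec 10 = CB" "hd_vec 11 = SB" "hd_vec 12 = A1" "hd_vec 13 = A2" "hd_vec 14 = U" "hd_vec 15 = P1" "hd_vec 16 = P2"
 "hd_vec 17 = SL" "hd_vec 18 = NP" "hd_vec 19 = YC"
 by (simp_all add: hd_vec_def nth_Cons')

lemma P1_less: "P1 < 2 ^ b" "k * L + 4 < 2 ^ b" "J <= k * L + 4"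
proof -
 have "k * L + 4 - J < b" using kLb by linarith
 then show "P1 < 2 ^ b" unfolding P1_def by (intro power_strict_increasing) auto
 show "k * L + 4 < 2 ^ b" using kLb less_exp[of b] by linarith
 have "1 * L <= k * L" using k2 by (intro mult_le_mono1) simp
 then show "J <= k * L + 4" using JL by linarith
qed

lemma ev_P1E: "6 < j ==> evals b inp (hm j) (P1E k) K V P1 14"
 unfolding P1E_def
proof (rule evals_weaken[where v = "1 * 2 ^ (k * L + 4 - J)" and T = "1 + (((1 + 2 + 1) + 1 + 1) + 2 + 1) + 1"], goal_cases a)
 assume j: "6 < j"
 case a show ?case
  by (intro ev_SHLE ev_SUBT ev_ADD ev_MUL evals_CST ev_HD)
   (use j P1_less k_less kL_less[of "k * L"] in "auto simp: hm_simps hd_vals P1_def simp del: power_strict_increasing_iff intro: small")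
qed (simp_all add: P1_def)

lemma ev_NLE: "3 < j ==> evals b inp (hm j) (LET (CST k) (POWE L1E)) K V NL (11 * k + 7)"
 unfolding NL_def
proof (rule evals_weaken[where v = "Suc L ^ k" and T = "1 + (k * (4 + 7) + 5) + 1"], goal_cases a)
 assume j: "3 < j"
 have L1: "evals b inp (hm j) L1E K' V' (Suc L) 4" for K' V'
  unfolding L1E_def
 proof (rule evals_weaken[where v = "L + 1" and T = "2 + 1 + 1"], goal_cases a)
  case a show ?case
  proof (intro ev_ADD ev_HD evals_CST)
   show "L + 1 < 2 ^ b" using L3 less_exp[of b] by linarith
  qed (use j in "auto simp: hm_simps hd_vals intro!: small")
 qed simp_all
 case a show ?case
 proof (rule ev_LET)
  show "evals b inp (hm j) (CST k) K V k 1" by (rule evals_CST) (rule k_less)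
  fix V1 assume "V1 K = k"
  then show "evals b inp (hm j) (POWE L1E K) (Suc K) V1 (Suc L ^ k) (k * (4 + 7) + 5)"
   by (intro ev_POWE L1) (use k_less SucL_pow[of k] b0 in auto)
 qed
qed simp_all

lemma prods_less: "k * 2 ^ L * len < 2 ^ b" "k * 2 ^ L < 2 ^ b" "Suc d ^ k * len < 2 ^ b"
 "(2 * R1 + R2 * (t + 1)) * SL < 2 ^ b" "2 * R1 + R2 * (t + 1) < 2 ^ b" "NL * R1 * P1 < 2 ^ b" "NL * R1 < 2 ^ b" "b + Q < 2 ^ b" "2 * R1 < 2 ^ b"
proof -
 show "k * 2 ^ L * len < 2 ^ b" "Suc d ^ k * len < 2 ^ b" using addr addr_less by linarith+
 \<comment> \<open>\<open>L\<close> is positive because \<open>R1 = C1 * L\<close> is.\<close>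
 have kl: "k <= k * L"
 proof (cases "L = 0")
  case True
  then show ?thesis using R1p R1_eq by simp
 qed simp
 have "k * 2 ^ L < 2 ^ k * 2 ^ L" using less_exp[of k] by (intro mult_strict_right_mono) auto
 also have "... = 2 ^ (k + L)" by (simp add: power_add)
 also have "... <= (2::nat) ^ b"
 proof (rule power_increasing)
  have "1 * L <= k * L" using k2 by (intro mult_le_mono1) simp
  then show "k + L <= b" using kl kLb by linarith
 qed simp
 finally show "k * 2 ^ L < 2 ^ b" .
 show 1: "(2 * R1 + R2 * (t + 1)) * SL < 2 ^ b" using addr_less NS_def by simp
 have "(2 * R1 + R2 * (t + 1)) * 1 <= (2 * R1 + R2 * (t + 1)) * SL" using SL_pos by (intro mult_le_mono2) linarith
 from le_less_trans[OF this 1] show "2 * R1 + R2 * (t + 1) < 2 ^ b" by simp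
 then show "2 * R1 < 2 ^ b" by linarith
 show 2: "NL * R1 * P1 < 2 ^ b" using addr addr_less by linarith
 have "NL * R1 * 1 <= NL * R1 * P1" using P1_pos by (intro mult_le_mono2) linarith
 from le_less_trans[OF this 2] show "NL * R1 < 2 ^ b" by simp
 show "b + Q < 2 ^ b" using NP_less unfolding NP_def .
qed

lemma ev_HDRE: "j < 20 ==> evals b inp (hm j) (HDRE ka C1 C2 k d j) K V (hd_vec j) tHDR"
proof -
 note pl = prods_less P1_less addr_less
 have J2: "2 ^ (2 * J + 1) < (2::nat) ^ b" "2 * J + 1 < 2 ^ b"
  using JL L3 less_exp[of b] by (intro power_strict_increasing, linarith, simp, linarith)
 have R2a: "R2 < 2 ^ b" "R2 * (t + 1) < 2 ^ b" using R2b t_pos by (auto simp: distrib_left)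
 have R1a: "C1 * L < 2 ^ b" using R1b R1_eq by linarith
 have R2c: "C2 * t * L < 2 ^ b" using R2a R2_eq by simp
 have Qa: "b * lim + 2 < 2 ^ b" "b * lim < 2 ^ b" using Q_less Q_eq by linarith+
 have SLa: "(b + Q) * Q < 2 ^ b" using addr_less unfolding SL_def NP_def by simp
 assume "j < 20"
 then have "j = 0 \<or> j = 1 \<or> j = 2 \<or> j = 3 \<or> j = 4 \<or> j = 5 \<or> j = 6 \<or> j = 7 \<or> j = 8 \<or> j = 9 \<or> j = 10 \<or> j = 11 \<or> j = 12
  \<or> j = 13 \<or> j = 14 \<or> j = 15 \<or> j = 16 \<or> j = 17 \<or> j = 18 \<or> j = 19" by presburger
 then consider "j = 0" | "j = 1" | "j = 2" | "j = 3" | "j = 4" | "j = 5" | "j = 6" | "j = 7" | "j = 8" | "j = 9" | "j = 10" | "j = 11" | "j = 12"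
  | "j = 13" | "j = 14" | "j = 15" | "j = 16" | "j = 17" | "j = 18" | "j = 19" by blast
 then show ?thesis
 proof cases
  case 1 show ?thesis unfolding 1 HDRE_vals
   by (rule evals_weaken[OF evals_INP[OF evals_CST refl]]) (auto simp: hd_vals inp0 tHDR_def)
 next case 2 show ?thesis unfolding 2 HDRE_vals
   by (rule evals_weaken[OF evals_INP[OF evals_CST refl]]) (auto simp: hd_vals inp0 tHDR_def small)
 next case 3
  show ?thesis unfolding 3 HDRE_vals
  proof (rule evals_weaken[where v = "(w + b - 1) div b" and T = "(((1 + 1) + 2 + 1) + 1 + 1) + 2 + 1"], goal_cases a)
   case a show ?case
    by (intro ev_DIVE ev_SUBT ev_ADD evals_INP[OF evals_CST] ev_HD evals_CST) (use 3 wb b0 in "auto simp: inp0 hm_simps hd_vals intro: small")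
  qed (auto simp: hd_vals len_eq[symmetric] tHDR_def)
 next case 4
  show ?thesis unfolding 4 HDRE_vals
  proof (rule evals_weaken[where v = "b div ka" and T = "2 + 1 + 1"], goal_cases a)
   case a show ?case
    by (intro ev_DIVE ev_HD evals_CST) (use 4 kab in "auto simp: hm_simps hd_vals")
  qed (auto simp: hd_vals L_eq[symmetric] tHDR_def)
 next case 5
  show ?thesis unfolding 5 HDRE_vals
  proof (rule evals_weaken[where v = "b * lim + 2" and T = "(2 + 6 + 1) + 1 + 1"], goal_cases a)
   case a show ?case
    by (intro ev_ADD ev_MUL ev_LIME ev_HD evals_CST) (use 5 Qa in "auto simp: hm_simps hd_vals intro: small")
  qed (simp only: hd_vals Q_eq[symmetric], simp add: tHDR_def)
 next case 6
  show ?thesis unfolding 6 HDRE_vals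
  proof (rule evals_weaken[where v = "1 * 2 ^ J" and T = "1 + (L * 20 + 10) + 1"], goal_cases a)
   case a show ?case
    by (intro ev_SHLE ev_JE evals_CST) (use 6 t_less in "auto simp: t_def simp del: power_strict_increasing_iff intro: small")
  qed (auto simp: hd_vals t_def tHDR_def)
 next case 7
  show ?thesis unfolding 7 HDRE_vals by (rule evals_weaken[of _ _ _ _ _ _ J "L * 20 + 10"]) (auto simp: hd_vals tHDR_def intro: ev_JE)
 next case 8
  show ?thesis unfolding 8 HDRE_vals
  proof (rule evals_weaken[where v = "C1 * L" and T = "1 + 2 + 1"], goal_cases a)
   case a show ?case
    by (intro ev_MUL ev_HD evals_CST) (use 8 C1b R1a in "auto simp: hm_simps hd_vals intro: small")
  qed (auto simp: hd_vals R1_eq[symmetric] tHDR_def)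
 next case 9
  show ?thesis unfolding 9 HDRE_vals
  proof (rule evals_weaken[where v = "C2 * t * L" and T = "(1 + 2 + 1) + 2 + 1"], goal_cases a)
   case a show ?case
    by (intro ev_MUL ev_HD evals_CST) (use 9 C2b R2c in "auto simp: hm_simps hd_vals intro: small")
  qed (auto simp: hd_vals R2_eq[symmetric] tHDR_def)
 next case 10
  show ?thesis unfolding 10 HDRE_vals by (rule evals_weaken[of _ _ _ _ _ _ lim 6]) (auto simp: hd_vals tHDR_def intro: ev_LIME)
 next case 11
  show ?thesis unfolding 11 HDRE_vals
  proof (rule evals_weaken[where v = "32 + k * (1 * 2 ^ L) * len" and T = "1 + ((1 + (1 + 2 + 1) + 1) + 2 + 1) + 1"], goal_cases a)
   case a show ?case
    by (intro ev_ADD ev_MUL ev_SHLE ev_HD evals_CST) (use 11 pl k_less two_lev CB_def in "auto simp: hm_simps hd_vals intro: small")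
  qed (auto simp: hd_vals CB_def tHDR_def)
 next case 12
  show ?thesis unfolding 12 HDRE_vals
  proof (rule evals_weaken[where v = "CB + Suc d ^ k * len" and T = "2 + (1 + 2 + 1) + 1"], goal_cases a)
   case a show ?case
    by (intro ev_ADD ev_MUL ev_HD evals_CST) (use 12 pl db SB_def in "auto simp: hm_simps hd_vals intro: small")
  qed (auto simp: hd_vals SB_def tHDR_def)
 next case 13
  show ?thesis unfolding 13 HDRE_vals
  proof (rule evals_weaken[where v = "SB + (2 * R1 + R2 * (t + 1)) * ((b + Q) * Q)" and T = "2 + (((1 + 2 + 1) + (2 + (2 + 1 + 1) + 1) + 1) + ((2 + 2 + 1) + 2 + 1) + 1) + 1"], goal_cases a)
   case a show ?case
    by (intro ev_ADD ev_MUL ev_HD evals_CST)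
    (use 13 pl t_less R2a SLa A1_def[unfolded NS_def SL_def NP_def] in "auto simp: hm_simps hd_vals SL_def[unfolded NP_def] intro: small")
  qed (auto simp: hd_vals A1_def NS_def SL_def NP_def tHDR_def)
 next case 14
  show ?thesis unfolding 14 HDRE_vals
  proof (rule evals_weaken[where v = "A1 + NL * R1 * P1" and T = "2 + (((11 * k + 7) + 2 + 1) + 14 + 1) + 1"], goal_cases a)
   case a show ?case
    by (intro ev_ADD ev_MUL ev_HD ev_NLE ev_P1E) (use 14 pl A2_def in "auto simp: hm_simps hd_vals intro: small")
  qed (auto simp: hd_vals A2_def tHDR_def)
 next case 15
  show ?thesis unfolding 15 HDRE_vals
  proof (rule evals_weaken[where v = "1 * 2 ^ (k * L)" and T = "1 + (1 + 2 + 1) + 1"], goal_cases a)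
   case a show ?case
    by (intro ev_SHLE ev_MUL ev_HD evals_CST) (use 15 U_less k_less kL_less[of "k * L"] in "auto simp: hm_simps hd_vals U_def simp del: power_strict_increasing_iff intro: small")
  qed (auto simp: hd_vals U_def tHDR_def)
 next case 16
  show ?thesis unfolding 16 HDRE_vals by (rule evals_weaken[of _ _ _ _ _ _ P1 14]) (auto simp: hd_vals tHDR_def intro: ev_P1E)
 next case 17
  show ?thesis unfolding 17 HDRE_vals
  proof (rule evals_weaken[where v = "U div (1 * 2 ^ (2 * J + 1))" and T = "2 + (1 + ((1 + 2 + 1) + 1 + 1) + 1) + 1"], goal_cases a)
   case a show ?case
    by (intro ev_DIVE ev_SHLE ev_ADD ev_MUL ev_HD evals_CST) (use 17 J2 in "auto simp: hm_simps hd_vals simp del: power_strict_increasing_iff intro: small")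
  qed (auto simp: hd_vals P2_def tHDR_def)
 next case 18
  show ?thesis unfolding 18 HDRE_vals
  proof (rule evals_weaken[where v = "(b + Q) * Q" and T = "(2 + 2 + 1) + 2 + 1"], goal_cases a)
   case a show ?case
    by (intro ev_ADD ev_MUL ev_HD) (use 18 pl SLa in "auto simp: hm_simps hd_vals intro: small")
  qed (auto simp: hd_vals SL_def NP_def tHDR_def)
 next case 19
  show ?thesis unfolding 19 HDRE_vals
  proof (rule evals_weaken[where v = "b + Q" and T = "2 + 2 + 1"], goal_cases a)
   case a show ?case
    by (intro ev_ADD ev_HD) (use 19 pl in "auto simp: hm_simps hd_vals intro: small")
  qed (auto simp: hd_vals NP_def tHDR_def)
 next case 20
  have "evals b inp (hm j) (BIN Sub (CST 0) (CST 1)) K V (binop_val b Sub 0 1) (1 + 1 + 1)"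
   by (intro ev_BIN evals_CST) (auto intro: small)
  \<comment> \<open>Subtraction wraps around and yields the largest word.\<close>
  moreover have "binop_val b Sub 0 1 = YC" using take_bit_nat_eq_self[of "2 ^ b - 1" b] by (simp add: YC_def)
  ultimately show ?thesis unfolding 20 HDRE_vals by (elim evals_weaken) (auto simp: hd_vals tHDR_def)
 qed
qed

lemma runs_HDRC: "j <= 20 ==> runs b inp (HDRC ka C1 C2 k d j) K V (%_. 0) us (hm j) us (j * (tHDR + 5) + 5)"
proof (induction j)
 case 0
 have "runs b inp (%K. Const K 0) K V (%_. 0) us (hm 0) us 5"
  unfolding runs_def by (rule tri_conseq[OF tri_Const, where P = "cfg (%_. 0) us K V" and Q = "cfg (hm 0) us K V"]) (auto simp: cfg_def set_reg_def hm_def)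
 then show ?case by simp
next
 case (Suc j)
 have "runs b inp (STO (CST j) (HDRE ka C1 C2 k d j)) K V (hm j) us (hm (Suc j)) us (1 + tHDR + 1)"
  unfolding hm_Suc[symmetric] by (intro runs_STO evals_CST ev_HDRE) (use Suc.prems in "auto intro: small")
 from runs_CSEQ[OF Suc.IH this] Suc.prems show ?case by (simp, elim runs_weaken) (auto simp: algebra_simps)
qed

end

section \<open>Sorted elements, coefficients and seeds in memory\<close>

context inst_build begin

definition "rk i j = (\<Sum>j'<n. of_bool (av i j' < av i j) :: nat)"

lemma rk_less: "j < n ==> rk i j < n"
proof -
 assume j: "j < n"
 have "rk i j = (\<Sum>j'\<in>{..<n} - {j}. of_bool (av i j' < av i j))"
  unfolding rk_def using j by (subst sum.remove[of _ j]) auto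
 also have "... <= (\<Sum>j'\<in>{..<n} - {j}. 1)" by (rule sum_mono) simp
 also have "... < n" using j by simp
 finally show ?thesis .
qed

lemma hdr_upds: "hdr M ==> (!!a v. (a, v) \<in> set ws ==> 20 <= a) ==> hdr (upds ws M)"
proof -
 assume h: "hdr M" "!!a v. (a, v) \<in> set ws ==> 20 <= a"
 have "upds ws M a = M a" if "a < 20" for a
  by (rule upds_notin) (use h(2) that in force)
 then show ?thesis using h(1) unfolding hdr_def by simp
qed

lemma hdr_upd: "hdr M ==> 20 <= a ==> hdr (M(a := v))"
 using hdr_upds[of M "[(a, v)]"] by simp

lemma sort_addr: "i < k ==> p < 2 ^ L ==> e < len ==> 32 + ((i * 2 ^ L + p) * len + e) < CB"
proof -
 assume h: "i < k" "p < 2 ^ L" "e < len"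
 have "(i * 2 ^ L + p) * len + e < k * 2 ^ L * len" using h by (intro index_le) auto
 then show ?thesis using addr by linarith
qed

lemma ev_AIN:
 assumes M: "hdr M" and v: "i < K" "j < K" "e < K" "V i = vi" "V j = vj" "V e = ve" "vi < k" "vj < n" "ve < len"
 shows "evals b inp M (AIN i j e) K V (av vi vj div 2 ^ (b * ve) mod 2 ^ b) 20"
 unfolding AIN_def
proof (rule evals_weaken[where v = "av vi vj div 2 ^ (b * ve) mod 2 ^ b" and T = "(1 + ((((1 + 2 + 1) + 1 + 1) + 2 + 1) + 1 + 1) + 1) + 1"], goal_cases a)
 have "n <= 2 ^ L" using nL by simp
 then have "k * n * len <= k * 2 ^ L * len" by (intro mult_le_mono1 mult_le_mono2)
 moreover have "(vi * n + vj) * len + ve < k * n * len" using v by (intro index_le) auto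
 ultimately have 3: "4 + ((vi * n + vj) * len + ve) < 2 ^ b" using addr addr_less by linarith
 have 4: "(vi * n + vj) * 1 <= (vi * n + vj) * len" using v by (intro mult_le_mono2) simp
 have 5: "(vi * n + vj) * len < 2 ^ b" using 3 by linarith
 have 6: "vi * n + vj < 2 ^ b" using le_less_trans[OF 4 5] by simp
 then have 7: "vi * n < 2 ^ b" by simp
 case a show ?case
 proof (rule evals_INP)
  show "evals b inp M (ADD (CST 4) (ADD (MUL (ADD (MUL (VAR i) (HD 1)) (VAR j)) (HD 2)) (VAR e))) K V (4 + ((vi * n + vj) * len + ve))
    (1 + ((((1 + 2 + 1) + 1 + 1) + 2 + 1) + 1 + 1) + 1)"
   by (intro ev_ADD ev_MUL ev_HD ev_VAR evals_CST) (use M v 3 5 6 7 in "auto simp: hdrD intro: small")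
 qed (use v inpA in auto)
qed simp_all

lemma ev_RANKE:
 assumes M: "hdr M" and v: "i < K" "j < K" "V i = vi" "V j = vj" "vi < k" "vj < n"
 shows "evals b inp M (RANKE i j) K V (rk vi vj) tRANK"
 unfolding RANKE_def rk_def
proof (rule evals_weaken)
 have nb: "n < 2 ^ b" by (rule two_pow_bounds(2))
 have "(\<Sum>j'<n. of_bool (av vi j' < av vi vj)) < (2::nat) ^ b" using rk_less[OF v(6), of vi] nb unfolding rk_def by linarith
 then show "evals b inp M (SUME (HD 1) (%j'. LESSE (HD 2) (AIN i j') (AIN i j))) K V (\<Sum>j'<n. of_bool (av vi j' < av vi vj))
  (2 + n * ((2 + len * (2 * 20 + 18) + 4) + 7) + 4)"
  by (intro ev_SUME ev_LESSE ev_HD ev_AIN) (use M v b0 nb len_less av_less in "auto simp: hdrD intro: small")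
 show "2 + n * ((2 + len * (2 * 20 + 18) + 4) + 7) + 4 <= tRANK" unfolding tRANK_def by (simp add: algebra_simps)
qed simp

definition wsS :: "(nat \<times> nat) list" where
 "wsS = concat (map (%i. concat (map (%j. concat (map (%e. [(32 + ((i * 2 ^ L + rk i j) * len + e), av i j div 2 ^ (b * e) mod 2 ^ b)])
   [0..<len])) [0..<n])) [0..<k])"

lemma wsS_iff: "(a, v) \<in> set wsS \<longleftrightarrow> (EX i<k. EX j<n. EX e<len. a = 32 + ((i * 2 ^ L + rk i j) * len + e) & v = av i j div 2 ^ (b * e) mod 2 ^ b)"
 unfolding wsS_def by (simp add: atLeast0LessThan) blast

lemma runs_SORTC:
 assumes M: "hdr M"
 shows "runs b inp (SORTC k) K V M us (upds wsS M) us tSORT"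
 unfolding SORTC_def wsS_def
proof (rule runs_weaken)
 have nb: "n < 2 ^ b" by (rule two_pow_bounds(2))
 have rkL: "rk i j < 2 ^ L" if "j < n" for i j using rk_less[OF that, of i] nL by simp
 show "runs b inp (FOR (CST k) (%i. FOR (HD 1) (%j. CLET (RANKE i j) (%p. FOR (HD 2) (%e.
   STO (ADD (CST 32) (ADD (MUL (ADD (MUL (VAR i) (SHLE (CST 1) (HD 3))) (VAR p)) (HD 2)) (VAR e))) (AIN i j e)))))) K V M us
   (upds (concat (map (%i. concat (map (%j. concat (map (%e. [(32 + ((i * 2 ^ L + rk i j) * len + e), av i j div 2 ^ (b * e) mod 2 ^ b)])
   [0..<len])) [0..<n])) [0..<k])) M) us (1 + k * ((2 + n * ((tRANK + (2 + len * ((30 + 20 + 1) + 4) + 3)) + 4) + 3) + 4) + 3)"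
 proof (rule runs_FOR_stat[where S = hdr, OF b0 _ _ M], goal_cases z a c)
  case a show ?case by (rule evals_CST) (rule k_less)
  case (c i V1 M1)
  note i = c(1) and M1 = c(2) and 1 = c(3,4)
  let ?K = "Suc (Suc K)"
  show ?case
  proof (rule runs_FOR_stat[where S = hdr, OF b0 nb _ M1], goal_cases a c)
   case a show ?case by (rule ev_HD) (use M1 in "auto simp: hdrD small")
   case (c j V2 M2)
   note j = c(1) and M2 = c(2) and 2 = c(3,4)
   let ?K2 = "Suc (Suc ?K)"
   show ?case
   proof (rule runs_CLET[where v = "rk i j"], goal_cases a 3)
    case a show ?case by (rule ev_RANKE[OF M2]) (use i j 1 2 in auto)
    case (3 V3)
    show ?case
    proof (rule runs_FOR_stat[where S = hdr, OF b0 len_less(1) _ M2], goal_cases a c)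
     case a show ?case by (rule ev_HD) (use M2 in "auto simp: hdrD small")
     case (c e V4 M3)
     note e = c(1) and M3 = c(2) and 4 = c(3,4)
     have 31: "32 + ((i * 2 ^ L + rk i j) * len + e) < 2 ^ b" using sort_addr[OF i rkL[OF j] e, of i] addr_less by linarith
     have 41: "(i * 2 ^ L + rk i j) * 1 <= (i * 2 ^ L + rk i j) * len" using e by (intro mult_le_mono2) simp
     have 5: "(i * 2 ^ L + rk i j) * len < 2 ^ b" using 31 by linarith
     have 6: "i * 2 ^ L + rk i j < 2 ^ b" using le_less_trans[OF 41 5] by simp
     then have 7: "i * 2 ^ L < 2 ^ b" by simp
     show ?case
     proof (rule runs_STO)
      show "evals b inp M3 (ADD (CST 32) (ADD (MUL (ADD (MUL (VAR (Suc K)) (SHLE (CST 1) (HD 3))) (VAR ?K2)) (HD 2)) (VAR (Suc (Suc ?K2))))) (Suc (Suc (Suc ?K2))) V4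
        (32 + ((i * 2 ^ L + rk i j) * len + e)) 30"
      proof (rule evals_weaken[where v = "32 + ((i * (1 * 2 ^ L) + rk i j) * len + e)" and T = "1 + ((((1 + (1 + 2 + 1) + 1) + 1 + 1) + 2 + 1) + 1 + 1) + 1"], goal_cases a)
       case a show ?case
        by (intro ev_ADD ev_MUL ev_SHLE ev_HD ev_VAR evals_CST) (use M3 1 2 3 4 31 5 6 7 two_lev in "auto simp: hdrD intro: small")
      qed simp_all
      show "evals b inp M3 (AIN (Suc K) (Suc ?K) (Suc (Suc ?K2))) (Suc (Suc (Suc (Suc ?K2)))) V5 (av i j div 2 ^ (b * e) mod 2 ^ b) 20"
       if "!!x. x < Suc (Suc (Suc ?K2)) ==> V5 x = V4 x" for V5
       by (rule ev_AIN[OF M3]) (use that 1 2 3 4 i j e in auto)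
     qed
    qed (auto intro: hdr_upd)
   qed
  qed (auto intro!: hdr_upds)
 qed (auto intro!: hdr_upds k_less)
 have "k * ((2 + n * ((tRANK + (2 + len * ((30 + 20 + 1) + 4) + 3)) + 4) + 3) + 4) <= k * (n * (tRANK + len * 70 + 40) + 40)"
  by (intro mult_le_mono2) (simp add: algebra_simps)
 then show "1 + k * ((2 + n * ((tRANK + (2 + len * ((30 + 20 + 1) + 4) + 3)) + 4) + 3) + 4) + 3 <= tSORT" unfolding tSORT_def by linarith
qed simp_all

definition wsC :: "(nat \<times> nat) list" where
 "wsC = concat (map (%x. [(CB + x, take_bit b (nth_default 0 inp (4 + (k * n * len + x))))]) [0..<Suc d ^ k * len])"

lemma inC_less: "x < Suc d ^ k * len ==> 4 + (k * n * len + x) < 2 ^ b" "k * n * len < 2 ^ b" "k * n < 2 ^ b" "CB + x < 2 ^ b ==> x < 2 ^ b"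
proof -
 have n2: "n <= 2 ^ L" using nL by simp
 then have "k * n * len <= k * 2 ^ L * len" by (intro mult_le_mono1 mult_le_mono2)
 then show "x < Suc d ^ k * len ==> 4 + (k * n * len + x) < 2 ^ b" "k * n * len < 2 ^ b" using addr addr_less by linarith+
 show "k * n < 2 ^ b" using mult_le_mono2[OF n2, of k] prods_less(2) by linarith
qed simp

lemma runs_COEFC:
 assumes M: "hdr M"
 shows "runs b inp (COEFC k d) K V M us (upds wsC M) us tCOEF"
 unfolding COEFC_def wsC_def
proof (rule runs_weaken)
 show "runs b inp (FOR (MUL (CST (Suc d ^ k)) (HD 2)) (%x. STO (ADD (HD 10) (VAR x))
   (INP (ADD (CST 4) (ADD (MUL (MUL (CST k) (HD 1)) (HD 2)) (VAR x)))))) K V M us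
   (upds (concat (map (%x. [(CB + x, take_bit b (nth_default 0 inp (4 + (k * n * len + x))))]) [0..<Suc d ^ k * len])) M) us
   ((1 + 2 + 1) + Suc d ^ k * len * (((2 + 1 + 1) + ((1 + (((1 + 2 + 1) + 2 + 1) + 1 + 1) + 1) + 1) + 1) + 4) + 3)"
 proof (rule runs_FOR_stat[where S = hdr, OF b0 prods_less(3) _ M], goal_cases a c)
  case a show ?case
   by (intro ev_MUL evals_CST ev_HD) (use M db prods_less in "auto simp: hdrD intro: small")
  case (c x V1 M1)
  note x = c(1) and M1 = c(2) and 1 = c(3,4)
  have a: "CB + x < 2 ^ b" using x addr addr_less by linarith
  show ?case
  proof (rule runs_STO)
   show "evals b inp M1 (ADD (HD 10) (VAR (Suc K))) (Suc (Suc K)) V1 (CB + x) (2 + 1 + 1)"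
    by (intro ev_ADD ev_HD ev_VAR) (use M1 1 a in "auto simp: hdrD intro: small")
   fix V2 assume 2: "!!x. x < Suc (Suc K) ==> V2 x = V1 x"
   show "evals b inp M1 (INP (ADD (CST 4) (ADD (MUL (MUL (CST k) (HD 1)) (HD 2)) (VAR (Suc K))))) (Suc (Suc (Suc K))) V2
     (take_bit b (nth_default 0 inp (4 + (k * n * len + x)))) ((1 + (((1 + 2 + 1) + 2 + 1) + 1 + 1) + 1) + 1)"
   proof (rule evals_INP[OF _ refl])
    show "evals b inp M1 (ADD (CST 4) (ADD (MUL (MUL (CST k) (HD 1)) (HD 2)) (VAR (Suc K)))) (Suc (Suc (Suc K))) V2 (4 + (k * n * len + x)) (1 + (((1 + 2 + 1) + 2 + 1) + 1 + 1) + 1)"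
     by (intro ev_ADD ev_MUL ev_HD ev_VAR evals_CST) (use M1 1 2 inC_less(1)[OF x] inC_less(2,3) inC_less(4)[OF a] k_less in "auto simp: hdrD intro: small")
   qed
  qed
 qed (use addr in "auto intro!: hdr_upd")
qed (simp_all add: tCOEF_def)

definition wsR :: "nat list => nat => (nat \<times> nat) list" where
 "wsR us m = map (%x. (SB + x, us ! x)) [0..<m]"

lemma runs_SEEDC:
 assumes M: "hdr M" and us: "NS <= length us"
 shows "runs b inp SEEDC K V M us (upds (wsR us NS) M) (drop NS us) tSEED"
proof -
 have "runs b inp SEEDC K V (upds (wsR us 0) M) (drop 0 us) (upds (wsR us NS) M) (drop NS us) ((2 + 2 + 1) + NS * (((2 + 1 + 1) + 2) + 4) + 3)"
  unfolding SEEDC_def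
 proof (rule runs_FOR[where Mf = "%i. upds (wsR us i) M" and uf = "%i. drop i us", OF b0 addr_less(5)])
  have h: "hdr (upds (wsR us i) M)" for i
   by (rule hdr_upds[OF M]) (use addr in "auto simp: wsR_def")
  show "evals b inp (upds (wsR us 0) M) (SUBT (HD 12) (HD 11)) K V NS (2 + 2 + 1)"
  proof (rule evals_weaken[where v = "A1 - SB" and T = "2 + 2 + 1"], goal_cases a)
   case a show ?case
    by (intro ev_SUBT ev_HD) (use h[of 0] addr addr_less in "auto simp: hdrD intro: small")
  qed (use addr in simp_all)
  fix i V1 assume i: "i < NS" and 1: "V1 (Suc K) = i"
  have "runs b inp (RND (ADD (HD 11) (VAR (K + 1)))) (K + 2) V1 (upds (wsR us i) M) (drop i us) (upds [(SB + i, us ! i)] (upds (wsR us i) M)) (drop (Suc i) us) ((2 + 1 + 1) + 2)"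
  proof (rule runs_RND)
   have "SB + i < 2 ^ b" using i addr addr_less by linarith
   then show "evals b inp (upds (wsR us i) M) (ADD (HD 11) (VAR (K + 1))) (K + 2) V1 (SB + i) (2 + 1 + 1)"
    by (intro ev_ADD ev_HD ev_VAR) (use h 1 in "auto simp: hdrD simp flip: Suc_eq_plus1 intro: small")
   show "drop i us = us ! i # drop (Suc i) us" by (rule Cons_nth_drop_Suc[symmetric]) (use i us in simp)
  qed
  then show "runs b inp (RND (ADD (HD 11) (VAR (K + 1)))) (K + 2) V1 (upds (wsR us i) M) (drop i us) (upds (wsR us (Suc i)) M) (drop (Suc i) us) ((2 + 1 + 1) + 2)"
   by (simp add: wsR_def upds_append)
 qed
 then show ?thesis by (simp add: wsR_def, elim runs_weaken) (simp_all add: tSEED_def wsR_def)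
qed

definition Mst :: "nat list => nat => nat" where
 "Mst us = upds (wsR us NS) (upds wsC (upds wsS (hm 20)))"

lemma wsS_addr: "(a, v) \<in> set wsS ==> 32 <= a & a < CB"
 unfolding wsS_iff using sort_addr rk_less nL by (metis le_add1 less_trans)

lemma wsC_addr: "(a, v) \<in> set wsC ==> CB <= a & a < SB"
 using addr by (auto simp: wsC_def)

lemma wsR_addr: "(a, v) \<in> set (wsR us NS) ==> SB <= a & a < A1"
 using addr by (auto simp: wsR_def)

lemma Mst_S: "a < CB ==> Mst us a = upds wsS (hm 20) a"
proof -
 assume a: "a < CB"
 have "a \<notin> fst ` set (wsR us NS)" "a \<notin> fst ` set wsC" using a wsR_addr wsC_addr addr by fastforce+
 then show ?thesis unfolding Mst_def by (simp add: upds_notin)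
qed

lemma hdr_Mst: "hdr (upds wsS (hm 20))" "hdr (upds wsC (upds wsS (hm 20)))" "hdr (Mst us)"
proof -
 have ge: "32 <= CB" "32 <= SB" using addr by linarith+
 show 1: "hdr (upds wsS (hm 20))"
 proof (rule hdr_upds[OF hm_hdr])
  fix a v assume "(a, v) \<in> set wsS" then show "20 <= a" using wsS_addr[of a v] by simp
 qed simp
 show 2: "hdr (upds wsC (upds wsS (hm 20)))"
 proof (rule hdr_upds[OF 1])
  fix a v assume "(a, v) \<in> set wsC" then show "20 <= a" using wsC_addr[of a v] ge by simp
 qed
 show "hdr (Mst us)" unfolding Mst_def
 proof (rule hdr_upds[OF 2])
  fix a v assume "(a, v) \<in> set (wsR us NS)" then show "20 <= a" using wsR_addr[of a v us] ge by simp
 qed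
qed

lemma dat_Mst: "dat (Mst us)"
 unfolding dat_def
proof (intro conjI allI impI)
 fix i p e :: nat assume h: "i < k" "p < 2 ^ L" "e < len"
 let ?a = "32 + ((i * 2 ^ L + p) * len + e)"
 have 0: "Mst us ?a = upds wsS (hm 20) ?a" by (rule Mst_S[OF sort_addr[OF h]])
 have uniq: "rk i' j' = p & i' = i & e' = e" if "i' < k" "j' < n" "e' < len" "?a = 32 + ((i' * 2 ^ L + rk i' j') * len + e')" for i' j' e'
 proof -
  have "i * 2 ^ L + p = i' * 2 ^ L + rk i' j' & e = e'" by (rule index_inj) (use that h in auto)
  moreover then have "i = i' & p = rk i' j'" by (intro index_inj[of i "2 ^ L"]) (use that h rk_less[of j' i'] nL in auto)
  ultimately show ?thesis by simp
 qed
 show "Mst us ?a = nm i p div 2 ^ (b * e) mod 2 ^ b"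
 proof (cases "p < n")
  case True
  then obtain j where j: "j < n" "rk i j = p" using rank_surj[OF h(1) True] unfolding rk_def by blast
  have "upds wsS (hm 20) ?a = av i j div 2 ^ (b * e) mod 2 ^ b"
  proof (rule upds_unique)
   show "(?a, av i j div 2 ^ (b * e) mod 2 ^ b) \<in> set wsS" unfolding wsS_iff using h j by blast
   fix v assume "(?a, v) \<in> set wsS"
   then obtain i' j' e' where *: "i' < k" "j' < n" "e' < len" "?a = 32 + ((i' * 2 ^ L + rk i' j') * len + e')" "v = av i' j' div 2 ^ (b * e') mod 2 ^ b"
    unfolding wsS_iff by blast
   from uniq[OF *(1-4)] have "rk i j' = rk i j" "i' = i" "e' = e" using j by auto
   \<comment> \<open>Positions of equal rank carry the same element by \<open>nm_rank\<close>, so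
     all writes to this address agree.\<close>
   moreover have "av i j' = av i j" using nm_rank[OF h(1) *(2)] nm_rank[OF h(1) j(1)] \<open>rk i j' = rk i j\<close> unfolding rk_def by simp
   ultimately show "v = av i j div 2 ^ (b * e) mod 2 ^ b" using * by simp
  qed
  moreover have "nm i p = av i j" using nm_rank[OF h(1) j(1)] j unfolding rk_def by simp
  ultimately show ?thesis using 0 by simp
 next
  case False
  have "?a \<notin> fst ` set wsS"
  proof
   assume "?a \<in> fst ` set wsS"
   then obtain v where "(?a, v) \<in> set wsS" by force
   then obtain i' j' e' where *: "i' < k" "j' < n" "e' < len" "?a = 32 + ((i' * 2 ^ L + rk i' j') * len + e')"
    unfolding wsS_iff by blast
   from uniq[OF this] rk_less[OF *(2), of i'] False show False by simp
  qed
  \<comment> \<open>Padding ranks are never written and keep the initial 0, the value of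
    \<open>nm\<close> there.\<close>
  then have "upds wsS (hm 20) ?a = 0" by (simp add: upds_notin hm_def)
  then show ?thesis using 0 nm_ge False by simp
 qed
next
 fix idx e assume h: "idx < Suc d ^ k" "e < len"
 have x: "idx * len + e < Suc d ^ k * len" by (rule index_le[OF h])
 let ?a = "CB + (idx * len + e)"
 have "?a \<notin> fst ` set (wsR us NS)" using x wsR_addr addr by fastforce
 then have "Mst us ?a = upds wsC (upds wsS (hm 20)) ?a" unfolding Mst_def by (rule upds_notin)
 also have "... = take_bit b (nth_default 0 inp (4 + (k * n * len + (idx * len + e))))"
  by (rule upds_unique) (use x in "auto simp: wsC_def")
 also have "... = cf idx div 2 ^ (b * e) mod 2 ^ b" by (rule inpC[OF h])
 finally show "Mst us ?a = cf idx div 2 ^ (b * e) mod 2 ^ b" .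
qed

lemma seeded_Mst: "seeded ((!) us) (Mst us)"
 unfolding seeded_def Mst_def
proof (intro allI impI)
 fix x assume "x < NS"
 then show "upds (wsR us NS) (upds wsC (upds wsS (hm 20))) (SB + x) = us ! x"
  by (intro upds_unique) (auto simp: wsR_def)
qed

lemma Mst_zero: "A1 <= a ==> Mst us a = 0"
proof -
 assume a: "A1 <= a"
 have "a \<notin> fst ` set (wsR us NS)" "a \<notin> fst ` set wsC" "a \<notin> fst ` set wsS" using a wsR_addr wsC_addr wsS_addr addr by fastforce+
 then show ?thesis unfolding Mst_def using a addr by (simp add: upds_notin hm_def)
qed

end

section \<open>Filling the sample tables and the rainbow tables\<close>

context inst_ok begin

lemma ev_NLE': "hdr M ==> evals b inp M (LET (CST k) (POWE L1E)) K V NL (11 * k + 7)"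
 unfolding NL_def
proof (rule evals_weaken[where v = "Suc L ^ k" and T = "1 + (k * (4 + 7) + 5) + 1"], goal_cases a)
 assume M: "hdr M"
 case a show ?case
 proof (rule ev_LET)
  show "evals b inp M (CST k) K V k 1" by (rule evals_CST) (rule k_less)
  fix V1 assume "V1 K = k"
  then show "evals b inp M (POWE L1E K) (Suc K) V1 (Suc L ^ k) (k * (4 + 7) + 5)"
   by (intro ev_POWE ev_L1E) (use M k_less SucL_pow[of k] b0 in auto)
 qed
qed simp_all

definition wsL :: "(nat => nat => (nat \<times> nat) list) => (nat \<times> nat) list" where
 "wsL wb = concat (map (%lam. if sa lam < 2 * J + 4 then [] else concat (map (wb lam) [0..<2 ^ (k * L - sa lam)])) [0..<NL])"

lemma big_less: "2 * J + 4 < 2 ^ b" "sa lam + 2 < 2 ^ b"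
proof -
 have "1 * L <= k * L" using k2 by (intro mult_le_mono1) simp
 then show "2 * J + 4 < 2 ^ b" "sa lam + 2 < 2 ^ b" using JL kLb less_exp[of b] sa_le[of lam] by linarith+
qed

lemma runs_LEVELSC:
 assumes S: "S M" "!!M. S M ==> hdr M"
  and body: "!!lam mu K' V' M x y. lam < NL ==> 2 * J + 4 <= sa lam ==> mu < 2 ^ (k * L - sa lam) ==> S M ==> x < K' ==> y < K' ==>
   V' x = lam ==> V' y = crn lam mu ==> runs b inp (bd x y) K' V' M us (upds (wb lam mu) M) us (Tb lam)"
  and Sb: "!!lam mu M. lam < NL ==> 2 * J + 4 <= sa lam ==> mu < 2 ^ (k * L - sa lam) ==> S M ==> S (upds (wb lam mu) M)"
  and TT: "!!lam. 2 * J + 4 <= sa lam ==> 2 ^ (k * L - sa lam) * (tCRN + Tb lam + 4) <= TT"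
 shows "runs b inp (LEVELSC k bd) K V M us (upds (wsL wb) M) us (NL * (TT + 2 * tOFF + 60) + 11 * k + 30)"
  and "S (upds (wsL wb) M)"
proof -
 let ?ws = "%lam. if sa lam < 2 * J + 4 then [] else concat (map (wb lam) [0..<2 ^ (k * L - sa lam)])"
 have Sw: "S (upds (?ws lam) M)" if "lam < NL" "S M" for lam M
  using upds_concat_inv[where S = S and n = "2 ^ (k * L - sa lam)" and i = "2 ^ (k * L - sa lam)" and ws = "wb lam", OF that(2) Sb] that by auto
 show "S (upds (wsL wb) M)"
  unfolding wsL_def using upds_concat_inv[where S = S and n = NL and i = NL and ws = ?ws, OF S(1) Sw] by auto
 let ?T1 = "((1 + ((1 + 2 + 1) + tOFF + 1) + 1) + TT + 3)"
 have "runs b inp (LEVELSC k bd) K V M us (upds (wsL wb) M) us ((11 * k + 7) + NL * ((((tOFF + ((1 + 2 + 1) + 1 + 1) + 1) + 1 + 1) + ?T1 + 2) + 4) + 3)"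
  unfolding LEVELSC_def wsL_def
 proof (rule runs_FOR_stat[where S = S, OF b0 NLb _ S(1)], goal_cases a c)
  case a show ?case by (rule ev_NLE'[OF S(2)[OF S(1)]])
  case (c lam V1 M1)
  note lam = c(1) and M1 = c(2) and 1 = c(3,4)
  let ?K = "Suc (Suc K)" let ?l = "Suc K"
  have h1: "hdr M1" by (rule S(2)[OF M1])
  have "runs b inp (CIF (EQE (LTE (SAE k ?l) (ADD (MUL (CST 2) (HD 6)) (CST 4))) (CST 0))
    (FOR (SHLE (CST 1) (SUBT (MUL (CST k) (HD 3)) (SAE k ?l))) (%mu. CLET (CRNE k ?l mu) (%zc. bd ?l zc)))) ?K V1 M1 us
    (if of_bool (of_bool (sa lam < 2 * J + 4) = (0::nat)) ~= (0::nat) then upds (concat (map (wb lam) [0..<2 ^ (k * L - sa lam)])) M1 else M1)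
    (if of_bool (of_bool (sa lam < 2 * J + 4) = (0::nat)) ~= (0::nat) then us else us)
    (((tOFF + ((1 + 2 + 1) + 1 + 1) + 1) + 1 + 1) + ?T1 + 2)"
  proof (rule runs_CIF)
   show "evals b inp M1 (EQE (LTE (SAE k ?l) (ADD (MUL (CST 2) (HD 6)) (CST 4))) (CST 0)) ?K V1 (of_bool (of_bool (sa lam < 2 * J + 4) = (0::nat)))
     ((tOFF + ((1 + 2 + 1) + 1 + 1) + 1) + 1 + 1)"
    by (intro ev_EQE ev_LTE ev_SAE ev_ADD ev_MUL ev_HD evals_CST) (use h1 1 b0 big_less in "auto simp: hdrD intro: small")
   assume "of_bool (of_bool (sa lam < 2 * J + 4) = (0::nat)) ~= (0::nat)"
   then have bg: "2 * J + 4 <= sa lam" by (auto split: if_splits)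
   have pw: "2 ^ (k * L - sa lam) < (2::nat) ^ b" by (rule le_less_trans[OF pow_kL U_less(1)]) simp
   show "runs b inp (FOR (SHLE (CST 1) (SUBT (MUL (CST k) (HD 3)) (SAE k ?l))) (%mu. CLET (CRNE k ?l mu) (%zc. bd ?l zc))) ?K V1 M1 us
     (upds (concat (map (wb lam) [0..<2 ^ (k * L - sa lam)])) M1) us ?T1"
   proof (rule runs_weaken)
    show "runs b inp (FOR (SHLE (CST 1) (SUBT (MUL (CST k) (HD 3)) (SAE k ?l))) (%mu. CLET (CRNE k ?l mu) (%zc. bd ?l zc))) ?K V1 M1 us
     (upds (concat (map (wb lam) [0..<2 ^ (k * L - sa lam)])) M1) us ((1 + ((1 + 2 + 1) + tOFF + 1) + 1) + 2 ^ (k * L - sa lam) * ((tCRN + Tb lam) + 4) + 3)"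
    proof (rule runs_FOR_stat[where S = S, OF b0 pw _ M1], goal_cases a c)
     case a show ?case
     proof (rule evals_weaken[where v = "1 * 2 ^ (k * L - sa lam)" and T = "1 + ((1 + 2 + 1) + tOFF + 1) + 1"], goal_cases a)
      case a show ?case
       by (intro ev_SHLE ev_SUBT ev_SAE ev_MUL ev_HD evals_CST)
        (use h1 1 pw k_less sa_le kL_less[of "k * L"] in "auto simp: hdrD simp del: power_strict_increasing_iff intro: small")
     qed simp_all
     case (c mu V2 M2)
     note mu = c(1) and M2 = c(2) and 2 = c(3,4)
     show ?case
     proof (rule runs_CLET[where v = "crn lam mu"], goal_cases a 3)
      case a show ?case
       by (rule ev_CRNE) (use S(2)[OF M2] 1 2 in auto)
      case (3 V3)
      show ?case
       by (rule body[OF lam bg mu M2]) (use 1 2 3 in auto)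
     qed
    qed (use Sb[OF lam bg] in auto)
   qed (use TT[OF bg] in simp_all)
  qed
  then show ?case
   by (elim runs_weaken) auto
 qed (use Sw in auto)
 then show "runs b inp (LEVELSC k bd) K V M us (upds (wsL wb) M) us (NL * (TT + 2 * tOFF + 60) + 11 * k + 30)"
 proof (rule runs_weaken)
  have "NL * ((((tOFF + ((1 + 2 + 1) + 1 + 1) + 1) + 1 + 1) + ?T1 + 2) + 4) <= NL * (TT + 2 * tOFF + 60)"
   by (intro mult_le_mono2) simp
  then show "(11 * k + 7) + NL * ((((tOFF + ((1 + 2 + 1) + 1 + 1) + 1) + 1 + 1) + ?T1 + 2) + 4) + 3 <= NL * (TT + 2 * tOFF + 60) + 11 * k + 30" by linarith
 qed simp_all
qed

lemma runs_LAYERC: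
 assumes S: "S M" "!!M. S M ==> hdr M" and R: "!!M. S M ==> M j = R" "j < 2 ^ b" "R < 2 ^ b" and m: "2 ^ e < (2::nat) ^ b"
  and ce: "!!M K' V'. S M ==> K <= K' ==> (!!x. x < K ==> V' x = V x) ==> evals b inp M ce K' V' e Tc"
  and cell: "!!M K' V' r c x y. S M ==> r < R ==> c < 2 ^ e ==> K <= x ==> x < K' ==> y < K' ==> (!!x. x < K ==> V' x = V x) ==>
   V' x = r ==> V' y = c ==> evals b inp M (cell x y) K' V' (fst (w r c)) Te"
  and w: "!!r c. snd (w r c) = c + 1" and upd: "!!M r c. r < R ==> c < 2 ^ e ==> S M ==> S (upds [w r c] M)"
 shows "runs b inp (LAYERC j ce cell) K V M us (upds (concat (map (%r. concat (map (%c. [w r c]) [0..<2 ^ e])) [0..<R])) M) us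
   (R * (2 ^ e * (Te + 8) + Tc + 9) + 5)" (is ?A)
  and "S (upds (concat (map (%r. concat (map (%c. [w r c]) [0..<2 ^ e])) [0..<R])) M)"
proof -
 have S2: "S (upds (concat (map (%c. [w r c]) [0..<2 ^ e])) M)" if "r < R" "S M" for r M
  using upds_concat_inv[where S = S and n = "2 ^ e" and i = "2 ^ e", OF that(2) upd[OF that(1)]] by simp
 show "S (upds (concat (map (%r. concat (map (%c. [w r c]) [0..<2 ^ e])) [0..<R])) M)"
  using upds_concat_inv[where S = S and n = R and i = R, OF S(1) S2] by simp
 show ?A
  unfolding LAYERC_def
 proof (rule runs_weaken[OF runs_FOR_stat[where S = S, OF b0 R(3) _ S(1) runs_FOR_stat[where S = S, OF b0 m]] refl refl])
  show "evals b inp M (HD j) K V R 2" by (rule ev_HD) (use R S in auto)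
  fix r V1 M1 assume r: "r < R" and M1: "S M1" and 1: "!!x. x < K ==> V1 x = V x" "V1 (Suc K) = r"
  let ?K = "Suc (Suc K)"
  show "evals b inp M1 (SHLE (CST 1) ce) ?K V1 (2 ^ e) (1 + Tc + 1)"
   by (rule evals_weaken[OF ev_SHLE[OF evals_CST ce[OF M1]]]) (use m 1 in "auto intro: small")
  fix c V2 M2 assume c: "c < 2 ^ e" and M2: "S M2" and 2: "!!x. x < ?K ==> V2 x = V1 x" "V2 (Suc ?K) = c"
  have c1: "c + 1 < 2 ^ b" using c m by linarith
  show "runs b inp (STO (cell (Suc K) (Suc ?K)) (ADD (VAR (Suc ?K)) (CST 1))) (Suc (Suc ?K)) V2 M2 us (upds [w r c] M2) us (Te + (1 + 1 + 1) + 1)"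
  proof (rule runs_weaken[OF runs_STO[where v = "c + 1"]])
   show "evals b inp M2 (cell (Suc K) (Suc ?K)) (Suc (Suc ?K)) V2 (fst (w r c)) Te"
    by (rule cell[OF M2 r c]) (use 1 2 in auto)
   show "evals b inp M2 (ADD (VAR (Suc ?K)) (CST 1)) (Suc (Suc (Suc ?K))) V3 (c + 1) (1 + 1 + 1)"
    if "!!x. x < Suc (Suc ?K) ==> V3 x = V2 x" for V3
    by (intro ev_ADD ev_VAR evals_CST) (use that 2 c1 in "auto intro: small")
  qed (use w[of r c] in \<open>cases "w r c"; auto\<close>, simp_all)
 qed (use S2 upd in "auto simp: algebra_simps")
qed

text \<open>\<open>m1\<close> is 4 * 2^sa / t, the number of samples per box: a value with more than
  \<open>t\<close> preimages is sampled more than four times on average. \<open>m2\<close> is 2^sa /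
  (16 t^2), the number of chains per box.\<close>

definition m1 :: "nat => nat" where "m1 lam = 2 ^ (sa lam + 2 - J)"
definition m2 :: "nat => nat" where "m2 lam = 2 ^ (sa lam - (2 * J + 4))"

definition
 "w1 H lam zc r c = (A1 + ((lam * R1 + r) * P1 + H (2 * r + 1) (kf 0 zc (zc + dep lam (H (2 * r) (kf 0 zc ((c + 1) * U + zc))))) mod P1), c + 1)"

definition
 "wb1 H lam mu = concat (map (%r. concat (map (%c. [w1 H lam (crn lam mu) r c]) [0..<m1 lam])) [0..<R1])"

definition
 "w2 H T lam zc r c = (cell2 H 0 lam zc r (wlk H T 0 lam zc r 0 t ((c + 1) * U + zc)), c + 1)"

definition
 "wb2 H T lam mu = concat (map (%r. concat (map (%c. [w2 H T lam (crn lam mu) r c]) [0..<m2 lam])) [0..<R2])"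

definition "ws1 H = wsL (wb1 H)"
definition "ws2 H T = wsL (wb2 H T)"

text \<open>The invariant while tables are filled: all writes go to addresses from \<open>A1\<close>
  on and store counters, so the header, the data and the seeds survive.\<close>

definition st1 :: "(nat => nat) => (nat => nat) => bool" where
 "st1 sd M \<longleftrightarrow> hdr M & dat M & seeded sd M & tabs_ok M"

lemma st1_upd:
 assumes "st1 sd M" "A1 <= a" "v <= 4 * U"
 shows "st1 sd (M(a := v))"
proof -
 have lt: "32 <= CB" "CB <= SB" "SB <= A1" using addr by linarith+
 have "hdr (M(a := v))" using assms(1,2) lt unfolding st1_def hdr_def by simp
 moreover have "dat (M(a := v))"
 proof -
  have 1: "32 + ((i * 2 ^ L + p) * len + e) ~= a" if "i < k" "p < 2 ^ L" "e < len" for i p e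
  proof -
   have "(i * 2 ^ L + p) * len + e < k * 2 ^ L * len" using that by (intro index_le) auto
   then show ?thesis using addr assms(2) lt by linarith
  qed
  have 2: "CB + (idx * len + e) ~= a" if "idx < Suc d ^ k" "e < len" for idx e
  proof -
   have "idx * len + e < Suc d ^ k * len" using that by (intro index_le) auto
   then show ?thesis using addr assms(2) lt by linarith
  qed
  show ?thesis using assms(1) 1 2 unfolding st1_def dat_def by simp
 qed
 moreover have "seeded sd (M(a := v))" using assms(1,2) addr unfolding st1_def seeded_def by auto
 moreover have "tabs_ok (M(a := v))" using assms unfolding st1_def tabs_ok_def by simp
 ultimately show ?thesis unfolding st1_def by simp
qed

lemma st1D: "st1 sd M ==> hdr M" "st1 sd M ==> dat M" "st1 sd M ==> seeded sd M" "st1 sd M ==> tabs_ok M"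
 by (simp_all add: st1_def)

lemma m1_le: "m1 lam <= 4 * U" "m2 lam <= U"
proof -
 have "m1 lam <= 2 ^ (sa lam + 2)" unfolding m1_def by (intro power_increasing) auto
 also have "... = 4 * 2 ^ sa lam" by simp
 finally show "m1 lam <= 4 * U" using pow_kL[OF sa_le[of lam]] by simp
 have "m2 lam <= 2 ^ sa lam" unfolding m2_def by (intro power_increasing) auto
 then show "m2 lam <= U" using pow_kL[OF sa_le[of lam]] by simp
qed

lemma ev_START:
 assumes M: "hdr M" and v: "zc < K" "c < K" "V zc = vz" "V c = vc" "vz < U" "vc + 1 <= 4 * U"
 shows "evals b inp M (START zc c) K V ((vc + 1) * U + vz) 9"
 unfolding START_def
proof (rule evals_weaken)
 have s: "(vc + 1) * U + vz < 2 ^ b" using start_code[OF v(6,5)] YC_less by linarith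
 moreover have "vc + 1 < 2 ^ b" using v(6) U_less by linarith
 ultimately have "(vc + 1) * U + vz < 2 ^ b" "(vc + 1) * U < 2 ^ b" "vc + 1 < 2 ^ b" by linarith+
 then show "evals b inp M (ADD (MUL (ADD (VAR c) (CST 1)) (HD 14)) (VAR zc)) K V ((vc + 1) * U + vz) (((1 + 1 + 1) + 2 + 1) + 1 + 1)"
  by (intro ev_ADD ev_MUL ev_HD ev_VAR evals_CST) (use M v in "auto simp: hdrD intro: small")
qed simp_all

lemma ev_CELL1E:
 assumes M: "hdr M" "dat M" "seeded sd M"
  and v: "lam < K" "zc < K" "r < K" "c < K" "V lam = vl" "V zc = vz" "V r = vr" "V c = vc"
  and b: "vl < NL" "vr < R1" "vz < U" "vc + 1 <= 4 * U"
 shows "evals b inp M (CELL1E k d lam zc r c) K V (fst (w1 (hash_of sd) vl vz vr vc)) tCELL1"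
proof -
 let ?H = "hash_of sd"
 let ?st = "(vc + 1) * U + vz"
 let ?z = "vz + dep vl (?H (2 * vr) (kf 0 vz ?st))"
 let ?a = "A1 + ((vl * R1 + vr) * P1 + ?H (2 * vr + 1) (kf 0 vz ?z) mod P1)"
 have al: "?a < 2 ^ b" using T1_addr[OF b(1,2)] addr_less by (meson less_trans)
 have al2: "(vl * R1 + vr) * P1 + ?H (2 * vr + 1) (kf 0 vz ?z) mod P1 < 2 ^ b" "(vl * R1 + vr) * P1 < 2 ^ b" using al by linarith+
 have "(vl * R1 + vr) * 1 <= (vl * R1 + vr) * P1" using P1_pos by (intro mult_le_mono2) linarith
 then have al3: "vl * R1 + vr < 2 ^ b" "vl * R1 < 2 ^ b" using al2(2) by (simp_all add: add_mult_distrib)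
 have sok: "okc 0 inp ?st" by (rule okc_start[OF b(4,3)])
 have zok: "okc 0 inp ?z" using b(3) dep_less[of vl "?H (2 * vr) (kf 0 vz ?st)"] by (intro okc_point) simp
 have "evals b inp M (CELL1E k d lam zc r c) K V ?a
   (9 + (((1 + 1 + 1) + 2 + 1) + (tPT + ((((1 + 1 + 1) + 1 + 1) + 2 + 1) + (2 + (((1 + 2 + 1) + 1 + 1) + 2 + 1 + (tH + 2 + 1) + 1) + 1) + 1) + 1) + 1) + 1)"
  unfolding CELL1E_def
 proof (rule ev_LET[where ?v1.0 = "?st"], goal_cases a 1)
  case a show ?case by (rule ev_START) (use M v b in auto)
  case (1 V1)
  show ?case
  proof (rule ev_LET[where ?v1.0 = "2 * vr * SL"], goal_cases a 2)
   case a show ?case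
    by (intro ev_MUL ev_VAR ev_HD evals_CST) (use M v 1 r1_less[OF b(2)] in "auto simp: hdrD intro: small")
   case (2 V2)
   show ?case
   proof (rule ev_LET[where ?v1.0 = "?z"], goal_cases a 3)
    case a show ?case
     by (rule ev_PTE[OF M, where j = "2 * vr"]) (use v b 1 2 sok in auto)
    case (3 V3)
    let ?K = "Suc (Suc (Suc K))"
    show ?case
    proof (rule ev_LET[where ?v1.0 = "(2 * vr + 1) * SL"], goal_cases a 4)
     case a show ?case
      by (intro ev_MUL ev_ADD ev_VAR ev_HD evals_CST) (use M v 1 2 3 r1_less[OF b(2)] in "auto simp: hdrD intro: small")
     case (4 V4)
     have hash: "evals b inp M (HASHE k d ?K zc (Suc (Suc K))) K' V' (?H (2 * vr + 1) (kf 0 vz ?z)) tH"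
      if "Suc ?K <= K'" "!!x. x < Suc ?K ==> V' x = V4 x" for K' V'
      by (rule ev_HASHE[OF M, where j = "2 * vr + 1"]) (use that v b 1 2 3 4 zok in auto)
     show ?case
      by (intro ev_ADD ev_MUL ev_MODE ev_VAR ev_HD hash) (use M v 1 2 3 4 al al2 al3 in "auto simp: hdrD intro: small")
    qed
   qed
  qed
 qed
 then show ?thesis by (rule evals_weaken) (simp_all add: w1_def tCELL1_def)
qed

definition "TB1 lam = R1 * (m1 lam * (tCELL1 + 20) + tOFF + 40) + 20"
definition "TB2 lam = R2 * (m2 lam * (tW + tH + 130) + tOFF + 40) + 20"

lemma w1_addr: "lam < NL ==> r < R1 ==> A1 <= fst (w1 H lam zc r c) & fst (w1 H lam zc r c) < A2"
 unfolding w1_def using T1_addr by simp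

lemma runs_T1:
 assumes M: "st1 sd M"
  and TT: "!!lam. 2 * J + 4 <= sa lam ==> 2 ^ (k * L - sa lam) * (tCRN + TB1 lam + 4) <= TT"
 shows "runs b inp (T1C k d) K V M us (upds (ws1 (hash_of sd)) M) us (NL * (TT + 2 * tOFF + 60) + 11 * k + 30)"
  and "st1 sd (upds (ws1 (hash_of sd)) M)"
proof -
 let ?H = "hash_of sd"
 have S1: "st1 sd (upds [w1 ?H lam (crn lam mu) r c] M)" if "lam < NL" "r < R1" "c < m1 lam" "st1 sd M" for lam mu r c M
  using st1_upd[OF that(4), of "fst (w1 ?H lam (crn lam mu) r c)" "c + 1"] w1_addr[OF that(1,2), of ?H "crn lam mu" c] that(3) m1_le[of lam]
  by (simp add: w1_def)
 have body: "runs b inp (LAYERC 7 (SUBT (ADD (SAE k x) (CST 2)) (HD 6)) (CELL1E k d x y)) K V M us (upds (wb1 ?H lam mu) M) us (TB1 lam)"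
   and S3: "st1 sd (upds (wb1 ?H lam mu) M)"
  if lam: "lam < NL" and bg: "2 * J + 4 <= sa lam" and M: "st1 sd M" and v: "x < K" "y < K" "V x = lam" "V y = crn lam mu" for lam mu K V M x y
 proof -
  have m1b: "m1 lam < 2 ^ b" using m1_le(1)[of lam] U_less by linarith
  have 1: "st1 sd M ==> M 7 = R1" for M using st1D(1) by (auto simp: hdrD)
  have ce: "evals b inp M (SUBT (ADD (SAE k x) (CST 2)) (HD 6)) K' V' (sa lam + 2 - J) ((tOFF + 1 + 1) + 2 + 1)"
   if "st1 sd M" "K <= K'" "!!x. x < K ==> V' x = V x" for M K' V'
   by (intro ev_SUBT ev_ADD ev_SAE ev_HD evals_CST) (use st1D(1)[OF that(1)] that v bg big_less in "auto simp: hdrD intro: small")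
  have cell: "evals b inp M (CELL1E k d x y x' y') K' V' (fst (w1 ?H lam (crn lam mu) r c)) tCELL1"
   if "st1 sd M" "r < R1" "c < m1 lam" "K <= x'" "x' < K'" "y' < K'" "!!x. x < K ==> V' x = V x" "V' x' = r" "V' y' = c" for M K' V' r c x' y'
   by (rule ev_CELL1E[OF st1D(1-3)[OF that(1)]]) (use v that lam m1_le(1)[of lam] crn_less in auto)
  note * = runs_LAYERC[where S = "st1 sd" and j = 7 and w = "w1 ?H lam (crn lam mu)" and e = "sa lam + 2 - J" and R = R1, folded m1_def]
  have 2: "R1 < 2 ^ b" "(7::nat) < 2 ^ b" "snd (w1 ?H lam (crn lam mu) r c) = c + 1" for r c using R1b by (auto simp: w1_def intro: small)
  show "st1 sd (upds (wb1 ?H lam mu) M)" unfolding wb1_def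
   by (rule *(2)) (fact M st1D(1) 1 2 m1b ce cell S1[OF lam])+
  show "runs b inp (LAYERC 7 (SUBT (ADD (SAE k x) (CST 2)) (HD 6)) (CELL1E k d x y)) K V M us (upds (wb1 ?H lam mu) M) us (TB1 lam)"
   unfolding wb1_def
  proof (rule runs_weaken[OF *(1) refl refl])
   show "R1 * (m1 lam * (tCELL1 + 8) + ((tOFF + 1 + 1) + 2 + 1) + 9) + 5 <= TB1 lam" by (simp add: TB1_def algebra_simps)
  qed (fact M st1D(1) 1 2 m1b ce cell S1[OF lam])+
 qed
 \<comment> \<open>The conclusion does not mention registers; a dummy environment discharges the
   premises about them.\<close>
 have S3': "st1 sd (upds (wb1 ?H lam mu) M)" if "lam < NL" "2 * J + 4 <= sa lam" "st1 sd M" for lam mu M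
  by (rule S3[where x = 0 and y = 1 and K = 2 and V = "%x. if x = 0 then lam else crn lam mu"]) (use that in auto)
 show "runs b inp (T1C k d) K V M us (upds (ws1 ?H) M) us (NL * (TT + 2 * tOFF + 60) + 11 * k + 30)"
  unfolding T1C_def ws1_def
  by (rule runs_LEVELSC(1)[where S = "st1 sd", OF M st1D(1) body S3' TT])
 show "st1 sd (upds (ws1 ?H) M)"
  unfolding ws1_def by (rule runs_LEVELSC(2)[where S = "st1 sd", OF M st1D(1) body S3' TT])
qed

text \<open>Lookups of heavy values, and with them walks, read only the sample tables. Filling the
  rainbow tables does not change any walk.\<close>

lemma hv_cong: "(!!a. A1 <= a ==> a < A2 ==> M a = M' a) ==> lam < NL ==> hv H M Y lam zc code = hv H M' Y lam zc code"
 unfolding hv_def Let_def using T1_addr by (metis le_add1)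

lemma wlk_cong: "(!!a. A1 <= a ==> a < A2 ==> M a = M' a) ==> lam < NL ==> wlk H M Y lam zc r s0 m code = wlk H M' Y lam zc r s0 m code"
 unfolding wlk_def by (induction m) (simp_all add: stp_def Let_def hv_cong[of M M'])

lemma runs_T2:
 assumes M: "st1 sd M0"
  and TT: "!!lam. 2 * J + 4 <= sa lam ==> 2 ^ (k * L - sa lam) * (tCRN + TB2 lam + 4) <= TT"
 shows "runs b inp (T2C k d) K V M0 us (upds (ws2 (hash_of sd) M0) M0) us (NL * (TT + 2 * tOFF + 60) + 11 * k + 30)"
  and "st1 sd (upds (ws2 (hash_of sd) M0) M0)" "a < A2 ==> upds (ws2 (hash_of sd) M0) M0 a = M0 a"
proof -
 let ?H = "hash_of sd"
 \<comment> \<open>\<open>M0\<close> is the memory with completed sample tables. Since everything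
   below \<open>A2\<close> is preserved, walks in the current memory equal walks in
   \<open>M0\<close>, in terms of which the list of writes is fixed.\<close>
 let ?S = "%M. st1 sd M & (ALL a<A2. M a = M0 a)"
 have S1: "?S (upds [w2 ?H M0 lam (crn lam mu) r c] M)" if "lam < NL" "r < R2" "c < m2 lam" "?S M" for lam mu r c M
 proof -
  have a: "A2 <= fst (w2 ?H M0 lam (crn lam mu) r c)" by (simp add: w2_def cell2_def)
  have "c + 1 <= 4 * U" using that(3) m1_le(2)[of lam] U_pos by linarith
  moreover have "A1 <= fst (w2 ?H M0 lam (crn lam mu) r c)" using a addr by linarith
  ultimately have "st1 sd (M(fst (w2 ?H M0 lam (crn lam mu) r c) := c + 1))" using st1_upd that by blast
  then show ?thesis using a that(4) by (simp add: w2_def)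
 qed
 let ?ce = "%x. SUBT (SAE k x) (ADD (MUL (CST 2) (HD 6)) (CST 4))"
 let ?cell = "%x y r c. LET (START y c) (%st. LET (CST 0) (%z0. LET (HD 5) (%m. LET (WALKE k d x y r z0 m st) (%e. CELL2E k d x y r e))))"
 have body: "runs b inp (LAYERC 8 (?ce x) (?cell x y)) K V M us (upds (wb2 ?H M0 lam mu) M) us (TB2 lam)"
   and S3: "?S (upds (wb2 ?H M0 lam mu) M)"
  if lam: "lam < NL" and bg: "2 * J + 4 <= sa lam" and M: "?S M" and v: "x < K" "y < K" "V x = lam" "V y = crn lam mu" for lam mu K V M x y
 proof -
  have R2': "R2 < 2 ^ b" using R2b t_pos by (simp add: distrib_left)
  have m2b: "m2 lam < 2 ^ b" using m1_le(2)[of lam] U_less by linarith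
  have P2: "0 < P2" by (rule P2_pos[OF bg])
  have bl: "2 * J < 2 ^ b" "2 * J + 4 < 2 ^ b" "sa lam < 2 ^ b" using big_less(1) big_less(2)[of lam] by linarith+
  let ?TC = "9 + (1 + (2 + (tW + (tH + 60) + 1) + 1) + 1) + 1"
  have 1: "?S M ==> M 8 = R2" "?S M ==> hdr M" for M using st1D(1) by (auto simp: hdrD)
  have ce: "evals b inp M (?ce x) K' V' (sa lam - (2 * J + 4)) (tOFF + ((1 + 2 + 1) + 1 + 1) + 1)"
   if "?S M" "K <= K'" "!!x. x < K ==> V' x = V x" for M K' V'
   by (intro ev_SUBT ev_ADD ev_MUL ev_SAE ev_HD evals_CST) (use 1(2)[OF that(1)] that v bg bl in "auto simp: hdrD intro: small")
  have cell: "evals b inp M (?cell x y x' y') K' V' (fst (w2 ?H M0 lam (crn lam mu) r c)) ?TC"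
   if "?S M" "r < R2" "c < m2 lam" "K <= x'" "x' < K'" "y' < K'" "!!x. x < K ==> V' x = V x" "V' x' = r" "V' y' = c" for M K' V' r c x' y'
  proof -
   have s2: "hdr M" "dat M" "seeded sd M" "tabs_ok M" using that(1) st1D by blast+
   have c4: "c + 1 <= 4 * U" using that(3) m1_le(2)[of lam] U_pos by linarith
   let ?st = "(c + 1) * U + crn lam mu"
   let ?e = "wlk ?H M0 0 lam (crn lam mu) r 0 t ?st"
   have e: "wlk ?H M 0 lam (crn lam mu) r 0 t ?st = ?e" by (rule wlk_cong) (use that(1) lam in auto)
   have sok: "okc 0 inp ?st" by (rule okc_start[OF c4 crn_less])
   have eok: "okc 0 inp ?e" by (rule wlk_okc[OF sok crn_less])
   show ?thesis unfolding w2_def fst_conv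
   proof (rule ev_LET[where ?v1.0 = "?st"], goal_cases a 3)
    case a show ?case by (rule ev_START) (use s2 v that c4 crn_less in auto)
    case (3 V3)
        show ?case
    proof (rule ev_LET[where ?v1.0 = "0"], goal_cases a 4)
     case a show ?case by (rule evals_CST) simp
     case (4 V4)
     show ?case
     proof (rule ev_LET[where ?v1.0 = "t"], goal_cases a 5)
      case a show ?case by (rule ev_HD) (use s2 in "auto simp: hdrD small")
      case (5 V5)
      show ?case
      proof (rule ev_LET[where ?v1.0 = "?e"], goal_cases a 6)
       case a show ?case
        unfolding e[symmetric] by (rule ev_WALKE[OF s2]) (use v that 3 4 5 lam sok crn_less in auto)
       case (6 V6)
       show ?case
        by (rule ev_CELL2E[OF s2(1-3)]) (use v that 3 4 5 6 lam eok P2 in auto)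
      qed
     qed
    qed
   qed
  qed
  note * = runs_LAYERC[where S = ?S and j = 8 and w = "w2 ?H M0 lam (crn lam mu)" and e = "sa lam - (2 * J + 4)" and R = R2, folded m2_def]
  have 2: "(8::nat) < 2 ^ b" "snd (w2 ?H M0 lam (crn lam mu) r c) = c + 1" for r c by (auto simp: w2_def intro: small)
  show "?S (upds (wb2 ?H M0 lam mu) M)" unfolding wb2_def
   by (rule *(2)) (fact M 1 2 R2' m2b ce cell S1[OF lam])+
  show "runs b inp (LAYERC 8 (?ce x) (?cell x y)) K V M us (upds (wb2 ?H M0 lam mu) M) us (TB2 lam)"
   unfolding wb2_def
  proof (rule runs_weaken[OF *(1) refl refl])
   show "R2 * (m2 lam * (?TC + 8) + (tOFF + ((1 + 2 + 1) + 1 + 1) + 1) + 9) + 5 <= TB2 lam" by (simp add: TB2_def algebra_simps)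
  qed (fact M 1 2 R2' m2b ce cell S1[OF lam])+
 qed
 have S3': "?S (upds (wb2 ?H M0 lam mu) M)" if "lam < NL" "2 * J + 4 <= sa lam" "?S M" for lam mu M
  by (rule S3[where x = 0 and y = 1 and K = 2 and V = "%x. if x = 0 then lam else crn lam mu"]) (use that in auto)
 have h: "?S M ==> hdr M" for M using st1D(1) by blast
 have S0: "?S M0" using M by simp
 show "runs b inp (T2C k d) K V M0 us (upds (ws2 ?H M0) M0) us (NL * (TT + 2 * tOFF + 60) + 11 * k + 30)"
  unfolding T2C_def ws2_def
  by (rule runs_LEVELSC(1)[where S = ?S, OF S0 h body S3' TT])
 have "?S (upds (ws2 ?H M0) M0)"
  unfolding ws2_def by (rule runs_LEVELSC(2)[where S = ?S, OF S0 h body S3' TT])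
 then show "st1 sd (upds (ws2 ?H M0) M0)" "a < A2 ==> upds (ws2 ?H M0) M0 a = M0 a" by auto
qed

end

section \<open>Total cost and resulting memory\<close>

context inst_build begin

text \<open>A shape has \<open>2 ^ (k * L - sa lam)\<close> boxes of \<open>2 ^ sa lam\<close>
  points each. Expenses proportional to the number of points of a box thus add up to
  \<open>U\<close> per shape.\<close>

lemma pow_split: "2 ^ (k * L - sa lam) <= U" "2 ^ (k * L - sa lam) * m1 lam <= 4 * U"
 "2 * J + 4 <= sa lam ==> 2 ^ (k * L - sa lam) * m2 lam * (16 * t * t) = U"
proof -
 show 1: "2 ^ (k * L - sa lam) <= U" by (rule pow_kL) simp
 have "m1 lam <= 2 ^ (sa lam + 2)" unfolding m1_def by (intro power_increasing) auto
 then have "2 ^ (k * L - sa lam) * m1 lam <= 2 ^ (k * L - sa lam) * 2 ^ (sa lam + 2)" by (rule mult_le_mono2)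
 also have "... = 2 ^ (k * L + 2)" using sa_le[of lam] by (simp flip: power_add)
 also have "... = 4 * U" by (simp add: U_def)
 finally show "2 ^ (k * L - sa lam) * m1 lam <= 4 * U" .
 assume bg: "2 * J + 4 <= sa lam"
 have "16 * t * t = 2 ^ (2 * J + 4)" by (simp add: t_def power_add power_mult power2_eq_square mult.commute flip: power_mult_distrib)
 then have "2 ^ (k * L - sa lam) * m2 lam * (16 * t * t) = 2 ^ (k * L - sa lam) * 2 ^ (sa lam - (2 * J + 4)) * 2 ^ (2 * J + 4)"
  by (simp add: m2_def)
 also have "... = 2 ^ (k * L - sa lam + (sa lam - (2 * J + 4)) + (2 * J + 4))" by (simp only: power_add)
 also have "k * L - sa lam + (sa lam - (2 * J + 4)) + (2 * J + 4) = k * L" using bg sa_le[of lam] by simp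
 finally show "2 ^ (k * L - sa lam) * m2 lam * (16 * t * t) = U" by (simp add: U_def)
qed

lemma TT1_bound: "2 ^ (k * L - sa lam) * (tCRN + TB1 lam + 4) <= TT1"
proof -
 let ?X = "2 ^ (k * L - sa lam) :: nat"
 have "?X * (tCRN + TB1 lam + 4) = ?X * (tCRN + 24 + R1 * (tOFF + 40)) + ?X * m1 lam * R1 * (tCELL1 + 20)"
  unfolding TB1_def by (simp add: algebra_simps)
 also have "... <= TT1" unfolding TT1_def by (intro add_mono mult_le_mono pow_split order.refl)
 finally show ?thesis .
qed

text \<open>For each shape, \<open>C2 * t * L\<close> tables with U / (16 t^2) chains of length
  \<open>t\<close> have to be walked. The factors \<open>t\<close> cancel and leave about
  \<open>U\<close> steps up to polylogarithmic factors.\<close>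

lemma TT2_bound: "2 * J + 4 <= sa lam ==> 2 ^ (k * L - sa lam) * (tCRN + TB2 lam + 4) <= TT2 C2"
proof -
 assume bg: "2 * J + 4 <= sa lam"
 let ?X = "2 ^ (k * L - sa lam) :: nat"
 have m2p: "1 <= m2 lam" by (simp add: m2_def)
 have tt: "1 <= t" using t_pos by linarith
 have e: "?X * m2 lam * (16 * t * t) = U" by (rule pow_split(3)[OF bg])
 have "?X * t <= ?X * m2 lam * (16 * t * t)"
 proof -
  have "?X * t = ?X * 1 * (1 * t * 1)" by simp
  also have "... <= ?X * m2 lam * (16 * t * t)" by (intro mult_le_mono m2p tt) auto
  finally show ?thesis .
 qed
 then have X1: "?X * t <= U" unfolding e .
 have "?X * m2 lam * t * t = ?X * m2 lam * (1 * t * t)" by simp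
 also have "... <= ?X * m2 lam * (16 * t * t)" by (intro mult_le_mono) auto
 finally have X2: "?X * m2 lam * t * t <= U" unfolding e .
 have tw: "tW + tH + 130 <= t * (tS + tH + 200)"
 proof -
  have "1 * (tH + 150) <= t * (tH + 150)" by (intro mult_le_mono1 tt)
  then show ?thesis unfolding tW_def by (simp add: algebra_simps)
 qed
 have TB2: "TB2 lam = C2 * t * L * (m2 lam * (tW + tH + 130) + tOFF + 40) + 20"
  by (subst R2_eq[symmetric]) (rule TB2_def)
 have "?X * (tCRN + TB2 lam + 4) = ?X * (tCRN + 24) + (?X * t) * (C2 * L * (tOFF + 40)) + ?X * m2 lam * t * (C2 * L) * (tW + tH + 130)"
  unfolding TB2 by (simp add: algebra_simps)
 also have "... <= U * (tCRN + 24) + U * (C2 * L * (tOFF + 40)) + ?X * m2 lam * t * (C2 * L) * (t * (tS + tH + 200))"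
  by (intro add_mono mult_le_mono pow_split X1 tw order.refl)
 also have "... = U * (tCRN + 24) + U * (C2 * L * (tOFF + 40)) + (?X * m2 lam * t * t) * ((C2 * L) * (tS + tH + 200))"
  by (simp add: algebra_simps)
 also have "... <= U * (tCRN + 24) + U * (C2 * L * (tOFF + 40)) + U * ((C2 * L) * (tS + tH + 200))"
  by (intro add_mono mult_le_mono X2 order.refl)
 also have "... = TT2 C2" unfolding TT2_def by (simp add: algebra_simps)
 finally show ?thesis .
qed

definition Mt1 :: "nat list => nat => nat" where
 "Mt1 us = upds (ws1 (hash_of ((!) us))) (Mst us)"
definition Mfin :: "nat list => nat => nat" where
 "Mfin us = upds (ws2 (hash_of ((!) us)) (Mt1 us)) (Mt1 us)"

lemma st1_Mst: "st1 ((!) us) (Mst us)"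
 unfolding st1_def tabs_ok_def using hdr_Mst dat_Mst seeded_Mst Mst_zero by simp

lemma st1_Mt1: "st1 ((!) us) (Mt1 us)"
 unfolding Mt1_def by (rule runs_T1(2)[OF st1_Mst TT1_bound])

lemma st1_Mfin: "st1 ((!) us) (Mfin us)" "a < A2 ==> Mfin us a = Mt1 us a"
 unfolding Mfin_def by (rule runs_T2(2)[OF st1_Mt1 TT2_bound], assumption, rule runs_T2(3)[OF st1_Mt1 TT2_bound])

lemma build_exec:
 assumes "NS <= length us"
 shows "EX t s. t <= tBUILD C2 & exec b inp (BUILDC ka C1 C2 k d 0) (init_state (%_. 0) us) t s & mem s = Mfin us"
proof -
 have "runs b inp (BUILDC ka C1 C2 k d) 0 (%_. 0) (%_. 0) us (Mfin us) (drop NS us)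
   ((20 * (tHDR + 5) + 5) + (tSORT + (tCOEF + (tSEED + ((NL * (TT1 + 2 * tOFF + 60) + 11 * k + 30) + (NL * (TT2 C2 + 2 * tOFF + 60) + 11 * k + 30))))))"
  unfolding BUILDC_def
 proof (intro runs_CSEQ)
  show "runs b inp (HDRC ka C1 C2 k d 20) 0 (%_. 0) (%_. 0) us (hm 20) us (20 * (tHDR + 5) + 5)" by (rule runs_HDRC) simp
  show "runs b inp (SORTC k) 0 (%_. 0) (hm 20) us (upds wsS (hm 20)) us tSORT" by (rule runs_SORTC[OF hm_hdr]) simp
  show "runs b inp (COEFC k d) 0 (%_. 0) (upds wsS (hm 20)) us (upds wsC (upds wsS (hm 20))) us tCOEF" by (rule runs_COEFC[OF hdr_Mst(1)])
  show "runs b inp SEEDC 0 (%_. 0) (upds wsC (upds wsS (hm 20))) us (Mst us) (drop NS us) tSEED"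
   unfolding Mst_def by (rule runs_SEEDC[OF hdr_Mst(2) assms])
  show "runs b inp (T1C k d) 0 (%_. 0) (Mst us) (drop NS us) (Mt1 us) (drop NS us) (NL * (TT1 + 2 * tOFF + 60) + 11 * k + 30)"
   unfolding Mt1_def by (rule runs_T1(1)[OF st1_Mst TT1_bound])
  show "runs b inp (T2C k d) 0 (%_. 0) (Mt1 us) (drop NS us) (Mfin us) (drop NS us) (NL * (TT2 C2 + 2 * tOFF + 60) + 11 * k + 30)"
   unfolding Mfin_def by (rule runs_T2(1)[OF st1_Mt1 TT2_bound])
 qed
 from this[unfolded runs_def tri_def, rule_format, of "init_state (%_. 0) us"] obtain t s where ts:
  "t <= (20 * (tHDR + 5) + 5) + (tSORT + (tCOEF + (tSEED + ((NL * (TT1 + 2 * tOFF + 60) + 11 * k + 30) + (NL * (TT2 C2 + 2 * tOFF + 60) + 11 * k + 30)))))"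
  "exec b inp (BUILDC ka C1 C2 k d 0) (init_state (%_. 0) us) t s" "mem s = Mfin us"
  by (auto simp: init_state_def cfg_def)
 moreover have "(20 * (tHDR + 5) + 5) + (tSORT + (tCOEF + (tSEED + ((NL * (TT1 + 2 * tOFF + 60) + 11 * k + 30) + (NL * (TT2 C2 + 2 * tOFF + 60) + 11 * k + 30))))) <= tBUILD C2"
  unfolding tBUILD_def by (simp add: algebra_simps)
 ultimately show ?thesis by (meson le_trans)
qed

definition Mq :: "nat list => nat => nat" where
 "Mq us a = (if a < TOT then Mfin us a else 0)"

lemma st1_Mq: "st1 ((!) us) (Mq us)"
proof -
 note s = st1_Mfin(1)[of us]
 have eq: "Mq us a = Mfin us a" if "a < A1" for a using that addr unfolding Mq_def by simp
 have lt: "32 <= CB" "CB <= SB" "SB <= A1" using addr by linarith+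
 have "hdr (Mq us)" using s eq lt unfolding st1_def hdr_def by simp
 moreover have "dat (Mq us)"
 proof -
  have 1: "32 + ((i * 2 ^ L + p) * len + e) < A1" if "i < k" "p < 2 ^ L" "e < len" for i p e
   using sort_addr[OF that] lt by linarith
  have 2: "CB + (idx * len + e) < A1" if "idx < Suc d ^ k" "e < len" for idx e
  proof -
   have "idx * len + e < Suc d ^ k * len" using that by (intro index_le) auto
   then show ?thesis using addr lt by linarith
  qed
  show ?thesis using s 1 2 unfolding st1_def dat_def by (simp add: eq)
 qed
 moreover have "seeded ((!) us) (Mq us)" using s addr eq unfolding st1_def seeded_def by simp
 moreover have "tabs_ok (Mq us)" using s unfolding st1_def tabs_ok_def Mq_def by simp
 ultimately show ?thesis unfolding st1_def by simp
qed

lemma query_exec: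
 assumes "lin 0 l qin" "lin 1 r qin"
  and Y: "take_bit b (nth_default 0 qin (2 * k * len)) = sgn'" "take_bit b (nth_default 0 qin (2 * k * len + (1 + 2 * lim))) = en"
   "sgn' = 0 ==> en = 0 ==> okc Y qin YC"
 shows "EX t s. t <= tQ & exec b qin (QRYE k d 0) (init_state (%a. if a < TOT then Mfin us a else 0) []) t s &
   reg s 0 = of_bool (sgn' = 0 & en = 0 & qry (hash_of ((!) us)) (Mq us) Y l r)"
proof -
 note s = st1_Mq[of us]
 have "evals b qin (Mq us) (QRYE k d) 0 (%_. 0) (of_bool (sgn' = 0 & en = 0 & qry (hash_of ((!) us)) (Mq us) Y l r)) tQ"
  by (rule ev_QRYE[OF st1D(1)[OF s] st1D(2)[OF s] st1D(3)[OF s] st1D(4)[OF s] assms])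
 from this[unfolded evals_def tri_def, rule_format, of "[]" "init_state (Mq us) []"]
 obtain t s where "t <= tQ" "exec b qin (QRYE k d 0) (init_state (Mq us) []) t s"
   "reg s 0 = of_bool (sgn' = 0 & en = 0 & qry (hash_of ((!) us)) (Mq us) Y l r)"
  by (auto simp: init_state_def cfg_def)
 then show ?thesis unfolding Mq_def[abs_def] by blast
qed

end

section \<open>Correctness of the answers\<close>

text \<open>The numbers 1 / (m * (m - 1 choose c)) form Leibniz's harmonic triangle, where an entry
  of column \<open>c + 1\<close> is the difference of two entries of column \<open>c\<close>. A
  common multiple of 1, ..., Q clears the denominators of the first column and hence of all
  columns.\<close>

lemma leibniz_dvd:
 assumes "!!m. 1 <= m ==> m <= Q ==> m dvd D"
 shows "c < m ==> m <= Q ==> EX z::int. real D / (real m * real ((m - 1) choose c)) = of_int z"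
proof (induction c arbitrary: m)
 case 0
 then have "m dvd D" using assms[of m] by simp
 then obtain x where "D = m * x" by blast
 with 0 show ?case by (intro exI[of _ "int x"]) simp
next
 case (Suc c)
 define p where "p = m - 2"
 have m: "m = Suc (Suc p)" "c <= p" using Suc.prems by (auto simp: p_def)
 obtain z1 where z1: "real D / (real (Suc p) * real (p choose c)) = of_int z1"
  using Suc.IH[of "Suc p"] Suc.prems m by auto
 obtain z2 where z2: "real D / (real (Suc (Suc p)) * real (Suc p choose c)) = of_int z2"
  using Suc.IH[of "Suc (Suc p)"] Suc.prems m by auto
 have pos: "0 < real (p choose c)" "0 < real (Suc p choose c)" "0 < real (Suc p choose Suc c)"
  using m by (simp_all del: binomial_Suc_Suc)
 have e1: "real (Suc c) * real (Suc p choose Suc c) = real (Suc p) * real (p choose c)"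
  by (simp only: Suc_times_binomial flip: of_nat_mult)
 have e2: "(real p + 1 - real c) * real (Suc p choose c) = real (Suc p) * real (p choose c)"
 proof -
  have "(Suc p - c) * (Suc p choose c) = Suc p * (p choose c)"
   using binomial_absorb_comp[of "Suc p" c] by simp
  then have "real (Suc p - c) * real (Suc p choose c) = real (Suc p) * real (p choose c)"
   by (metis of_nat_mult)
  moreover have "real (Suc p - c) = real p + 1 - real c" using m by (simp add: of_nat_diff)
  ultimately show ?thesis by simp
 qed
 have "1 / (real (Suc p) * real (p choose c)) - 1 / (real (Suc (Suc p)) * real (Suc p choose c))
   = 1 / (real (Suc (Suc p)) * real (Suc p choose Suc c))"
 proof -
  define X where "X = real (Suc p) * real (p choose c)"
  have X: "0 < X" using pos by (simp add: X_def)
  have c1: "real (Suc p choose Suc c) = X / (real c + 1)" using e1 unfolding X_def[symmetric] by (simp add: field_simps)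
  have pc: "0 < real p + 1 - real c" using m by linarith
  have c2: "real (Suc p choose c) = X / (real p + 1 - real c)" using e2 pc unfolding X_def[symmetric] by (simp add: field_simps)
  have "1 / X - 1 / ((real p + 2) * (X / (real p + 1 - real c))) = 1 / X * (1 - (real p + 1 - real c) / (real p + 2))"
   by (simp add: diff_divide_distrib right_diff_distrib mult.commute)
  also have "1 - (real p + 1 - real c) / (real p + 2) = (real c + 1) / (real p + 2)" by (simp add: field_simps)
  finally show ?thesis unfolding c1 c2 X_def[symmetric] by (simp add: add.commute)
 qed
 then have "real D * (1 / (real (Suc p) * real (p choose c)) - 1 / (real (Suc (Suc p)) * real (Suc p choose c)))
   = real D * (1 / (real (Suc (Suc p)) * real (Suc p choose Suc c)))" by simp
 then have "real D / (real (Suc (Suc p)) * real (Suc p choose Suc c)) = of_int (z1 - z2)"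
  using z1 z2 by (simp add: right_diff_distrib)
 then have "real D / (real m * real (m - 1 choose Suc c)) = of_int (z1 - z2)" using m(1) by (simp del: binomial_Suc_Suc)
 then show ?case by blast
qed

text \<open>By \<open>leibniz_dvd\<close> every \<open>Q * ((Q - 1) choose c)\<close> divides
  \<open>D\<close> and so is at most \<open>D\<close>. Summing over the \<open>Q\<close> values of
  \<open>c\<close> gives \<open>Q * 2 ^ (Q - 1) <= Q * D\<close>.\<close>

lemma common_multiple_ge:
 assumes "!!m. 1 <= m ==> m <= Q ==> m dvd D" "0 < D" "1 <= Q"
 shows "2 ^ (Q - 1) <= D"
proof -
 have le: "Q * ((Q - 1) choose c) <= D" if c: "c < Q" for c
 proof -
  obtain z where z: "real D / (real Q * real ((Q - 1) choose c)) = of_int z"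
   using leibniz_dvd[where Q = Q, OF assms(1) c] by auto
  have p: "0 < real Q * real ((Q - 1) choose c)" using c by simp
  then have "0 < real_of_int z" unfolding z[symmetric] using assms(2) by simp
  then have "1 <= real_of_int z" by simp
  then have "real Q * real ((Q - 1) choose c) <= real D" using p unfolding z[symmetric] by (simp add: field_simps)
  then show ?thesis by (metis of_nat_le_iff of_nat_mult)
 qed
 have "Q * 2 ^ (Q - 1) = (\<Sum>c<Q. Q * ((Q - 1) choose c))"
  using choose_row_sum[of "Q - 1"] assms(3) by (simp add: sum_distrib_left[symmetric] lessThan_Suc_atMost[symmetric])
 also have "... <= (\<Sum>c<Q. D)" by (intro sum_mono le) simp
 finally show ?thesis using assms(3) by simp
qed

text \<open>Otherwise the difference would be a positive common multiple of 1, ..., Q below the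
  bound of \<open>common_multiple_ge\<close>.\<close>

lemma residues_determine:
 assumes "!!m. 1 <= m ==> m <= Q ==> x mod m = y mod m" "x < 2 ^ (Q - 1)" "y < 2 ^ (Q - 1)" "1 <= Q"
 shows "x = (y::nat)"
proof -
 have *: "x = y" if xy: "x <= y" "y < 2 ^ (Q - 1)" and res: "!!m. 1 <= m ==> m <= Q ==> x mod m = y mod m" for x y
 proof (rule ccontr)
  assume "x ~= y"
  then have "0 < y - x" using xy by simp
  moreover have "m dvd y - x" if m: "1 <= m" "m <= Q" for m
   using res[OF m] mod_eq_dvd_iff_nat[OF xy(1), of m] by simp
  ultimately have "2 ^ (Q - 1) <= y - x" by (intro common_multiple_ge assms)
  then show False using xy by simp
 qed
 show ?thesis using *[of x y] *[of y x] assms by (metis nat_le_linear)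
qed

section \<open>Mixed-radix digits and the geometry of boxes\<close>

definition unext :: "(nat => nat) => nat => (nat => nat) => nat" where
 "unext a m x = (\<Sum>i<m. x i * 2 ^ (\<Sum>j<i. a j))"

lemma unext_less: "(!!i. i < m ==> x i < 2 ^ a i) ==> unext a m x < 2 ^ (\<Sum>i<m. a i)"
proof (induction m)
 case (Suc m)
 have "unext a m x < 2 ^ (\<Sum>i<m. a i)" using Suc by simp
 moreover have "Suc (x m) * 2 ^ (\<Sum>i<m. a i) <= 2 ^ a m * 2 ^ (\<Sum>i<m. a i)" using Suc.prems[of m] by (intro mult_le_mono1) simp
 ultimately show ?case by (simp add: unext_def power_add mult.commute)
qed (simp add: unext_def)

lemma unext_ext: "unext a m (ext a h) = h mod 2 ^ (\<Sum>i<m. a i)"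
proof (induction m)
 case (Suc m)
 then show ?case by (simp add: unext_def power_add mod_mult2_eq ext_def)
qed (simp add: unext_def)

lemma ext_unext: "(!!i. i < m ==> x i < 2 ^ a i) ==> i < m ==> ext a (unext a m x) i = x i"
proof (induction m)
 case (Suc m)
 have u: "unext a m x < 2 ^ (\<Sum>i<m. a i)" using Suc.prems by (intro unext_less) simp
 have e: "unext a (Suc m) x = unext a m x + x m * 2 ^ (\<Sum>i<m. a i)" by (simp add: unext_def)
 show ?case
 proof (cases "i = m")
  case True
  then show ?thesis using Suc.prems(1)[of m] u by (simp add: e ext_def)
 next
  case False
  then have i: "i < m" using Suc.prems by simp
  then have "(\<Sum>j<Suc i. a j) <= (\<Sum>i<m. a i)" by (intro sum_mono2) auto
  then obtain c where c: "(\<Sum>i<m. a i) = (\<Sum>j<i. a j) + a i + c"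
   unfolding le_iff_add by (metis sum.lessThan_Suc)
  have "x m * 2 ^ (\<Sum>i<m. a i) = 2 ^ (\<Sum>j<i. a j) * (2 ^ a i * (x m * 2 ^ c))" unfolding c by (simp add: power_add)
  then have e': "unext a (Suc m) x = unext a m x + 2 ^ (\<Sum>j<i. a j) * (2 ^ a i * (x m * 2 ^ c))" unfolding e by (rule arg_cong)
  have "ext a (unext a (Suc m) x) i = (unext a m x div 2 ^ (\<Sum>j<i. a j) + 2 ^ a i * (x m * 2 ^ c)) mod 2 ^ a i"
   unfolding ext_def e' by (subst div_mult_self2) simp_all
  also have "... = ext a (unext a m x) i" by (simp only: ext_def mod_mult_self2)
  also have "... = x i" using Suc i by simp
  finally show ?thesis .
 qed
qed simp

lemma ext_mod: "i < m ==> ext a (h mod 2 ^ (\<Sum>j<m. a j)) i = ext a h i"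
 unfolding unext_ext[symmetric] by (rule ext_unext) (auto simp: ext_def)

lemma fld_ext: "fld L z = ext (%_. L) z"
 by (auto simp: fld_def ext_def)

lemma pack_unext: "pack m L x = unext (%_. L) m x"
 by (auto simp: pack_def unext_def)

lemma fld_pack: "(!!i. i < m ==> x i < 2 ^ L) ==> i < m ==> fld L (pack m L x) i = x i"
 unfolding fld_ext pack_unext by (rule ext_unext)

lemma pack_fld: "z < 2 ^ (m * L) ==> pack m L (fld L z) = z"
 unfolding fld_ext pack_unext unext_ext by simp

lemma pack_add: "pack m L x + pack m L y = pack m L (%i. x i + y i)"
 by (simp add: pack_def sum.distrib algebra_simps)

lemma pack_cong: "(!!i. i < m ==> x i = y i) ==> pack m L x = pack m L y"
 by (simp add: pack_def)

lemma dg_digits: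
 assumes "!!i. i < m ==> x i < v"
 shows "EX h<v ^ m. ALL i<m. dg v h i = x i"
 using assms
proof (induction m)
 case (Suc m)
 then obtain h where h: "h < v ^ m" "ALL i<m. dg v h i = x i" by auto
 have v: "0 < v" using Suc.prems[of 0] by simp
 let ?h = "h + x m * v ^ m"
 have "Suc (x m) * v ^ m <= v * v ^ m" using Suc.prems[of m] by (intro mult_le_mono1) simp
 then have "?h < v ^ Suc m" using h by simp
 moreover have "dg v ?h i = x i" if i: "i < Suc m" for i
 proof (cases "i = m")
  case True
  then show ?thesis using h v Suc.prems[of m] by (simp add: dg_def)
 next
  case False
  then have "v ^ m = v ^ i * (v * v ^ (m - Suc i))" using i by (simp flip: power_add power_Suc)
  then have "?h = h + v ^ i * (v * (x m * v ^ (m - Suc i)))" by simp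
  then have "?h div v ^ i = h div v ^ i + v * (x m * v ^ (m - Suc i))" using v by (simp only: div_mult_self2) simp
  then show ?thesis using h i False by (simp add: dg_def)
 qed
 ultimately show ?case by blast
qed simp

context inst_ok begin

lemma lev_compl: "(\<Sum>i<k. L - lev lam i) = k * L - sa lam" "lev lam i + (L - lev lam i) = L"
proof -
 have "(\<Sum>i<k. L - lev lam i) + sa lam = (\<Sum>i<k. L)"
  unfolding sa_def sum.distrib[symmetric] using lev_le by (intro sum.cong) auto
 then show "(\<Sum>i<k. L - lev lam i) = k * L - sa lam" by simp
 show "lev lam i + (L - lev lam i) = L" using lev_le by simp
qed

lemma dep_mod: "dep lam (h mod 2 ^ sa lam) = dep lam h"
 unfolding dep_def sa_def by (intro pack_cong ext_mod)

lemma crn_ub: "ext (%j. L - lev lam j) mu i * 2 ^ lev lam i + 2 ^ lev lam i <= 2 ^ L"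
proof -
 have "Suc (ext (%j. L - lev lam j) mu i) * 2 ^ lev lam i <= 2 ^ (L - lev lam i) * 2 ^ lev lam i"
  by (intro mult_le_mono1) (use ext_less[of "%j. L - lev lam j" mu i] in simp)
 also have "... = 2 ^ L" using lev_compl(2)[of lam i] by (simp add: add.commute flip: power_add)
 finally show ?thesis by simp
qed

lemma fld_crn: "i < k ==> fld L (crn lam mu) i = ext (%j. L - lev lam j) mu i * 2 ^ lev lam i"
 unfolding crn_def by (rule fld_pack) (rule crn_field_less)

text \<open>By \<open>crn_ub\<close> a corner leaves room for a full block in every field, so adding
  an offset produces no carry between fields.\<close>

lemma fld_pt: "i < k ==> fld L (crn lam mu + dep lam h) i = fld L (crn lam mu) i + ext (lev lam) h i"
 and pt_less: "crn lam mu + dep lam h < U"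
proof -
 let ?f = "%i. ext (%j. L - lev lam j) mu i * 2 ^ lev lam i + ext (lev lam) h i"
 have l: "?f i < 2 ^ L" for i using crn_ub[of lam mu i] ext_less[of "lev lam" h i] by linarith
 have e: "crn lam mu + dep lam h = pack k L ?f" unfolding crn_def dep_def pack_add ..
 show "crn lam mu + dep lam h < U" unfolding e U_def by (rule pack_less) (rule l)
 show "i < k ==> fld L (crn lam mu + dep lam h) i = fld L (crn lam mu) i + ext (lev lam) h i"
  unfolding e fld_crn by (rule fld_pack) (rule l)
qed

lemma crn_inj: "mu < 2 ^ (k * L - sa lam) ==> mu' < 2 ^ (k * L - sa lam) ==> crn lam mu = crn lam mu' ==> mu = mu'"
proof -
 assume h: "mu < 2 ^ (k * L - sa lam)" "mu' < 2 ^ (k * L - sa lam)" "crn lam mu = crn lam mu'"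
 let ?e = "ext (%j. L - lev lam j)"
 have "?e mu i = ?e mu' i" if "i < k" for i
  using fld_crn[OF that, of lam mu] fld_crn[OF that, of lam mu'] h(3) by simp
 then have "unext (%j. L - lev lam j) k (?e mu) = unext (%j. L - lev lam j) k (?e mu')" unfolding unext_def by simp
 then show "mu = mu'" using h unfolding unext_ext lev_compl by simp
qed

lemma crn_surj:
 assumes "!!i. i < k ==> C i = c i * 2 ^ lev lam i" "!!i. i < k ==> C i + 2 ^ lev lam i <= 2 ^ L"
 shows "EX mu<2 ^ (k * L - sa lam). crn lam mu = pack k L C"
proof -
 have l: "c i < 2 ^ (L - lev lam i)" if i: "i < k" for i
 proof -
  have "Suc (c i) * 2 ^ lev lam i <= 2 ^ L" using assms[OF i] by simp
  also have "... = 2 ^ (L - lev lam i) * 2 ^ lev lam i" using lev_compl(2)[of lam i] by (simp add: add.commute flip: power_add)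
  finally show ?thesis by (metis Suc_le_eq mult_le_cancel2 zero_less_power zero_less_numeral)
 qed
 let ?mu = "unext (%j. L - lev lam j) k c"
 have "?mu < 2 ^ (k * L - sa lam)" unfolding lev_compl(1)[symmetric] by (rule unext_less) (rule l)
 moreover have "crn lam ?mu = pack k L C" unfolding crn_def
 proof (rule pack_cong)
  fix i assume i: "i < k"
  show "ext (%j. L - lev lam j) ?mu i * 2 ^ lev lam i = C i"
   unfolding assms(1)[OF i] by (subst ext_unext) (use i l in auto)
 qed
 ultimately show ?thesis by blast
qed

lemma box_iff:
 assumes "z < U" "!!i. i < k ==> fld L (crn lam mu) i <= fld L z i & fld L z i < fld L (crn lam mu) i + 2 ^ lev lam i"
 shows "EX h<2 ^ sa lam. z = crn lam mu + dep lam h"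
proof -
 let ?x = "%i. fld L z i - fld L (crn lam mu) i"
 have l: "?x i < 2 ^ lev lam i" if "i < k" for i using assms(2)[OF that] by linarith
 let ?h = "unext (lev lam) k ?x"
 have h: "?h < 2 ^ sa lam" unfolding sa_def by (rule unext_less) (rule l)
 have f: "fld L (crn lam mu + dep lam ?h) i = fld L z i" if i: "i < k" for i
 proof -
  have "ext (lev lam) ?h i = ?x i" by (rule ext_unext) (use i l in auto)
  then show ?thesis unfolding fld_pt[OF i] using assms(2)[OF i] by linarith
 qed
 have "pack k L (fld L (crn lam mu + dep lam ?h)) = pack k L (fld L z)" by (rule pack_cong) (rule f)
 then have eq: "crn lam mu + dep lam ?h = z"
  unfolding pack_fld[OF assms(1)[unfolded U_def]] pack_fld[OF pt_less[unfolded U_def]] .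
 show ?thesis by (rule exI[of _ ?h]) (rule conjI[OF h eq[symmetric]])
qed

lemma pt_range: "i < k ==> fld L (crn lam mu) i <= fld L (crn lam mu + dep lam h) i &
  fld L (crn lam mu + dep lam h) i < fld L (crn lam mu) i + 2 ^ lev lam i"
 using fld_pt[of i lam mu h] ext_less[of "lev lam" h i] by simp

text \<open>\<open>2 ^ sa lam\<close> divides \<open>2 ^ b\<close>, so a uniform word selects a
  uniform point of the box.\<close>

lemma avg_pt:
 "avg (2 ^ b) (%w. of_bool (X (zc + dep lam w))) = real (card {h. h < 2 ^ sa lam & X (zc + dep lam h)}) / 2 ^ sa lam"
proof -
 have "sa lam <= b" using sa_le[of lam] kLb by linarith
 then have W: "(2::nat) ^ sa lam dvd 2 ^ b" by (rule le_imp_power_dvd)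
 note E = expct_avg[of "2 ^ b"]
 have "avg (2 ^ b) (%w. of_bool (X (zc + dep lam w))) =
  avg (2 ^ b) (%w. \<Sum>h\<in>{h. h < 2 ^ sa lam & X (zc + dep lam h)}. of_bool (w mod 2 ^ sa lam = h))"
 proof (rule E_cong[OF E])
  fix w
  have "of_bool (X (zc + dep lam w)) = (of_bool (X (zc + dep lam (w mod 2 ^ sa lam))) :: real)" by (simp add: dep_mod)
  also have "... = of_bool (w mod 2 ^ sa lam \<in> {h. h < 2 ^ sa lam & X (zc + dep lam h)})" by simp
  also have "... = (\<Sum>h\<in>{h. h < 2 ^ sa lam & X (zc + dep lam h)}. of_bool (w mod 2 ^ sa lam = h))"
   by (simp add: of_bool_def)
  finally show "of_bool (X (zc + dep lam w)) = (\<Sum>h\<in>{h. h < 2 ^ sa lam & X (zc + dep lam h)}. of_bool (w mod 2 ^ sa lam = h) :: real)" .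
 qed simp
 also have "... = (\<Sum>h\<in>{h. h < 2 ^ sa lam & X (zc + dep lam h)}. 1 / real (2 ^ sa lam))"
 proof -
  let ?I = "{h. h < 2 ^ sa lam & X (zc + dep lam h)}"
  have "finite ?I" by simp
  then have "avg (2 ^ b) (%w. \<Sum>h\<in>?I. of_bool (w mod 2 ^ sa lam = h)) = (\<Sum>h\<in>?I. avg (2 ^ b) (%w. of_bool (w mod 2 ^ sa lam = h)))"
   by (rule E_sum[OF E, rotated]) simp
  also have "... = (\<Sum>h\<in>?I. 1 / real (2 ^ sa lam))" by (intro sum.cong refl avg_mod W) auto
  finally show ?thesis .
 qed
 finally show ?thesis by simp
qed

end

section \<open>What a key determines\<close>

locale inst_math = inst_build +
 assumes pv_less: "z < U ==> pv z < 2 ^ (b * lim)"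
begin

lemma U_le_YC: "z < U ==> z ~= YC"
 using YC_less by auto

lemma key_in: "kf Y zc code \<in> keys_of NP Q"
 unfolding keys_of_def by (auto simp: kf_def comp_less)

lemma kf_indep: "code ~= YC ==> kf Y zc code = kf Y' zc code"
 by (simp add: kf_def comp_def)

lemma bits_eq: "x < 2 ^ b ==> y < 2 ^ b ==> (!!q. q < b ==> x div 2 ^ q mod 2 = y div 2 ^ q mod 2) ==> x = (y::nat)"
 by (rule bit_eqI) (metis bit_iff_odd odd_iff_mod_2_eq_one take_bit_nat_eq_self bit_take_bit_iff)

text \<open>The choice \<open>Q = b * lim + 2\<close> makes \<open>2 ^ (Q - 1)\<close> larger than
  every value of \<open>lim\<close> words, as \<open>residues_determine\<close> requires.\<close>

lemma val_resid: "x < 2 ^ (b * lim) ==> y < 2 ^ (b * lim) ==> (!!q. b <= q ==> q < NP ==> x mod (q - b + 1) = y mod (q - b + 1)) ==> x = y"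
proof (rule residues_determine[where Q = Q])
 assume h: "x < 2 ^ (b * lim)" "y < 2 ^ (b * lim)" "!!q. b <= q ==> q < NP ==> x mod (q - b + 1) = y mod (q - b + 1)"
 have "2 ^ (b * lim) <= (2::nat) ^ (Q - 1)" unfolding Q_eq by (intro power_increasing) auto
 then show "x < 2 ^ (Q - 1)" "y < 2 ^ (Q - 1)" using h by linarith+
 fix m assume "1 <= m" "m <= Q"
 then show "x mod m = y mod m" using h(3)[of "b + m - 1"] by (simp add: NP_def)
qed (use Q2 in simp)

definition val :: "nat => nat => nat" where "val Y code = (if code = YC then Y else pv code)"

lemma comp_val: "code < U \<or> code = YC ==> comp Y zc code q = (if q < b then zc div 2 ^ q mod 2 else val Y code mod (q - b + 1))"
 using U_le_YC by (auto simp: comp_def val_def)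

text \<open>The bits recover the corner and the residues recover the value. Points of a box with the
  same value are thereby identified, and chains effectively run on values.\<close>

lemma kf_eq:
 assumes "u < U \<or> u = YC" "v < U \<or> v = YC" "Y < 2 ^ (b * lim)" "Y' < 2 ^ (b * lim)" "zc < U" "zc' < U"
 shows "kf Y zc u = kf Y' zc' v \<longleftrightarrow> zc = zc' & val Y u = val Y' v"
proof
 assume e: "kf Y zc u = kf Y' zc' v"
 then have c: "comp Y zc u q = comp Y' zc' v q" if "q < NP" for q
  using kf_nth[OF that] by metis
 have "zc = zc'"
 proof (rule bits_eq)
  show "zc < 2 ^ b" "zc' < 2 ^ b" using assms U_less by linarith+
  show "zc div 2 ^ q mod 2 = zc' div 2 ^ q mod 2" if "q < b" for q
   using c[of q] that assms(1,2) NP_pos by (simp add: comp_val)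
 qed
 moreover have "val Y u = val Y' v"
 proof (rule val_resid)
  show "val Y u < 2 ^ (b * lim)" "val Y' v < 2 ^ (b * lim)" using assms pv_less by (auto simp: val_def)
  show "val Y u mod (q - b + 1) = val Y' v mod (q - b + 1)" if "b <= q" "q < NP" for q
   using c[of q] that assms(1,2) by (simp add: comp_val)
 qed
 ultimately show "zc = zc' & val Y u = val Y' v" by blast
next
 assume "zc = zc' & val Y u = val Y' v"
 then show "kf Y zc u = kf Y' zc' v" using assms by (auto simp: kf_def comp_val)
qed

text \<open>The bits in the key of a start spell the start itself, which is at least
  \<open>U\<close>; those of a point or of \<open>y\<close> spell a corner, which is below
  \<open>U\<close>.\<close>

lemma kf_start:
 assumes "U <= u" "u < YC" "v < U \<or> v = YC" "zc' < U"
 shows "kf Y zc u ~= kf Y' zc' v"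
proof
 assume e: "kf Y zc u = kf Y' zc' v"
 have "u = zc'"
 proof (rule bits_eq)
  show "u < 2 ^ b" "zc' < 2 ^ b" using assms YC_less U_less by linarith+
  fix q assume q: "q < b"
  then have "comp Y zc u q = comp Y' zc' v q" using e kf_nth[of q] NP_pos by (metis less_trans)
  then show "u div 2 ^ q mod 2 = zc' div 2 ^ q mod 2" using q assms by (simp add: comp_val comp_def)
 qed
 then show False using assms by linarith
qed

lemma kf_start_start:
 assumes "U <= u" "u < YC" "U <= v" "v < YC" "kf Y zc u = kf Y' zc' v"
 shows "u = v"
proof (rule bits_eq)
 show "u < 2 ^ b" "v < 2 ^ b" using assms YC_less by linarith+
 fix q assume q: "q < b"
 then have "comp Y zc u q = comp Y' zc' v q" using assms(5) kf_nth[of q] NP_pos by (metis less_trans)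
 then show "u div 2 ^ q mod 2 = v div 2 ^ q mod 2" using q assms by (simp add: comp_def)
qed

end

text \<open>Take the largest aligned block around \<open>x\<close> inside the interval; its parent
  sticks out. If the block is a left child, the parent sticks out above, and the block is the last
  one that ends by \<open>hi\<close>. If it is a right child, the parent sticks out below, and the
  block is the first one that begins at or after \<open>lo\<close>.\<close>

lemma dyadic_cover:
 fixes lo x hi L :: nat
 assumes "lo <= x" "x < hi" "hi < 2 ^ L"
 shows "EX a<=L. EX c. c <= x & x < c + 2 ^ a & lo <= c & c + 2 ^ a <= hi &
   (c = (lo + 2 ^ a - 1) div 2 ^ a * 2 ^ a \<or> (0 < hi div 2 ^ a & c = (hi div 2 ^ a - 1) * 2 ^ a))"
proof -
 define ins where "ins a \<longleftrightarrow> lo <= x div 2 ^ a * 2 ^ a & x div 2 ^ a * 2 ^ a + 2 ^ a <= hi" for a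
 have 0: "ins 0" using assms by (simp add: ins_def)
 have "~ ins L" using assms by (simp add: ins_def)
 then obtain a where a: "ins a" "~ ins (Suc a)" "a < L"
 proof -
  have "EX a<L. ins a & ~ ins (Suc a)"
   using 0 \<open>~ ins L\<close> by (induction L) (auto, metis less_Suc_eq)
  then show ?thesis using that by blast
 qed
 define P where "P = (2::nat) ^ a"
 have P: "0 < P" by (simp add: P_def)
 define q where "q = x div P"
 have x: "q * P <= x" "x < q * P + P" unfolding q_def using P
  by (simp_all add: div_times_less_eq_dividend) (metis add.commute dividend_less_div_times)
 have in1: "lo <= q * P" "q * P + P <= hi" using a(1) by (simp_all add: ins_def q_def P_def)
 have qq: "x div 2 ^ Suc a = q div 2" unfolding q_def P_def by (simp only: power_Suc2 div_mult2_eq)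
 have out: "~ (lo <= q div 2 * (2 * P) & q div 2 * (2 * P) + 2 * P <= hi)"
  using a(2) unfolding ins_def qq by (simp add: P_def)
 have "q * P = (lo + P - 1) div P * P \<or> (0 < hi div P & q * P = (hi div P - 1) * P)"
 proof (cases "even q")
  case True
  then obtain q' where q': "q = 2 * q'" by blast
  have "hi < q * P + 2 * P" using out in1 unfolding q' by (auto simp: algebra_simps)
  then have "hi < (q + 2) * P" by (simp add: algebra_simps)
  moreover have "(q + 1) * P <= hi" using in1 by (simp add: algebra_simps)
  ultimately have "hi div P = q + 1" using P by (intro div_nat_eqI) (simp_all add: algebra_simps)
  then show ?thesis by simp
 next
  case False
  then obtain q' where q': "q = 2 * q' + 1" using oddE by blast
  have "q div 2 * (2 * P) + 2 * P = q * P + P" unfolding q' by (simp add: algebra_simps)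
  then have "q div 2 * (2 * P) < lo" using out in1 by linarith
  then have l: "q * P < lo + P" unfolding q' by (simp add: algebra_simps)
  have "(lo + P - 1) div P = q"
  proof (rule div_nat_eqI)
   show "P * q <= lo + P - 1" using l by (simp add: mult.commute)
   show "lo + P - 1 < P * Suc q" using in1 P by (simp add: mult.commute)
  qed
  then show ?thesis by simp
 qed
 then show ?thesis using a(3) x in1 unfolding P_def by (intro exI[of _ a] conjI exI[of _ "q * 2 ^ a"]) auto
qed

section \<open>Soundness and completeness of the answers\<close>

context inst_math begin

lemma start_bounds:
 assumes "0 < c" "c <= 4 * U" "zc < U"
 shows "U <= c * U + zc" "c * U + zc < YC" "c * U + zc ~= YC"
proof -
 have "1 * U <= c * U" using assms by (intro mult_le_mono1) simp
 then show "U <= c * U + zc" unfolding mult_1 by (rule trans_le_add1)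
 show "c * U + zc < YC" by (rule start_code[OF assms(2,3)])
 then show "c * U + zc ~= YC" by simp
qed

text \<open>Lookups and walks see a code only through its key. A query may therefore start from
  \<open>y\<close> in place of an unknown point with this value, and \<open>Y\<close> may be
  exchanged for 0 when keys of points and starts are compared.\<close>

lemma hv_kf_cong:
 assumes T: "tabs_ok T" and z: "zc < U" and pt: "!!h. zc + dep lam h < U" and e: "kf Y zc u = kf Y' zc v"
 shows "hv H T Y lam zc u = hv H T Y' lam zc v"
proof -
 have le: "T (A1 + x) <= 4 * U" for x using T unfolding tabs_ok_def by simp
 have "c * U + zc ~= YC" if "c <= 4 * U" for c using start_code[OF that z] by simp
 then have s: "kf Y zc (T (A1 + x) * U + zc) = kf Y' zc (T (A1 + x) * U + zc)" for x
  using le by (intro kf_indep) blast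
 have p: "kf Y zc (zc + dep lam h) = kf Y' zc (zc + dep lam h)" for h
  by (intro kf_indep U_le_YC pt)
 show ?thesis unfolding hv_def Let_def e s p ..
qed

lemma stp_kf_cong:
 assumes T: "tabs_ok T" and z: "zc < U" and pt: "!!h. zc + dep lam h < U" and e: "kf Y zc u = kf Y' zc v"
 shows "kf Y zc (stp H T Y lam zc r s u) = kf Y' zc (stp H T Y' lam zc r s v)"
proof -
 have p: "kf Y zc (zc + dep lam h) = kf Y' zc (zc + dep lam h)" for h
  by (intro kf_indep U_le_YC pt)
 show ?thesis unfolding stp_def Let_def e using hv_kf_cong[OF T z pt p] p e by simp
qed

lemma wlk_Suc: "wlk H T Y lam zc r s0 (Suc m) u = stp H T Y lam zc r (s0 + m) (wlk H T Y lam zc r s0 m u)"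
 by (simp add: wlk_def)

lemma wlk_kf_cong:
 assumes T: "tabs_ok T" and z: "zc < U" and pt: "!!h. zc + dep lam h < U" and e: "kf Y zc u = kf Y' zc v"
 shows "kf Y zc (wlk H T Y lam zc r s0 m u) = kf Y' zc (wlk H T Y' lam zc r s0 m v)"
proof (induction m)
 case (Suc m)
 show ?case unfolding wlk_Suc by (rule stp_kf_cong[OF T z pt Suc])
qed (simp add: wlk_def e)

lemma wlk_add: "wlk H T Y lam zc r s0 (m + m') u = wlk H T Y lam zc r (s0 + m) m' (wlk H T Y lam zc r s0 m u)"
 by (induction m') (simp_all add: wlk_def add.assoc)

lemma wlk_range: "wlk H T Y lam zc r s0 m u = u \<or> (EX h. wlk H T Y lam zc r s0 m u = zc + dep lam h)"
proof (induction m)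
 case (Suc m)
 have "stp H T Y lam zc r s v = v \<or> (EX h. stp H T Y lam zc r s v = zc + dep lam h)" for s v
  unfolding stp_def Let_def by auto
 then show ?case using Suc unfolding wlk_def by simp metis
qed (simp add: wlk_def)

lemma pt_val:
 assumes Y: "Y < 2 ^ (b * lim)" and e: "kf Y (crn lam mu) (crn lam mu + dep lam h) = kf Y (crn lam mu) YC"
 shows "EX h<2 ^ sa lam. pv (crn lam mu + dep lam h) = Y"
proof -
 have "val Y (crn lam mu + dep lam h) = val Y YC"
  using e kf_eq[of "crn lam mu + dep lam h" YC Y Y "crn lam mu" "crn lam mu"] pt_less crn_less Y by simp
 then have "pv (crn lam mu + dep lam (h mod 2 ^ sa lam)) = Y" using U_le_YC[OF pt_less, of lam mu h] by (simp add: val_def dep_mod)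
 then show ?thesis by (intro exI[of _ "h mod 2 ^ sa lam"]) simp
qed

text \<open>This holds for all seeds: acceptance requires the key of \<open>y\<close> to equal the
  key of a recomputed code. That code cannot be a start, whose key is different, so it is a point of
  the box.\<close>

lemma qbox_sound:
 assumes T: "tabs_ok M" and Y: "Y < 2 ^ (b * lim)" and q: "qbox H M Y lam (crn lam mu)"
 shows "EX h<2 ^ sa lam. pv (crn lam mu + dep lam h) = Y"
proof (cases "sa lam < 2 * J + 4")
 case True
 then show ?thesis using q pt_val[OF Y] unfolding qbox_def by auto
next
 case False
 let ?zc = "crn lam mu"
 consider "hv H M Y lam ?zc YC" | r s where "r < R2" "s < t"
  "0 < M (cell2 H Y lam ?zc r (wlk H M Y lam ?zc r (s + 1) (t - (s + 1)) YC))"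
  "kf Y ?zc (wlk H M Y lam ?zc r 0 (s + 1) (M (cell2 H Y lam ?zc r (wlk H M Y lam ?zc r (s + 1) (t - (s + 1)) YC)) * U + ?zc)) = kf Y ?zc YC"
  using q False unfolding qbox_def Let_def by auto
 then show ?thesis
 proof cases
  case 1
  then show ?thesis using pt_val[OF Y] unfolding hv_def Let_def by blast
 next
  case 2
  define c where "c = M (cell2 H Y lam ?zc r (wlk H M Y lam ?zc r (s + 1) (t - (s + 1)) YC))"
  have c: "0 < c" "kf Y ?zc (wlk H M Y lam ?zc r 0 (s + 1) (c * U + ?zc)) = kf Y ?zc YC" using 2 by (simp_all only: c_def)
  have c4: "c <= 4 * U" using T addr unfolding c_def tabs_ok_def cell2_def by simp
  have "kf Y ?zc (c * U + ?zc) ~= kf Y ?zc YC"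
   by (rule kf_start) (use start_bounds[OF c(1) c4 crn_less] crn_less in auto)
  then show ?thesis using wlk_range[of H M Y lam ?zc r 0 "s + 1" "c * U + ?zc"] c(2) pt_val[OF Y] by metis
 qed
qed

lemma wsL_iff: "x \<in> set (wsL wb) \<longleftrightarrow> (EX lam<NL. 2 * J + 4 <= sa lam & (EX mu<2 ^ (k * L - sa lam). x \<in> set (wb lam mu)))"
 unfolding wsL_def by (auto simp: atLeast0LessThan not_less split: if_splits)

lemma ws1_iff: "x \<in> set (ws1 H) \<longleftrightarrow> (EX lam<NL. 2 * J + 4 <= sa lam & (EX mu<2 ^ (k * L - sa lam). EX r<R1. EX c<m1 lam. x = w1 H lam (crn lam mu) r c))"
 unfolding ws1_def wsL_iff wb1_def by (auto simp: atLeast0LessThan)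

lemma ws2_iff: "x \<in> set (ws2 H T) \<longleftrightarrow> (EX lam<NL. 2 * J + 4 <= sa lam & (EX mu<2 ^ (k * L - sa lam). EX r<R2. EX c<m2 lam. x = w2 H T lam (crn lam mu) r c))"
 unfolding ws2_def wsL_iff wb2_def by (auto simp: atLeast0LessThan)

lemma table_inj:
 assumes "(lam * R + r) * P + x mod P = (lam' * R + r') * P + x' mod P" "r < R" "r' < R" "0 < (P::nat)"
 shows "lam = lam' & r = r' & x mod P = x' mod P"
proof -
 have 1: "lam * R + r = lam' * R + r' & x mod P = x' mod P"
  by (rule index_inj[OF assms(1)]) (use assms(4) in auto)
 then have "lam = lam' & r = r'" using index_inj[of lam R r lam' r'] assms by blast
 with 1 show ?thesis by blast
qed

definition start :: "nat => nat => nat" where "start zc c = (c + 1) * U + zc"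

text \<open>The point \<open>h\<close> of the box \<open>mu\<close> at level \<open>lam\<close> is heavy or on a chain whose end cell is not shared.\<close>

definition
 "found H T lam mu h r \<longleftrightarrow> (let zc = crn lam mu in EX c<m2 lam. EX s<t.
   kf 0 zc (wlk H T 0 lam zc r 0 (s + 1) (start zc c)) = kf 0 zc (zc + dep lam h) &
   (ALL mu'<2 ^ (k * L - sa lam). ALL c'<m2 lam. (mu', c') ~= (mu, c) -->
    cell2 H 0 lam zc r (wlk H T 0 lam zc r 0 t (start zc c)) ~= cell2 H 0 lam (crn lam mu') r (wlk H T 0 lam (crn lam mu') r 0 t (start (crn lam mu') c'))))"

lemma m2_le: "2 * J + 4 <= sa lam ==> m2 lam <= U"
 unfolding m2_def by (rule pow_kL) (use sa_le[of lam] in linarith)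

lemma P2_pos: "2 * J + 4 <= sa lam ==> 0 < P2"
proof -
 assume "2 * J + 4 <= sa lam"
 then have "2 ^ (2 * J + 1) <= U" by (intro pow_kL) (use sa_le[of lam] in linarith)
 then show ?thesis by (simp add: P2_def div_greater_zero_iff)
qed

lemma Mq_eq: "a < TOT ==> Mq us a = Mfin us a"
 by (simp add: Mq_def)

lemma Mq_Mt1: "a < A2 ==> Mq us a = Mt1 us a"
 using addr st1_Mfin(2)[of a us] by (simp add: Mq_def)

text \<open>Consider an unshared chain that meets the target in step \<open>s + 1\<close>. The walk
  from \<open>y\<close> has the keys of the rest of this chain, so it arrives at the same end cell
  and reads the counter of the chain there.\<close>

lemma qbox_complete:
 assumes lam: "lam < NL" and mu: "mu < 2 ^ (k * L - sa lam)" and h: "h < 2 ^ sa lam"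
  and good: "2 * J + 4 <= sa lam ==> hv (hash_of ((!) us)) (Mt1 us) 0 lam (crn lam mu) (crn lam mu + dep lam h) \<or>
   (EX r<R2. found (hash_of ((!) us)) (Mt1 us) lam mu h r)"
 shows "qbox (hash_of ((!) us)) (Mq us) (pv (crn lam mu + dep lam h)) lam (crn lam mu)"
proof -
 let ?zc = "crn lam mu" and ?z = "crn lam mu + dep lam h" and ?H = "hash_of ((!) us)"
 let ?Y = "pv ?z"
 have Y: "?Y < 2 ^ (b * lim)" by (rule pv_less[OF pt_less])
 have key: "kf 0 ?zc ?z = kf ?Y ?zc YC"
  using kf_eq[of ?z YC 0 ?Y ?zc ?zc] pt_less[of lam mu h] crn_less Y U_le_YC[OF pt_less] by (simp add: val_def)
 have keyY: "kf ?Y ?zc ?z = kf ?Y ?zc YC" unfolding key[symmetric] by (rule kf_indep[OF U_le_YC[OF pt_less]])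
 have T: "tabs_ok (Mq us)" "tabs_ok (Mt1 us)" using st1_Mq[of us] st1_Mt1[of us] by (auto simp: st1_def)
 show ?thesis
 proof (cases "sa lam < 2 * J + 4")
  case True
  then show ?thesis using h keyY unfolding qbox_def by auto
 next
  case False
  then have bg: "2 * J + 4 <= sa lam" by simp
  have hvM: "hv ?H (Mq us) Y' lam zc u = hv ?H (Mt1 us) Y' lam zc u" for Y' zc u
   by (rule hv_cong) (use lam Mq_Mt1 in auto)
  have wlkM: "wlk ?H (Mq us) Y' lam zc r s m u = wlk ?H (Mt1 us) Y' lam zc r s m u" for Y' zc r s m u
   by (rule wlk_cong) (use lam Mq_Mt1 in auto)
  consider "hv ?H (Mt1 us) 0 lam ?zc ?z" | r where "r < R2" "found ?H (Mt1 us) lam mu h r" using good[OF bg] by blast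
  then show ?thesis
  proof cases
   case 1
   then have "hv ?H (Mq us) ?Y lam ?zc YC" unfolding hvM using hv_kf_cong[OF T(2) crn_less pt_less key] by simp
   then show ?thesis using False unfolding qbox_def by simp
  next
   case 2
   obtain c s where c: "c < m2 lam" "s < t"
    and ks: "kf 0 ?zc (wlk ?H (Mt1 us) 0 lam ?zc r 0 (s + 1) (start ?zc c)) = kf 0 ?zc ?z"
    and un: "!!mu' c'. mu' < 2 ^ (k * L - sa lam) ==> c' < m2 lam ==>
     cell2 ?H 0 lam ?zc r (wlk ?H (Mt1 us) 0 lam ?zc r 0 t (start ?zc c)) = cell2 ?H 0 lam (crn lam mu') r (wlk ?H (Mt1 us) 0 lam (crn lam mu') r 0 t (start (crn lam mu') c'))
     ==> (mu', c') = (mu, c)"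
    using 2(2) unfolding found_def Let_def by blast
   let ?a = "cell2 ?H 0 lam ?zc r (wlk ?H (Mt1 us) 0 lam ?zc r 0 t (start ?zc c))"
   have stc: "start ?zc c ~= YC" "U <= start ?zc c" unfolding start_def
    using start_bounds[of "c + 1" ?zc] c m2_le[OF bg] U_pos crn_less[of lam mu] by auto
   have kst: "kf 0 ?zc (start ?zc c) = kf ?Y ?zc (start ?zc c)" by (rule kf_indep[OF stc(1)])
   have P2p: "0 < P2" by (rule P2_pos[OF bg])
   \<comment> \<open>No other value is written to this cell: other shapes and other tables occupy
     other addresses, and within this table \<open>found\<close> excludes all other chains.\<close>
   have "upds (ws2 ?H (Mt1 us)) (Mt1 us) ?a = c + 1"
   proof (rule upds_unique)
    show "(?a, c + 1) \<in> set (ws2 ?H (Mt1 us))" unfolding ws2_iff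
     using lam bg mu 2(1) c(1) by (intro exI[of _ lam] exI[of _ mu] exI[of _ r] exI[of _ c] conjI) (auto simp: w2_def start_def)
    fix v' assume "(?a, v') \<in> set (ws2 ?H (Mt1 us))"
    then obtain lam' mu' r' c' where w: "lam' < NL" "mu' < 2 ^ (k * L - sa lam')" "r' < R2" "c' < m2 lam'"
     "(?a, v') = w2 ?H (Mt1 us) lam' (crn lam' mu') r' c'" unfolding ws2_iff by blast
    then have ad: "?a = cell2 ?H 0 lam' (crn lam' mu') r' (wlk ?H (Mt1 us) 0 lam' (crn lam' mu') r' 0 t (start (crn lam' mu') c'))"
     and v': "v' = c' + 1" by (simp_all add: w2_def start_def)
    have "lam = lam' & r = r'" using ad table_inj[OF _ 2(1) w(3) P2p] unfolding cell2_def by (simp only: add_left_cancel)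
    then show "v' = c + 1" using un[of mu' c'] ad w v' by simp
   qed
   then have "Mfin us ?a = c + 1" by (simp add: Mfin_def)
   moreover have "?a < TOT" unfolding cell2_def by (rule T2_addr[OF lam 2(1) P2p])
   ultimately have cont: "Mq us ?a = c + 1" by (simp add: Mq_eq)
   have ksY: "kf ?Y ?zc (wlk ?H (Mt1 us) ?Y lam ?zc r 0 (s + 1) (start ?zc c)) = kf ?Y ?zc YC"
    using wlk_kf_cong[OF T(2) crn_less pt_less kst, where H = ?H and r = r and ?s0.0 = 0 and m = "s + 1"] ks key by simp
   have "kf ?Y ?zc (wlk ?H (Mt1 us) ?Y lam ?zc r (s + 1) (t - (s + 1)) YC)
     = kf ?Y ?zc (wlk ?H (Mt1 us) ?Y lam ?zc r (s + 1) (t - (s + 1)) (wlk ?H (Mt1 us) ?Y lam ?zc r 0 (s + 1) (start ?zc c)))"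
    by (rule wlk_kf_cong[OF T(2) crn_less pt_less ksY[symmetric]])
   also have "... = kf ?Y ?zc (wlk ?H (Mt1 us) ?Y lam ?zc r 0 t (start ?zc c))"
    using wlk_add[of ?H "Mt1 us" ?Y lam ?zc r 0 "s + 1" "t - (s + 1)" "start ?zc c"] c(2) by simp
   also have "... = kf 0 ?zc (wlk ?H (Mt1 us) 0 lam ?zc r 0 t (start ?zc c))"
    by (rule wlk_kf_cong[OF T(2) crn_less pt_less kst[symmetric]])
   finally have "cell2 ?H ?Y lam ?zc r (wlk ?H (Mq us) ?Y lam ?zc r (s + 1) (t - (s + 1)) YC) = ?a"
    unfolding cell2_def wlkM by simp
   then have "EX r<R2. EX s<t. let c = Mq us (cell2 ?H ?Y lam ?zc r (wlk ?H (Mq us) ?Y lam ?zc r (s + 1) (t - (s + 1)) YC)) in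
     0 < c & kf ?Y ?zc (wlk ?H (Mq us) ?Y lam ?zc r 0 (s + 1) (c * U + ?zc)) = kf ?Y ?zc YC"
    using 2(1) c(2) cont ksY by (intro exI[of _ r] exI[of _ s] conjI) (simp_all add: wlkM start_def)
   then show ?thesis using False unfolding qbox_def by (simp only: if_False disj_commute) blast
  qed
 qed
qed

lemma not_bad_crn:
 assumes "!!i. i < k ==> ~ bad l r lam side i"
 shows "EX mu<2 ^ (k * L - sa lam). crn lam mu = pack k L (corn l r lam side)"
proof -
 have nb: "corn l r lam side i + 2 ^ lev lam i <= hi r i" if "i < k" for i using assms[OF that] by (simp add: bad_def)
 have "EX c. corn l r lam side i = c * 2 ^ lev lam i" if i: "i < k" for i
 proof -
  \<comment> \<open>The placeholder \<open>n\<close> for a missing block would end beyond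
    \<open>hi\<close>, which is at most \<open>n\<close>.\<close>
  have "corn l r lam side i ~= n" using nb[OF i] lo_hi_le(2)[of r i] by (metis add_le_same_cancel1 le_trans le_zero_eq power_not_zero zero_neq_numeral)
  then show ?thesis unfolding corn_def Let_def by (auto split: if_splits)
 qed
 then obtain c where "!!i. i < k ==> corn l r lam side i = c i * 2 ^ lev lam i" by metis
 moreover have "corn l r lam side i + 2 ^ lev lam i <= 2 ^ L" if "i < k" for i
  using nb[OF that] lo_hi_le(2)[of r i] nL by linarith
 ultimately show ?thesis by (rule crn_surj)
qed

text \<open>The only random event in the correctness argument. It depends on the seeds and not on a
  query, so a good choice of seeds serves all queries.\<close>

definition all_found :: "nat list => bool" where
 "all_found us \<longleftrightarrow> (ALL lam<NL. 2 * J + 4 <= sa lam --> (ALL mu<2 ^ (k * L - sa lam). ALL h<2 ^ sa lam.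
   hv (hash_of ((!) us)) (Mt1 us) 0 lam (crn lam mu) (crn lam mu + dep lam h) \<or>
   (EX r<R2. found (hash_of ((!) us)) (Mt1 us) lam mu h r)))"

lemma qry_iff:
 assumes good: "all_found us" and Y: "Y < 2 ^ (b * lim)"
 shows "qry (hash_of ((!) us)) (Mq us) Y l r \<longleftrightarrow> (EX z<U. (ALL i<k. lo l i <= fld L z i & fld L z i < hi r i) & pv z = Y)"
proof
 assume "qry (hash_of ((!) us)) (Mq us) Y l r"
 then obtain lam side where q: "lam < NL" "!!i. i < k ==> ~ bad l r lam side i" "qbox (hash_of ((!) us)) (Mq us) Y lam (pack k L (corn l r lam side))"
  unfolding qry_def by blast
 obtain mu where mu: "mu < 2 ^ (k * L - sa lam)" "crn lam mu = pack k L (corn l r lam side)" using not_bad_crn q(2) by blast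
 have "tabs_ok (Mq us)" using st1_Mq[of us] by (simp add: st1_def)
 then obtain h where h: "h < 2 ^ sa lam" "pv (crn lam mu + dep lam h) = Y" using qbox_sound[OF _ Y] q(3) mu(2) by metis
 have "corn l r lam side i < 2 ^ L" if "i < k" for i
 proof -
  have "corn l r lam side i + 2 ^ lev lam i <= hi r i" using q(2)[OF that] by (simp add: bad_def)
  then show ?thesis using lo_hi_le(2)[of r i] nL by linarith
 qed
 then have f: "fld L (crn lam mu) i = corn l r lam side i" if "i < k" for i unfolding mu(2) using that by (rule fld_pack)
 have "lo l i <= fld L (crn lam mu + dep lam h) i & fld L (crn lam mu + dep lam h) i < hi r i" if i: "i < k" for i
  using pt_range[OF i, of lam mu h] q(2)[OF i] unfolding f[OF i] bad_def by linarith
 then show "EX z<U. (ALL i<k. lo l i <= fld L z i & fld L z i < hi r i) & pv z = Y" using h(2) pt_less by blast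
next
 assume "EX z<U. (ALL i<k. lo l i <= fld L z i & fld L z i < hi r i) & pv z = Y"
 then obtain z where z: "z < U" "!!i. i < k ==> lo l i <= fld L z i & fld L z i < hi r i" "pv z = Y" by blast
 \<comment> \<open>Level, side and corner of the block that \<open>dyadic_cover\<close> yields for
   one coordinate. The levels are then assembled into the shape \<open>lam\<close>, the sides into
   the number \<open>side\<close>.\<close>
 define D where "D i a sd c \<longleftrightarrow> a < Suc L & sd < (2::nat) & c <= fld L z i & fld L z i < c + 2 ^ a & lo l i <= c & c + 2 ^ a <= hi r i &
   c = (if 0 < sd then (let u = hi r i div 2 ^ a in if 0 < u then (u - 1) * 2 ^ a else n) else (lo l i + 2 ^ a - 1) div 2 ^ a * 2 ^ a)" for i a sd c
 have "EX a sd c. D i a sd c" if i: "i < k" for i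
 proof -
  have "hi r i < 2 ^ L" using lo_hi_le(2)[of r i] nL by linarith
  from dyadic_cover[OF z(2)[OF i, THEN conjunct1] z(2)[OF i, THEN conjunct2] this] obtain a c where
   ac: "a <= L" "c <= fld L z i" "fld L z i < c + 2 ^ a" "lo l i <= c" "c + 2 ^ a <= hi r i"
   "c = (lo l i + 2 ^ a - 1) div 2 ^ a * 2 ^ a \<or> (0 < hi r i div 2 ^ a & c = (hi r i div 2 ^ a - 1) * 2 ^ a)" by blast
  have "EX sd<2::nat. c = (if 0 < sd then (let u = hi r i div 2 ^ a in if 0 < u then (u - 1) * 2 ^ a else n) else (lo l i + 2 ^ a - 1) div 2 ^ a * 2 ^ a)"
  proof (cases "c = (lo l i + 2 ^ a - 1) div 2 ^ a * 2 ^ a")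
   case True
   then show ?thesis by (intro exI[of _ "0::nat"]) simp
  next
   case False
   then show ?thesis using ac(6) by (intro exI[of _ "1::nat"]) simp
  qed
  then show ?thesis using ac(1-5) unfolding D_def less_Suc_eq_le by blast
 qed
 then obtain a sd c where "!!i. i < k ==> D i (a i) (sd i) (c i)" by metis
 note acs = this[unfolded D_def, THEN conjunct1] this[unfolded D_def, THEN conjunct2, THEN conjunct1]
  this[unfolded D_def, THEN conjunct2, THEN conjunct2, THEN conjunct1] this[unfolded D_def, THEN conjunct2, THEN conjunct2, THEN conjunct2, THEN conjunct1]
  this[unfolded D_def, THEN conjunct2, THEN conjunct2, THEN conjunct2, THEN conjunct2, THEN conjunct1]
  this[unfolded D_def, THEN conjunct2, THEN conjunct2, THEN conjunct2, THEN conjunct2, THEN conjunct2, THEN conjunct1]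
  this[unfolded D_def, THEN conjunct2, THEN conjunct2, THEN conjunct2, THEN conjunct2, THEN conjunct2, THEN conjunct2]
 have "EX lam<NL. ALL i<k. lev lam i = a i" unfolding NL_def lev_def by (rule dg_digits) (rule acs(1))
 then obtain lam where lam: "lam < NL" "!!i. i < k ==> lev lam i = a i" by blast
 have "EX side<2 ^ k. ALL i<k. dg 2 side i = sd i" by (rule dg_digits) (rule acs(2))
 then obtain side where side: "side < 2 ^ k" "!!i. i < k ==> dg 2 side i = sd i" by blast
 have cc: "corn l r lam side i = c i" if "i < k" for i using acs(7)[OF that] by (simp add: corn_def Let_def lam(2)[OF that] side(2)[OF that])
 have nb: "~ bad l r lam side i" if "i < k" for i
  unfolding bad_def cc[OF that] lam(2)[OF that] using acs(5,6)[OF that] by simp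
 obtain mu where mu: "mu < 2 ^ (k * L - sa lam)" "crn lam mu = pack k L (corn l r lam side)" using not_bad_crn nb by blast
 have cl: "corn l r lam side i < 2 ^ L" if "i < k" for i
  using acs(3)[OF that] cc[OF that] by (simp add: fld_def) (metis le_less_trans mod_less_divisor zero_less_numeral zero_less_power)
 have f: "fld L (crn lam mu) i = c i" if "i < k" for i unfolding mu(2) using fld_pack[of k "corn l r lam side" L, OF cl that] cc[OF that] by simp
 obtain h where h: "h < 2 ^ sa lam" "z = crn lam mu + dep lam h"
  using box_iff[OF z(1), of lam mu] acs(3,4) f lam(2) by auto
 have "qbox (hash_of ((!) us)) (Mq us) Y lam (crn lam mu)"
  unfolding z(3)[symmetric] h(2) by (rule qbox_complete[OF lam(1) mu(1) h(1)]) (use good lam(1) mu(1) h(1) in "auto simp: all_found_def")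
 then show "qry (hash_of ((!) us)) (Mq us) Y l r" unfolding qry_def using lam(1) side(1) nb mu(2) by auto
qed

end

section \<open>Probability of success\<close>

context chains begin

lemma run_append: "run (gs @ [g]) s = trans (run gs s) (ap g (run gs s))"
 by (induction gs arbitrary: s) auto

lemma hit_iff: "hit gs s i \<longleftrightarrow> i < length gs & ap (gs ! i) (run (take i gs) s) \<in> Wy"
proof (induction gs arbitrary: s i)
 case (Cons g gs)
 then show ?case by (cases i) auto
qed simp

end

section \<open>Success probability of a single table\<close>

context inst_math begin

abbreviation "Hb \<equiv> hE (2 ^ b) NP Q"

definition bh :: "nat list list => nat => nat list => nat" where
 "bh gs j key = hl (2 ^ b) NP Q (gs ! j) key"

definition kfs :: "nat \<times> nat => nat list" where "kfs s = kf 0 (fst s) (snd s)"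

text \<open>States carry the corner of their box because a table contains the chains of all boxes of
  one shape.\<close>

definition Vs :: "nat => nat => (nat \<times> nat) set" where
 "Vs lam m = {(crn lam mu, code) | mu code. mu < 2 ^ (k * L - sa lam) & (code < U \<or> (EX c<m. code = start (crn lam mu) c))}"

definition Sts :: "nat => nat => (nat \<times> nat) set" where
 "Sts lam m = (%(mu, c). (crn lam mu, start (crn lam mu) c)) ` ({..<2 ^ (k * L - sa lam)} \<times> {..<m})"

text \<open>The skipping rule \<open>hvp\<close> is a parameter, so that samples, which skip
  nothing, and chains, which skip caught values, are instances of the same locale.\<close>

definition tr :: "(nat => nat => bool) => nat => nat \<times> nat => nat => nat \<times> nat" where
 "tr hvp lam s x = (fst s, if hvp (fst s) (fst s + dep lam x) then snd s else fst s + dep lam x)"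

definition cnt :: "nat => nat => nat => nat" where
 "cnt lam zc h = card {h'. h' < 2 ^ sa lam & kf 0 zc (zc + dep lam h') = kf 0 zc (zc + dep lam h)}"

lemma start_ok: "c < m ==> m <= 4 * U ==> U <= start (crn lam mu) c & start (crn lam mu) c < YC"
 using start_bounds[of "c + 1" "crn lam mu"] crn_less unfolding start_def by auto

lemma start_inj: "start zc c = start zc c' ==> c = c'"
 using U_pos by (simp add: start_def)

lemma Vs_cases:
 assumes "s \<in> Vs lam m"
 obtains mu code where "s = (crn lam mu, code)" "mu < 2 ^ (k * L - sa lam)" "code < U"
  | mu c where "s = (crn lam mu, start (crn lam mu) c)" "mu < 2 ^ (k * L - sa lam)" "c < m"
 using assms unfolding Vs_def by blast

lemma V_pt: "mu < 2 ^ (k * L - sa lam) ==> code < U ==> (crn lam mu, code) \<in> Vs lam m"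
 and V_st: "mu < 2 ^ (k * L - sa lam) ==> c < m ==> (crn lam mu, start (crn lam mu) c) \<in> Vs lam m"
 unfolding Vs_def by blast+

lemma kfs_box:
 assumes m: "m <= 4 * U" and s: "s \<in> Vs lam m" "s' \<in> Vs lam m" "kfs s = kfs s'"
 shows "fst s = fst s'"
proof -
 note Z = zero_less_power[of "2::nat" "b * lim"]
 show ?thesis
  using s(1)
 proof (cases rule: Vs_cases)
  case 1
  note a = this
  show ?thesis using s(2)
  proof (cases rule: Vs_cases)
   case 1
   then show ?thesis using a s(3) kf_eq[of _ _ 0 0] crn_less by (auto simp: kfs_def)
  next
   case (2 mu' c')
   then show ?thesis using a s(3) kf_start[of "start (crn lam mu') c'" "snd s" "fst s" 0 "crn lam mu'" 0] start_ok[OF 2(3) m] crn_less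
    by (auto simp: kfs_def)
  qed
 next
  case (2 mu c)
  note a = this
  show ?thesis using s(2)
  proof (cases rule: Vs_cases)
   case 1
   then show ?thesis using a s(3) kf_start[of "start (crn lam mu) c" "snd s'" "fst s'" 0 "crn lam mu" 0] start_ok[OF 2(3) m] crn_less
    by (auto simp: kfs_def)
  next
   case (2 mu' c')
   then have "start (crn lam mu) c = start (crn lam mu') c'"
    using a s(3) start_ok[OF 2(3) m, of lam mu'] start_ok[OF a(3) m, of lam mu]
    by (intro kf_start_start[where Y = 0 and Y' = 0 and zc = "crn lam mu" and zc' = "crn lam mu'"]) (auto simp: kfs_def)
   \<comment> \<open>A start is a multiple of \<open>U\<close> plus its corner, so its residue
     modulo \<open>U\<close> recovers the corner.\<close>
   then have "start (crn lam mu) c mod U = start (crn lam mu') c' mod U" by simp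
   then have "crn lam mu mod U = crn lam mu' mod U" unfolding start_def by (simp only: mod_mult_self3)
   then show ?thesis using a 2 crn_less by simp
  qed
 qed
qed

lemma Sts_V: "Sts lam m \<subseteq> Vs lam m" "finite (Sts lam m)" "card (Sts lam m) = 2 ^ (k * L - sa lam) * m"
proof -
 show "Sts lam m \<subseteq> Vs lam m" unfolding Sts_def Vs_def by auto
 show "finite (Sts lam m)" unfolding Sts_def by auto
 have "inj_on (%(mu, c). (crn lam mu, start (crn lam mu) c)) ({..<2 ^ (k * L - sa lam)} \<times> {..<m})"
  by (rule inj_onI) (auto dest: crn_inj start_inj)
 then show "card (Sts lam m) = 2 ^ (k * L - sa lam) * m" unfolding Sts_def by (simp add: card_image)
qed

lemma Sts_inj: "m <= 4 * U ==> inj_on kfs (Sts lam m)"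
proof (rule inj_onI)
 fix s s' assume m: "m <= 4 * U" and s: "s \<in> Sts lam m" "s' \<in> Sts lam m" "kfs s = kfs s'"
 have e: "fst s = fst s'" using kfs_box[OF m] s Sts_V(1) by blast
 obtain mu c mu' c' where c: "s = (crn lam mu, start (crn lam mu) c)" "c < m" "s' = (crn lam mu', start (crn lam mu') c')" "c' < m"
  using s(1,2) unfolding Sts_def by auto
 have "start (crn lam mu) c = start (crn lam mu') c'"
  using s(3) c start_ok[OF c(2) m, of lam mu] start_ok[OF c(4) m, of lam mu']
  by (intro kf_start_start[where Y = 0 and Y' = 0 and zc = "crn lam mu" and zc' = "crn lam mu'"]) (auto simp: kfs_def)
 then show "s = s'" using e c by simp
qed

lemma Sts_box: "mu < 2 ^ (k * L - sa lam) ==> {s \<in> Sts lam m. fst s = crn lam mu} = (%c. (crn lam mu, start (crn lam mu) c)) ` {..<m}"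
 "card ((%c. (zc, start zc c)) ` {..<m}) = m"
proof -
 show "card ((%c. (zc, start zc c)) ` {..<m}) = m" by (subst card_image) (auto intro!: inj_onI dest: start_inj)
 assume mu: "mu < 2 ^ (k * L - sa lam)"
 show "{s \<in> Sts lam m. fst s = crn lam mu} = (%c. (crn lam mu, start (crn lam mu) c)) ` {..<m}"
  unfolding Sts_def using mu by (auto 0 3 dest: crn_inj)
qed

text \<open>By \<open>light\<close> every value that is not skipped has a small share of its box,
  which yields \<open>\<beta>\<close>. A skipped step keeps the current key, and for this key no
  bound is demanded.\<close>

lemma chains_inst:
 assumes m: "m <= 4 * U" and mu: "mu < 2 ^ (k * L - sa lam)" and P: "0 < P" "P dvd 2 ^ b" and \<beta>: "0 <= \<beta>"
  and hv: "!!zc u v. zc < U ==> (!!h. zc + dep lam h < U) ==> kf 0 zc u = kf 0 zc v ==> hvp zc u = hvp zc v"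
  and light: "!!mu h. mu < 2 ^ (k * L - sa lam) ==> h < 2 ^ sa lam ==> ~ hvp (crn lam mu) (crn lam mu + dep lam h) ==>
   real (cnt lam (crn lam mu) h) / 2 ^ sa lam <= \<beta>"
  and nhv: "~ hvp (crn lam mu) (crn lam mu + dep lam h)"
 shows "chains (2 ^ b) P NP Q kfs (tr hvp lam) (Vs lam m) fst \<beta> (kf 0 (crn lam mu) (crn lam mu + dep lam h))
   {w. kf 0 (crn lam mu) (crn lam mu + dep lam w) = kf 0 (crn lam mu) (crn lam mu + dep lam h)} (crn lam mu)"
proof
 show "kfs s \<in> keys_of NP Q" for s by (simp add: kfs_def key_in)
 show "tr hvp lam s w \<in> Vs lam m" if "s \<in> Vs lam m" for s w
  using that
 proof (cases rule: Vs_cases)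
  case (1 mu code)
  then show ?thesis using pt_less[of lam mu w] by (simp add: tr_def V_pt)
 next
  case (2 mu c)
  then show ?thesis using pt_less[of lam mu w] by (simp add: tr_def V_pt V_st)
 qed
 show "fst s = fst s'" if "s \<in> Vs lam m" "s' \<in> Vs lam m" "kfs s = kfs s'" for s s' by (rule kfs_box[OF m that])
 show "kfs (tr hvp lam s w) = kfs (tr hvp lam s' w)" if "s \<in> Vs lam m" "s' \<in> Vs lam m" "kfs s = kfs s'" for s s' w
  using kfs_box[OF m that] that(3) unfolding tr_def kfs_def by auto
 show "fst s = crn lam mu" if "s \<in> Vs lam m" "kfs s = kf 0 (crn lam mu) (crn lam mu + dep lam h)" for s
 proof -
  have "(crn lam mu, crn lam mu + dep lam h) \<in> Vs lam m" unfolding Vs_def using mu pt_less by auto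
  then show ?thesis using kfs_box[OF m that(1)] that(2) by (auto simp: kfs_def)
 qed
 show "kfs (tr hvp lam s w) = kf 0 (crn lam mu) (crn lam mu + dep lam h)"
  if "s \<in> Vs lam m" "fst s = crn lam mu" "w \<in> {w. kf 0 (crn lam mu) (crn lam mu + dep lam w) = kf 0 (crn lam mu) (crn lam mu + dep lam h)}" for s w
 proof -
  have "~ hvp (crn lam mu) (crn lam mu + dep lam w)"
   using nhv hv[of "crn lam mu" "crn lam mu + dep lam w" "crn lam mu + dep lam h", OF crn_less pt_less] that(3) by simp
  then show ?thesis using that by (simp add: tr_def kfs_def)
 qed
 show "avg (2 ^ b) (%w. of_bool (kfs (tr hvp lam s w) = kk)) <= \<beta>" if s: "s \<in> Vs lam m" and kk: "kk ~= kfs s" for s kk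
 proof -
  obtain mu' where mu': "fst s = crn lam mu'" "mu' < 2 ^ (k * L - sa lam)" using s unfolding Vs_def by auto
  let ?zc = "crn lam mu'"
  let ?X = "%z. kf 0 ?zc z = kk & ~ hvp ?zc z"
  have "avg (2 ^ b) (%w. of_bool (kfs (tr hvp lam s w) = kk)) = avg (2 ^ b) (%w. of_bool (?X (?zc + dep lam w)))"
  proof (rule E_cong[OF expct_avg])
   fix w :: nat
   show "of_bool (kfs (tr hvp lam s w) = kk) = (of_bool (?X (?zc + dep lam w)) :: real)"
    using kk by (auto simp: tr_def kfs_def mu'(1))
  qed simp
  also have "... = real (card {h. h < 2 ^ sa lam & ?X (?zc + dep lam h)}) / 2 ^ sa lam" by (rule avg_pt)
  also have "... <= \<beta>"
  \<comment> \<open>All points counted have the same key, so any of them can represent the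
    count.\<close>
  proof (cases "EX h<2 ^ sa lam. ?X (?zc + dep lam h)")
   case True
   then obtain h where h: "h < 2 ^ sa lam" "?X (?zc + dep lam h)" by blast
   have "card {h. h < 2 ^ sa lam & ?X (?zc + dep lam h)} <= cnt lam ?zc h"
    unfolding cnt_def using h by (intro card_mono) auto
   then have "real (card {h. h < 2 ^ sa lam & ?X (?zc + dep lam h)}) / 2 ^ sa lam <= real (cnt lam ?zc h) / 2 ^ sa lam"
    by (intro divide_right_mono) auto
   also have "... <= \<beta>" by (rule light[OF mu'(2) h(1)]) (use h in blast)
   finally show ?thesis .
  next
   case False
   then have e: "{h. h < 2 ^ sa lam & ?X (?zc + dep lam h)} = {}" by blast
   show ?thesis unfolding e using \<beta> by simp
  qed
  finally show ?thesis .
 qed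
qed (use P \<beta> NP_pos in "auto simp: tr_def")

lemma delta_eq:
 assumes "chains (2 ^ b) P NP Q kfs tr' V bf \<beta> ky {w. kf 0 zc (zc + dep lam w) = kf 0 zc (zc + dep lam h)} bx"
 shows "chains.\<delta> (2 ^ b) {w. kf 0 zc (zc + dep lam w) = kf 0 zc (zc + dep lam h)} = real (cnt lam zc h) / 2 ^ sa lam"
 unfolding chains.\<delta>_def[OF assms] cnt_def mem_Collect_eq by (rule avg_pt)

lemma cnt_pos: "h < 2 ^ sa lam ==> 0 < cnt lam zc h"
 unfolding cnt_def by (subst card_gt_0_iff) auto

text \<open>Overwriting by a sample with the same key is harmless, since it proves the value heavy
  just as well. Only samples with other keys have to stay away from the cell.\<close>

definition caught :: "nat => nat => nat => nat list list => bool" where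
 "caught lam mu h gs \<longleftrightarrow> (let zc = crn lam mu; ky = kf 0 zc (zc + dep lam h); pt = (%zc c. zc + dep lam (bh gs 0 (kf 0 zc (start zc c)))) in
   (EX c<m1 lam. kf 0 zc (pt zc c) = ky) &
   (ALL mu'<2 ^ (k * L - sa lam). ALL c<m1 lam. kf 0 (crn lam mu') (pt (crn lam mu') c) ~= ky -->
    bh gs 1 (kf 0 (crn lam mu') (pt (crn lam mu') c)) mod P1 ~= bh gs 1 ky mod P1))"

text \<open>The value is expected at least four times among the samples of its box, so it is absent
  with probability at most 1/4. All samples together fill a quarter of the table, so the cell is
  overwritten with probability at most 1/4.\<close>

lemma caught_prob:
 assumes mu: "mu < 2 ^ (k * L - sa lam)" and bg: "2 * J + 4 <= sa lam" and c: "t < cnt lam (crn lam mu) h"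
 shows "seqE Hb 2 (%gs. of_bool (~ caught lam mu h gs)) <= 1 / 2"
proof -
 let ?zc = "crn lam mu" let ?ky = "kf 0 ?zc (?zc + dep lam h)" let ?S = "2 ^ (k * L - sa lam)"
 let ?Wy = "{w. kf 0 ?zc (?zc + dep lam w) = ?ky}" let ?N = "%_ _. False"
 have P1: "P1 dvd 2 ^ b"
 proof -
  have "L <= k * L" using k2 by simp
  then show ?thesis unfolding P1_def by (intro le_imp_power_dvd) (use kLb in linarith)
 qed
 \<comment> \<open>A sample is a chain of one step without skipping; the trivial bound 1 serves as
   \<open>\<beta>\<close>.\<close>
 have ch: "chains (2 ^ b) P1 NP Q kfs (tr ?N lam) (Vs lam (m1 lam)) fst 1 ?ky ?Wy ?zc"
 proof (rule chains_inst[OF m1_le(1) mu P1_pos P1])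
  fix mu h
  have "cnt lam (crn lam mu) h <= card {h. h < (2::nat) ^ sa lam}" unfolding cnt_def by (intro card_mono) auto
  also have "... = 2 ^ sa lam" by simp
  finally show "real (cnt lam (crn lam mu) h) / 2 ^ sa lam <= 1" by simp
 qed auto
 interpret ch: chains "2 ^ b" P1 NP Q kfs "tr ?N lam" "Vs lam (m1 lam)" fst 1 ?ky ?Wy ?zc by (rule ch)
 note d = delta_eq[OF ch]
 have s2: "(2::nat) ^ J * m1 lam = 4 * 2 ^ sa lam"
  unfolding m1_def using bg by (simp flip: power_add)
 have m1pos: "0 < m1 lam" by (simp add: m1_def)
 have md: "4 <= real (m1 lam) * ch.\<delta>"
 proof -
  have "real (m1 lam) * ch.\<delta> = real (m1 lam) * real (cnt lam ?zc h) / 2 ^ sa lam" unfolding d by simp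
  also have "... >= real (m1 lam) * real t / 2 ^ sa lam" using c by (intro divide_right_mono mult_left_mono) auto
  moreover have "real (m1 lam) * real t / 2 ^ sa lam = 4"
  proof -
   have "real t * real (m1 lam) = 4 * 2 ^ sa lam" using arg_cong[OF s2, of real] by (simp add: t_def)
   then show ?thesis by (simp add: mult.commute)
  qed
  ultimately show ?thesis by simp
 qed
 have P1r: "real (card (Sts lam (m1 lam))) / real P1 = 1 / 4"
 proof -
  have "4 * (?S * m1 lam) = P1"
  proof -
   have e: "2 + (k * L - sa lam + (sa lam + 2 - J)) = k * L + 4 - J" using sa_le[of lam] bg by linarith
   have "4 * (?S * m1 lam) = 2 ^ (2 + (k * L - sa lam + (sa lam + 2 - J)))" unfolding m1_def by (simp add: power_add)
   then show ?thesis unfolding e P1_def .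
  qed
  then have "real P1 = 4 * real (?S * m1 lam)" by (metis of_nat_mult of_nat_numeral)
  then show ?thesis using m1pos by (simp add: Sts_V(3))
 qed
 have Sy: "card {s \<in> Sts lam (m1 lam). fst s = ?zc} = m1 lam" unfolding Sts_box(1)[OF mu] by (rule Sts_box(2))
 have "seqE Hb 2 (%gs. of_bool (~ caught lam mu h gs)) = Hb (%g. Hb (%gl. of_bool (~ caught lam mu h [g, gl])))"
  by (simp add: numeral_2_eq_2)
 also have "... = Hb (%g. Hb (%gl. of_bool (~ ((\<exists>s\<in>{s \<in> Sts lam (m1 lam). fst s = ?zc}. ch.ap g s \<in> ?Wy) &
    (\<forall>s\<in>Sts lam (m1 lam). kfs (tr ?N lam s (ch.ap g s)) ~= ?ky --> ch.ap gl (tr ?N lam s (ch.ap g s)) mod P1 ~= hl (2 ^ b) NP Q gl ?ky mod P1)))))"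
 proof (intro arg_cong[where f = Hb] ext arg_cong[where f = of_bool] arg_cong[where f = Not])
  fix g gl
  show "caught lam mu h [g, gl] = ((\<exists>s\<in>{s \<in> Sts lam (m1 lam). fst s = ?zc}. ch.ap g s \<in> ?Wy) &
    (\<forall>s\<in>Sts lam (m1 lam). kfs (tr ?N lam s (ch.ap g s)) ~= ?ky --> ch.ap gl (tr ?N lam s (ch.ap g s)) mod P1 ~= hl (2 ^ b) NP Q gl ?ky mod P1))"
   unfolding Sts_box(1)[OF mu] unfolding caught_def Sts_def Let_def by (auto simp: ch.ap_def tr_def kfs_def bh_def)
 qed
 also have "... <= 1 / (real (card {s \<in> Sts lam (m1 lam). fst s = ?zc}) * ch.\<delta>) + real (card (Sts lam (m1 lam))) / real P1"
  by (rule ch.sample_prob[OF Sts_V(2,1) Sts_inj[OF m1_le(1)] refl key_in]) (simp only: Sy, use md in linarith)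
 also have "... <= 1 / 4 + 1 / 4" unfolding P1r Sy using md by (intro add_mono) (simp_all add: divide_simps)
 finally show ?thesis by simp
qed

definition cov :: "(nat => nat => bool) => nat => nat => nat => nat list list => bool" where
 "cov hvp lam mu h gs \<longleftrightarrow> (let zc = crn lam mu in chains.covered (2 ^ b) P2 NP Q kfs (tr hvp lam) fst
   {w. kf 0 zc (zc + dep lam w) = kf 0 zc (zc + dep lam h)} zc (Sts lam (m2 lam)) (take t gs) (gs ! t))"

lemma P2_eq: "2 * J + 4 <= sa lam ==> P2 * (2 * t * t) = U"
proof -
 assume bg: "2 * J + 4 <= sa lam"
 have e: "2 * t * t = 2 ^ (2 * J + 1)" by (simp add: t_def power_add power_mult power2_eq_square mult.commute flip: power_mult_distrib)
 have "(2::nat) ^ (2 * J + 1) dvd U" unfolding U_def using bg sa_le[of lam] by (intro le_imp_power_dvd) linarith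
 then show ?thesis unfolding P2_def e by (simp only: dvd_div_mult_self)
qed

lemma cov_inst:
 assumes mu: "mu < 2 ^ (k * L - sa lam)" and bg: "2 * J + 4 <= sa lam"
  and hv: "!!zc u v. zc < U ==> (!!h. zc + dep lam h < U) ==> kf 0 zc u = kf 0 zc v ==> hvp zc u = hvp zc v"
  and light: "!!mu h. mu < 2 ^ (k * L - sa lam) ==> h < 2 ^ sa lam ==> ~ hvp (crn lam mu) (crn lam mu + dep lam h) ==> cnt lam (crn lam mu) h <= t"
  and nhv: "~ hvp (crn lam mu) (crn lam mu + dep lam h)"
 shows "chains (2 ^ b) P2 NP Q kfs (tr hvp lam) (Vs lam (m2 lam)) fst (real t / 2 ^ sa lam) (kf 0 (crn lam mu) (crn lam mu + dep lam h))
   {w. kf 0 (crn lam mu) (crn lam mu + dep lam w) = kf 0 (crn lam mu) (crn lam mu + dep lam h)} (crn lam mu)"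
proof (rule chains_inst[where hvp = hvp and lam = lam and mu = mu and h = h, OF _ mu P2_pos[OF bg] _ _ hv _ nhv])
 show "m2 lam <= 4 * U" using m2_le[OF bg] by simp
 have "P2 dvd U" using P2_eq[OF bg] by (metis dvd_triv_left)
 also have "U dvd 2 ^ b" unfolding U_def using kLb by (intro le_imp_power_dvd) linarith
 finally show "P2 dvd 2 ^ b" .
 show "real (cnt lam (crn lam mu) h) / 2 ^ sa lam <= real t / 2 ^ sa lam"
  if "mu < 2 ^ (k * L - sa lam)" "h < 2 ^ sa lam" "~ hvp (crn lam mu) (crn lam mu + dep lam h)" for mu h
  using light[OF that] by (intro divide_right_mono) auto
qed auto

text \<open>A value with \<open>x\<close> preimages, 1 <= x <= t, has y = x / (16 t) expected hits.
  The relative losses are 3/16 by merging, 1/8 by shared cells and \<open>y\<close>, at most 1/16,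
  by repeated hits. More than half of \<open>y\<close> remains, and \<open>y\<close> is at least 1 /
  (16 t).\<close>

lemma cov_prob:
 assumes mu: "mu < 2 ^ (k * L - sa lam)" and bg: "2 * J + 4 <= sa lam"
  and hv: "!!zc u v. zc < U ==> (!!h. zc + dep lam h < U) ==> kf 0 zc u = kf 0 zc v ==> hvp zc u = hvp zc v"
  and light: "!!mu h. mu < 2 ^ (k * L - sa lam) ==> h < 2 ^ sa lam ==> ~ hvp (crn lam mu) (crn lam mu + dep lam h) ==> cnt lam (crn lam mu) h <= t"
  and nhv: "~ hvp (crn lam mu) (crn lam mu + dep lam h)" and h: "h < 2 ^ sa lam"
 shows "seqE Hb (t + 1) (%gs. of_bool (~ cov hvp lam mu h gs)) <= 1 - 1 / (32 * real t)"
proof -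
 let ?zc = "crn lam mu" let ?ky = "kf 0 ?zc (?zc + dep lam h)" let ?S = "2 ^ (k * L - sa lam)"
 let ?Wy = "{w. kf 0 ?zc (?zc + dep lam w) = ?ky}" let ?St = "Sts lam (m2 lam)"
 have ch: "chains (2 ^ b) P2 NP Q kfs (tr hvp lam) (Vs lam (m2 lam)) fst (real t / 2 ^ sa lam) ?ky ?Wy ?zc"
  by (rule cov_inst) (use mu bg hv light nhv in blast)+
 interpret ch: chains "2 ^ b" P2 NP Q kfs "tr hvp lam" "Vs lam (m2 lam)" fst "real t / 2 ^ sa lam" ?ky ?Wy ?zc by (rule ch)
 let ?cov = "%gs gl. of_bool (ch.covered ?St gs gl) :: real"
 note d = delta_eq[OF ch]
 have m2U: "m2 lam <= 4 * U" using m2_le[OF bg] by simp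
 define x where "x = real (cnt lam ?zc h)"
 have x: "1 <= x" "x <= real t" using cnt_pos[OF h, of ?zc] light[OF mu h nhv] by (simp_all add: x_def)
 have tp: "0 < real t" using t_pos by simp
 have m2e: "real (m2 lam) * (16 * real t * real t) = 2 ^ sa lam"
 proof -
  have "16 * real t * real t = 2 ^ (2 * J + 4)" by (simp add: t_def power_add power_mult power2_eq_square mult.commute flip: power_mult_distrib)
  moreover have "real (m2 lam) * 2 ^ (2 * J + 4) = 2 ^ sa lam" unfolding m2_def using bg by (simp flip: power_add)
  ultimately show ?thesis by simp
 qed
 then have m2: "real (m2 lam) = 2 ^ sa lam / (16 * real t * real t)" using tp by (simp add: field_simps)
 have X: "real (m2 lam) * real t * ch.\<delta> = x / (16 * real t)" unfolding d m2 x_def[symmetric] using tp by (simp add: field_simps)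
 have Y: "3 * real (m2 lam) * real t * (real t / 2 ^ sa lam) = 3 / 16" unfolding m2 using tp by (simp add: field_simps)
 have m2pos: "0 < m2 lam" by (simp add: m2_def)
 have Z: "real (card ?St) / real P2 = 1 / 8"
 proof -
  have "?S * m2 lam * (16 * t * t) = P2 * (2 * t * t)" unfolding P2_eq[OF bg] by (rule pow_split(3)[OF bg])
  then have "8 * (?S * m2 lam) * (2 * t * t) = P2 * (2 * t * t)" by (simp add: algebra_simps)
  then have "8 * (?S * m2 lam) = P2" using t_pos by (simp add: mult.commute)
  then have "real P2 = 8 * real (?S * m2 lam)" by (metis of_nat_mult of_nat_numeral)
  then show ?thesis using m2pos by (simp add: Sts_V(3))
 qed
 have Sy: "card {s \<in> ?St. fst s = ?zc} = m2 lam" unfolding Sts_box(1)[OF mu] by (rule Sts_box(2))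
 have ne: "kfs s ~= ?ky" if sS: "s \<in> ?St" for s
 proof -
  obtain mu' c where s: "s = (crn lam mu', start (crn lam mu') c)" "c < m2 lam" using sS unfolding Sts_def by auto
  then show ?thesis unfolding s kfs_def fst_conv snd_conv
   by (intro kf_start) (use start_ok[OF s(2) m2U, of lam mu'] pt_less crn_less in auto)
 qed
 have cp: "real (card {s \<in> ?St. fst s = ?zc}) * real t * ch.\<delta> * (1 - 3 * real (card {s \<in> ?St. fst s = ?zc}) * real t * (real t / 2 ^ sa lam)
   - real (card ?St) / real P2 - real (card {s \<in> ?St. fst s = ?zc}) * real t * ch.\<delta>)
   <= seqE Hb t (%gs. Hb (%gl. ?cov gs gl))"
  by (rule ch.covered_prob[OF Sts_V(2,1) Sts_inj[OF m2U] ne refl])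
 define y where "y = x / (16 * real t)"
 have y: "1 / (16 * real t) <= y" "y <= 1 / 16" unfolding y_def using x tp by (simp_all add: divide_simps)
 have y0: "0 <= y" using x tp by (simp add: y_def)
 have "1 / (32 * real t) <= y * (1 / 2)" using y(1) by simp
 also have "... <= y * (1 - 3 / 16 - 1 / 8 - y)" using y y0 by (intro mult_left_mono) linarith+
 also have "... <= seqE Hb t (%gs. Hb (%gl. ?cov gs gl))"
  using cp unfolding Sy X Y Z y_def[symmetric] .
 finally have lb: "1 / (32 * real t) <= seqE Hb t (%gs. Hb (%gl. ?cov gs gl))" .
 have EH: "expct Hb ch.G" by (rule ch.expE)
 have "seqE Hb (t + 1) (%gs. of_bool (~ cov hvp lam mu h gs)) = seqE Hb t (%gs. Hb (%gl. of_bool (~ cov hvp lam mu h (gs @ [gl]))))"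
  unfolding Suc_eq_plus1[symmetric] by (rule seqE_snoc[OF EH])
 also have "... = seqE Hb t (%gs. 1 - Hb (%gl. ?cov gs gl))"
 proof (rule E_cong[OF expct_seqE[OF EH]])
  fix gs :: "nat list list" assume "gs \<in> {gs. length gs = t & set gs \<subseteq> ch.G}"
  then have l: "length gs = t" by simp
  have "Hb (%gl. of_bool (~ cov hvp lam mu h (gs @ [gl]))) = Hb (%gl. 1 - ?cov gs gl)"
   unfolding cov_def Let_def l[symmetric] nth_append_length by (simp add: of_bool_not_iff)
  also have "... = 1 - Hb (%gl. ?cov gs gl)"
   by (simp only: E_diff[OF EH] E_const[OF EH])
  finally show "Hb (%gl. of_bool (~ cov hvp lam mu h (gs @ [gl]))) = 1 - Hb (%gl. ?cov gs gl)" .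
 qed
 also have "... = 1 - seqE Hb t (%gs. Hb (%gl. ?cov gs gl))"
  by (simp only: E_diff[OF expct_seqE[OF EH]] E_const[OF expct_seqE[OF EH]])
 finally show ?thesis using lb by linarith
qed

end

lemma upds_base: "M a = M' a ==> upds ws M a = upds ws M' a"
proof (induction ws arbitrary: M M')
 case (Cons x ws)
 obtain y v where x: "x = (y, v)" by force
 show ?case unfolding x upds.simps by (rule Cons.IH) (simp add: Cons.prems)
qed simp

lemma nth_concat_blocks: "(!!x. x \<in> set gs ==> length x = m) ==> j < length gs ==> i < m ==> concat gs ! (j * m + i) = gs ! j ! i"
proof (induction gs arbitrary: j)
 case (Cons g gs)
 then show ?case
 proof (cases j)
  case (Suc j')
  have "length g = m" using Cons.prems(1) by simp
  then show ?thesis using Cons Suc by (simp add: nth_append)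
 qed (simp add: nth_append)
qed simp

section \<open>From seeds to tables, and the union bound\<close>

context inst_math begin

definition T1c :: "nat list list => nat => nat" where "T1c g1 = upds (ws1 (bh g1)) (%_. 0)"

text \<open>The rule for skipping, expressed by the seeds \<open>g1\<close> alone: it is fixed
  before the independent seeds of the chains are drawn.\<close>

definition hvy :: "nat list list => nat => nat => nat => bool" where
 "hvy g1 lam zc code = hv (bh g1) (T1c g1) 0 lam zc code"

lemma hvy_kf: "kf 0 zc u = kf 0 zc v ==> hvy g1 lam zc u = hvy g1 lam zc v"
 unfolding hvy_def hv_def by simp

text \<open>The counter finally stored in the cell may belong to another sample, but only to one
  with the same key.\<close>

lemma caught_hvy:
 assumes lam: "lam < NL" and bg: "2 * J + 4 <= sa lam" and mu: "mu < 2 ^ (k * L - sa lam)" and r: "r < R1" and g1: "length g1 = R1 * 2"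
  and c: "caught lam mu h (take 2 (drop (r * 2) g1))"
 shows "hvy g1 lam (crn lam mu) (crn lam mu + dep lam h)"
proof -
 let ?zc = "crn lam mu" let ?ky = "kf 0 ?zc (?zc + dep lam h)"
 let ?pt = "%zc c. zc + dep lam (bh g1 (2 * r) (kf 0 zc (start zc c)))"
 have len: "r * 2 + 1 < length g1" using r g1 by simp
 have b0: "bh (take 2 (drop (r * 2) g1)) 0 key = bh g1 (2 * r) key" "bh (take 2 (drop (r * 2) g1)) 1 key = bh g1 (2 * r + 1) key" for key
  using len by (simp_all add: bh_def mult.commute)
 obtain c0 where c0: "c0 < m1 lam" "kf 0 ?zc (?pt ?zc c0) = ?ky"
  and un: "!!mu' c. mu' < 2 ^ (k * L - sa lam) ==> c < m1 lam ==> bh g1 (2 * r + 1) (kf 0 (crn lam mu') (?pt (crn lam mu') c)) mod P1 = bh g1 (2 * r + 1) ?ky mod P1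
    ==> kf 0 (crn lam mu') (?pt (crn lam mu') c) = ?ky"
  using c unfolding caught_def Let_def b0 by blast
 let ?a = "A1 + ((lam * R1 + r) * P1 + bh g1 (2 * r + 1) ?ky mod P1)"
 have "w1 (bh g1) lam ?zc r c0 \<in> set (ws1 (bh g1))" unfolding ws1_iff using lam bg mu r c0(1) by blast
 moreover have "w1 (bh g1) lam ?zc r c0 = (?a, c0 + 1)" unfolding w1_def using c0(2) by (simp add: start_def)
 ultimately have "?a \<in> fst ` set (ws1 (bh g1))" by force
 then have "(?a, T1c g1 ?a) \<in> set (ws1 (bh g1))" unfolding T1c_def by (rule upds_in)
 then obtain lam' mu' r' c' where w: "2 * J + 4 <= sa lam'" "mu' < 2 ^ (k * L - sa lam')" "r' < R1" "c' < m1 lam'"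
  "(?a, T1c g1 ?a) = w1 (bh g1) lam' (crn lam' mu') r' c'" unfolding ws1_iff by blast
 have ad: "(lam * R1 + r) * P1 + bh g1 (2 * r + 1) ?ky mod P1 = (lam' * R1 + r') * P1 +
   bh g1 (2 * r' + 1) (kf 0 (crn lam' mu') (crn lam' mu' + dep lam' (bh g1 (2 * r') (kf 0 (crn lam' mu') ((c' + 1) * U + crn lam' mu'))))) mod P1"
  and T: "T1c g1 ?a = c' + 1" using w(5) unfolding w1_def prod.inject add_left_cancel by blast+
 have e: "lam = lam' & r = r' & bh g1 (2 * r + 1) ?ky mod P1 =
   bh g1 (2 * r' + 1) (kf 0 (crn lam' mu') (crn lam' mu' + dep lam' (bh g1 (2 * r') (kf 0 (crn lam' mu') ((c' + 1) * U + crn lam' mu'))))) mod P1"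
  by (rule table_inj[OF ad r w(3) P1_pos])
 then have lr: "lam' = lam" "r' = r" by simp_all
 have mods: "bh g1 (2 * r + 1) (kf 0 (crn lam mu') (?pt (crn lam mu') c')) mod P1 = bh g1 (2 * r + 1) ?ky mod P1"
  using e[THEN conjunct2, THEN conjunct2, symmetric] unfolding lr start_def .
 have mu': "mu' < 2 ^ (k * L - sa lam)" "c' < m1 lam" using w e by auto
 have ky: "kf 0 (crn lam mu') (?pt (crn lam mu') c') = ?ky" by (rule un[OF mu' mods])
 then have "crn lam mu' = ?zc" using kf_eq[of _ _ 0 0 "crn lam mu'" ?zc] pt_less crn_less by simp
 then have ky': "kf 0 ?zc (?pt ?zc c') = ?ky" using ky by simp
 show ?thesis unfolding hvy_def hv_def Let_def
  by (intro exI[of _ r] conjI r) (use T ky' in "simp_all add: start_def")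
qed

lemma ws1_cong:
 assumes "!!j key. j < 2 * R1 ==> key \<in> keys_of NP Q ==> H j key = H' j key"
 shows "ws1 H = ws1 H'"
proof -
 have "w1 H lam zc r c = w1 H' lam zc r c" if "r < R1" for lam zc r c
 proof -
  have "H (2 * r) key = H' (2 * r) key" "H (2 * r + 1) key = H' (2 * r + 1) key" if "key \<in> keys_of NP Q" for key
   using assms that \<open>r < R1\<close> by auto
  then show ?thesis unfolding w1_def by (simp add: key_in)
 qed
 then have "wb1 H lam mu = wb1 H' lam mu" for lam mu unfolding wb1_def
  by (intro arg_cong[where f = concat] map_cong refl) auto
 then show ?thesis unfolding ws1_def by (metis ext)
qed

text \<open>The words \<open>g1\<close> seed the hash functions of the sample tables, \<open>g2\<close> those of the rainbow tables.\<close>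

context
 fixes g1 g2 :: "nat list list" and ys us :: "nat list"
 assumes g1: "length g1 = R1 * 2" and g2: "length g2 = R2 * (t + 1)" and us: "us = concat (g1 @ g2) @ ys"
  and gl: "!!g. g \<in> set g1 \<union> set g2 ==> length g = NP * Q"
begin

lemma hash_blocks: "j < R1 * 2 + R2 * (t + 1) ==> key \<in> keys_of NP Q ==> hash_of ((!) us) j key = hl (2 ^ b) NP Q ((g1 @ g2) ! j) key"
proof -
 assume j: "j < R1 * 2 + R2 * (t + 1)" and key: "key \<in> keys_of NP Q"
 have l: "length (concat (g1 @ g2)) = (R1 * 2 + R2 * (t + 1)) * SL"
 proof -
  have "length (concat gs) = length gs * SL" if "!!g. g \<in> set gs ==> length g = NP * Q" for gs :: "nat list list"
   using that by (induction gs) (auto simp: SL_def)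
  then show ?thesis using gl g1 g2 by (simp add: algebra_simps)
 qed
 have "us ! (j * SL + q * Q + key ! q) = (g1 @ g2) ! j ! (q * Q + key ! q)" if "q < NP" for q
 proof -
  have i: "q * Q + key ! q < SL" unfolding SL_def by (rule key_index_less[OF key that])
  have "j * SL + (q * Q + key ! q) < (R1 * 2 + R2 * (t + 1)) * SL" by (rule index_le[OF j i])
  then have "us ! (j * SL + (q * Q + key ! q)) = concat (g1 @ g2) ! (j * SL + (q * Q + key ! q))"
   unfolding us using l by (simp only: nth_append if_True)
  also have "... = (g1 @ g2) ! j ! (q * Q + key ! q)"
   by (rule nth_concat_blocks) (use gl j g1 g2 i in "auto simp: SL_def")
  finally show ?thesis by (simp add: add.assoc)
 qed
 then show ?thesis unfolding hash_of_def hl_def by simp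
qed

lemma hash1: "j < 2 * R1 ==> key \<in> keys_of NP Q ==> hash_of ((!) us) j key = bh g1 j key"
 using hash_blocks[of j key] g1 by (simp add: bh_def nth_append)

lemma hash2: "r < R2 ==> s <= t ==> key \<in> keys_of NP Q ==>
  hash_of ((!) us) (2 * R1 + (r * (t + 1) + s)) key = hl (2 ^ b) NP Q (take (t + 1) (drop (r * (t + 1)) g2) ! s) key"
proof -
 assume h: "r < R2" "s <= t" "key \<in> keys_of NP Q"
 have i: "r * (t + 1) + s < R2 * (t + 1)" by (rule index_le) (use h in auto)
 then have "hash_of ((!) us) (2 * R1 + (r * (t + 1) + s)) key = hl (2 ^ b) NP Q (g2 ! (r * (t + 1) + s)) key"
  using hash_blocks[of "2 * R1 + (r * (t + 1) + s)" key] h g1 by (simp add: nth_append add.assoc)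
 moreover have "take (t + 1) (drop (r * (t + 1)) g2) ! s = g2 ! (r * (t + 1) + s)"
  using h i g2 by (subst nth_take) simp_all
 ultimately show ?thesis by simp
qed

lemma Mt1_T1c: "A1 <= a ==> Mt1 us a = T1c g1 a"
proof -
 assume a: "A1 <= a"
 have "ws1 (hash_of ((!) us)) = ws1 (bh g1)" by (rule ws1_cong) (rule hash1)
 then show ?thesis unfolding Mt1_def T1c_def using Mst_zero[OF a] by (metis upds_base)
qed

lemma hv_hvy: "hv (hash_of ((!) us)) (Mt1 us) 0 lam zc code = hvy g1 lam zc code"
proof -
 have h: "hash_of ((!) us) (2 * r) key = bh g1 (2 * r) key" "hash_of ((!) us) (2 * r + 1) key = bh g1 (2 * r + 1) key"
  if "r < R1" "key \<in> keys_of NP Q" for r key using hash1[of "2 * r" key] hash1[of "2 * r + 1" key] that by auto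
 have T: "Mt1 us (A1 + x) = T1c g1 (A1 + x)" for x by (rule Mt1_T1c) simp
 show ?thesis unfolding hvy_def hv_def Let_def T using h key_in by (metis (no_types, lifting))
qed

text \<open>Carries the abstract chains over to the program: \<open>run\<close> becomes
  \<open>wlk\<close>, and distinct residues of the last hash function become distinct cells.\<close>

lemma cov_found:
 assumes lam: "lam < NL" and bg: "2 * J + 4 <= sa lam" and mu: "mu < 2 ^ (k * L - sa lam)" and r: "r < R2"
  and light: "!!mu h. mu < 2 ^ (k * L - sa lam) ==> h < 2 ^ sa lam ==> ~ hvy g1 lam (crn lam mu) (crn lam mu + dep lam h) ==> cnt lam (crn lam mu) h <= t"
  and nhv: "~ hvy g1 lam (crn lam mu) (crn lam mu + dep lam h)"
  and c: "cov (hvy g1 lam) lam mu h (take (t + 1) (drop (r * (t + 1)) g2))"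
 shows "found (hash_of ((!) us)) (Mt1 us) lam mu h r"
proof -
 let ?zc = "crn lam mu" let ?ky = "kf 0 ?zc (?zc + dep lam h)" let ?H = "hash_of ((!) us)" let ?T = "Mt1 us"
 let ?Wy = "{w. kf 0 ?zc (?zc + dep lam w) = ?ky}" let ?gs = "take (t + 1) (drop (r * (t + 1)) g2)"
 have ch: "chains (2 ^ b) P2 NP Q kfs (tr (hvy g1 lam) lam) (Vs lam (m2 lam)) fst (real t / 2 ^ sa lam) ?ky ?Wy ?zc"
  by (rule cov_inst) (use mu bg hvy_kf light nhv in blast)+
 interpret ch: chains "2 ^ b" P2 NP Q kfs "tr (hvy g1 lam) lam" "Vs lam (m2 lam)" fst "real t / 2 ^ sa lam" ?ky ?Wy ?zc by (rule ch)
 have lgs: "length ?gs = t + 1"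
 proof -
  have "Suc r * (t + 1) <= R2 * (t + 1)" using r by (intro mult_le_mono1) simp
  then show ?thesis using g2 by simp
 qed
 have ltk: "length (take t ?gs) = t" using lgs by simp
 have ap: "ch.ap (?gs ! s) (zc, code) = ?H (2 * R1 + (r * (t + 1) + s)) (kf 0 zc code)" if "s <= t" for s zc code
  unfolding ch.ap_def kfs_def fst_conv snd_conv by (rule hash2[OF r that key_in, symmetric])
 have run: "ch.run (take m (take t ?gs)) (zc, code) = (zc, wlk ?H ?T 0 lam zc r 0 m code)" if "m <= t" for m zc code
  using that
 proof (induction m)
  case (Suc m)
  then have tk: "take (Suc m) (take t ?gs) = take m (take t ?gs) @ [?gs ! m]"
   using ltk by (subst take_Suc_conv_app_nth) auto
  have st: "stp ?H ?T 0 lam zc r m code = (if hvy g1 lam zc (zc + dep lam (?H (2 * R1 + (r * (t + 1) + m)) (kf 0 zc code))) then code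
    else zc + dep lam (?H (2 * R1 + (r * (t + 1) + m)) (kf 0 zc code)))" for code
   unfolding stp_def Let_def hv_hvy ..
  have "ch.run (take (Suc m) (take t ?gs)) (zc, code) =
    tr (hvy g1 lam) lam (zc, wlk ?H ?T 0 lam zc r 0 m code) (?H (2 * R1 + (r * (t + 1) + m)) (kf 0 zc (wlk ?H ?T 0 lam zc r 0 m code)))"
   unfolding tk ch.run_append Suc.IH[OF Suc_leD[OF Suc.prems]] ap[OF Suc_leD[OF Suc.prems]] ..
  also have "... = (zc, wlk ?H ?T 0 lam zc r 0 (Suc m) code)" unfolding wlk_Suc st tr_def fst_conv snd_conv add_0 ..
  finally show ?case .
 qed (simp add: wlk_def)
 obtain s0 i where s0: "s0 \<in> Sts lam (m2 lam)" "fst s0 = ?zc" and i: "i < t" and hit0: "ch.hit (take t ?gs) s0 i"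
  and nc0: "!!s'. s' \<in> Sts lam (m2 lam) ==> s' ~= s0 ==> ~ ch.coll (take t ?gs) (?gs ! t) s0 s'"
  using c unfolding cov_def Let_def ch.covered_def ltk by blast
 obtain mu' c where s: "mu' < 2 ^ (k * L - sa lam)" "c < m2 lam" "s0 = (crn lam mu', start (crn lam mu') c)"
  using s0(1) unfolding Sts_def by auto
 note hit = hit0[unfolded s(3)] and nc = nc0[unfolded s(3)]
 have mm: "mu' = mu" by (rule crn_inj[OF s(1) mu]) (use s0(2) s(3) in simp)
 have "ch.ap (take t ?gs ! i) (ch.run (take i (take t ?gs)) (?zc, start ?zc c)) \<in> ?Wy" using hit unfolding mm ch.hit_iff by blast
 then have kw: "kf 0 ?zc (?zc + dep lam (?H (2 * R1 + (r * (t + 1) + i)) (kf 0 ?zc (wlk ?H ?T 0 lam ?zc r 0 i (start ?zc c))))) = ?ky"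
  unfolding run[OF less_imp_le[OF i]] nth_take[OF i] ap[OF less_imp_le[OF i]] by (rule CollectD)
 \<comment> \<open>The point drawn in step \<open>i\<close> has the key of the target, which is not
   skipped; so the walk really moves there.\<close>
 have "kf 0 ?zc (wlk ?H ?T 0 lam ?zc r 0 (Suc i) (start ?zc c)) = ?ky"
  unfolding wlk_Suc stp_def Let_def hv_hvy add_0 using kw nhv hvy_kf[OF kw] by simp
 then have "kf 0 ?zc (wlk ?H ?T 0 lam ?zc r 0 (i + 1) (start ?zc c)) = ?ky" unfolding Suc_eq_plus1 .
 moreover have "cell2 ?H 0 lam ?zc r (wlk ?H ?T 0 lam ?zc r 0 t (start ?zc c)) ~= cell2 ?H 0 lam (crn lam mu'') r (wlk ?H ?T 0 lam (crn lam mu'') r 0 t (start (crn lam mu'') c'))"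
  if h: "mu'' < 2 ^ (k * L - sa lam)" "c' < m2 lam" "(mu'', c') ~= (mu, c)" for mu'' c'
 proof -
  have "(crn lam mu'', start (crn lam mu'') c') \<in> Sts lam (m2 lam)" unfolding Sts_def using h by auto
  moreover have "(crn lam mu'', start (crn lam mu'') c') ~= (?zc, start ?zc c)"
   using h crn_inj[OF h(1) mu] start_inj by auto
  ultimately have "~ ch.coll (take t ?gs) (?gs ! t) (?zc, start ?zc c) (crn lam mu'', start (crn lam mu'') c')" using nc unfolding mm by blast
  moreover have "take t (take t ?gs) = take t ?gs" by (simp only: take_take min.left_idem)
  ultimately show ?thesis using run[of t] unfolding ch.coll_def cell2_def by (simp only: ap[OF order.refl] order.refl add_left_cancel simp_thms)
 qed
 ultimately show ?thesis unfolding found_def Let_def using s(2) i by blast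
qed

end

definition targets :: "(nat \<times> nat \<times> nat) set" where
 "targets = (SIGMA lam:{lam. lam < NL & 2 * J + 4 <= sa lam}. {..<2 ^ (k * L - sa lam)} \<times> {..<2 ^ sa lam})"

lemma targets_card: "finite targets" "card targets <= NL * U"
proof -
 have f: "finite {lam. lam < NL & 2 * J + 4 <= sa lam}" by simp
 then show "finite targets" unfolding targets_def by (intro finite_SigmaI) auto
 have "card targets = (\<Sum>lam\<in>{lam. lam < NL & 2 * J + 4 <= sa lam}. card ({..<2 ^ (k * L - sa lam) :: nat} \<times> {..<2 ^ sa lam :: nat}))"
  unfolding targets_def using f by (intro card_SigmaI) auto
 also have "... = (\<Sum>lam\<in>{lam. lam < NL & 2 * J + 4 <= sa lam}. U)"
 proof (intro sum.cong refl)
  fix lam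
  have "card ({..<2 ^ (k * L - sa lam) :: nat} \<times> {..<2 ^ sa lam :: nat}) = 2 ^ (k * L - sa lam + sa lam)"
   by (simp only: card_cartesian_product card_lessThan power_add)
  then show "card ({..<2 ^ (k * L - sa lam) :: nat} \<times> {..<2 ^ sa lam :: nat}) = U" using sa_le[of lam] by (simp add: U_def)
 qed
 also have "... <= NL * U"
 proof -
  have "card {lam. lam < NL & 2 * J + 4 <= sa lam} <= card {..<NL}" by (intro card_mono) auto
  then show ?thesis by simp
 qed
 finally show "card targets <= NL * U" .
qed

definition missed :: "nat list list => nat \<times> nat \<times> nat => bool" where
 "missed g1 = (%(lam, mu, h). ~ hvy g1 lam (crn lam mu) (crn lam mu + dep lam h))"

definition heavy :: "nat \<times> nat \<times> nat => bool" where
 "heavy = (%(lam, mu, h). t < cnt lam (crn lam mu) h)"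

definition uncovered :: "nat list list => nat list list => nat \<times> nat \<times> nat => bool" where
 "uncovered g1 g2 = (%(lam, mu, h). ALL r<R2. ~ cov (hvy g1 lam) lam mu h (take (t + 1) (drop (r * (t + 1)) g2)))"

lemma missed_prob: "x \<in> targets ==> heavy x ==> seqE Hb (R1 * 2) (%g1. of_bool (missed g1 x)) <= (1 / 2) ^ R1"
proof -
 assume x: "x \<in> targets" "heavy x"
 obtain lam mu h where d: "x = (lam, mu, h)" by (metis prod_cases3)
 have l: "lam < NL" "2 * J + 4 <= sa lam" "mu < 2 ^ (k * L - sa lam)" and c: "t < cnt lam (crn lam mu) h"
  using x unfolding d targets_def heavy_def by auto
 note EH = expct_hE[of "2 ^ b" NP Q, OF zero_less_power[OF zero_less_numeral]]
 have "seqE Hb (R1 * 2) (%g1. of_bool (missed g1 x)) <= seqE Hb (R1 * 2) (%g1. of_bool (ALL r<R1. ~ caught lam mu h (take 2 (drop (r * 2) g1))))"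
  by (rule E_mono[OF expct_seqE[OF EH]]) (use caught_hvy[OF l(1,2,3)] in "auto simp: missed_def d")
 also have "... <= (1 / 2) ^ R1" by (rule seqE_groups[OF EH caught_prob[OF l(3,2) c]]) simp
 finally show ?thesis .
qed

lemma uncovered_prob:
 assumes x: "x \<in> targets" "missed g1 x" and ok: "!!x. x \<in> targets ==> heavy x ==> ~ missed g1 x"
 shows "seqE Hb (R2 * (t + 1)) (%g2. of_bool (uncovered g1 g2 x)) <= (1 - 1 / (32 * real t)) ^ R2"
proof -
 obtain lam mu h where d: "x = (lam, mu, h)" by (metis prod_cases3)
 have l: "lam < NL" "2 * J + 4 <= sa lam" "mu < 2 ^ (k * L - sa lam)" "h < 2 ^ sa lam" and c: "~ hvy g1 lam (crn lam mu) (crn lam mu + dep lam h)"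
  using x unfolding d targets_def missed_def by auto
 note EH = expct_hE[of "2 ^ b" NP Q, OF zero_less_power[OF zero_less_numeral]]
 have light: "cnt lam (crn lam mu) h <= t" if "mu < 2 ^ (k * L - sa lam)" "h < 2 ^ sa lam" "~ hvy g1 lam (crn lam mu) (crn lam mu + dep lam h)" for mu h
  using ok[of "(lam, mu, h)"] that l unfolding heavy_def missed_def targets_def by force
 have p: "seqE Hb (t + 1) (%gs. of_bool (~ cov (hvy g1 lam) lam mu h gs)) <= 1 - 1 / (32 * real t)"
  by (rule cov_prob) (use l c light hvy_kf in blast)+
 have "1 <= real t" using t_pos by simp
 then have "0 <= 1 - 1 / (32 * real t)" by (simp add: divide_simps)
 from seqE_groups[OF EH p this, of R2] show ?thesis unfolding uncovered_def d by simp
qed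

lemma not_all_found:
 assumes g: "length g1 = R1 * 2" "length g2 = R2 * (t + 1)" "us = concat (g1 @ g2) @ ys" "!!g. g \<in> set g1 \<union> set g2 ==> length g = NP * Q"
  and n: "~ all_found us" and ok: "!!x. x \<in> targets ==> heavy x ==> ~ missed g1 x"
 shows "\<exists>x\<in>targets. missed g1 x & uncovered g1 g2 x"
proof -
 obtain lam mu h where l: "lam < NL" "2 * J + 4 <= sa lam" "mu < 2 ^ (k * L - sa lam)" "h < 2 ^ sa lam"
  and nh: "~ hv (hash_of ((!) us)) (Mt1 us) 0 lam (crn lam mu) (crn lam mu + dep lam h)"
  and nf: "!!r. r < R2 ==> ~ found (hash_of ((!) us)) (Mt1 us) lam mu h r"
  using n unfolding all_found_def by blast
 have nhv: "~ hvy g1 lam (crn lam mu) (crn lam mu + dep lam h)"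
 proof -
  have "hv (hash_of ((!) us)) (Mt1 us) 0 lam (crn lam mu) (crn lam mu + dep lam h) = hvy g1 lam (crn lam mu) (crn lam mu + dep lam h)"
   by (rule hv_hvy) (use g in blast)+
  then show ?thesis using nh by simp
 qed
 have light: "cnt lam (crn lam mu) h <= t" if "mu < 2 ^ (k * L - sa lam)" "h < 2 ^ sa lam" "~ hvy g1 lam (crn lam mu) (crn lam mu + dep lam h)" for mu h
  using ok[of "(lam, mu, h)"] that l unfolding heavy_def missed_def targets_def by force
 have "found (hash_of ((!) us)) (Mt1 us) lam mu h r" if "r < R2" "cov (hvy g1 lam) lam mu h (take (t + 1) (drop (r * (t + 1)) g2))" for r
  by (rule cov_found) (use g l(1,2,3) that light nhv in blast)+
 then have "uncovered g1 g2 (lam, mu, h)" unfolding uncovered_def using nf by auto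
 moreover have "(lam, mu, h) \<in> targets" "missed g1 (lam, mu, h)" using l nhv by (auto simp: targets_def missed_def)
 ultimately show ?thesis by blast
qed

text \<open>Two rounds are necessary because the skipping rule comes from the sample tables. First,
  each value with more than \<open>t\<close> preimages is missed with probability at most 2^-R1. If
  \<open>g1\<close> misses none of them, all remaining values have at most \<open>t\<close>
  preimages, and for this fixed \<open>g1\<close> the rainbow tables succeed as in
  \<open>cov_prob\<close>.\<close>

lemma fail_bound:
 assumes N: "NS <= N"
 shows "seqE (avg (2 ^ b)) N (%us. of_bool (~ all_found us)) <= real (NL * U) * ((1 / 2) ^ R1 + (1 - 1 / (32 * real t)) ^ R2)"
proof -
 let ?A = "avg (2 ^ b)" let ?p1 = "(1 / 2 :: real) ^ R1" let ?p2 = "(1 - 1 / (32 * real t)) ^ R2"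
 note EA = expct_avg[of "2 ^ b", OF zero_less_power[OF zero_less_numeral]]
 note EH = expct_hE[of "2 ^ b" NP Q, OF zero_less_power[OF zero_less_numeral]]
 note ES = expct_seqE[OF EH]
 have tp: "1 <= real t" using t_pos by simp
 have p2: "0 <= ?p2" using tp by (intro zero_le_power) (simp add: divide_simps)
 \<comment> \<open>\<open>M\<close> counts the random words beyond the seeds; they are averaged
   out.\<close>
 obtain M where M: "N = NS + M" using N le_iff_add by blast
 have NS: "NS = (R1 * 2 + R2 * (t + 1)) * (NP * Q)" by (simp add: NS_def SL_def mult.commute)
 let ?f = "%g1 g2 ys. of_bool (~ all_found (concat (g1 @ g2) @ ys)) :: real"
 let ?F1 = "%g1. \<Sum>x\<in>{x \<in> targets. heavy x}. of_bool (missed g1 x) :: real"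
 let ?ok = "%g1 :: nat list list. \<forall>x\<in>targets. heavy x --> ~ missed g1 x"
 have "seqE ?A N (%us. of_bool (~ all_found us)) = seqE Hb (R1 * 2) (%g1. seqE Hb (R2 * (t + 1)) (%g2. seqE ?A M (%ys. ?f g1 g2 ys)))"
  unfolding M NS seqE_append[OF EA] seqE_concat[OF EA] seqE_append[OF EH] ..
 \<comment> \<open>If \<open>g1\<close> misses a heavy value, \<open>?F1 g1\<close> is at least 1
   and exceeds any probability. Otherwise the second summand is the union bound over the targets
   left to the rainbow tables.\<close>
 also have "... <= seqE Hb (R1 * 2) (%g1. ?F1 g1 + real (card targets) * ?p2)"
 proof (rule E_mono[OF ES])
  fix g1 :: "nat list list" assume "g1 \<in> {gs. length gs = R1 * 2 & set gs \<subseteq> {gs. length gs = NP * Q & set gs \<subseteq> {..<2 ^ b}}}"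
  then have g1: "length g1 = R1 * 2" "!!g. g \<in> set g1 ==> length g = NP * Q" by auto
  show "seqE Hb (R2 * (t + 1)) (%g2. seqE ?A M (%ys. ?f g1 g2 ys)) <= ?F1 g1 + real (card targets) * ?p2"
  proof (cases "?ok g1")
   case False
   then obtain x where x: "x \<in> targets" "heavy x" "missed g1 x" by blast
   have "seqE Hb (R2 * (t + 1)) (%g2. seqE ?A M (%ys. ?f g1 g2 ys)) <= 1"
    by (intro E_le_const[OF ES] E_le_const[OF expct_seqE[OF EA]]) simp
   also have "1 = (of_bool (missed g1 x) :: real)" using x by simp
   also have "... <= ?F1 g1" using targets_card(1) x by (intro member_le_sum) auto
   finally show ?thesis using p2 by (simp add: add_increasing2)
  next
   case True
   let ?T = "{x \<in> targets. missed g1 x}"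
   have fT: "finite ?T" using targets_card(1) by simp
   have "seqE Hb (R2 * (t + 1)) (%g2. seqE ?A M (%ys. ?f g1 g2 ys)) <= seqE Hb (R2 * (t + 1)) (%g2. \<Sum>x\<in>?T. of_bool (uncovered g1 g2 x))"
   proof (rule E_mono[OF ES])
    fix g2 :: "nat list list" assume "g2 \<in> {gs. length gs = R2 * (t + 1) & set gs \<subseteq> {gs. length gs = NP * Q & set gs \<subseteq> {..<2 ^ b}}}"
    then have g2: "length g2 = R2 * (t + 1)" "!!g. g \<in> set g2 ==> length g = NP * Q" by auto
    show "seqE ?A M (%ys. ?f g1 g2 ys) <= (\<Sum>x\<in>?T. of_bool (uncovered g1 g2 x))"
    proof (rule E_le_const[OF expct_seqE[OF EA]])
     fix ys
     show "?f g1 g2 ys <= (\<Sum>x\<in>?T. of_bool (uncovered g1 g2 x))"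
     proof (cases "all_found (concat (g1 @ g2) @ ys)")
      case False
      have "\<exists>x\<in>targets. missed g1 x & uncovered g1 g2 x"
       by (rule not_all_found[OF g1(1) g2(1) refl _ False]) (use g1 g2 True in auto)
      then obtain x where x: "x \<in> ?T" "uncovered g1 g2 x" by blast
      have "?f g1 g2 ys = of_bool (uncovered g1 g2 x)" using x False by simp
      also have "... <= (\<Sum>x\<in>?T. of_bool (uncovered g1 g2 x))" using fT x by (intro member_le_sum) auto
      finally show ?thesis .
     qed (simp add: sum_nonneg)
    qed
   qed
   also have "... = (\<Sum>x\<in>?T. seqE Hb (R2 * (t + 1)) (%g2. of_bool (uncovered g1 g2 x)))" by (rule E_sum[OF ES fT])
   also have "... <= (\<Sum>x\<in>?T. ?p2)" by (intro sum_mono uncovered_prob) (use True in auto)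
   also have "... = real (card ?T) * ?p2" by simp
   also have "... <= real (card targets) * ?p2" using p2 targets_card(1) by (intro mult_right_mono of_nat_mono card_mono) auto
   finally show ?thesis by (simp add: add_increasing sum_nonneg)
  qed
 qed
 also have "... = (\<Sum>x\<in>{x \<in> targets. heavy x}. seqE Hb (R1 * 2) (%g1. of_bool (missed g1 x))) + real (card targets) * ?p2"
  unfolding E_add[OF ES] E_const[OF ES] using targets_card(1) by (subst E_sum[OF ES]) auto
 also have "... <= (\<Sum>x\<in>{x \<in> targets. heavy x}. ?p1) + real (card targets) * ?p2"
  by (intro add_right_mono sum_mono missed_prob) auto
 also have "... <= real (card targets) * ?p1 + real (card targets) * ?p2"
 proof -
  have "real (card {x \<in> targets. heavy x}) <= real (card targets)" using targets_card(1) by (intro of_nat_mono card_mono) auto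
  then show ?thesis by (intro add_right_mono) (simp add: mult_right_mono)
 qed
 also have "... = real (card targets) * (?p1 + ?p2)" by (simp add: distrib_left)
 also have "... <= real (NL * U) * (?p1 + ?p2)" using p2 targets_card(2) by (intro mult_right_mono of_nat_mono) auto
 finally show ?thesis .
qed

end

section \<open>Encodings of instances and queries\<close>

declare One_nat_def [simp]

lemma length_concat_blocks: "(!!x. x \<in> set gs ==> length x = m) ==> length (concat gs) = length gs * m"
 by (induction gs) auto

lemma ceil_div: "0 < b ==> nat \<lceil>real w / real b\<rceil> = (w + b - 1) div b"
proof -
 assume b: "0 < b"
 define q where "q = (w + b - 1) div b"
 have 1: "q * b <= w + b - 1" unfolding q_def by simp
 have 2: "w + b - 1 < (q + 1) * b" unfolding q_def using b by (metis Suc_eq_plus1 dividend_less_div_times mult_Suc add.commute)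
 have "w + b >= q * b + 1" using 1 b by linarith
 then have "real q * real b + 1 <= real w + real b" by (metis of_nat_1 of_nat_add of_nat_le_iff of_nat_mult)
 then have "real q - 1 < real w / real b" using b by (simp add: field_simps)
 moreover have "real w / real b <= real q"
 proof -
  have "w <= q * b" using 2 b by (simp add: algebra_simps)
  then have "real w <= real q * real b" by (metis of_nat_le_iff of_nat_mult)
  then show ?thesis using b by (simp add: field_simps)
 qed
 ultimately have "\<lceil>real w / real b\<rceil> = int q" by (intro ceiling_unique) auto
 then show ?thesis by (simp add: q_def)
qed

lemma digits_simps: "length (digits b len x) = len" "e < len ==> digits b len x ! e = x div 2 ^ (b * e) mod 2 ^ b"
 by (simp_all add: digits_def)

lemma encode_num_simps:
 assumes "0 < b"
 shows "length (encode_num b w x) = (w + b - 1) div b"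
  "e < (w + b - 1) div b ==> encode_num b w x ! e = x div 2 ^ (b * e) mod 2 ^ b"
 unfolding encode_num_def ceil_div[OF assms] by (simp_all add: digits_simps)

lemma nth_default_append2: "nth_default z (xs @ ys) (length xs + i) = nth_default z ys i"
 by (simp add: nth_default_append)

lemma nth_default_append1: "i < length xs ==> nth_default z (xs @ ys) i = xs ! i"
 by (simp add: nth_default_append nth_default_nth)

lemma encode_instance_skip:
 "nth_default 0 (encode_instance b w k d n \<alpha> A p) (4 + x) =
   nth_default 0 (concat (map (%i. concat (map (encode_num b w) (A i))) [0..<k]) @ encode_poly b w k d p) x"
proof -
 have "length [b, n, w, nat \<lceil>real n powr \<alpha>\<rceil>] = 4" by simp
 then show ?thesis unfolding encode_instance_def using nth_default_append2[of 0 "[b, n, w, nat \<lceil>real n powr \<alpha>\<rceil>]"] by metis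
qed

lemma encode_instance_arrays:
 assumes b: "0 < b" and len: "len = (w + b - 1) div b" and A: "!!i. i < k ==> length (A i) = n" and h: "i < k" "j < n" "e < len"
 shows "nth_default 0 (encode_instance b w k d n \<alpha> A p) (4 + ((i * n + j) * len + e)) = A i ! j div 2 ^ (b * e) mod 2 ^ b"
proof -
 let ?B = "%i. concat (map (encode_num b w) (A i))"
 have lB: "length (?B i) = n * len" if "i < k" for i
  by (subst length_concat_blocks[where m = len]) (use A[OF that] in "auto simp: encode_num_simps[OF b] len")
 have l: "length (concat (map ?B [0..<k])) = k * (n * len)"
  by (subst length_concat_blocks[where m = "n * len"]) (use lB in auto)
 have i2: "j * len + e < n * len"
 proof -
  have "j * len + e < Suc j * len" using h by simp
  also have "... <= n * len" using h by (intro mult_le_mono1) simp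
  finally show ?thesis .
 qed
 have i1: "i * (n * len) + (j * len + e) < k * (n * len)"
 proof -
  have "i * (n * len) + (j * len + e) < Suc i * (n * len)" using i2 by simp
  also have "... <= k * (n * len)" using h by (intro mult_le_mono1) simp
  finally show ?thesis .
 qed
 have "nth_default 0 (encode_instance b w k d n \<alpha> A p) (4 + ((i * n + j) * len + e)) =
   nth_default 0 (concat (map ?B [0..<k]) @ encode_poly b w k d p) (i * (n * len) + (j * len + e))"
  unfolding encode_instance_skip by (simp only: add_mult_distrib mult.assoc add.assoc)
 also have "... = concat (map ?B [0..<k]) ! (i * (n * len) + (j * len + e))"
  by (rule nth_default_append1) (use l i1 in simp)
 also have "... = ?B i ! (j * len + e)"
  by (subst nth_concat_blocks[where m = "n * len"]) (use lB i2 h in auto)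
 also have "... = encode_num b w (A i ! j) ! e"
  by (subst nth_concat_blocks[where m = len]) (use A h in "auto simp: encode_num_simps[OF b] len")
 also have "... = A i ! j div 2 ^ (b * e) mod 2 ^ b" using h by (simp add: encode_num_simps[OF b] len)
 finally show ?thesis .
qed

lemma encode_instance_poly:
 assumes b: "0 < b" and len: "len = (w + b - 1) div b" and A: "!!i. i < k ==> length (A i) = n" and h: "idx < Suc d ^ k" "e < len"
 shows "nth_default 0 (encode_instance b w k d n \<alpha> A p) (4 + (k * n * len + (idx * len + e))) =
   Poly_Mapping.lookup p (Poly_Mapping.nth (List.n_lists k [0..<Suc d] ! idx)) div 2 ^ (b * e) mod 2 ^ b"
proof -
 let ?B = "%i. concat (map (encode_num b w) (A i))"
 have lB: "length (?B i) = n * len" if "i < k" for i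
  by (subst length_concat_blocks[where m = len]) (use A[OF that] in "auto simp: encode_num_simps[OF b] len")
 have l: "length (concat (map ?B [0..<k])) = k * (n * len)"
  by (subst length_concat_blocks[where m = "n * len"]) (use lB in auto)
 have il: "idx < length (List.n_lists k [0..<Suc d])" using h by (simp add: length_n_lists)
 have ip: "idx * len + e < length (encode_poly b w k d p)"
 proof -
  have "length (encode_poly b w k d p) = Suc d ^ k * len"
   unfolding encode_poly_def by (subst length_concat_blocks[where m = len]) (auto simp: encode_num_simps[OF b] len length_n_lists)
  moreover have "idx * len + e < Suc idx * len" using h by simp
  moreover have "Suc idx * len <= Suc d ^ k * len" using h by (intro mult_le_mono1) simp
  ultimately show ?thesis by linarith
 qed
 have "nth_default 0 (encode_instance b w k d n \<alpha> A p) (4 + (k * n * len + (idx * len + e))) =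
   nth_default 0 (concat (map ?B [0..<k]) @ encode_poly b w k d p) (k * (n * len) + (idx * len + e))"
  unfolding encode_instance_skip by (simp only: add_mult_distrib mult.assoc add.assoc)
 also have "... = nth_default 0 (encode_poly b w k d p) (idx * len + e)" unfolding l[symmetric] by (rule nth_default_append2)
 also have "... = encode_poly b w k d p ! (idx * len + e)" using ip by (simp add: nth_default_nth)
 also have "... = encode_num b w (Poly_Mapping.lookup p (Poly_Mapping.nth (List.n_lists k [0..<Suc d] ! idx))) ! e"
  unfolding encode_poly_def by (subst nth_concat_blocks[where m = len]) (use il h in "auto simp: encode_num_simps[OF b] len simp del: upt_Suc")
 also have "... = Poly_Mapping.lookup p (Poly_Mapping.nth (List.n_lists k [0..<Suc d] ! idx)) div 2 ^ (b * e) mod 2 ^ b"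
  using h by (simp add: encode_num_simps[OF b] len)
 finally show ?thesis .
qed

lemma encode_instance_header: "nth_default 0 (encode_instance b w k d n \<alpha> A p) 0 = b" "nth_default 0 (encode_instance b w k d n \<alpha> A p) 1 = n"
 "nth_default 0 (encode_instance b w k d n \<alpha> A p) 2 = w" "nth_default 0 (encode_instance b w k d n \<alpha> A p) 3 = nat \<lceil>real n powr \<alpha>\<rceil>"
 by (simp_all add: encode_instance_def numeral_2_eq_2 numeral_3_eq_3)

lemma encode_query_bounds:
 assumes b: "0 < b" and len: "len = (w + b - 1) div b" and h: "i < k" "e < len"
 shows "nth_default 0 (encode_query b w k l r y) ((2 * i + 0) * len + e) = l i div 2 ^ (b * e) mod 2 ^ b"
  "nth_default 0 (encode_query b w k l r y) ((2 * i + 1) * len + e) = r i div 2 ^ (b * e) mod 2 ^ b"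
  "nth_default 0 (encode_query b w k l r y) (2 * k * len + x) = nth_default 0 (encode_int b y) x"
proof -
 let ?B = "%i. encode_num b w (l i) @ encode_num b w (r i)"
 have lB: "length (?B i) = 2 * len" for i by (simp add: encode_num_simps[OF b] len)
 have l: "length (concat (map ?B [0..<k])) = k * (2 * len)"
  by (subst length_concat_blocks[where m = "2 * len"]) (use lB in auto)
 have *: "nth_default 0 (encode_query b w k l r y) (i * (2 * len) + x) = ?B i ! x" if "x < 2 * len" for x
 proof -
  have "i * (2 * len) + x < Suc i * (2 * len)" using that by simp
  moreover have "Suc i * (2 * len) <= k * (2 * len)" using h by (intro mult_le_mono1) simp
  ultimately have "nth_default 0 (encode_query b w k l r y) (i * (2 * len) + x) = concat (map ?B [0..<k]) ! (i * (2 * len) + x)"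
   unfolding encode_query_def by (intro nth_default_append1) (use l in linarith)
  also have "... = ?B i ! x" by (subst nth_concat_blocks[where m = "2 * len"]) (use lB that h in auto)
  finally show ?thesis .
 qed
 show "nth_default 0 (encode_query b w k l r y) ((2 * i + 0) * len + e) = l i div 2 ^ (b * e) mod 2 ^ b"
  using *[of e] h by (simp add: nth_append encode_num_simps[OF b] len algebra_simps)
 show "nth_default 0 (encode_query b w k l r y) ((2 * i + 1) * len + e) = r i div 2 ^ (b * e) mod 2 ^ b"
  using *[of "len + e"] h by (simp add: nth_append encode_num_simps[OF b] len algebra_simps)
 show "nth_default 0 (encode_query b w k l r y) (2 * k * len + x) = nth_default 0 (encode_int b y) x"
  using nth_default_append2[of 0 "concat (map ?B [0..<k])" "encode_int b y" x] unfolding l encode_query_def by (simp add: algebra_simps)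
qed

text \<open>Past the end the input reads as 0, so the formulas for announcing words and digits hold
  for every \<open>e\<close>. The query relies on this when it reads \<open>lim\<close> digits of a
  shorter \<open>y\<close>.\<close>

lemma encode_int_simps:
 assumes b: "0 < b" and m: "m = (LEAST len. nat \<bar>y\<bar> < 2 ^ (b * len))"
 shows "nth_default 0 (encode_int b y) 0 = of_bool (y < 0)"
  "nth_default 0 (encode_int b y) (1 + 2 * e) = of_bool (e < m)"
  "nth_default 0 (encode_int b y) (2 + 2 * e) = (if e < m then nat \<bar>y\<bar> div 2 ^ (b * e) mod 2 ^ b else 0)"
proof -
 let ?ds = "digits b m (nat \<bar>y\<bar>)" let ?C = "concat (map (%v. [1, v]) ?ds)"
 have e: "encode_int b y = of_bool (y < 0) # ?C @ [0]" by (simp add: encode_int_def m)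
 have l: "length ?C = m * 2" by (subst length_concat_blocks[where m = 2]) (auto simp: digits_simps)
 have C: "?C ! (e * 2 + i) = [1, ?ds ! e] ! i" if "e < m" "i < 2" for e i
  by (subst nth_concat_blocks[where m = 2]) (use that in "auto simp: digits_simps")
 show "nth_default 0 (encode_int b y) 0 = of_bool (y < 0)" by (simp add: e)
 show "nth_default 0 (encode_int b y) (1 + 2 * e) = of_bool (e < m)"
 proof (cases "e < m")
  case True
  then have "nth_default 0 (?C @ [0]) (e * 2 + 0) = ?C ! (e * 2 + 0)" by (intro nth_default_append1) (use l in simp)
  then show ?thesis using C[of e 0] True by (simp add: e mult.commute)
 next
  case False
  then obtain x where "e = m + x" using le_iff_add not_le by metis
  then have "nth_default 0 (?C @ [0]) (2 * e) = nth_default 0 [0] (2 * x)"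
   using nth_default_append2[of 0 ?C "[0]" "2 * x"] l by (simp add: algebra_simps)
  moreover have "nth_default 0 [0] (2 * x) = (0::nat)" by (cases x) (simp_all add: nth_default_def)
  ultimately show ?thesis using False unfolding e plus_1_eq_Suc nth_default_Cons_Suc by (simp only: of_bool_def if_False)
 qed
 show "nth_default 0 (encode_int b y) (2 + 2 * e) = (if e < m then nat \<bar>y\<bar> div 2 ^ (b * e) mod 2 ^ b else 0)"
 proof (cases "e < m")
  case True
  then have "nth_default 0 (?C @ [0]) (e * 2 + 1) = ?C ! (e * 2 + 1)" by (intro nth_default_append1) (use l in simp)
  then show ?thesis using C[of e 1] True by (simp add: e mult.commute digits_simps)
 next
  case False
  then show ?thesis using l by (simp add: e nth_default_def nth_append)
 qed
qed

text \<open>In \<open>List.n_lists\<close> the first entry varies fastest, so the exponents are the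
  base-\<open>v\<close> digits of the index, least significant first.\<close>

lemma n_lists_nth: "idx < v ^ k ==> List.n_lists k [0..<v] ! idx = map (dg v idx) [0..<k]"
proof (induction k arbitrary: idx)
 case (Suc k)
 have v: "0 < v" using Suc.prems by (cases v) auto
 define q r where "q = idx div v" and "r = idx mod v"
 have i: "idx = q * v + r" "r < v" using v by (simp_all add: q_def r_def)
 have q: "q < v ^ k" using Suc.prems v unfolding q_def by (simp add: div_less_iff_less_mult mult.commute)
 have "List.n_lists (Suc k) [0..<v] ! idx = map (%ys. map (%y. y # ys) [0..<v]) (List.n_lists k [0..<v]) ! q ! r"
  unfolding i List.n_lists.simps by (rule nth_concat_blocks) (use q i in "auto simp: length_n_lists")
 also have "... = r # map (dg v q) [0..<k]" using q i Suc.IH[OF q] by (simp add: length_n_lists)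
 also have "... = map (dg v idx) [0..<Suc k]"
  unfolding upt_rec[of 0 "Suc k"] by (simp add: map_Suc_upt[symmetric] dg_def q_def r_def div_mult2_eq del: upt_Suc)
 finally show ?case .
qed simp

lemma dg_sum: "(\<Sum>i<k. dg v x i * v ^ i) = x mod v ^ k"
proof (induction k)
 case (Suc k)
 then show ?case by (simp add: dg_def mod_mult2_eq mult.commute[of v] )
qed simp

definition mon :: "nat => nat => nat => (nat \<Rightarrow>\<^sub>0 nat)" where
 "mon v k idx = Poly_Mapping.nth (map (dg v idx) [0..<k])"

lemma lookup_mon: "Poly_Mapping.lookup (mon v k idx) i = (if i < k then dg v idx i else 0)"
 by (simp add: mon_def nth.rep_eq nth_default_def)

lemma mon_inj: "inj_on (mon v k) {..<v ^ k}"
proof (rule inj_onI)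
 fix x y assume xy: "x \<in> {..<v ^ k}" "y \<in> {..<v ^ k}" "mon v k x = mon v k y"
 then have "dg v x i = dg v y i" if "i < k" for i using lookup_mon[of v k x i] lookup_mon[of v k y i] that by simp
 then have "x mod v ^ k = y mod v ^ k" unfolding dg_sum[symmetric] by simp
 then show "x = y" using xy by simp
qed

lemma keys_sub_mon:
 assumes "in_vars k p" "total_degree_le p d"
 shows "Poly_Mapping.keys p \<subseteq> mon (Suc d) k ` {..<Suc d ^ k}"
proof
 fix m assume m: "m \<in> Poly_Mapping.keys p"
 have ks: "Poly_Mapping.keys m \<subseteq> {..<k}" using assms(1) m by (auto simp: in_vars_def)
 have "Poly_Mapping.lookup m i <= d" for i
 proof (cases "i \<in> Poly_Mapping.keys m")
  case True
  then have "Poly_Mapping.lookup m i <= (\<Sum>i\<in>Poly_Mapping.keys m. Poly_Mapping.lookup m i)" by (intro member_le_sum) auto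
  also have "... <= d" using assms(2) m by (auto simp: total_degree_le_def)
  finally show ?thesis .
 qed (simp add: in_keys_iff)
 then have "EX h<Suc d ^ k. ALL i<k. dg (Suc d) h i = Poly_Mapping.lookup m i" by (intro dg_digits) (simp add: less_Suc_eq_le)
 then obtain h where h: "h < Suc d ^ k" "!!i. i < k ==> dg (Suc d) h i = Poly_Mapping.lookup m i" by blast
 have "m = mon (Suc d) k h"
 proof (rule poly_mapping_eqI)
  fix i show "Poly_Mapping.lookup m i = Poly_Mapping.lookup (mon (Suc d) k h) i"
   using h(2) ks by (auto simp: lookup_mon in_keys_iff subset_iff)
 qed
 then show "m \<in> mon (Suc d) k ` {..<Suc d ^ k}" using h(1) by blast
qed

lemma prod_keys: fixes m :: "nat \<Rightarrow>\<^sub>0 nat" shows "Poly_Mapping.keys m \<subseteq> {..<k} ==> (\<Prod>i\<in>Poly_Mapping.keys m. (x i :: nat) ^ Poly_Mapping.lookup m i) = (\<Prod>i<k. x i ^ Poly_Mapping.lookup m i)"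
 by (rule prod.mono_neutral_left) (auto simp: in_keys_iff)

lemma poly_eval_eq:
 assumes "in_vars k p" "total_degree_le p d"
 shows "poly_eval p x = (\<Sum>idx<Suc d ^ k. Poly_Mapping.lookup p (mon (Suc d) k idx) * (\<Prod>i<k. x i ^ dg (Suc d) idx i))"
proof -
 let ?f = "%m. Poly_Mapping.lookup p m * (\<Prod>i<k. x i ^ Poly_Mapping.lookup m i)"
 have "poly_eval p x = (\<Sum>m\<in>Poly_Mapping.keys p. ?f m)"
  unfolding poly_eval_def using assms(1) by (intro sum.cong refl arg_cong2[where f = "(*)"] prod_keys) (auto simp: in_vars_def)
 also have "... = (\<Sum>m\<in>mon (Suc d) k ` {..<Suc d ^ k}. ?f m)"
  using keys_sub_mon[OF assms] by (intro sum.mono_neutral_left) (auto simp: in_keys_iff)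
 also have "... = (\<Sum>idx<Suc d ^ k. ?f (mon (Suc d) k idx))" by (subst sum.reindex[OF mon_inj]) simp
 also have "... = (\<Sum>idx<Suc d ^ k. Poly_Mapping.lookup p (mon (Suc d) k idx) * (\<Prod>i<k. x i ^ dg (Suc d) idx i))"
  by (intro sum.cong refl arg_cong2[where f = "(*)"] prod.cong) (simp_all add: lookup_mon)
 finally show ?thesis .
qed

text \<open>There are at most \<open>Suc d ^ k\<close>, hence at most
  \<open>2 ^ (Suc d * k)\<close>, monomials, each the product of a coefficient and at most
  \<open>d\<close> factors below \<open>2 ^ w\<close>.\<close>

lemma poly_eval_bound:
 assumes p: "in_vars k p" "total_degree_le p d" "!!m. Poly_Mapping.lookup p m < 2 ^ w" and x: "!!i. i < k ==> x i < 2 ^ w"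
 shows "poly_eval p x <= 2 ^ (Suc d * w + Suc d * k)"
proof -
 have "card (Poly_Mapping.keys p) <= card (mon (Suc d) k ` {..<Suc d ^ k})" by (rule card_mono) (use keys_sub_mon[OF p(1,2)] in auto)
 also have "... <= card {..<Suc d ^ k}" by (rule card_image_le) simp
 also have "... = Suc d ^ k" by simp
 also have "... <= (2 ^ Suc d) ^ k" using less_exp[of "Suc d"] by (intro power_mono) auto
 finally have c: "card (Poly_Mapping.keys p) <= 2 ^ (Suc d * k)" unfolding power_mult .
 have "Poly_Mapping.lookup p m * (\<Prod>i\<in>Poly_Mapping.keys m. x i ^ Poly_Mapping.lookup m i) <= 2 ^ (Suc d * w)" if m: "m \<in> Poly_Mapping.keys p" for m
 proof -
  have ks: "Poly_Mapping.keys m \<subseteq> {..<k}" using p(1) m by (auto simp: in_vars_def)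
  have "(\<Prod>i\<in>Poly_Mapping.keys m. x i ^ Poly_Mapping.lookup m i) <= (\<Prod>i\<in>Poly_Mapping.keys m. (2 ^ w) ^ Poly_Mapping.lookup m i)"
   using ks x by (intro prod_mono conjI power_mono) (auto intro: less_imp_le)
  also have "... = 2 ^ (w * (\<Sum>i\<in>Poly_Mapping.keys m. Poly_Mapping.lookup m i))" by (simp add: sum_distrib_left power_sum power_mult)
  also have "... <= 2 ^ (w * d)" using p(2) m by (intro power_increasing mult_le_mono2) (auto simp: total_degree_le_def)
  finally have "Poly_Mapping.lookup p m * (\<Prod>i\<in>Poly_Mapping.keys m. x i ^ Poly_Mapping.lookup m i) <= 2 ^ w * 2 ^ (w * d)"
   using less_imp_le[OF p(3)] by (intro mult_le_mono)
  then show ?thesis by (simp add: power_add mult.commute)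
 qed
 then have "poly_eval p x <= card (Poly_Mapping.keys p) * 2 ^ (Suc d * w)" unfolding poly_eval_def using sum_bounded_above[of "Poly_Mapping.keys p"] by (metis (no_types, lifting) of_nat_id)
 also have "... <= 2 ^ (Suc d * k) * 2 ^ (Suc d * w)" using c by (rule mult_le_mono1)
 finally show ?thesis by (simp add: power_add mult.commute)
qed

lemma rank_sorted:
 assumes "distinct xs" "p < length xs" "j < length xs" "xs ! j = sort xs ! p"
 shows "(\<Sum>j'<length xs. of_bool (xs ! j' < xs ! j)) = (p :: nat)"
proof -
 let ?ys = "sort xs" and ?c = "xs ! j"
 have ss: "sorted_wrt (<) ?ys" using assms(1) by (simp add: strict_sorted_iff)
 have lt: "?ys ! a < ?ys ! a'" if "a < a'" "a' < length xs" for a a' using sorted_wrt_nth_less[OF ss that(1)] that(2) by simp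
 have "(\<Sum>j'<length xs. of_bool (xs ! j' < ?c)) = card {j'. j' < length xs & xs ! j' < ?c}"
  by (simp add: sum.If_cases of_bool_def lessThan_def Int_def conj_commute)
 also have "... = card ((!) xs ` {j'. j' < length xs & xs ! j' < ?c})"
  by (rule card_image[symmetric]) (use assms(1) in "auto intro!: inj_onI simp: nth_eq_iff_index_eq")
 also have "(!) xs ` {j'. j' < length xs & xs ! j' < ?c} = {x \<in> set ?ys. x < ?c}" by (auto simp: in_set_conv_nth)
 also have "... = (!) ?ys ` {..<p}"
 proof (intro equalityI subsetI)
  fix x assume "x \<in> {x \<in> set ?ys. x < ?c}"
  then have "x \<in> set ?ys" "x < ?ys ! p" by (simp_all only: mem_Collect_eq assms(4))
  then obtain a where a: "a < length xs" "x = ?ys ! a" by (metis in_set_conv_nth length_sort)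
  have "a < p" using lt[of p a] a \<open>x < ?ys ! p\<close> by (metis linorder_neqE_nat less_asym less_irrefl)
  then show "x \<in> (!) ?ys ` {..<p}" using a by blast
 next
  fix x assume "x \<in> (!) ?ys ` {..<p}"
  then obtain a where a: "a < p" "x = ?ys ! a" by blast
  then have "x \<in> set ?ys" using assms(2) by (metis length_sort less_trans nth_mem)
  then show "x \<in> {x \<in> set ?ys. x < ?c}" using lt[OF a(1) assms(2)] a assms(4) by simp
 qed
 also have "card ... = card {..<p}"
  by (rule card_image) (use assms(1,2) in "auto intro!: inj_onI simp: nth_eq_iff_index_eq")
 finally show ?thesis by simp
qed

lemma sort_index:
 assumes "j < length xs" shows "EX p<length xs. xs ! j = sort xs ! p"
proof -
 have "xs ! j \<in> set (sort xs)" using assms by simp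
 then show ?thesis by (metis in_set_conv_nth length_sort)
qed

lemma unsort_index:
 assumes "p < length xs" shows "EX j<length xs. xs ! j = sort xs ! p"
proof -
 have "sort xs ! p \<in> set (sort xs)" using assms by (intro nth_mem) simp
 then show ?thesis by (metis in_set_conv_nth set_sort)
qed

section \<open>Choice of the parameters\<close>

lemma SO_mult': "SO a f ==> SO a' g ==> a + a' <= e ==> SO e (%n. f n * g n)"
 using SO_mult SO_mono by blast

lemma SO_Suc: "SO 0 f ==> SO 0 (%n. Suc (f n))"
 using SO_add[OF SO_const[of 1], of f] by simp

lemma SO_max: "SO a f ==> SO a g ==> SO a (%n. max (f n) (g n))"
 by (rule SO_le[OF SO_add, of a f g]) (auto intro!: always_eventually)

lemma SO_pos: "SO 0 f ==> 0 <= a ==> SO a f"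
 by (rule SO_mono)

lemma word_size_lg: "word_size ka n = ka * lg n"
 by (simp add: word_size_def lg_def)

lemma pb_Suc: "pb F ==> pb (%ka n. Suc (F ka n))"
 using pb_add[OF pb_const[of 1], of F] by simp

section \<open>Parameters as functions of n and their growth\<close>

locale params =
 fixes k d c :: nat and \<alpha> :: real and w :: "nat => nat"
 assumes k2: "2 <= k" and \<alpha>: "0 < \<alpha>" "\<alpha> < 1" and wPL: "SO 0 w"
begin

text \<open>\<open>2 * k\<close> pays for the union bound over at most
  \<open>2 ^ (2 * k * lg n)\<close> targets, 1 for the two kinds of tables, and \<open>c\<close> for
  the failure probability n^-c. The factor 32 in \<open>pC2\<close> matches the success probability
  1 / (32 t).\<close>

definition "pC1 = 2 * k + 1 + c"
definition "pC2 = 32 * pC1"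
definition "pT n = nat \<lceil>real n powr \<alpha>\<rceil>"
definition "pJ n = (\<Sum>i<lg n. of_bool (2 ^ (3 * i) < pT n) :: nat)"
definition "plen ka n = (w n + word_size ka n - 1) div word_size ka n"
definition "plim ka n = Suc d * plen ka n + (Suc d * k + 1)"
definition "pQ ka n = word_size ka n * plim ka n + 2"
definition "pR1 n = pC1 * lg n"
definition "pR2 n = pC2 * inst.t (pJ n) * lg n"

abbreviation "tt n \<equiv> inst.t (pJ n)"
abbreviation "UU n \<equiv> inst.U k (lg n)"
abbreviation "nNL n \<equiv> inst.NL k (lg n)"
abbreviation "nNS ka n \<equiv> inst.NS (word_size ka n) (pJ n) (pQ ka n) (pR1 n) (pR2 n)"
abbreviation "nP1 n \<equiv> inst.P1 k (lg n) (pJ n)"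
abbreviation "nP2 n \<equiv> inst.P2 k (lg n) (pJ n)"
abbreviation "nTOT ka n \<equiv> inst.TOT k d (word_size ka n) (plen ka n) (lg n) (pJ n) (pQ ka n) (pR1 n) (pR2 n)"
abbreviation "npv n \<equiv> inst.pv k d (lg n)"
abbreviation "ntBUILD ka n \<equiv> inst.tBUILD k d (word_size ka n) n (plen ka n) (lg n) (pJ n) (pQ ka n) (pR1 n) (pR2 n) (plim ka n) pC2"
abbreviation "ntE ka n \<equiv> inst.tE k d (word_size ka n) (plen ka n) (pQ ka n) (plim ka n)"
abbreviation "ntH ka n \<equiv> inst.tH k d (word_size ka n) (plen ka n) (pQ ka n) (plim ka n)"
abbreviation "ntQ ka n \<equiv> inst.tQ k d (word_size ka n) (plen ka n) (lg n) (pJ n) (pQ ka n) (pR1 n) (pR2 n) (plim ka n)"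
abbreviation "ntS ka n \<equiv> inst.tS k d (word_size ka n) (plen ka n) (pQ ka n) (pR1 n) (plim ka n)"
abbreviation "ntW ka n \<equiv> inst.tW k d (word_size ka n) (plen ka n) (pJ n) (pQ ka n) (pR1 n) (plim ka n)"

lemma pT_le: "1 <= n ==> 1 <= pT n & pT n <= n & real n powr \<alpha> <= real (pT n) & real (pT n) <= 2 * real n powr \<alpha>"
proof -
 assume n: "1 <= n"
 have 1: "1 <= real n powr \<alpha>" using n \<alpha> by (simp add: ge_one_powr_ge_zero)
 have "real n powr \<alpha> <= real n powr 1" using n \<alpha> by (intro powr_mono) auto
 then have 2: "real n powr \<alpha> <= real_of_int (int n)" using n by simp
 have "\<lceil>real n powr \<alpha>\<rceil> <= int n" using 2 by (simp only: ceiling_le_iff)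
 moreover have "1 <= \<lceil>real n powr \<alpha>\<rceil>" using 1 by linarith
 moreover have "real (nat \<lceil>real n powr \<alpha>\<rceil>) = real_of_int \<lceil>real n powr \<alpha>\<rceil>" using 1 by simp
 ultimately show ?thesis unfolding pT_def using 1 by linarith
qed

text \<open>The sum counts an initial segment: \<open>8 ^ i < pT n\<close> holds exactly for
  \<open>i\<close> below the least \<open>m\<close> with \<open>pT n <= 8 ^ m\<close>. Minimality of
  \<open>m\<close> gives the last bound.\<close>

lemma pJ_props: assumes "1 <= n" shows "pJ n <= lg n" "pT n <= 8 ^ pJ n" "8 ^ pJ n <= 8 * pT n"
proof -
 define m where "m = (LEAST m. pT n <= 8 ^ m)"
 have "pT n <= 2 ^ lg n" using pT_le[OF assms] lg_bounds(2)[of n] by linarith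
 also have "(2::nat) ^ lg n <= 8 ^ lg n" by (intro power_mono) auto
 finally have ex: "pT n <= 8 ^ lg n" .
 have m: "pT n <= 8 ^ m" unfolding m_def by (rule LeastI[of _ "lg n"]) (rule ex)
 have ml: "m <= lg n" unfolding m_def by (rule Least_le) (rule ex)
 have lt: "8 ^ i < pT n" if "i < m" for i using not_less_Least[of i "%m. pT n <= 8 ^ m"] that unfolding m_def by simp
 have "8 ^ i < pT n \<longleftrightarrow> i < m" for i
 proof
  assume "8 ^ i < pT n"
  then have "(8::nat) ^ i < 8 ^ m" using m by linarith
  then show "i < m" by simp
 qed (rule lt)
 then have "pJ n = (\<Sum>i<lg n. of_bool (i < m))" unfolding pJ_def by (simp add: power_mult)
 also have "... = card {i. i < lg n & i < m}" by (simp add: sum.If_cases of_bool_def lessThan_def Int_def)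
 also have "{i. i < lg n & i < m} = {..<m}" using ml by auto
 finally have J: "pJ n = m" by simp
 show "pJ n <= lg n" "pT n <= 8 ^ pJ n" unfolding J by (rule ml, rule m)
 show "8 ^ pJ n <= 8 * pT n"
 proof (cases m)
  case 0
  then show ?thesis using pT_le[OF assms] unfolding J by simp
 next
  case (Suc m')
  then show ?thesis using lt[of m'] unfolding J by simp
 qed
qed

lemma tt_cube: "real (tt n) ^ 3 = real (8 ^ pJ n)"
proof -
 have "(2 ^ pJ n) ^ 3 = ((2::real) ^ 3) ^ pJ n" unfolding power_mult[symmetric] by (simp only: mult.commute)
 then show ?thesis by (simp add: inst.t_def)
qed

lemma powr_cube: "1 <= n ==> (real n powr (\<alpha> / 3)) ^ 3 = real n powr \<alpha>"
 by (simp add: powr_power[symmetric] powr_powr flip: powr_realpow)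

text \<open>Both sides are compared after cubing. The factor 3 comes from 8 * 2 <= 3^3, where 8 is
  lost by rounding \<open>J\<close> up and 2 by rounding n^\<alpha> up.\<close>

lemma tt_bounds: assumes "1 <= n" shows "real n powr (\<alpha> / 3) <= real (tt n)" "real (tt n) <= 3 * real n powr (\<alpha> / 3)"
proof -
 have "(real n powr (\<alpha> / 3)) ^ 3 <= real (tt n) ^ 3"
  unfolding powr_cube[OF assms] tt_cube using pT_le[OF assms] pJ_props(2)[OF assms] by (meson of_nat_mono order_trans)
 then show "real n powr (\<alpha> / 3) <= real (tt n)" by (rule power_le_imp_le_base[of _ 2, unfolded eval_nat_numeral, folded eval_nat_numeral]) simp
 have "real (tt n) ^ 3 <= 8 * real (pT n)" unfolding tt_cube using pJ_props(3)[OF assms] by (metis of_nat_mono of_nat_mult of_nat_numeral)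
 also have "... <= 27 * real n powr \<alpha>" using pT_le[OF assms] by simp
 also have "... = (3 * real n powr (\<alpha> / 3)) ^ 3" unfolding power_mult_distrib powr_cube[OF assms] by simp
 finally show "real (tt n) <= 3 * real n powr (\<alpha> / 3)" by (rule power_le_imp_le_base[of _ 2, unfolded eval_nat_numeral, folded eval_nat_numeral]) simp
qed

lemma SO_t: "SO (\<alpha> / 3) tt"
 by (rule SO_I[where C = 3]) (use n_ge1 in eventually_elim, rule tt_bounds(2))

lemma SO_U: "SO (real k) UU"
 unfolding inst.U_def by (rule SO_two_lg)

text \<open>Turns the counting bounds, which have the form \<open>g * t = O(U)\<close>, into the
  exponent k - \<alpha> / 3 of the space bound.\<close>

lemma SO_div_t: assumes "!!n. g n * tt n <= C * UU n" shows "SO (real k - \<alpha> / 3) g"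
proof (rule SO_I[where C = "real C * 6 ^ k"])
 show "eventually (%n. real (g n) <= real C * 6 ^ k * real n powr (real k - \<alpha> / 3)) at_top"
  using n_ge1
 proof eventually_elim
  case (elim n)
  have p: "0 < real n powr (\<alpha> / 3)" using elim by simp
  have "UU n = (2 ^ lg n) ^ k" by (simp add: inst.U_def power_mult[symmetric] mult.commute)
  also have "... <= (6 * n) ^ k" using lg_bounds(3)[of n] elim by (intro power_mono) auto
  finally have "real (UU n) <= real ((6 * n) ^ k)" by (rule of_nat_mono)
  then have U: "real (UU n) <= 6 ^ k * real n powr real k" using elim by (simp add: powr_realpow power_mult_distrib)
  have "real (g n) * real n powr (\<alpha> / 3) <= real (g n) * real (tt n)" using tt_bounds(1)[OF elim] by (intro mult_left_mono) auto
  also have "... <= real C * real (UU n)" using assms[of n] by (metis of_nat_mono of_nat_mult)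
  also have "... <= real C * (6 ^ k * real n powr real k)" using U by (intro mult_left_mono) auto
  finally have "real (g n) <= real C * (6 ^ k * real n powr real k) / real n powr (\<alpha> / 3)" using p by (simp add: pos_le_divide_eq)
  then show ?case using elim by (simp add: powr_diff)
 qed
qed

lemma P1_eq: "nP1 n * tt n <= 16 * UU n" if "1 <= n"
proof -
 have "1 * lg n <= k * lg n" using k2 by (intro mult_le_mono1) simp
 then have "k * lg n + 4 - pJ n + pJ n = k * lg n + 4" using pJ_props(1)[OF that] by linarith
 then have "nP1 n * tt n = 2 ^ (k * lg n + 4)" unfolding inst.P1_def inst.t_def power_add[symmetric] by simp
 then show ?thesis by (simp add: inst.U_def power_add)
qed

lemma P2_eq: "nP2 n * tt n * tt n <= UU n" "nP2 n <= UU n"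
proof -
 have "nP2 n * 2 ^ (2 * pJ n + 1) <= UU n" unfolding inst.P2_def by simp
 moreover have "tt n * tt n <= 2 ^ (2 * pJ n + 1)" unfolding inst.t_def power_add[symmetric] by (intro power_increasing) auto
 ultimately show "nP2 n * tt n * tt n <= UU n" by (metis mult.assoc mult_le_mono2 order_trans)
 show "nP2 n <= UU n" by (simp add: inst.P2_def)
qed

lemma SO_P1: "SO (real k - \<alpha> / 3) nP1"
proof (rule SO_le)
 show "SO (real k - \<alpha> / 3) (%n. if 1 <= n then nP1 n else 0)"
  by (rule SO_div_t[where C = 16]) (use P1_eq in auto)
 show "eventually (%n. nP1 n <= (if 1 <= n then nP1 n else 0)) at_top"
  using n_ge1 by eventually_elim simp
qed

text \<open>\<open>pR2\<close> is \<open>t\<close> up to a logarithm, so this measures all rainbow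
  tables of one shape: t * U / t^2 cells.\<close>

lemma SO_tP2: "SO (real k - \<alpha> / 3) (%n. tt n * nP2 n)"
 by (rule SO_div_t[where C = 1]) (use P2_eq(1) in "simp add: mult.commute mult.left_commute")

lemma plen_le: "1 <= ka ==> plen ka n <= w n"
proof -
 assume "1 <= ka"
 then have b: "0 < word_size ka n" using lg_bounds(1)[of n] by (simp add: word_size_lg)
 have "w n + word_size ka n - 1 < (w n + 1) * word_size ka n"
 proof -
  have "w n * 1 <= w n * word_size ka n" using b by (intro mult_le_mono2) simp
  then show ?thesis using b unfolding add_mult_distrib by linarith
 qed
 then have "plen ka n < w n + 1" unfolding plen_def using b by (simp add: div_less_iff_less_mult)
 then show ?thesis by simp
qed

context
 fixes ka :: nat
 assumes ka: "1 <= ka"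
begin

lemma PL_base: "SO 0 (word_size ka)" "SO 0 (plen ka)" "SO 0 (plim ka)" "SO 0 (pQ ka)" "SO 0 pR1"
proof -
 have "SO 0 (%n. ka * lg n)" by (intro SO_mult_PL SO_const SO_lg)
 then show b: "SO 0 (word_size ka)" by (simp add: word_size_lg[abs_def])
 show l: "SO 0 (plen ka)" by (rule SO_le[OF wPL]) (use plen_le[OF ka] in auto)
 show m: "SO 0 (plim ka)" unfolding plim_def[abs_def] by (intro SO_add SO_mult_PL SO_const l)
 show "SO 0 (pQ ka)" unfolding pQ_def[abs_def] by (intro SO_add SO_mult_PL SO_const b m)
 show "SO 0 pR1" unfolding pR1_def[abs_def] by (intro SO_mult_PL SO_const SO_lg)
qed

lemmas PLr = SO_const PL_base SO_lg wPL SO_Suc PL_pow SO_add SO_mult_PL(1)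

lemma PL_NP: "SO 0 (%n. inst.NP (word_size ka n) (pQ ka n))" "SO 0 (%n. inst.SL (word_size ka n) (pQ ka n))" "SO 0 nNL"
 unfolding inst.SL_def inst.NP_def inst.NL_def by (intro PLr)+

lemma PL_tC: "SO 0 (%n. inst.tC k d (plen ka n) (plim ka n))"
 unfolding inst.tC_def inst.tPV_def inst.tNUM_def inst.tY_def by (intro PLr)

lemma PL_tH: "SO 0 (ntH ka)" "SO 0 (ntE ka)"
 unfolding inst.tH_def inst.tE_def by (intro PL_NP PL_tC PLr)+

lemma PL_tPT: "SO 0 (%n. inst.tPT k d (word_size ka n) (plen ka n) (pQ ka n) (plim ka n))"
 unfolding inst.tPT_def by (intro PL_tH PLr)

lemma PL_tHV: "SO 0 (%n. inst.tHV k d (word_size ka n) (plen ka n) (pQ ka n) (pR1 n) (plim ka n))"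
 unfolding inst.tHV_def by (intro PL_tH PL_tPT PLr)

lemma PL_tS: "SO 0 (ntS ka)"
 unfolding inst.tS_def by (intro PL_tHV PL_tPT PLr)

lemma PL_tB: "SO 0 (%n. inst.tBAD k (plen ka n) (lg n))" "SO 0 (%n. inst.tCORN k (plen ka n) (lg n))"
 unfolding inst.tBAD_def inst.tCORN_def inst.tBS_def inst.tLESS_def by (intro PLr)+

lemma SO_tW: "SO (\<alpha> / 3) (ntW ka)"
 unfolding inst.tW_def
 by (rule SO_add[OF SO_mult_PL(2)[OF SO_t SO_add[OF PL_tS SO_const]] SO_const']) (use \<alpha> in simp)

lemma SO_R2: "SO (\<alpha> / 3) pR2"
 unfolding pR2_def[abs_def] by (rule SO_mult_PL(2)[OF SO_mult_PL(1)[OF SO_const SO_t] SO_lg])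

text \<open>Searching a small box costs of order t^2. In a large one, \<open>pR2\<close> tables,
  \<open>t\<close> positions and walks of length \<open>t\<close> multiply to t^3, which is
  n^\<alpha>.\<close>

lemma SO_tBOX: "SO \<alpha> (%n. inst.tBOX k d (word_size ka n) (plen ka n) (pJ n) (pQ ka n) (pR1 n) (pR2 n) (plim ka n))"
proof -
 have a0: "0 <= \<alpha>" "0 <= \<alpha> / 3" "0 <= 2 * \<alpha> / 3" using \<alpha> by auto
 have SM: "SO \<alpha> (%n. inst.tSM k d (word_size ka n) (plen ka n) (pJ n) (pQ ka n) (plim ka n))"
 proof -
  have "SO \<alpha> (%n. 16 * tt n * tt n)" by (rule SO_mult'[OF SO_mult_PL(1)[OF SO_const SO_t] SO_t]) (use \<alpha> in simp)
  moreover have "SO 0 (%n. inst.tDEP k + ntE ka n + 40)" by (intro PL_tH PLr)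
  ultimately show ?thesis unfolding inst.tSM_def by (intro SO_add SO_const' a0) (rule SO_mult_PL(2))
 qed
 have 1: "SO (\<alpha> / 3) (%n. 2 * ntW ka n +
   ntH ka n + ntE ka n + 200)"
  by (intro SO_add SO_mult_PL(1) SO_const SO_const' SO_tW a0 SO_pos[OF PL_tH(1)] SO_pos[OF PL_tH(2)])
 have 2: "SO (2 * \<alpha> / 3) (%n. tt n * (2 * ntW ka n +
   ntH ka n + ntE ka n + 200) + 40)"
  by (intro SO_add SO_const' a0 SO_mult'[OF SO_t 1]) simp
 have BIG: "SO \<alpha> (%n. inst.tBIG k d (word_size ka n) (plen ka n) (pJ n) (pQ ka n) (pR1 n) (pR2 n) (plim ka n))"
  unfolding inst.tBIG_def by (intro SO_add SO_const' a0 SO_mult'[OF SO_R2 2]) simp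
 show ?thesis unfolding inst.tBOX_def by (intro SO_add SM BIG SO_const' a0 SO_pos[OF PL_tHV])
qed

lemma SO_tQ: "SO \<alpha> (ntQ ka)"
proof -
 have a0: "0 <= \<alpha>" using \<alpha> by simp
 have 1: "SO 0 (%n. k * (inst.tBAD k (plen ka n) (lg n) + inst.tCORN k (plen ka n) (lg n) + 40))" by (intro PL_tB PLr)
 show ?thesis unfolding inst.tQ_def
  by (intro SO_add SO_const' a0 SO_mult_PL(1)[OF PL_NP(3)] SO_mult_PL(1)[OF SO_const] SO_tBOX SO_pos[OF 1])
qed

lemma SO_NS: "SO (2 * \<alpha> / 3) (nNS ka)"
proof -
 have a0: "0 <= \<alpha> / 3" "0 <= 2 * \<alpha> / 3" using \<alpha> by auto
 have 1: "SO 0 (%n. 2 * pR1 n)" by (intro PLr)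
 have "SO (2 * \<alpha> / 3) (%n. pR2 n * (tt n + 1))"
  by (rule SO_mult'[OF SO_R2 SO_add[OF SO_t SO_const'[OF a0(1)]]]) simp
 then show ?thesis unfolding inst.NS_def by (intro SO_mult_PL(2)[OF SO_add PL_NP(2)] SO_pos[OF 1] a0)
qed

lemma SO_TOT: "SO (real k - \<alpha> / 3) (nTOT ka)"
proof -
 have "2 <= real k" using k2 by simp
 \<comment> \<open>As k is at least 2, the copy of the sets, of size n, and the seeds, of order t^2,
   are dominated by the tables.\<close>
 then have a0: "1 <= real k - \<alpha> / 3" "0 <= real k - \<alpha> / 3" "2 * \<alpha> / 3 <= real k - \<alpha> / 3" using \<alpha> by linarith+
 have 1: "SO 1 (%n. k * 2 ^ lg n * plen ka n)" by (rule SO_mult_PL(2)[OF SO_mult_PL(1)[OF SO_const SO_two_lg(1)] PL_base(2)])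
 have 2: "SO 0 (%n. Suc d ^ k * plen ka n)" by (intro PLr)
 have A1: "SO (real k - \<alpha> / 3) (%n. inst.A1 k d (word_size ka n) (plen ka n) (lg n) (pJ n) (pQ ka n) (pR1 n) (pR2 n))"
  unfolding inst.A1_def inst.SB_def inst.CB_def
  by (intro SO_add SO_const' a0 SO_mono[OF 1] SO_mono[OF 2] SO_mono[OF SO_NS])
 have A2: "SO (real k - \<alpha> / 3) (%n. inst.A2 k d (word_size ka n) (plen ka n) (lg n) (pJ n) (pQ ka n) (pR1 n) (pR2 n))"
  unfolding inst.A2_def by (intro SO_add A1 SO_mult_PL(1)[OF _ SO_P1] SO_mult_PL(1)[OF PL_NP(3) PL_base(5)])
 have "SO 0 (%n. nNL n * (pC2 * lg n))" by (intro PL_NP PLr)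
 from SO_mult_PL(1)[OF this SO_tP2]
 have "SO (real k - \<alpha> / 3) (%n. nNL n * pR2 n * nP2 n)"
  unfolding pR2_def by (simp add: algebra_simps)
 then show ?thesis unfolding inst.TOT_def by (intro SO_add A2)
qed

lemma SO_tBUILD: "SO (real k) (ntBUILD ka)"
proof -
 have k: "2 <= real k" "0 <= real k" "1 <= real k" using k2 by auto
 have H: "SO 0 (%n. 20 * (inst.tHDR k (lg n) + 5))" unfolding inst.tHDR_def by (intro PLr)
 have C: "SO 0 (%n. inst.tCOEF k d (plen ka n))" unfolding inst.tCOEF_def by (intro PLr)
 have l: "SO 0 (%n. plen ka n * 60 + 40)" by (intro PLr)
 have RK: "SO 1 (%n. inst.tRANK n (plen ka n))" unfolding inst.tRANK_def
  by (rule SO_add[OF SO_mult_PL(2)[OF SO_id l] SO_const']) simp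
 have l2: "SO 0 (%n. plen ka n * 70)" by (intro PLr)
 have "SO 1 (%n. inst.tRANK n (plen ka n) + plen ka n * 70 + 40)" by (intro SO_add RK SO_pos[OF l2] SO_const') auto
 from SO_mult'[OF SO_id this, of "real k"]
 have "SO (real k) (%n. n * (inst.tRANK n (plen ka n) + plen ka n * 70 + 40))" using k by simp
 then have SORT: "SO (real k) (%n. inst.tSORT k n (plen ka n))" unfolding inst.tSORT_def
  by (intro SO_add SO_mult_PL(1)[OF SO_const] SO_const' k)
 have SEED: "SO (2 * \<alpha> / 3) (%n. inst.tSEED (word_size ka n) (pJ n) (pQ ka n) (pR1 n) (pR2 n))" unfolding inst.tSEED_def
  by (intro SO_add SO_mult_PL(2)[OF SO_NS SO_const] SO_const') (use \<alpha> in simp)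
 have ak: "2 * \<alpha> / 3 <= real k" using k \<alpha> by linarith
 have CELL: "SO 0 (%n. inst.tCELL1 k d (word_size ka n) (plen ka n) (pQ ka n) (plim ka n))" unfolding inst.tCELL1_def by (intro PL_tPT PL_tH PLr)
 have a: "SO 0 (%n. inst.tCRN k + 24 + pR1 n * (inst.tOFF k + 40))" by (intro PLr)
 have b: "SO 0 (%n. pR1 n)" by (intro PLr)
 have TT1: "SO (real k) (%n. inst.TT1 k d (word_size ka n) (plen ka n) (lg n) (pQ ka n) (pR1 n) (plim ka n))" unfolding inst.TT1_def
  by (intro SO_add SO_mult_PL(2)[OF SO_U a] SO_mult_PL(2)[OF SO_mult_PL(2)[OF SO_mult_PL(1)[OF SO_const SO_U] b]] CELL SO_const)
 have a2: "SO 0 (%n. inst.tCRN k + 24 + pC2 * lg n * (inst.tOFF k + 40))" by (intro PLr)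
 have b2: "SO 0 (%n. ntS ka n + ntH ka n + 200)"
  by (intro PL_tS PL_tH PLr)
 have TT2: "SO (real k) (%n. inst.TT2 k d (word_size ka n) (plen ka n) (lg n) (pQ ka n) (pR1 n) (plim ka n) pC2)" unfolding inst.TT2_def
  by (intro SO_add SO_mult_PL(2)[OF SO_U a2] SO_mult_PL(2)[OF SO_mult_PL(2)[OF SO_mult_PL(2)[OF SO_U SO_const] SO_lg] b2])
 show ?thesis unfolding inst.tBUILD_def
  by (intro SO_add SORT SO_pos[OF H] SO_pos[OF C] SO_mono[OF SEED ak] SO_const' k SO_mult_PL(1)[OF PL_NP(3)] TT1 TT2)
qed

end

text \<open>The sum of all quantities that have to fit into a word: a single inequality for it
  yields every side condition on the word size.\<close>

definition REQ :: "nat => nat => nat" where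
 "REQ ka n = nTOT ka n + 40 + (pQ ka n * pQ ka n + pQ ka n)
   + (64 * UU n + 64) * UU n + nNL n + Suc d ^ k + (2 * k * plen ka n + 2 * plim ka n + 10) + 2 ^ (2 * (k * lg n) + 2 * k + 10)
   + pR1 n * 2 + pR2 n * (tt n + 1) + (w n + word_size ka n) + ka + pC1 + pC2 * tt n + (Suc d * k + 1) + 256 + 2 ^ lg n"

text \<open>Restricted to positive \<open>n\<close>, the range of \<open>pJ_props\<close>;
  \<open>t'\<close> and \<open>R2'\<close> in the proof are cut off accordingly.\<close>

lemma pb_REQ: "pb (%ka n. if 1 <= n then REQ ka n else 0)"
proof -
 obtain B where B: "!!n. w n <= B * 2 ^ lg n" using PL_bounded[OF wPL] by blast
 have two: "pb (%_ n. 2 ^ lg n)" using pb_two[of 1] by simp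
 have w: "pb (%_. w)" by (rule pb_le[OF pb_mult[OF pb_const[of B] two]]) (rule B)
 have b: "pb word_size" unfolding word_size_lg[abs_def] by (intro pb_mult pb_kappa pb_lg)
 have len: "pb plen" by (rule pb_le[OF w]) (rule plen_le)
 have lim: "pb plim" unfolding plim_def[abs_def] by (intro pb_add pb_mult pb_const len)
 have Q: "pb pQ" unfolding pQ_def[abs_def] by (intro pb_add pb_mult pb_const b lim)
 have U: "pb (%_. UU)" unfolding inst.U_def by (rule pb_two)
 define t' where "t' = (%n. if 1 <= n then tt n else 0)"
 have t: "pb (%_. t')"
 proof (rule pb_le[OF two])
  fix n show "t' n <= 2 ^ lg n" using pJ_props(1)[of n] by (auto simp: t'_def inst.t_def intro: power_increasing)
 qed
 have R1: "pb (%_. pR1)" unfolding pR1_def[abs_def] by (intro pb_mult pb_const pb_lg)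
 define R2' where "R2' = (%n. pC2 * t' n * lg n)"
 have R2: "pb (%_. R2')" unfolding R2'_def by (intro pb_mult pb_const pb_lg t)
 have NL: "pb (%_ n. nNL n)" unfolding inst.NL_def by (intro pb_pow pb_Suc pb_lg)
 have P1: "nP1 n <= 16 * UU n" for n
 proof -
  have "nP1 n <= 2 ^ (k * lg n + 4)" unfolding inst.P1_def by (intro power_increasing) auto
  then show ?thesis by (simp add: inst.U_def power_add)
 qed
 have "pb (%ka n. (32 + k * 2 ^ lg n * plen ka n + Suc d ^ k * plen ka n + (2 * pR1 n + R2' n * (t' n + 1)) * ((word_size ka n + pQ ka n) * pQ ka n)
   + nNL n * pR1 n * (16 * UU n) + nNL n * R2' n * UU n) + 40 + (pQ ka n * pQ ka n + pQ ka n)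
   + (64 * UU n + 64) * UU n + nNL n + Suc d ^ k + (2 * k * plen ka n + 2 * plim ka n + 10) + 2 ^ (2 * k * lg n) * 2 ^ (2 * k + 10)
   + pR1 n * 2 + R2' n * (t' n + 1) + (w n + word_size ka n) + ka + pC1 + pC2 * t' n + (Suc d * k + 1) + 256 + 2 ^ lg n)" (is "pb ?F")
  by (intro pb_add pb_mult pb_const pb_kappa pb_two len lim Q U t R1 R2 NL b w two)
 then show ?thesis
 proof (rule pb_le)
  fix ka n
  show "(if 1 <= n then REQ ka n else 0) <= ?F ka n"
  proof (cases "1 <= n")
   case True
   then have e: "t' n = tt n" "R2' n = pR2 n" by (simp_all add: t'_def R2'_def pR2_def)
   have "nTOT ka n <=
    32 + k * 2 ^ lg n * plen ka n + Suc d ^ k * plen ka n + (2 * pR1 n + pR2 n * (tt n + 1)) * ((word_size ka n + pQ ka n) * pQ ka n)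
   + nNL n * pR1 n * (16 * UU n) + nNL n * pR2 n * UU n"
    unfolding inst.TOT_def inst.A2_def inst.A1_def inst.SB_def inst.CB_def inst.NS_def inst.SL_def inst.NP_def
    by (intro add_mono mult_le_mono2 P1 P2_eq order.refl)
   moreover have "(2::nat) ^ (2 * (k * lg n) + 2 * k + 10) = 2 ^ (2 * k * lg n) * 2 ^ (2 * k + 10)" by (simp add: power_add mult.assoc)
   ultimately show ?thesis unfolding REQ_def e using True by simp
  qed simp
 qed
qed

end

section \<open>Valid instances satisfy all assumptions, and success\<close>

context params begin

context
 fixes ka n :: nat and S :: "nat => nat set" and A :: "nat => nat list" and p :: npoly
 assumes ka: "1 <= ka" and n: "1 <= n" and req: "REQ ka n < 2 ^ word_size ka n" and v: "valid_instance (w n) k d n S A p"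
begin

abbreviation "bb \<equiv> word_size ka n"
definition "ar i j = (if i < k & j < n then A i ! j else 0)"
definition "srt i q = (if i < k & q < n then sort (A i) ! q else 0)"
definition "coe idx = (if idx < Suc d ^ k then Poly_Mapping.lookup p (mon (Suc d) k idx) else 0)"
abbreviation "ein \<equiv> encode_instance bb (w n) k d n \<alpha> A p"

lemma vi: "i < k ==> length (A i) = n" "i < k ==> set (A i) = S i" "i < k ==> distinct (A i)" "i < k ==> x \<in> S i ==> x < 2 ^ w n"
 "in_vars k p" "total_degree_le p d" "Poly_Mapping.lookup p m < 2 ^ w n"
 using v distinct_card[of "A i"] by (auto simp: valid_instance_def)

lemma bb_pos: "0 < bb"
 using ka lg_bounds(1)[of n] by (simp add: word_size_lg)

lemma w_le: "w n <= bb * plen ka n"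
proof -
 have "w n + bb - 1 < bb * (plen ka n + 1)" unfolding plen_def using bb_pos
  by (metis Suc_eq_plus1 dividend_less_times_div mult_Suc_right add.commute)
 then show ?thesis using bb_pos by simp
qed

lemma two_w: "x < 2 ^ w n ==> (x :: nat) < 2 ^ (bb * plen ka n)"
 by (erule less_le_trans) (intro power_increasing w_le, simp)

lemma elems: "i < k ==> j < n ==> A i ! j \<in> S i" "i < k ==> j < n ==> sort (A i) ! j \<in> S i"
 using vi(1,2) by (metis nth_mem, metis length_sort nth_mem set_sort)

lemma srt_less: "srt i q < 2 ^ w n"
 using elems vi(4) by (auto simp: srt_def)

lemma pv_eq: "npv n srt coe z = poly_eval p (%i. srt i (fld (lg n) z i))"
 unfolding inst.pv_def poly_eval_eq[OF vi(5,6)] by (intro sum.cong refl) (simp add: coe_def)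

lemma eval_less:
 assumes "!!i. i < k ==> x i < 2 ^ w n" shows "poly_eval p x < 2 ^ (bb * plim ka n)"
proof -
 have "Suc d * w n + 1 * (Suc d * k + 1) <= Suc d * (bb * plen ka n) + bb * (Suc d * k + 1)"
  by (intro add_mono mult_le_mono2 mult_le_mono1 w_le) (use bb_pos in simp)
 also have "... = bb * plim ka n" by (simp add: plim_def algebra_simps)
 finally have e: "Suc d * w n + Suc d * k < bb * plim ka n" unfolding mult_1 by linarith
 have "poly_eval p x <= 2 ^ (Suc d * w n + Suc d * k)" by (rule poly_eval_bound[OF vi(5,6,7) assms])
 also have "... < 2 ^ (bb * plim ka n)" using e by (rule power_strict_increasing) simp
 finally show ?thesis .
qed

lemma req_each:
 "nTOT ka n + 40 < 2 ^ bb" "pQ ka n * pQ ka n + pQ ka n < 2 ^ bb" "(64 * UU n + 64) * UU n < 2 ^ bb" "nNL n < 2 ^ bb" "Suc d ^ k < 2 ^ bb"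
 "2 * k * plen ka n + 2 * plim ka n + 10 < 2 ^ bb" "2 ^ (2 * (k * lg n) + 2 * k + 10) < (2::nat) ^ bb" "pR1 n * 2 < 2 ^ bb"
 "pR2 n * (tt n + 1) < 2 ^ bb" "w n + bb < 2 ^ bb" "ka < 2 ^ bb" "pC1 < 2 ^ bb" "pC2 * tt n < 2 ^ bb" "Suc d * k + 1 < 2 ^ bb" "2 ^ lg n < (2 :: nat) ^ bb"
 using req[unfolded REQ_def] by linarith+

lemma bb_ge: "2 * (k * lg n) + 2 * k + 10 <= bb" "8 <= bb"
proof -
 show "2 * (k * lg n) + 2 * k + 10 <= bb"
  using req_each(7) by (metis less_imp_le one_less_numeral_iff power_less_imp_less_exp semiring_norm(76))
 then show "8 <= bb" by linarith
qed

lemma tt_pos: "1 <= tt n"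
 by (simp add: inst.t_def)

lemma im: "inst_math k d bb n (plen ka n) (lg n) (pJ n) (pQ ka n) (pR1 n) (pR2 n) (plim ka n) srt coe ka pC1 pC2 (w n) (pT n) ein ar"
proof
 have "1 * 1 <= pC1 * lg n" using lg_bounds(1)[of n] by (intro mult_le_mono) (simp_all add: pC1_def)
 then show "1 <= pR1 n" by (simp add: pR1_def)
 show "pJ n <= lg n" by (rule pJ_props(1)[OF n])
 show n2: "n < 2 ^ lg n" using lg_bounds(2)[of n] by linarith
 show "srt i q < 2 ^ (bb * plen ka n)" for i q by (rule two_w[OF srt_less])
 show "coe idx < 2 ^ (bb * plen ka n)" for idx by (rule two_w) (simp add: coe_def vi(7))
 show "lg n = bb div ka" using ka by (simp add: word_size_lg)
 show "pC2 < 2 ^ bb"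
 proof -
  have "pC2 * 1 <= pC2 * tt n" by (intro mult_le_mono2 tt_pos)
  then show ?thesis using req_each(13) by linarith
 qed
 have nb: "n < 2 ^ bb" using n2 req_each(15) by linarith
 show "take_bit bb (nth_default 0 ein 0) = bb" unfolding encode_instance_header by (rule take_bit_nat_eq_self) simp
 show "take_bit bb (nth_default 0 ein 1) = n" unfolding encode_instance_header by (rule take_bit_nat_eq_self[OF nb])
 show "take_bit bb (nth_default 0 ein 2) = w n" unfolding encode_instance_header by (rule take_bit_nat_eq_self) (use req_each(10) in linarith)
 show "take_bit bb (nth_default 0 ein 3) = pT n" unfolding encode_instance_header pT_def[symmetric]
  by (rule take_bit_nat_eq_self) (use pT_le[OF n] nb in linarith)
 show "take_bit bb (nth_default 0 ein (4 + ((i * n + j) * plen ka n + e))) = ar i j div 2 ^ (bb * e) mod 2 ^ bb"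
  if "i < k" "j < n" "e < plen ka n" for i j e
  using encode_instance_arrays[where A = A and p = p and \<alpha> = \<alpha> and d = d, OF bb_pos plen_def vi(1) that] that by (simp add: ar_def take_bit_eq_mod)
 show "take_bit bb (nth_default 0 ein (4 + (k * n * plen ka n + (idx * plen ka n + e)))) = coe idx div 2 ^ (bb * e) mod 2 ^ bb"
  if "idx < Suc d ^ k" "e < plen ka n" for idx e
  using encode_instance_poly[where A = A and p = p and \<alpha> = \<alpha> and d = d, OF bb_pos plen_def vi(1) that] that
  by (simp add: coe_def take_bit_eq_mod n_lists_nth[OF that(1)] mon_def del: upt_Suc)
 show "ar i j < 2 ^ (bb * plen ka n)" for i j using elems(1) vi(4) by (auto simp: ar_def intro: two_w)
 have rank: "(\<Sum>j'<n. of_bool (ar i j' < ar i j)) = q" if "i < k" "j < n" "q < n" "A i ! j = sort (A i) ! q" for i j q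
  using rank_sorted[OF vi(3)[OF that(1)], of q j] that vi(1)[OF that(1)] by (simp add: ar_def cong: sum.cong_simp)
 show "srt i (\<Sum>j'<n. of_bool (ar i j' < ar i j)) = ar i j" if h: "i < k" "j < n" for i j
 proof -
  obtain q where "q < n" "A i ! j = sort (A i) ! q" using sort_index[of j "A i"] h vi(1) by auto
  then show ?thesis using rank h by (simp add: srt_def) (simp add: ar_def)
 qed
 show "srt i q = 0" if "n <= q" for i q using that by (simp add: srt_def)
 show "EX j<n. (\<Sum>j'<n. of_bool (ar i j' < ar i j)) = q" if h: "i < k" "q < n" for i q
 proof -
  obtain j where "j < n" "A i ! j = sort (A i) ! q" using unsort_index[of q "A i"] h vi(1) by auto
  then show ?thesis using rank h by blast
 qed
 show "npv n srt coe z < 2 ^ (bb * plim ka n)" if "z < UU n" for z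
  unfolding pv_eq by (rule eval_less) (rule srt_less)
qed (fact k2 req_each bb_ge | simp add: plen_def plim_def pQ_def pJ_def pR1_def pR2_def)+

interpretation im: inst_math k d bb n "plen ka n" "lg n" "pJ n" "pQ ka n" "pR1 n" "pR2 n" "plim ka n" srt coe ka pC1 pC2 "w n" "pT n" ein ar
 by (rule im)

lemma range_iff:
 assumes i: "i < k"
 shows "im.lo l i <= f & f < im.hi r i \<longleftrightarrow> f < n & l i <= srt i f & srt i f <= r i"
proof -
 have mono: "srt i (x - 1) <= srt i (y - 1)" if "0 < x" "x <= y" "y <= n" for x y
 proof -
  have "x - 1 <= y - 1" "y - 1 < length (sort (A i))" using that vi(1)[OF i] by auto
  then have "sort (A i) ! (x - 1) <= sort (A i) ! (y - 1)" by (intro sorted_nth_mono sorted_sort)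
  moreover have "x - 1 < n" "y - 1 < n" using that by linarith+
  ultimately show ?thesis using i by (simp only: srt_def if_True simp_thms)
 qed
 \<comment> \<open>The searches count elements, so rank \<open>f\<close> corresponds to position
   \<open>f + 1\<close>.\<close>
 have lo: "f + 1 <= im.lo l i \<longleftrightarrow> srt i f < l i" if "f < n"
  using bsr_spec[where P = "%x. srt i (x - 1) < l i" and n = n and L = "lg n" and p = "f + 1"] mono im.nL that unfolding im.lo_def
  by (auto intro: le_less_trans)
 have hi: "f + 1 <= im.hi r i \<longleftrightarrow> srt i f <= r i" if "f < n"
  using bsr_spec[where P = "%x. srt i (x - 1) <= r i" and n = n and L = "lg n" and p = "f + 1"] mono im.nL that unfolding im.hi_def
  by (auto intro: order_trans)
 show ?thesis
 proof (cases "f < n")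
  case True
  then show ?thesis using lo hi by auto
 next
  case False
  then show ?thesis using im.lo_hi_le(2)[of r i] by auto
 qed
qed

lemma answer_iff:
 "(EX z<UU n. (ALL i<k. im.lo l i <= fld (lg n) z i & fld (lg n) z i < im.hi r i) & npv n srt coe z = Y) \<longleftrightarrow>
  query_answer k S p (%i. {l i..r i}) (int Y)"
proof
 assume "EX z<UU n. (ALL i<k. im.lo l i <= fld (lg n) z i & fld (lg n) z i < im.hi r i) & npv n srt coe z = Y"
 then obtain z where z: "!!i. i < k ==> fld (lg n) z i < n & l i <= srt i (fld (lg n) z i) & srt i (fld (lg n) z i) <= r i" "npv n srt coe z = Y"
  using range_iff by blast
 moreover have "srt i f \<in> S i" if "i < k" "f < n" for i f using elems(2)[OF that] that by (simp add: srt_def)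
 ultimately have "ALL i<k. srt i (fld (lg n) z i) \<in> {l i..r i} \<inter> S i" by auto
 then show "query_answer k S p (%i. {l i..r i}) (int Y)" unfolding query_answer_def z(2)[symmetric] pv_eq
  by (intro exI[of _ "%i. srt i (fld (lg n) z i)"]) simp
next
 assume "query_answer k S p (%i. {l i..r i}) (int Y)"
 then obtain x where x: "!!i. i < k ==> x i \<in> {l i..r i} \<inter> S i" "poly_eval p x = Y" unfolding query_answer_def by auto
 have "EX q<n. x i = srt i q" if i: "i < k" for i
 proof -
  have "x i \<in> set (sort (A i))" using x(1)[OF i] vi(2)[OF i] by simp
  then obtain q where "q < length (A i)" "x i = sort (A i) ! q" by (metis in_set_conv_nth length_sort)
  then show ?thesis using i vi(1)[OF i] by (auto simp: srt_def)
 qed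
 then obtain q where q: "!!i. i < k ==> q i < n" "!!i. i < k ==> x i = srt i (q i)" by metis
 have ql: "q i < 2 ^ lg n" if "i < k" for i using q(1)[OF that] im.nL by linarith
 define z where "z = pack k (lg n) q"
 have f: "fld (lg n) z i = q i" if "i < k" for i unfolding z_def by (rule fld_pack) (use ql that in auto)
 have "z < UU n" unfolding z_def inst.U_def by (rule im.pack_less) (rule ql)
 moreover have "im.lo l i <= fld (lg n) z i & fld (lg n) z i < im.hi r i" if "i < k" for i
  unfolding range_iff[OF that] f[OF that] using q[OF that] x(1)[OF that] by auto
 moreover have "npv n srt coe z = Y" unfolding pv_eq x(2)[symmetric] poly_eval_eq[OF vi(5,6)]
  by (intro sum.cong refl arg_cong2[where f = "(*)"] prod.cong) (simp add: f q(2))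
 ultimately show "EX z<UU n. (ALL i<k. im.lo l i <= fld (lg n) z i & fld (lg n) z i < im.hi r i) & npv n srt coe z = Y" by blast
qed

lemma answers:
 assumes good: "im.all_found us"
 shows "answers_all_queries bb (w n) k S p (QRYE k d 0) (ntQ ka n)
   (nTOT ka n) (im.Mfin us)"
 unfolding answers_all_queries_def
proof (intro allI impI)
 fix l r :: "nat => nat" and y :: int
 assume lr: "ALL i<k. l i < 2 ^ w n & r i < 2 ^ w n"
 let ?q = "encode_query bb (w n) k l r y" let ?len = "plen ka n" let ?lim = "plim ka n"
 define m where "m = (LEAST len. nat \<bar>y\<bar> < 2 ^ (bb * len))"
 have ex: "nat \<bar>y\<bar> < 2 ^ (bb * nat \<bar>y\<bar>)"
 proof -
  have "1 * nat \<bar>y\<bar> <= bb * nat \<bar>y\<bar>" using bb_pos by (intro mult_le_mono1) simp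
  then have "(2::nat) ^ nat \<bar>y\<bar> <= 2 ^ (bb * nat \<bar>y\<bar>)" by (intro power_increasing) auto
  then show ?thesis using less_exp[of "nat \<bar>y\<bar>"] by linarith
 qed
 have m: "nat \<bar>y\<bar> < 2 ^ (bb * m)" unfolding m_def by (rule LeastI[of _ "nat \<bar>y\<bar>"]) (rule ex)
 note ei = encode_int_simps[OF bb_pos m_def] and eq = encode_query_bounds[OF bb_pos plen_def[of ka n]]
 have kp: "0 < k" using k2 by simp
 \<comment> \<open>\<open>encode_query_bounds\<close> asks for a digit position below the length of
   a number. For length 0 the interval ends occupy no words and the query consists of
   \<open>y\<close> alone.\<close>
 have eqi: "nth_default 0 ?q (2 * k * ?len + x) = nth_default 0 (encode_int bb y) x" for x
 proof (cases "?len = 0")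
  case True
  then have "encode_num bb (w n) z = []" for z using encode_num_simps(1)[OF bb_pos, of "w n" z] plen_def[of ka n] by simp
  then have "?q = encode_int bb y" unfolding encode_query_def by (induction k) simp_all
  then show ?thesis using True by simp
 next
  case False
  then show ?thesis using eq(3)[OF kp, of 0] by simp
 qed
 have tb1: "take_bit bb (of_bool P) = (of_bool P :: nat)" for P using bb_pos by (cases P) auto
 define Y where "Y = nat y"
 have lin: "im.lin 0 l ?q" "im.lin 1 r ?q" unfolding im.lin_def
  using lr two_w eq(1,2) by (auto simp: take_bit_eq_mod)
 have sg: "take_bit bb (nth_default 0 ?q (2 * k * ?len)) = of_bool (y < 0)" using eqi[of 0] ei(1) by (simp add: tb1)
 have en: "take_bit bb (nth_default 0 ?q (2 * k * ?len + (1 + 2 * ?lim))) = of_bool (?lim < m)"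
  unfolding eqi ei(2) tb1 ..
 have okc: "im.okc Y ?q (inst.YC bb)" if "of_bool (y < 0) = (0::nat)" "of_bool (?lim < m) = (0::nat)"
 proof -
  have y0: "0 <= y" "m <= ?lim" using that by (auto split: if_splits)
  have Ym: "Y < 2 ^ (bb * m)" using m y0 by (simp add: Y_def)
  have "(2::nat) ^ (bb * m) <= 2 ^ (bb * ?lim)" using y0 by (intro power_increasing mult_le_mono2) auto
  then have "Y < 2 ^ (bb * ?lim)" using Ym by linarith
  moreover have "im.yin Y ?q" unfolding im.yin_def
  proof (intro allI impI)
   fix e assume "e < ?lim"
   show "take_bit bb (nth_default 0 ?q (2 * k * ?len + (2 + 2 * e))) = Y div 2 ^ (bb * e) mod 2 ^ bb"
   proof (cases "e < m")
    case True
    then show ?thesis unfolding eqi ei(3) using y0 by (simp add: Y_def take_bit_eq_mod)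
   next
    case False
    then have "(2::nat) ^ (bb * m) <= 2 ^ (bb * e)" by (intro power_increasing mult_le_mono2) auto
    then have "Y div 2 ^ (bb * e) = 0" using Ym by (intro div_less) linarith
    then show ?thesis unfolding eqi ei(3) using False by simp
   qed
  qed
  ultimately show ?thesis unfolding im.okc_def by blast
 qed
 have ans: "(of_bool (y < 0) = (0::nat) & of_bool (?lim < m) = (0::nat) & im.qry (im.hash_of ((!) us)) (im.Mq us) Y l r) \<longleftrightarrow>
   query_answer k S p (%i. {l i..r i}) y"
 proof (cases "y < 0 \<or> ?lim < m")
  case True
  \<comment> \<open>\<open>m\<close> is the number of digits of \<open>y\<close>. Values of the
    polynomial are nonnegative and have at most \<open>?lim\<close> digits, so such a
    \<open>y\<close> is not attained.\<close>
  have "~ query_answer k S p (%i. {l i..r i}) y"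
  proof
   assume "query_answer k S p (%i. {l i..r i}) y"
   then obtain x where x: "!!i. i < k ==> x i \<in> S i" "int (poly_eval p x) = y" unfolding query_answer_def by auto
   have "poly_eval p x < 2 ^ (bb * ?lim)" by (rule eval_less) (use x vi(4) in auto)
   then have "nat \<bar>y\<bar> < 2 ^ (bb * ?lim)" using x(2) by auto
   then have "m <= ?lim" unfolding m_def by (rule Least_le)
   then show False using True x(2) by auto
  qed
  then show ?thesis using True by auto
 next
  case False
  then have y: "int Y = y" "m <= ?lim" by (auto simp: Y_def)
  have "Y < 2 ^ (bb * ?lim)" using okc False unfolding im.okc_def by auto
  from im.qry_iff[OF good this, of l r] show ?thesis unfolding answer_iff y(1) using False by auto
 qed
 from im.query_exec[OF lin sg en okc, of us]
 show "EX t s. t <= ntQ ka n &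
   exec bb ?q (QRYE k d 0) (init_state (%a. if a < nTOT ka n then im.Mfin us a else 0) []) t s &
   reg s 0 = of_bool (query_answer k S p (%i. {l i..r i}) y)"
  unfolding ans .
qed

text \<open>Since (1 - 1 / (32 t))^(32 t) is at most exp(-1) and thus at most 1/2, the
  \<open>pR2\<close> rainbow tables are at least as good as \<open>pR1\<close> coin tosses. Both
  terms are then at most 2^-R1, and \<open>pC1\<close> is chosen to outweigh the number of
  targets.\<close>

lemma fail_small: "real (nNL n * UU n) * ((1 / 2) ^ pR1 n + (1 - 1 / (32 * real (tt n))) ^ pR2 n) <= 1 / real n ^ c"
proof -
 let ?L = "lg n"
 have t: "1 <= real (tt n)" using tt_pos by simp
 have p2: "(1 - 1 / (32 * real (tt n))) ^ pR2 n <= (1 / 2) ^ pR1 n"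
 proof -
  have e: "pR2 n = 32 * tt n * pR1 n" by (simp add: pR2_def pC2_def pR1_def)
  let ?x = "1 / (32 * real (tt n))"
  have "(1 - ?x) ^ (32 * tt n) <= exp (- ?x) ^ (32 * tt n)"
   using t exp_ge_add_one_self[of "- ?x"] by (intro power_mono) (auto simp: divide_simps)
  also have "... = exp (-1)" using t by (simp flip: exp_of_nat_mult)
  also have "... <= 1 / 2" using exp_ge_add_one_self[of 1] by (simp add: exp_minus divide_simps)
  finally have "((1 - ?x) ^ (32 * tt n)) ^ pR1 n <= (1 / 2) ^ pR1 n" using t by (intro power_mono) (auto simp: divide_simps)
  then show ?thesis unfolding e power_mult .
 qed
 have "inst.NL k ?L <= (2 ^ ?L) ^ k" unfolding inst.NL_def by (intro power_mono Suc_leI less_exp) simp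
 then have "inst.NL k ?L * UU n <= 2 ^ (k * ?L) * 2 ^ (k * ?L)" unfolding inst.U_def by (intro mult_le_mono1) (simp add: power_mult[symmetric] mult.commute)
 also have "... = 2 ^ (2 * k * ?L)" by (simp add: mult_2 add_mult_distrib power_add)
 finally have NU: "real (inst.NL k ?L * UU n) <= 2 ^ (2 * k * ?L)" by (metis of_nat_le_iff of_nat_numeral of_nat_power)
 have "real (inst.NL k ?L * UU n) * ((1 / 2) ^ pR1 n + (1 - 1 / (32 * real (tt n))) ^ pR2 n) <= 2 ^ (2 * k * ?L) * ((1 / 2) ^ pR1 n + (1 / 2) ^ pR1 n)"
  using NU p2 t by (intro mult_mono add_mono order.refl add_nonneg_nonneg zero_le_power) (auto simp: divide_simps)
 also have "... = 2 ^ (2 * k * ?L + 1) / 2 ^ pR1 n" by (simp add: power_divide)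
 also have "... <= 2 ^ (2 * k * ?L + ?L) / 2 ^ pR1 n" using lg_bounds(1)[of n] by (intro divide_right_mono power_increasing) auto
 also have "... = 1 / 2 ^ (c * ?L)"
 proof -
  have "pR1 n = (2 * k * ?L + ?L) + c * ?L" by (simp add: pR1_def pC1_def algebra_simps)
  then show ?thesis by (simp add: power_add)
 qed
 also have "... <= 1 / real n ^ c"
 proof -
  have "real n <= 2 ^ ?L" using lg_bounds(2)[of n] by (metis add_leD1 of_nat_le_iff of_nat_numeral of_nat_power)
  then have "real n ^ c <= (2 ^ ?L) ^ c" by (intro power_mono) auto
  then show ?thesis using n by (intro divide_left_mono) (auto simp: power_mult[symmetric] mult.commute)
 qed
 finally show ?thesis .
qed

lemma success:
 assumes N: "nNS ka n <= N"
  and T: "ntBUILD ka n <= N"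
 shows "measure_pmf.prob (random_words bb N)
    {us. EX t s. t <= N & exec bb ein (BUILDC ka pC1 pC2 k d 0) (init_state (%_. 0) us) t s &
      answers_all_queries bb (w n) k S p (QRYE k d 0) (ntQ ka n)
       (nTOT ka n) (mem s)} >= 1 - 1 / real n ^ c"
  (is "measure_pmf.prob _ ?E >= _")
proof -
 note EA = expct_seqE[OF expct_avg[of "2 ^ bb", OF zero_less_power[OF zero_less_numeral]], of N]
 have "1 - 1 / real n ^ c <= 1 - seqE (avg (2 ^ bb)) N (%us. of_bool (~ im.all_found us))"
  using im.fail_bound[OF N] fail_small by linarith
 also have "... = seqE (avg (2 ^ bb)) N (%us. 1 - of_bool (~ im.all_found us))"
  by (simp only: E_diff[OF EA] E_const[OF EA])
 also have "... <= seqE (avg (2 ^ bb)) N (indicator ?E)"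
 proof (rule E_mono[OF EA])
  fix us :: "nat list" assume "us \<in> {gs. length gs = N & set gs \<subseteq> {..<2 ^ bb}}"
  then have l: "nNS ka n <= length us" using N by simp
  show "1 - of_bool (~ im.all_found us) <= (indicator ?E us :: real)"
  proof (cases "im.all_found us")
   case True
   from im.build_exec[OF l] obtain t s where ts: "t <= ntBUILD ka n"
    "exec bb ein (BUILDC ka pC1 pC2 k d 0) (init_state (%_. 0) us) t s" "mem s = im.Mfin us" by blast
   have "us \<in> ?E" using ts T answers[OF True] by (intro CollectI exI[of _ t] exI[of _ s]) auto
   then show ?thesis by simp
  qed simp
 qed
 also have "... = measure_pmf.prob (random_words bb N) ?E" by (rule prob_random_words[OF bb_pos, symmetric])
 finally show ?thesis .
qed

end

lemma main:
 "EX ka build query (bt :: nat => nat) (sp :: nat => nat) (qt :: nat => nat). SO (real k) bt & SO (real k - \<alpha> / 3) sp & SO \<alpha> qt &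
  (ALL n>=1. ALL S A p. valid_instance (w n) k d n S A p -->
   measure_pmf.prob (random_words (word_size ka n) (bt n))
    {us. EX t s. t <= bt n & exec (word_size ka n) (encode_instance (word_size ka n) (w n) k d n \<alpha> A p) build (init_state (%_. 0) us) t s &
      answers_all_queries (word_size ka n) (w n) k S p query (qt n) (sp n) (mem s)} >= 1 - 1 / real n ^ c)"
proof -
 obtain ka where ka: "1 <= ka" "!!n. (if 1 <= n then REQ ka n else 0) < 2 ^ (ka * lg n)" using pb_choose[OF pb_REQ] by blast
 then have req: "1 <= n ==> REQ ka n < 2 ^ word_size ka n" for n unfolding word_size_lg by (metis (full_types))
 \<comment> \<open>\<open>bt\<close> bounds the running time and is also the number of random words
   supplied, so it has to cover the seeds as well.\<close>
 define bt where "bt = (%n. max (nNS ka n)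
   (ntBUILD ka n))"
 have ak: "2 * \<alpha> / 3 <= real k"
 proof -
  have "2 <= real k" using k2 by simp
  then show ?thesis using \<alpha> by linarith
 qed
 have bt: "SO (real k) bt" unfolding bt_def by (intro SO_max SO_mono[OF SO_NS[OF ka(1)] ak] SO_tBUILD[OF ka(1)])
 show ?thesis
  by (intro exI conjI allI impI, rule bt, rule SO_TOT[OF ka(1)], rule SO_tQ[OF ka(1)], rule success[OF ka(1) _ req])
   (auto simp: bt_def)
qed

end

theorem mainTheorem8:
  fixes k d c :: nat and \<alpha> :: real and w :: "nat \<Rightarrow> nat"
  assumes "2 \<le> k"
    and "0 < \<alpha>" and "\<alpha> < 1"
    and "(\<lambda>n. real (w n)) \<in> softO (\<lambda>_. 1)"
  shows "\<exists>\<kappa> build query (bt :: nat \<Rightarrow> nat) (sp :: nat \<Rightarrow> nat) (qt :: nat \<Rightarrow> nat).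
    (\<lambda>n. real (bt n)) \<in> softO (\<lambda>n. real n ^ k) \<and>
    (\<lambda>n. real (sp n)) \<in> softO (\<lambda>n. real n powr (real k - \<alpha> / 3)) \<and>
    (\<lambda>n. real (qt n)) \<in> softO (\<lambda>n. real n powr \<alpha>) \<and>
    (\<forall>n\<ge>1. \<forall>S A p. valid_instance (w n) k d n S A p \<longrightarrow>
      measure_pmf.prob (random_words (word_size \<kappa> n) (bt n))
        {us. \<exists>t s. t \<le> bt n \<and>
           exec (word_size \<kappa> n) (encode_instance (word_size \<kappa> n) (w n) k d n \<alpha> A p) build
             (init_state (\<lambda>_. 0) us) t s \<and>
           answers_all_queries (word_size \<kappa> n) (w n) k S p query (qt n) (sp n) (mem s)}
      \<ge> 1 - 1 / real n ^ c)"
proof -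
  have one: "softO (\<lambda>_. 1) = softO (\<lambda>n. real n powr 0)" by (rule softO_cong) (use n_ge1 in eventually_elim, simp)
  have pow: "softO (\<lambda>n. real n ^ k) = softO (\<lambda>n. real n powr real k)" by (rule softO_cong) (use n_ge1 in eventually_elim, simp add: powr_realpow)
  interpret params k d c \<alpha> w
    by unfold_locales (use assms in \<open>simp_all only: SO_softO one\<close>)
  show ?thesis using main unfolding SO_softO pow .
qed

end
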